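(* Let $q\ge 3$ and let $\chi$ be a non-principal Dirichlet character modulo $q$, and assume the Generalized Riemann Hypothesis for $L(s,\chi)$. Then there exists $\ell_\chi\in\mathbb C$, $\ell_\chi\ne 0$, such that for all $\varepsilon>0$ the natural density of the set \[\mathcal{E}_\chi:=\left\{x\ge 2\, :\, \left| (\log x)^{m_\chi} \prod_{p\le x}\left(1-\frac{\chi(p)}{p^{1/2}}\right)^{-1}-\ell_\chi \right|\le \frac{(\log \log x)^{3+\varepsilon}}{\log x} \right\}\] exists and equals $1$.
   Context: The product runs over primes $p\le x$. $m_\chi:=\mathrm{ord}_{s=1/2}L(s,\chi)$ is the order of vanishing of $L(s,\chi)$ at $s=1/2$. The natural density of a Borel set $A\subset[2,\infty)$ is $\lim_{X\to\infty}\frac1X\mathrm{meas}\{2\le x\le X: x\in A\}$ (Lebesgue measure), when the limit exists. *)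

theory Defs
  imports "HOL-Complex_Analysis.Complex_Analysis" "HOL-Computational_Algebra.Primes"
begin

definition dirichlet_character :: "nat \<Rightarrow> (nat \<Rightarrow> complex) \<Rightarrow> bool" where
  "dirichlet_character q chi \<longleftrightarrow>
     q \<ge> 1 \<and> (\<forall>n. chi (n + q) = chi n) \<and> (\<forall>m n. chi (m * n) = chi m * chi n) \<and>
     chi 1 = 1 \<and> (\<forall>n. chi n = 0 \<longleftrightarrow> \<not> coprime n q)"

definition principal_character :: "nat \<Rightarrow> (nat \<Rightarrow> complex) \<Rightarrow> bool" where
  "principal_character q chi \<longleftrightarrow> (\<forall>n. coprime n q \<longrightarrow> chi n = 1)"

text \<open>The Dirichlet L-function: the entire function (unique by the identity
  theorem; it exists for non-principal characters) which agrees with the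
  Dirichlet series sum_{n>=1} chi(n) n^{-s} on Re s > 1.\<close>
definition dirichlet_L :: "(nat \<Rightarrow> complex) \<Rightarrow> complex \<Rightarrow> complex" where
  "dirichlet_L chi = (SOME f. f holomorphic_on UNIV \<and>
      (\<forall>s. Re s > 1 \<longrightarrow> (\<lambda>n. chi (Suc n) / of_nat (Suc n) powr s) sums f s))"

definition GRH_for :: "(nat \<Rightarrow> complex) \<Rightarrow> bool" where
  "GRH_for chi \<longleftrightarrow> (\<forall>s. 0 < Re s \<and> Re s < 1 \<and> dirichlet_L chi s = 0 \<longrightarrow> Re s = 1/2)"

definition vanishing_order :: "(nat \<Rightarrow> complex) \<Rightarrow> nat" where
  "vanishing_order chi = nat (zorder (dirichlet_L chi) (1/2))"

definition has_natural_density :: "real set \<Rightarrow> real \<Rightarrow> bool" where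
  "has_natural_density A d \<longleftrightarrow> A \<in> sets lborel \<and>
     ((\<lambda>X. measure lborel (A \<inter> {2..X}) / X) \<longlongrightarrow> d) at_top"

end

theory Submission
  imports Defs "HOL-Number_Theory.Prime_Powers" "HOL-Number_Theory.Cong" "HOL-Real_Asymp.Real_Asymp"
    "HOL-Probability.Probability"
begin

text \<open>Write \<open>x = exp V\<close>. Up to a convergent constant and an error \<open>O(1/V)\<close>, the logarithm of the partial
  product is the sum of \<open>\<Lambda>(n) \<chi>(n) / (sqrt n ln n)\<close> over \<open>n \<le> x\<close> plus half the contribution of
  the squares of the primes between \<open>sqrt x\<close> and \<open>x\<close>; the latter tends to a constant by Mertens' theorem
  for \<open>\<chi>\<^sup>2\<close>. Partial summation reduces the former to
  \<open>E(V) = (\<Sum>n\<le>exp V. \<Lambda>(n) \<chi>(n) / sqrt n) + m V\<close>, which by Perron's formula is an integral of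
  \<open>- L'/L(1/2 + z) + m/z\<close> over a vertical line; under GRH the line can be moved to distance \<open>1/V\<close> from the
  critical line. There \<open>L'/L\<close> is, up to a small error, a sum of \<open>1/(s - \<rho>)\<close> over nearby zeros, and a
  Gaussian average of the square of the integral, estimated by Schur's test, shows that the mean square of
  \<open>E\<close> over \<open>[V, V + 1]\<close> is \<open>O((ln V)\<^sup>2)\<close>. Hence \<open>|E(V)| \<le> (ln V)\<^sup>3\<close> outside a set of density zero.\<close>

section \<open>Entire continuation of periodic Dirichlet series\<close>

text \<open>With the kernel 1/z Perron's integral for the sharp sum \<open>E\<close> does not
  converge absolutely. So its primitive \<open>E1\<close>, with kernel 1/z^2, is represented;
  difference quotients lead back to \<open>E\<close>, their integrands being O(|Q(z)|/|z|) uniformly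
  in the step, and Fatou's lemma passes to the limit. At distance 1/V from the critical line a term
  1/(s - rho) can be as large as V, yet its mass on a unit interval is only O(ln V). That single
  logarithm gives the mean square (ln V)^2; the height (ln V)^3 then leaves relative measure O((ln
  V)^(-4)), and the \<epsilon> of the theorem swallows constants. No functional equation enters:
  polynomial growth in Re s \<ge> -4 and a lower bound on Re s = 2 control the zeros locally. The
  logarithmic number of zeros is weakened to (1 + |t|)^(1/4), because after division by |z| the
  weight (1 + |t|)^(-3/4) still has an integrable square. The hypothesis speaks only of the open
  critical strip, so zeros on Re s = 1 are excluded unconditionally by Landau's method; the same
  argument gives the nonvanishing at 1 behind Mertens' theorem for a non-principal chi^2.\<close>

primrec fdiff :: "nat \<Rightarrow> complex \<Rightarrow> complex \<Rightarrow> complex" where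
  "fdiff 0 s z = z powr (-s)"
| "fdiff (Suc k) s z = fdiff k s z - fdiff k s (z + 1)"

lemma has_field_derivative_fdiff:
  assumes "Re z > 0"
  shows "(fdiff k s has_field_derivative (- s * fdiff k (s + 1) z)) (at z)"
  using assms
proof (induction k arbitrary: z)
  case 0
  have "z \<notin> \<real>\<^sub>\<le>\<^sub>0" using 0 by (auto elim!: nonpos_Reals_cases)
  then have "((\<lambda>z. z powr (-s)) has_field_derivative (-s * z powr (-s - 1))) (at z)"
    by (rule has_field_derivative_powr)
  moreover have "- s - 1 = - (s + 1)" by simp
  ultimately show ?case by (simp only: fdiff.simps)
next
  case (Suc k)
  have "((\<lambda>z. fdiff k s (z + 1)) has_field_derivative (- s * fdiff k (s + 1) (z + 1))) (at z)"
    using DERIV_shift[THEN iffD1, OF Suc.IH[of "z + 1"]] Suc.prems by simp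
  from DERIV_diff[OF Suc.IH[OF Suc.prems] this] show ?case
    by (simp add: algebra_simps)
qed

text \<open>A unit difference is controlled by the derivative \<open>- s * fdiff k (s + 1)\<close>,
  so each further difference costs one factor and gains one power of \<open>x\<close>; the shift to
  \<open>s + 1\<close> turns the product for \<open>k\<close> into the one for \<open>Suc k\<close>.
  The hypothesis on \<open>Re s + real k\<close> keeps the power decreasing, so that the left
  endpoint dominates the whole segment.\<close>

lemma norm_fdiff_le:
  assumes "x \<ge> 1" "Re s + real k \<ge> 0"
  shows "norm (fdiff k s (of_real x)) \<le> (\<Prod>j<k. norm s + real j) * x powr (- Re s - real k)"
  using assms
proof (induction k arbitrary: s x)
  case 0
  then show ?case by (simp add: norm_powr_real_powr)
next
  case (Suc k)
  let ?S = "closed_segment (complex_of_real x) (complex_of_real (x + 1))"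
  let ?P = "\<Prod>j<k. norm s + real (Suc j)"
  have "norm (fdiff k s (of_real x) - fdiff k s (of_real (x + 1)))
      \<le> (norm s * (?P * x powr (- Re s - real (Suc k)))) * norm (of_real x - complex_of_real (x + 1))"
  proof (rule field_differentiable_bound[of ?S])
    fix w assume "w \<in> ?S"
    then obtain y where y: "w = of_real y" "x \<le> y" "y \<le> x + 1"
      unfolding closed_segment_of_real closed_segment_eq_real_ivl by auto
    show "(fdiff k s has_field_derivative (- s * fdiff k (s + 1) w)) (at w within ?S)"
      using y Suc.prems by (intro has_field_derivative_fdiff[THEN has_field_derivative_at_within]) auto
    have "norm (fdiff k (s + 1) w) \<le> (\<Prod>j<k. norm (s + 1) + real j) * y powr (- Re (s + 1) - real k)"
      using Suc.IH[of y "s + 1"] Suc.prems y by simp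
    also have "\<dots> \<le> ?P * x powr (- Re s - real (Suc k))"
    proof (intro mult_mono prod_mono conjI)
      fix j show "norm (s + 1) + real j \<le> norm s + real (Suc j)"
        using norm_triangle_ineq[of s 1] by simp
      have "y powr (- (Re s + real (Suc k))) \<le> x powr (- (Re s + real (Suc k)))"
        using y Suc.prems by (intro powr_mono2') auto
      moreover have "- Re (s + 1) - real k = - (Re s + real (Suc k))" "- Re s - real (Suc k) = - (Re s + real (Suc k))"
        by simp_all
      ultimately show "y powr (- Re (s + 1) - real k) \<le> x powr (- Re s - real (Suc k))"
        by (simp only:)
    qed (auto intro!: prod_nonneg)
    finally show "norm (- s * fdiff k (s + 1) w) \<le> norm s * (?P * x powr (- Re s - real (Suc k)))"
      by (simp add: norm_mult mult_left_mono)
  qed auto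
  also have "norm (of_real x - complex_of_real (x + 1)) = 1"
    by simp
  also have "norm s * (?P * x powr (- Re s - real (Suc k))) * 1
      = (\<Prod>j<Suc k. norm s + real j) * x powr (- Re s - real (Suc k))"
    by (simp add: prod.lessThan_Suc_shift del: prod.lessThan_Suc)
  finally show ?case by (simp del: prod.lessThan_Suc)
qed

lemma holomorphic_fdiff [holomorphic_intros]:
  "x > 0 \<Longrightarrow> (\<lambda>s. fdiff k s (of_real x)) holomorphic_on A"
proof (induction k arbitrary: x)
  case 0
  then have "fdiff 0 s (of_real x) = exp (- s * of_real (ln x))" for s
    by (simp add: powr_def Ln_of_real)
  then show ?case by (simp only:) (intro holomorphic_intros)
next
  case (Suc k)
  from holomorphic_on_diff[OF Suc.IH[of x] Suc.IH[of "x + 1"]] Suc.prems show ?case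
    by simp
qed

section \<open>Periodic sequences of mean zero and repeated summation by parts\<close>

definition periodic_mean0 :: "nat \<Rightarrow> (nat \<Rightarrow> complex) \<Rightarrow> bool" where
  "periodic_mean0 q f \<longleftrightarrow> q > 0 \<and> (\<forall>n. f (n + q) = f n) \<and> (\<Sum>i<q. f i) = 0"

lemma periodic_mod:
  fixes f :: "nat \<Rightarrow> 'a"
  assumes "\<And>n. f (n + q) = f n"
  shows "f (n mod q) = f n"
proof -
  have "f (m + k * q) = f m" for m k
  proof (induction k)
    case (Suc k)
    then show ?case using assms[of "m + k * q"] by (simp add: add_ac)
  qed auto
  from this[of "n mod q" "n div q"] show ?thesis by simp
qed

lemma periodic_mean0_bounded:
  assumes "periodic_mean0 q f"
  obtains B where "B \<ge> 0" "\<And>n. norm (f n) \<le> B"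
proof
  show "(\<Sum>i<q. norm (f i)) \<ge> 0" by (intro sum_nonneg) auto
  fix n
  have "norm (f (n mod q)) \<le> (\<Sum>i<q. norm (f i))"
    using assms by (intro member_le_sum) (auto simp: periodic_mean0_def)
  then show "norm (f n) \<le> (\<Sum>i<q. norm (f i))"
    using assms periodic_mod[of f q n] by (auto simp: periodic_mean0_def)
qed

text \<open>Prefix sums of a mean-zero periodic sequence are periodic; subtracting their mean over a
  period makes them mean zero again, so summation by parts can be repeated as often as desired. The
  price is the constant \<open>c\<close> in the first term.\<close>

lemma periodic_mean0_prefix:
  assumes "periodic_mean0 q f"
  obtains F c where "periodic_mean0 q F" "\<And>n. f (Suc n) = F (Suc n) - F n" "f 0 = F 0 + c"
proof
  define G where "G = (\<lambda>n. \<Sum>i<n. f i)"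
  define c where "c = (\<Sum>i<q. G (Suc i)) / of_nat q"
  define F where "F = (\<lambda>n. G (Suc n) - c)"
  have q: "q > 0" "\<And>n. f (n + q) = f n" "(\<Sum>i<q. f i) = 0"
    using assms by (auto simp: periodic_mean0_def)
  have G: "G (n + q) = G n" for n
    by (induction n) (use q in \<open>auto simp: G_def\<close>)
  show "periodic_mean0 q F"
    using q(1) G[of "Suc _"] by (auto simp: periodic_mean0_def F_def sum_subtractf c_def)
  show "f (Suc n) = F (Suc n) - F n" for n by (simp add: F_def G_def)
  show "f 0 = F 0 + c" by (simp add: F_def G_def)
qed

lemma abel_sums:
  fixes f F g :: "nat \<Rightarrow> complex"
  assumes F: "\<And>n. f (Suc n) = F (Suc n) - F n" "f 0 = F 0 + c"
    and B: "\<And>n. norm (F n) \<le> B" and g: "g \<longlonglongrightarrow> 0"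
    and S: "(\<lambda>i. F i * (g i - g (Suc i))) sums S"
  shows "(\<lambda>i. f i * g i) sums (c * g 0 + S)"
proof -
  have eq: "(\<Sum>i<Suc N. f i * g i) = c * g 0 + (\<Sum>i<Suc N. F i * (g i - g (Suc i))) + F N * g (Suc N)" for N
  proof (induction N)
    case 0 then show ?case using F by (simp add: algebra_simps)
  next
    case (Suc N)
    have "(\<Sum>i<Suc (Suc N). f i * g i) = (\<Sum>i<Suc N. f i * g i) + f (Suc N) * g (Suc N)"
      by simp
    also have "\<dots> = c * g 0 + (\<Sum>i<Suc (Suc N). F i * (g i - g (Suc i))) + F (Suc N) * g (Suc (Suc N))"
      unfolding Suc by (simp add: F(1) algebra_simps)
    finally show ?case .
  qed
  have "(\<lambda>N. F N * g (Suc N)) \<longlonglongrightarrow> 0"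
  proof (rule Lim_null_comparison)
    show "\<forall>\<^sub>F N in sequentially. norm (F N * g (Suc N)) \<le> B * norm (g (Suc N))"
      by (intro always_eventually allI) (auto simp: norm_mult intro!: mult_right_mono B)
    show "(\<lambda>N. B * norm (g (Suc N))) \<longlonglongrightarrow> 0"
      using LIMSEQ_Suc[OF g] by (auto intro!: tendsto_eq_intros)
  qed
  moreover have "(\<lambda>N. \<Sum>i<Suc N. F i * (g i - g (Suc i))) \<longlonglongrightarrow> S"
    using S unfolding sums_def by (rule LIMSEQ_Suc)
  ultimately have "(\<lambda>N. \<Sum>i<Suc N. f i * g i) \<longlonglongrightarrow> c * g 0 + S + 0"
    unfolding eq by (intro tendsto_intros)
  then show ?thesis unfolding sums_def add_0_right by (rule LIMSEQ_imp_Suc)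
qed

lemma norm_fdiff_term_le:
  assumes "\<And>n. norm (F n) \<le> B" "Re s + real k \<ge> a" "a \<ge> 0" "norm s \<le> R"
  shows "norm (F i * fdiff k s (of_nat (Suc i))) \<le> B * (\<Prod>j<k. R + real j) * real (Suc i) powr (- a)"
proof -
  have "norm (fdiff k s (of_real (real (Suc i)))) \<le> (\<Prod>j<k. norm s + real j) * real (Suc i) powr (- Re s - real k)"
    using assms by (intro norm_fdiff_le) auto
  also have "\<dots> \<le> (\<Prod>j<k. R + real j) * real (Suc i) powr (- a)"
    using assms norm_ge_zero[of s] by (intro mult_mono prod_mono powr_mono conjI) (auto intro!: prod_nonneg simp del: norm_ge_zero)
  finally have "norm (fdiff k s (of_nat (Suc i))) \<le> (\<Prod>j<k. R + real j) * real (Suc i) powr (- a)" by simp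
  then have "norm (F i) * norm (fdiff k s (of_nat (Suc i))) \<le> B * ((\<Prod>j<k. R + real j) * real (Suc i) powr (- a))"
    using assms(1)[of i] norm_ge_zero[of "F i"] by (intro mult_mono) (linarith | simp)+
  then show ?thesis by (simp add: norm_mult mult.assoc)
qed

lemma summable_Suc_powr: "a > 1 \<Longrightarrow> summable (\<lambda>i. C * real (Suc i) powr (- a))"
  using summable_real_powr_iff[of "-a"]
  by (subst summable_Suc_iff[of "\<lambda>i. C * real i powr (- a)"]) (auto intro!: summable_mult)

lemma summable_fdiff:
  assumes "periodic_mean0 q F" "Re s + real k > 1"
  shows "summable (\<lambda>i. F i * fdiff k s (of_nat (Suc i)))"
proof -
  obtain B where B: "\<And>n. norm (F n) \<le> B" using periodic_mean0_bounded[OF assms(1)] by blast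
  show ?thesis
  proof (rule summable_comparison_test'[of _ 0])
    show "summable (\<lambda>i. B * (\<Prod>j<k. norm s + real j) * real (Suc i) powr (- (Re s + real k)))"
      using assms by (intro summable_Suc_powr) auto
    fix i show "norm (F i * fdiff k s (of_nat (Suc i)))
        \<le> B * (\<Prod>j<k. norm s + real j) * real (Suc i) powr (- (Re s + real k))"
      using assms B by (intro norm_fdiff_term_le) auto
  qed
qed

lemma holomorphic_fdiff_series:
  assumes "periodic_mean0 q F"
  shows "(\<lambda>s. \<Sum>i. F i * fdiff k s (of_nat (Suc i))) holomorphic_on {s. Re s > 1 - real k}"
proof (rule holomorphic_uniform_sequence[where f = "\<lambda>n s. \<Sum>i<n. F i * fdiff k s (of_nat (Suc i))"])
  obtain B where B: "\<And>n. norm (F n) \<le> B" using periodic_mean0_bounded[OF assms(1)] by blast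
  show "open {s. Re s > 1 - real k}" by (rule open_halfspace_Re_gt)
  show "(\<lambda>s. \<Sum>i<n. F i * fdiff k s (of_nat (Suc i))) holomorphic_on {s. Re s > 1 - real k}" for n
    using holomorphic_fdiff[of "real (Suc _)"] by (intro holomorphic_intros) auto
  fix x :: complex assume x: "x \<in> {s. Re s > 1 - real k}"
  define d where "d = (Re x + real k - 1) / 2"
  have d: "d > 0" using x by (simp add: d_def)
  have mem: "Re s + real k \<ge> 1 + d" "norm s \<le> norm x + d" if "s \<in> cball x d" for s
  proof -
    have "norm (x - s) \<le> d" using that by (simp add: dist_norm)
    moreover have "Re x - Re s \<le> norm (x - s)" using complex_Re_le_cmod[of "x - s"] by simp
    moreover have "norm s \<le> norm x + norm (x - s)" by (metis norm_minus_commute norm_triangle_sub)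
    ultimately show "Re s + real k \<ge> 1 + d" "norm s \<le> norm x + d" by (auto simp: d_def field_simps)
  qed
  have "uniform_limit (cball x d) (\<lambda>n s. \<Sum>i<n. F i * fdiff k s (of_nat (Suc i)))
      (\<lambda>s. \<Sum>i. F i * fdiff k s (of_nat (Suc i))) sequentially"
  proof (rule Weierstrass_m_test)
    show "summable (\<lambda>i. B * (\<Prod>j<k. (norm x + d) + real j) * real (Suc i) powr (- (1 + d)))"
      using d by (intro summable_Suc_powr) auto
    show "norm (F i * fdiff k s (of_nat (Suc i)))
        \<le> B * (\<Prod>j<k. (norm x + d) + real j) * real (Suc i) powr (- (1 + d))" if "s \<in> cball x d" for i s
      using mem[OF that] d B by (intro norm_fdiff_term_le) auto
  qed
  moreover have "cball x d \<subseteq> {s. Re s > 1 - real k}" using mem d by fastforce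
  ultimately show "\<exists>d>0. cball x d \<subseteq> {s. Re s > 1 - real k} \<and>
      uniform_limit (cball x d) (\<lambda>n s. \<Sum>i<n. F i * fdiff k s (of_nat (Suc i)))
      (\<lambda>s. \<Sum>i. F i * fdiff k s (of_nat (Suc i))) sequentially" using d by blast
qed

text \<open>Controls the boundary terms of the summations by parts, which are multiples of
  \<open>fdiff k s 1\<close>. The half-plane \<open>Re s \<ge> -4\<close> is the one reached by
  discs of radius 6 about points of real part 2.\<close>

lemma fdiff_1_bounded: "\<exists>C. \<forall>s. Re s \<ge> -4 \<longrightarrow> norm (fdiff k s (of_nat (Suc i))) \<le> C"
proof (induction k arbitrary: i)
  case 0
  show ?case
  proof (intro exI allI impI)
    fix s :: complex assume "Re s \<ge> -4"
    then have "real (Suc i) powr (- Re s) \<le> real (Suc i) powr 4" by (intro powr_mono) auto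
    then show "norm (fdiff 0 s (of_nat (Suc i))) \<le> real (Suc i) powr 4"
      using norm_powr_real_powr[of "of_nat (Suc i)" "-s"] by simp
  qed
next
  case (Suc k)
  obtain C1 C2 where C: "\<And>s. Re s \<ge> -4 \<Longrightarrow> norm (fdiff k s (of_nat (Suc i))) \<le> C1"
    "\<And>s. Re s \<ge> -4 \<Longrightarrow> norm (fdiff k s (of_nat (Suc (Suc i)))) \<le> C2" using Suc by meson
  show ?case
  proof (intro exI[of _ "C1 + C2"] allI impI)
    fix s :: complex assume s: "Re s \<ge> -4"
    show "norm (fdiff (Suc k) s (of_nat (Suc i))) \<le> C1 + C2"
      using norm_triangle_le_diff[OF add_mono[OF C(1)[OF s] C(2)[OF s]]] by (simp add: add_ac)
  qed
qed

text \<open>After \<open>k\<close> summations by parts the terms of the remaining series have size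
  \<open>n powr (- Re s - k)\<close>, so that it converges for \<open>Re s > 1 - k\<close>, while
  the boundary terms collect in the entire function \<open>e\<close>.\<close>

lemma fdiff_representation:
  assumes "periodic_mean0 q f"
  shows "\<exists>F e C. periodic_mean0 q F \<and> e holomorphic_on UNIV \<and> (\<forall>s. Re s \<ge> -4 \<longrightarrow> norm (e s) \<le> C) \<and>
    (\<forall>s. Re s > 1 \<longrightarrow> (\<lambda>i. f i * of_nat (Suc i) powr (-s)) sums
       (e s + (\<Sum>i. F i * fdiff k s (of_nat (Suc i)))))"
proof (induction k)
  case 0
  have "(\<lambda>i. f i * of_nat (Suc i) powr (-s)) sums
       (0 + (\<Sum>i. f i * fdiff 0 s (of_nat (Suc i))))" if "Re s > 1" for s
    using summable_sums[OF summable_fdiff[OF assms, of s 0]] that by simp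
  then show ?case using assms
    by (intro exI[of _ f] exI[of _ "\<lambda>_. 0"] exI[of _ 0]) simp
next
  case (Suc k)
  then obtain F e C where F: "periodic_mean0 q F" and e: "e holomorphic_on UNIV"
    and C: "\<And>s. Re s \<ge> -4 \<Longrightarrow> norm (e s) \<le> C" and
    sm: "\<And>s. Re s > 1 \<Longrightarrow> (\<lambda>i. f i * of_nat (Suc i) powr (-s)) sums
       (e s + (\<Sum>i. F i * fdiff k s (of_nat (Suc i))))" by blast
  obtain G c where G: "periodic_mean0 q G" "\<And>n. F (Suc n) = G (Suc n) - G n" "F 0 = G 0 + c"
    using periodic_mean0_prefix[OF F] by blast
  obtain B where B: "\<And>n. norm (G n) \<le> B" using periodic_mean0_bounded[OF G(1)] by metis
  obtain C' where C': "\<And>s. Re s \<ge> -4 \<Longrightarrow> norm (fdiff k s 1) \<le> C'"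
    using fdiff_1_bounded[of k 0] unfolding One_nat_def[symmetric] of_nat_1 by blast
  define e' where "e' = (\<lambda>s. e s + c * fdiff k s 1)"
  have "e' holomorphic_on UNIV" unfolding e'_def
    using holomorphic_fdiff[of 1 k] by (intro holomorphic_intros e) auto
  moreover have "norm (e' s) \<le> C + norm c * C'" if "Re s \<ge> -4" for s unfolding e'_def
    using C[OF that] C'[OF that] by (intro norm_triangle_mono) (auto simp: norm_mult intro!: mult_left_mono)
  moreover have "(\<lambda>i. f i * of_nat (Suc i) powr (-s)) sums
       (e' s + (\<Sum>i. G i * fdiff (Suc k) s (of_nat (Suc i))))" if s: "Re s > 1" for s
  proof -
    let ?g = "\<lambda>i. fdiff k s (of_nat (Suc i))"
    have gg: "?g i - ?g (Suc i) = fdiff (Suc k) s (of_nat (Suc i))" for i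
      by (simp add: add_ac)
    have "summable (\<lambda>i. 1 * fdiff k s (of_nat (Suc i)))"
    proof (rule summable_comparison_test'[of _ 0])
      show "summable (\<lambda>i. 1 * (\<Prod>j<k. norm s + real j) * real (Suc i) powr (- (Re s + real k)))"
        using s by (intro summable_Suc_powr) auto
      fix i show "norm (1 * fdiff k s (of_nat (Suc i)))
          \<le> 1 * (\<Prod>j<k. norm s + real j) * real (Suc i) powr (- (Re s + real k))"
        using s by (intro norm_fdiff_term_le[of "\<lambda>_. 1"]) auto
    qed
    then have "?g \<longlonglongrightarrow> 0" using summable_LIMSEQ_zero by fastforce
    moreover have "(\<lambda>i. G i * (?g i - ?g (Suc i))) sums (\<Sum>i. G i * fdiff (Suc k) s (of_nat (Suc i)))"
      unfolding gg using s by (intro summable_sums summable_fdiff[OF G(1)]) auto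
    ultimately have "(\<lambda>i. F i * ?g i) sums (c * ?g 0 + (\<Sum>i. G i * fdiff (Suc k) s (of_nat (Suc i))))"
      using G B by (intro abel_sums) auto
    then have "(\<Sum>i. F i * ?g i) = c * fdiff k s 1 + (\<Sum>i. G i * fdiff (Suc k) s (of_nat (Suc i)))"
      by (simp add: sums_iff)
    then show ?thesis using sm[OF s] by (simp add: e'_def add_ac)
  qed
  ultimately show ?case using G(1) by blast
qed

text \<open>The \<open>k\<close>-th representation continues the function to
  \<open>Re s > 1 - k\<close>; the pieces agree by the identity theorem and glue together. The sixth
  power comes from \<open>k = 6\<close>, the first level whose half-plane contains all of
  \<open>Re s \<ge> -4\<close>.\<close>

theorem dirichlet_series_entire:
  assumes "periodic_mean0 q f"
  obtains h C where "h holomorphic_on UNIV"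
    "\<And>s. Re s > 1 \<Longrightarrow> (\<lambda>i. f i * of_nat (Suc i) powr (-s)) sums h s"
    "\<And>s. Re s > 0 \<Longrightarrow> (\<lambda>i. f i * of_nat (Suc i) powr (-s)) sums h s"
    "\<And>s. Re s \<ge> -4 \<Longrightarrow> norm (h s) \<le> C * (1 + norm s) ^ 6"
proof -
  define R where "R k F e C \<longleftrightarrow> periodic_mean0 q F \<and> e holomorphic_on UNIV \<and> (\<forall>s. Re s \<ge> -4 \<longrightarrow> norm (e s) \<le> C) \<and>
    (\<forall>s. Re s > 1 \<longrightarrow> (\<lambda>i. f i * of_nat (Suc i) powr (-s)) sums
       (e s + (\<Sum>i. F i * fdiff k s (of_nat (Suc i)))))" for k F e and C :: real
  have "\<forall>k. \<exists>F e C. R k F e C"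
    using fdiff_representation[OF assms] unfolding R_def by blast
  then obtain F e C where R: "\<And>k. R k (F k) (e k) (C k)" by metis
  have F: "periodic_mean0 q (F k)" and e: "e k holomorphic_on UNIV" for k
    using R[of k] by (simp_all add: R_def)
  have C: "norm (e k s) \<le> C k" if "Re s \<ge> -4" for k s
    using R[of k] that by (simp add: R_def)
  have sm: "(\<lambda>i. f i * of_nat (Suc i) powr (-s)) sums
       (e k s + (\<Sum>i. F k i * fdiff k s (of_nat (Suc i))))" if "Re s > 1" for k s
    using R[of k] that by (simp add: R_def)
  define h where "h = (\<lambda>k s. e k s + (\<Sum>i. F k i * fdiff k s (of_nat (Suc i))))"
  define H where "H = (\<lambda>k. {s. Re s > 1 - real k})"
  have openH: "open (H k)" "connected (H k)" for k
    unfolding H_def by (auto simp: open_halfspace_Re_gt convex_halfspace_Re_gt convex_connected)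
  have hol: "h k holomorphic_on H k" for k unfolding h_def H_def
    using e[of k] by (intro holomorphic_intros holomorphic_fdiff_series[OF F]) (auto elim: holomorphic_on_subset)
  have eq: "h j s = h k s" if "s \<in> H j" "j \<le> k" for j k s
  proof (rule analytic_continuation_open[of "{s. Re s > 1}" "H j" "h j" "h k"])
    show "h j z = h k z" if "z \<in> {s. Re s > 1}" for z
      using sm[of z j] sm[of z k] that sums_unique2 unfolding h_def by blast
    show "{s. Re s > 1} \<noteq> {}" by (auto intro!: exI[of _ 2])
    show "{s. Re s > 1} \<subseteq> H j" by (auto simp: H_def)
    show "h k holomorphic_on H j"
      by (rule holomorphic_on_subset[OF hol]) (use that in \<open>auto simp: H_def\<close>)
  qed (use that hol openH open_halfspace_Re_gt in auto)
  \<comment> \<open>A level \<open>k \<ge> 2 - Re s\<close> has \<open>1 - k < Re s\<close>; for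
    \<open>Re s > 2\<close> the truncation by \<open>nat\<close> gives level 0, which also contains
    \<open>s\<close>.\<close>
  define g where "g = (\<lambda>s. h (nat \<lceil>2 - Re s\<rceil>) s)"
  have g: "g s = h k s" if "s \<in> H k" for s k
  proof -
    have "s \<in> H (nat \<lceil>2 - Re s\<rceil>)" unfolding H_def by simp linarith
    then show ?thesis using eq[of s] that by (metis g_def nle_le)
  qed
  have "g holomorphic_on H k" for k
    using hol[of k] holomorphic_cong[OF refl, of "H k" g "h k"] g by blast
  then have "g holomorphic_on (\<Union>k. H k)"
    by (intro holomorphic_on_UN_open openH) auto
  moreover have "(\<Union>k. H k) = UNIV"
  proof -
    have "s \<in> H (nat \<lceil>2 - Re s\<rceil>)" for s unfolding H_def by simp linarith
    then show ?thesis by blast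
  qed
  ultimately have gh: "g holomorphic_on UNIV" by simp
  have gs: "(\<lambda>i. f i * of_nat (Suc i) powr (-s)) sums g s" if "Re s > 1" for s
    using sm[OF that, of 0] g[of s 0] that by (simp add: h_def H_def)
  obtain B where B: "B \<ge> 0" "\<And>n. norm (F 6 n) \<le> B" using periodic_mean0_bounded[OF F] by blast
  define Z where "Z = (\<Sum>i. real (Suc i) powr (-2))"
  have Z: "summable (\<lambda>i. real (Suc i) powr (-2))" using summable_Suc_powr[of 2 1] by simp
  have bd: "norm (g s) \<le> (\<bar>C 6\<bar> + B * 720 * Z) * (1 + norm s) ^ 6" if s: "Re s \<ge> -4" for s
  proof -
    have "g s = h 6 s" using g[of s 6] s by (simp add: H_def)
    \<comment> \<open>Each factor is at most \<open>(j + 1) * (1 + norm s)\<close>, and 6! =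
      720.\<close>
    have "(\<Prod>j<6. norm s + real j) \<le> (\<Prod>j<6. (real (Suc j)) * (1 + norm s))"
      by (intro prod_mono) (auto simp: algebra_simps)
    also have "\<dots> = (\<Prod>j<6. real (Suc j)) * (1 + norm s) ^ 6" by (simp add: prod.distrib del: of_nat_Suc)
    also have "(\<Prod>j<6. real (Suc j)) = 720" by (simp add: numeral_eq_Suc)
    finally have prod_le: "(\<Prod>j<6. norm s + real j) \<le> 720 * (1 + norm s) ^ 6" .
    have "norm (F 6 i * fdiff 6 s (of_nat (Suc i))) \<le> B * (720 * (1 + norm s) ^ 6) * real (Suc i) powr (-2)" for i
    proof -
      have "norm (F 6 i * fdiff 6 s (of_nat (Suc i))) \<le> B * (\<Prod>j<6. norm s + real j) * real (Suc i) powr (-2)"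
        using s B by (intro norm_fdiff_term_le) auto
      also have "\<dots> \<le> B * (720 * (1 + norm s) ^ 6) * real (Suc i) powr (-2)"
        by (intro mult_right_mono mult_left_mono prod_le B) auto
      finally show ?thesis .
    qed
    then have "norm (\<Sum>i. F 6 i * fdiff 6 s (of_nat (Suc i))) \<le> (\<Sum>i. B * (720 * (1 + norm s) ^ 6) * real (Suc i) powr (-2))"
      by (intro norm_suminf_le summable_mult Z)
    also have "\<dots> = B * (720 * (1 + norm s) ^ 6) * Z"
      unfolding Z_def by (intro suminf_mult Z)
    finally have "norm (g s) \<le> C 6 + B * (720 * (1 + norm s) ^ 6) * Z"
      unfolding \<open>g s = h 6 s\<close> h_def using C[OF s, of 6] by (intro norm_triangle_mono)
    moreover have "C 6 \<le> \<bar>C 6\<bar> * (1 + norm s) ^ 6"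
    proof -
      have "\<bar>C 6\<bar> * 1 \<le> \<bar>C 6\<bar> * (1 + norm s) ^ 6" by (intro mult_left_mono one_le_power) auto
      then show ?thesis by linarith
    qed
    ultimately show ?thesis by (simp add: algebra_simps)
  qed
  \<comment> \<open>For \<open>0 < Re s \<le> 1\<close> the convergence is only conditional, and one
    summation by parts reaches it. This supplies the series at \<open>s = 1\<close> for the twisted
    Mertens estimate.\<close>
  have gs0: "(\<lambda>i. f i * of_nat (Suc i) powr (-s)) sums g s" if "Re s > 0" for s
  proof -
    obtain G c where G: "periodic_mean0 q G" "\<And>n. f (Suc n) = G (Suc n) - G n" "f 0 = G 0 + c"
      using periodic_mean0_prefix[OF assms] by blast
    obtain B where B: "\<And>n. norm (G n) \<le> B" using periodic_mean0_bounded[OF G(1)] by metis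
    define u where "u = (\<lambda>s. c * fdiff 0 s 1 + (\<Sum>i. G i * fdiff 1 s (of_nat (Suc i))))"
    have u: "(\<lambda>i. f i * of_nat (Suc i) powr (-s)) sums u s" if s: "Re s > 0" for s
    proof -
      let ?g = "\<lambda>i. fdiff 0 s (of_nat (Suc i))"
      have "?g \<longlonglongrightarrow> 0"
      proof (rule tendsto_norm_zero_cancel)
        have "(\<lambda>i. real (Suc i) powr (- Re s)) \<longlonglongrightarrow> 0"
          using s by (intro tendsto_neg_powr filterlim_compose[OF filterlim_real_sequentially] filterlim_Suc) auto
        moreover have "norm (?g i) = real (Suc i) powr (- Re s)" for i
          using norm_powr_real_powr[of "of_nat (Suc i)" "-s"] by simp
        ultimately show "(\<lambda>i. norm (?g i)) \<longlonglongrightarrow> 0" by (simp only:)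
      qed
      moreover have "(\<lambda>i. G i * (?g i - ?g (Suc i))) sums (\<Sum>i. G i * fdiff 1 s (of_nat (Suc i)))"
        using summable_sums[OF summable_fdiff[OF G(1), of s 1]] s by (simp add: add_ac)
      ultimately have "(\<lambda>i. f i * ?g i) sums (c * ?g 0 + (\<Sum>i. G i * fdiff 1 s (of_nat (Suc i))))"
        using G B by (intro abel_sums) auto
      then show ?thesis by (simp add: u_def)
    qed
    have "u s = g s"
    proof (rule analytic_continuation_open[of "{s. Re s > 1}" "{s. Re s > 0}" u g])
      show "u z = g z" if "z \<in> {s. Re s > 1}" for z
      proof (rule sums_unique2)
        show "(\<lambda>i. f i * of_nat (Suc i) powr (-z)) sums u z" using that by (intro u) auto
        show "(\<lambda>i. f i * of_nat (Suc i) powr (-z)) sums g z" using that by (intro gs) auto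
      qed
      show "{s. Re s > 1} \<noteq> {}" by (auto intro!: exI[of _ 2])
      show "connected {s. Re s > 0}" by (auto simp: convex_halfspace_Re_gt convex_connected)
      have "(\<lambda>s. \<Sum>i. G i * fdiff 1 s (of_nat (Suc i))) holomorphic_on {s. Re s > 0}"
        using holomorphic_fdiff_series[OF G(1), of 1] by simp
      then show "u holomorphic_on {s. Re s > 0}" unfolding u_def
        using holomorphic_fdiff[of 1 0] by (intro holomorphic_intros) auto
      show "g holomorphic_on {s. Re s > 0}" using gh by (rule holomorphic_on_subset) auto
    qed (use that open_halfspace_Re_gt in auto)
    then show ?thesis using u[OF that] by simp
  qed
  from that[OF gh gs gs0 bd] show ?thesis .
qed

section \<open>Dirichlet series of completely multiplicative functions\<close>

lemma sum_divisors_swap: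
  fixes F :: "nat \<Rightarrow> nat \<Rightarrow> 'a :: comm_monoid_add"
  shows "(\<Sum>n=1..N. \<Sum>d | d dvd n. F d (n div d)) = (\<Sum>d=1..N. \<Sum>m=1..N div d. F d m)"
proof -
  have le: "b * k \<le> N \<Longrightarrow> 0 < k \<Longrightarrow> b \<le> N" for b k :: nat
    by (cases k) auto
  have "(\<Sum>n=1..N. \<Sum>d | d dvd n. F d (n div d))
      = (\<Sum>(n,d)\<in>(SIGMA n:{1..N}. {d. d dvd n}). F d (n div d))"
    by (rule sum.Sigma) auto
  also have "\<dots> = (\<Sum>(d,m)\<in>(SIGMA d:{1..N}. {1..N div d}). F d m)"
    by (rule sum.reindex_bij_witness[of _ "\<lambda>(d,m). (d * m, d)" "\<lambda>(n,d). (d, n div d)"])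
      (auto elim!: dvdE simp: div_le_mono less_eq_div_iff_mult_less_eq mult.commute Suc_le_eq
        dest: le)
  also have "\<dots> = (\<Sum>d=1..N. \<Sum>m=1..N div d. F d m)"
    by (rule sum.Sigma[symmetric]) auto
  finally show ?thesis .
qed

lemma norm_nat_powr: "norm (complex_of_nat n powr s) = real n powr Re s"
proof (cases "n = 0")
  case False
  then show ?thesis using norm_powr_real_powr[of "of_nat n" s] by simp
qed auto

lemma nat_powr_mult: "complex_of_nat (m * n) powr s = of_nat m powr s * of_nat n powr s"
  using powr_times_real[of "of_nat m" "of_nat n" s] by simp

text \<open>The index starts at 0, where \<open>0 powr (-s) = 0\<close> removes the term, so sums
  over \<open>{1..N}\<close> compare directly with the series.\<close>

definition dser :: "(nat \<Rightarrow> complex) \<Rightarrow> complex \<Rightarrow> complex" where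
  "dser a s = (\<Sum>n. a n * of_nat n powr (-s))"

definition dconv :: "(nat \<Rightarrow> complex) \<Rightarrow> bool" where
  "dconv a \<longleftrightarrow> (\<forall>\<sigma>>1. summable (\<lambda>n. norm (a n) * real n powr (-\<sigma>)))"

lemma dconv_bounded:
  assumes "\<And>n. norm (a n) \<le> C"
  shows "dconv a"
  unfolding dconv_def
proof (intro allI impI)
  fix \<sigma> :: real assume "\<sigma> > 1"
  then have "summable (\<lambda>n. C * real n powr (-\<sigma>))"
    by (intro summable_mult) (simp add: summable_real_powr_iff)
  then show "summable (\<lambda>n. norm (a n) * real n powr (-\<sigma>))"
    by (rule summable_comparison_test'[where N = 0]) (auto intro!: mult_right_mono assms)
qed

lemma dconv_mono:
  assumes "dconv b" "\<And>n. norm (a n) \<le> norm (b n)"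
  shows "dconv a"
  unfolding dconv_def
proof (intro allI impI)
  fix \<sigma> :: real assume "\<sigma> > 1"
  then have "summable (\<lambda>n. norm (b n) * real n powr (-\<sigma>))"
    using assms by (simp add: dconv_def)
  then show "summable (\<lambda>n. norm (a n) * real n powr (-\<sigma>))"
    by (rule summable_comparison_test'[where N = 0]) (auto intro!: mult_right_mono assms)
qed

lemma dconv_ln:
  assumes "dconv a"
  shows "dconv (\<lambda>n. of_real (ln (real n)) * a n)"
  unfolding dconv_def
proof (intro allI impI)
  fix \<sigma> :: real assume s: "\<sigma> > 1"
  \<comment> \<open>Half of the distance to 1 pays for the logarithm through
    \<open>ln n \<le> n powr e / e\<close>, and the exponent \<open>\<sigma> - e\<close> stays above
    1.\<close>
  define e where "e = (\<sigma> - 1) / 2"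
  have e: "e > 0" "\<sigma> - e > 1" using s by (auto simp: e_def field_simps)
  have "summable (\<lambda>n. norm (a n) * real n powr (-(\<sigma> - e)))"
    using assms e by (auto simp: dconv_def)
  then have "summable (\<lambda>n. 1 / e * (norm (a n) * real n powr (-(\<sigma> - e))))"
    by (rule summable_mult)
  then show "summable (\<lambda>n. norm (of_real (ln (real n)) * a n) * real n powr (-\<sigma>))"
  proof (rule summable_comparison_test'[where N = 0])
    fix n :: nat
    show "norm (norm (of_real (ln (real n)) * a n) * real n powr (-\<sigma>)) \<le> 1 / e * (norm (a n) * real n powr (-(\<sigma> - e)))"
    proof (cases "n = 0")
      case False
      then have "ln (real n) \<le> real n powr e / e" using e by (intro ln_powr_bound) auto
      then have "ln (real n) * (norm (a n) * real n powr (-\<sigma>)) \<le> real n powr e / e * (norm (a n) * real n powr (-\<sigma>))"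
        by (intro mult_right_mono) auto
      also have "\<dots> = 1 / e * (norm (a n) * (real n powr e * real n powr (-\<sigma>)))" by simp
      also have "real n powr e * real n powr (-\<sigma>) = real n powr (-(\<sigma> - e))"
        by (simp add: powr_add[symmetric])
      finally show ?thesis using False by (simp add: norm_mult mult.assoc)
    qed auto
  qed
qed

lemma dser_summable_norm:
  assumes "dconv a" "Re s > 1"
  shows "summable (\<lambda>n. norm (a n * of_nat n powr (-s)))"
proof -
  have eq: "(\<lambda>n. norm (a n * of_nat n powr (-s))) = (\<lambda>n. norm (a n) * real n powr (- Re s))"
    by (simp only: norm_mult norm_nat_powr uminus_complex.sel)
  show ?thesis unfolding eq using assms unfolding dconv_def by blast
qed

lemma dser_sums:
  assumes "dconv a" "Re s > 1"
  shows "(\<lambda>n. a n * of_nat n powr (-s)) sums dser a s"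
  unfolding dser_def by (rule summable_sums[OF summable_norm_cancel[OF dser_summable_norm[OF assms]]])

lemma has_field_derivative_dser:
  assumes a: "dconv a" and s: "Re s > 1"
  shows "(dser a has_field_derivative - dser (\<lambda>n. of_real (ln (real n)) * a n) s) (at s)"
proof -
  let ?S = "{s. Re s > 1}"
  let ?f = "\<lambda>n s. a n * of_nat n powr (-s)"
  let ?f' = "\<lambda>n s. - (of_real (ln (real n)) * a n * of_nat n powr (-s))"
  have "\<exists>g g'. \<forall>x\<in>?S. (\<lambda>n. ?f n x) sums g x \<and> (\<lambda>n. ?f' n x) sums g' x \<and> (g has_field_derivative g' x) (at x)"
  proof (rule series_and_derivative_comparison_local[where f = ?f and f' = ?f' and S = ?S])
    show "open ?S" by (rule open_halfspace_Re_gt)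
    show "(?f n has_field_derivative ?f' n x) (at x)" for n x
    proof (cases "n = 0")
      case False
      have "((\<lambda>s. a n * exp (- s * of_real (ln (real n)))) has_field_derivative
         - (of_real (ln (real n)) * a n * exp (- x * of_real (ln (real n))))) (at x)"
        by (rule derivative_eq_intros refl | simp)+
      moreover have "complex_of_nat n powr (-s) = exp (- s * of_real (ln (real n)))" for s
        using False by (simp add: powr_def Ln_of_nat)
      ultimately show ?thesis by (simp only:)
    qed auto
    fix x assume x: "x \<in> ?S"
    define d where "d = (Re x - 1) / 2"
    have d: "d > 0" using x by (simp add: d_def)
    have "norm (?f n y) \<le> norm (a n) * real n powr (-(1 + d))" if "y \<in> ball x d" for n y
    proof -
      have "Re x - Re y \<le> d" using that complex_Re_le_cmod[of "x - y"] by (simp add: dist_norm)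
      then have "Re y \<ge> 1 + d" by (simp add: d_def field_simps)
      then have "real n powr (- Re y) \<le> real n powr (-(1 + d))"
        by (cases "n = 0") (auto intro!: powr_mono)
      then show ?thesis by (simp add: norm_mult norm_nat_powr mult_left_mono)
    qed
    moreover have "summable (\<lambda>n. norm (a n) * real n powr (-(1 + d)))" using a[unfolded dconv_def, rule_format, of "1 + d"] d by simp
    ultimately show "\<exists>d h. 0 < d \<and> summable h \<and> (\<forall>\<^sub>F n in sequentially. \<forall>y\<in>ball x d \<inter> ?S. norm (?f n y) \<le> h n)"
      using d by (intro exI[of _ d] exI[of _ "\<lambda>n. norm (a n) * real n powr (-(1 + d))"]) auto
  qed
  then obtain g g' where g: "\<And>x. Re x > 1 \<Longrightarrow> (\<lambda>n. ?f n x) sums g x"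
     "\<And>x. Re x > 1 \<Longrightarrow> (\<lambda>n. ?f' n x) sums g' x" "\<And>x. Re x > 1 \<Longrightarrow> (g has_field_derivative g' x) (at x)"
    by blast
  have "dser a x = g x" if "Re x > 1" for x
    using g(1)[OF that] by (simp add: dser_def sums_iff)
  moreover have "g' s = - dser (\<lambda>n. of_real (ln (real n)) * a n) s"
    using g(2)[OF s] sums_minus[OF dser_sums[OF dconv_ln[OF a] s]] sums_unique2 by blast
  ultimately show ?thesis
    using has_field_derivative_transform_within_open[OF g(3)[OF s] open_halfspace_Re_gt[of 1], of "dser a"] s
    by auto
qed

lemma holomorphic_dser:
  assumes "dconv a" shows "dser a holomorphic_on {s. Re s > 1}"
  using has_field_derivative_dser[OF assms] open_halfspace_Re_gt[of 1]
  by (auto simp: holomorphic_on_open)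

section \<open>Logarithm and logarithmic derivative of an Euler product\<close>

locale cmult =
  fixes a :: "nat \<Rightarrow> complex"
  assumes mult: "a (m * n) = a m * a n" and a1: "a 1 = 1" and bdd: "norm (a n) \<le> 1"
begin

lemma dconv: "dconv a" using dconv_bounded bdd by blast

lemma dconv_Lambda: "dconv (\<lambda>n. mangoldt n * a n)"
proof (rule dconv_mono[OF dconv_ln[OF dconv]])
  fix n
  show "norm (mangoldt n * a n) \<le> norm (of_real (ln (real n)) * a n)"
    using mangoldt_le[of n] by (cases "n = 0") (auto simp: norm_mult intro!: mult_right_mono)
qed

text \<open>The finite form of -L' = (-L'/L) L: \<open>ln\<close> is the divisor sum of
  \<open>mangoldt\<close>, and complete multiplicativity splits the twist. Being finite, it can also
  be used at \<open>s = 1\<close>, where the series converges only conditionally.\<close>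

lemma sum_ln:
  "(\<Sum>n=1..N. of_real (ln (real n)) * a n * of_nat n powr (-s)) =
   (\<Sum>d=1..N. mangoldt d * a d * of_nat d powr (-s) * (\<Sum>m=1..N div d. a m * of_nat m powr (-s)))"
proof -
  have "(\<Sum>n=1..N. of_real (ln (real n)) * a n * of_nat n powr (-s)) =
     (\<Sum>n=1..N. \<Sum>d | d dvd n. mangoldt d * a d * of_nat d powr (-s) * (a (n div d) * of_nat (n div d) powr (-s)))"
  proof (intro sum.cong refl)
    fix n assume n: "n \<in> {1..N}"
    have "of_real (ln (real n)) * a n * of_nat n powr (-s) = (\<Sum>d | d dvd n. mangoldt d * (a n * of_nat n powr (-s)))"
      using mangoldt_sum[of n, where ?'a = complex] n by (simp add: sum_distrib_right[symmetric])
    also have "\<dots> = (\<Sum>d | d dvd n. mangoldt d * a d * of_nat d powr (-s) * (a (n div d) * of_nat (n div d) powr (-s)))"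
    proof (intro sum.cong refl)
      fix d assume "d \<in> {d. d dvd n}"
      then have "n = d * (n div d)" by simp
      then have "a n * of_nat n powr (-s) = (a d * a (n div d)) * (of_nat d powr (-s) * of_nat (n div d) powr (-s))"
        using mult[of d "n div d"] nat_powr_mult[of d "n div d" "-s"] by simp
      then show "mangoldt d * (a n * of_nat n powr (-s)) = mangoldt d * a d * of_nat d powr (-s) * (a (n div d) * of_nat (n div d) powr (-s))"
        by simp
    qed
    finally show "of_real (ln (real n)) * a n * of_nat n powr (-s) = (\<Sum>d | d dvd n. mangoldt d * a d * of_nat d powr (-s) * (a (n div d) * of_nat (n div d) powr (-s)))" .
  qed
  also have "\<dots> = (\<Sum>d=1..N. \<Sum>m=1..N div d. mangoldt d * a d * of_nat d powr (-s) * (a m * of_nat m powr (-s)))"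
    by (rule sum_divisors_swap)
  finally show ?thesis by (simp add: sum_distrib_left)
qed

text \<open>Passes to the limit in \<open>sum_ln\<close> by Tannery's theorem: the inner partial
  sums are bounded by \<open>Z\<close> uniformly in the cut-off, so no product of series has to be
  rearranged.\<close>

lemma dser_ln:
  assumes s: "Re s > 1"
  shows "dser (\<lambda>n. of_real (ln (real n)) * a n) s = dser (\<lambda>n. mangoldt n * a n) s * dser a s"
proof -
  have lim: "(\<lambda>N. \<Sum>n=1..N. b n * of_nat n powr (-s)) \<longlonglongrightarrow> dser b s" if "dconv b" for b
  proof -
    have "(\<lambda>N. \<Sum>n<Suc N. b n * of_nat n powr (-s)) \<longlonglongrightarrow> dser b s"
      using dser_sums[OF that s] unfolding sums_def by (rule LIMSEQ_Suc)
    moreover have "(\<Sum>n<Suc N. b n * of_nat n powr (-s)) = (\<Sum>n=1..N. b n * of_nat n powr (-s))" for N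
      by (rule sum.mono_neutral_right) (auto simp: not_le)
    ultimately show ?thesis by simp
  qed
  define M where "M = (\<lambda>d. norm (mangoldt d * a d * of_nat d powr (-s)))"
  define Z where "Z = (\<Sum>m. norm (a m * of_nat m powr (-s)))"
  define c where "c = (\<lambda>d N. if d \<in> {1..N} then mangoldt d * a d * of_nat d powr (-s) * (\<Sum>m=1..N div d. a m * of_nat m powr (-s)) else 0)"
  have sM: "summable M" unfolding M_def using dser_summable_norm[OF dconv_Lambda s] by simp
  have Z: "norm (\<Sum>m=1..K. a m * of_nat m powr (-s)) \<le> Z" for K
    unfolding Z_def by (intro order_trans[OF norm_sum] sum_le_suminf dser_summable_norm[OF dconv s]) auto
  have Z0: "Z \<ge> 0" unfolding Z_def by (intro suminf_nonneg dser_summable_norm[OF dconv s]) auto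
  have "((\<lambda>N. \<Sum>d. c d N) \<longlonglongrightarrow> (\<Sum>d. mangoldt d * a d * of_nat d powr (-s) * dser a s))"
  proof (rule tannerys_theorem[THEN conjunct2, THEN conjunct2])
    show "summable (\<lambda>d. M d * Z)" using sM by (rule summable_mult2)
    show "\<forall>\<^sub>F (d, N) in sequentially \<times>\<^sub>F sequentially. norm (c d N) \<le> M d * Z"
      using Z Z0 by (intro always_eventually) (auto simp: c_def M_def norm_mult intro!: mult_left_mono mult_nonneg_nonneg mangoldt_nonneg)
    show "c d \<longlonglongrightarrow> mangoldt d * a d * of_nat d powr (-s) * dser a s" for d
    proof (cases "d = 0")
      case False
      have "filterlim (\<lambda>N. N div d) at_top at_top"
      proof (rule filterlim_at_top_mono)
        show "filterlim (\<lambda>N. nat \<lfloor>real N / real d\<rfloor>) at_top at_top"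
          using False by real_asymp
        show "\<forall>\<^sub>F N in at_top. nat \<lfloor>real N / real d\<rfloor> \<le> N div d"
          by (simp add: floor_divide_of_nat_eq)
      qed
      from filterlim_compose[OF lim[OF dconv] this]
      have "(\<lambda>N. mangoldt d * a d * of_nat d powr (-s) * (\<Sum>m=1..N div d. a m * of_nat m powr (-s))) \<longlonglongrightarrow> mangoldt d * a d * of_nat d powr (-s) * dser a s"
        by (intro tendsto_intros)
      moreover have "\<forall>\<^sub>F N in sequentially. mangoldt d * a d * of_nat d powr (-s) * (\<Sum>m=1..N div d. a m * of_nat m powr (-s)) = c d N"
        using eventually_ge_at_top[of d] by eventually_elim (use False in \<open>auto simp: c_def\<close>)
      ultimately show ?thesis by (rule Lim_transform_eventually)
    qed (auto simp: c_def)
  qed auto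
  moreover have "(\<Sum>d. c d N) = (\<Sum>n=1..N. of_real (ln (real n)) * a n * of_nat n powr (-s))" for N
  proof -
    have "(\<Sum>d. c d N) = (\<Sum>d\<in>{1..N}. c d N)" by (rule suminf_finite) (auto simp: c_def)
    then show ?thesis unfolding sum_ln by (simp add: c_def)
  qed
  ultimately have "dser (\<lambda>n. of_real (ln (real n)) * a n) s = (\<Sum>d. mangoldt d * a d * of_nat d powr (-s) * dser a s)"
    using lim[OF dconv_ln[OF dconv]] LIMSEQ_unique by fastforce
  also have "\<dots> = dser (\<lambda>n. mangoldt n * a n) s * dser a s"
    unfolding dser_def[of "\<lambda>n. mangoldt n * a n"]
    by (intro suminf_mult2[symmetric] sums_summable[OF dser_sums] dconv_Lambda s)
  finally show ?thesis .
qed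

text \<open>The coefficient of the logarithm of the Euler product, \<open>a p ^ k / k\<close> at
  \<open>n = p ^ k\<close>. At \<open>n = 1\<close> the convention \<open>x / 0 = 0\<close> agrees
  with \<open>mangoldt 1 = 0\<close>.\<close>

definition logcoeff :: "nat \<Rightarrow> complex" where "logcoeff n = mangoldt n * a n / of_real (ln (real n))"

lemma norm_logcoeff: "norm (logcoeff n) \<le> 1"
proof (cases "n \<ge> 2")
  case True
  then have "mangoldt n / ln (real n) \<le> 1" using mangoldt_le[of n] by simp
  then have "mangoldt n / ln (real n) * norm (a n) \<le> 1 * 1"
    using True by (intro mult_mono bdd) auto
  then show ?thesis using True by (simp add: logcoeff_def norm_divide norm_mult)
next
  case False
  then have "n = 0 \<or> n = 1" by auto
  then show ?thesis by (auto simp: logcoeff_def)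
qed

lemma dconv_logcoeff: "dconv logcoeff"
  using dconv_bounded norm_logcoeff by blast

lemma ln_logcoeff: "of_real (ln (real n)) * logcoeff n = mangoldt n * a n"
proof (cases "n \<ge> 2")
  case True then show ?thesis by (simp add: logcoeff_def)
next
  case False
  then have "n = 0 \<or> n = 1" by auto
  then show ?thesis by (auto simp: logcoeff_def)
qed

text \<open>The term \<open>n = 2\<close> is at most 1/4, and the rest at most 1/2, because 1/n^2
  \<le> 1/(n - 1) - 1/n telescopes from \<open>n = 3\<close> on. The series is therefore at least
  1/4 in modulus on \<open>Re s = 2\<close>, which is the lower bound at the centres of the discs
  used to count zeros.\<close>

lemma norm_dser_minus_1:
  assumes "Re s \<ge> 2"
  shows "norm (dser a s - 1) \<le> 3/4"
proof -
  have s: "Re s > 1" using assms by simp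
  let ?t = "\<lambda>n. a n * of_nat n powr (-s)"
  have nt: "norm (?t n) \<le> 1 / real n ^ 2" if "n \<ge> 1" for n
  proof -
    have "norm (?t n) \<le> 1 * real n powr (-2)"
      unfolding norm_mult norm_nat_powr using assms that by (intro mult_mono bdd powr_mono) auto
    also have "\<dots> = 1 / real n ^ 2" using that by (simp add: powr_minus divide_inverse)
    finally show ?thesis .
  qed
  have "dser a s = (\<Sum>n. ?t (n + 3)) + (\<Sum>n<3. ?t n)"
    unfolding dser_def by (intro suminf_split_initial_segment sums_summable[OF dser_sums[OF dconv s]])
  also have "(\<Sum>n<3. ?t n) = 1 + ?t 2" using a1 by (simp add: eval_nat_numeral)
  finally have eq: "dser a s - 1 = (\<Sum>n. ?t (n + 3)) + ?t 2" by simp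
  have "(\<lambda>n. 1 / (real n + 2)) \<longlonglongrightarrow> 0" by real_asymp
  from telescope_sums'[OF this]
  have tel: "(\<lambda>n. 1 / (real n + 2) - 1 / (real (Suc n) + 2)) sums (1/2)" by simp
  have "norm (\<Sum>n. ?t (n + 3)) \<le> (\<Sum>n. 1 / (real n + 2) - 1 / (real (Suc n) + 2))"
  proof (rule norm_suminf_le[OF _ sums_summable[OF tel]])
    fix n
    have "norm (?t (n + 3)) \<le> 1 / real (n + 3) ^ 2" by (intro nt) simp
    also have "\<dots> \<le> 1 / ((real n + 2) * (real n + 3))"
      unfolding power2_eq_square by (intro divide_left_mono mult_mono mult_pos_pos) auto
    also have "\<dots> = 1 / (real n + 2) - 1 / (real (Suc n) + 2)"
      by (simp add: divide_simps)
    finally show "norm (?t (n + 3)) \<le> 1 / (real n + 2) - 1 / (real (Suc n) + 2)" .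
  qed
  also have "\<dots> = 1/2" using tel by (simp add: sums_iff)
  finally have "norm (\<Sum>n. ?t (n + 3)) \<le> 1/2" .
  moreover have "norm (?t 2) \<le> 1/4" using nt[of 2] by simp
  ultimately show ?thesis unfolding eq using norm_triangle_ineq[of "\<Sum>n. ?t (n + 3)" "?t 2"] by linarith
qed

text \<open>The product of \<open>dser a\<close> with \<open>exp (- dser logcoeff)\<close> has
  derivative zero by \<open>dser_ln\<close>. The constant is only shown to be nonzero, from the
  value at 2, which avoids a limit at infinity.\<close>

lemma dser_eq_exp:
  obtains C where "C \<noteq> 0" "\<And>s. Re s > 1 \<Longrightarrow> dser a s = C * exp (dser logcoeff s)"
proof -
  let ?S = "{s. Re s > 1}"
  have "\<exists>C. \<forall>s\<in>?S. dser a s * exp (- dser logcoeff s) = C"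
  proof (rule has_field_derivative_zero_constant)
    show "convex ?S" by (rule convex_halfspace_Re_gt)
    fix s assume s: "s \<in> ?S"
    have 1: "(dser a has_field_derivative - (dser (\<lambda>n. mangoldt n * a n) s * dser a s)) (at s)"
      using has_field_derivative_dser[OF dconv, of s] s dser_ln[of s] by simp
    have 2: "(dser logcoeff has_field_derivative - dser (\<lambda>n. mangoldt n * a n) s) (at s)"
      using has_field_derivative_dser[OF dconv_logcoeff, of s] s by (simp add: ln_logcoeff)
    have "((\<lambda>s. dser a s * exp (- dser logcoeff s)) has_field_derivative 0) (at s)"
      by (rule derivative_eq_intros 1 2 refl)+ simp
    then show "((\<lambda>s. dser a s * exp (- dser logcoeff s)) has_field_derivative 0) (at s within ?S)"
      by (rule has_field_derivative_at_within)
  qed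
  then obtain C where C: "\<And>s. Re s > 1 \<Longrightarrow> dser a s * exp (- dser logcoeff s) = C" by auto
  show ?thesis
  proof
    show eq: "dser a s = C * exp (dser logcoeff s)" if "Re s > 1" for s
      using C[OF that] by (simp add: exp_minus field_simps)
    have "dser a 2 \<noteq> 0" using norm_dser_minus_1[of 2] by auto
    then show "C \<noteq> 0" using eq[of 2] by auto
  qed
qed

lemma dser_nonzero:
  assumes s: "Re s > 1"
  shows "dser a s \<noteq> 0"
proof -
  obtain C where "C \<noteq> 0" "\<And>s. Re s > 1 \<Longrightarrow> dser a s = C * exp (dser logcoeff s)"
    using dser_eq_exp by blast
  then show ?thesis using s by simp
qed

end

section \<open>Mertens estimates\<close>

definition cheb :: "nat \<Rightarrow> real" where "cheb N = (\<Sum>d=1..N. mangoldt d)"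

text \<open>Legendre's formula for \<open>ln (fact N)\<close>.\<close>

lemma sum_ln_eq: "(\<Sum>n=1..N. ln (real n)) = (\<Sum>d=1..N. mangoldt d * real (N div d))"
proof -
  have "(\<Sum>n=1..N. ln (real n)) = (\<Sum>n=1..N. \<Sum>d | d dvd n. mangoldt d)"
  proof (intro sum.cong refl)
    fix n assume "n \<in> {1..N}"
    then show "ln (real n) = (\<Sum>d | d dvd n. mangoldt d)"
      using mangoldt_sum[of n, where ?'a = real] by simp
  qed
  also have "\<dots> = (\<Sum>d=1..N. \<Sum>m=1..N div d. mangoldt d)"
    by (rule sum_divisors_swap)
  finally show ?thesis by (simp add: mult.commute)
qed

text \<open>Chebyshev's argument: by Legendre's formula \<open>ln ((2 * N) choose N)\<close> is the
  sum of \<open>mangoldt d\<close> weighted with \<open>(2 * N) div d - 2 * (N div d)\<close>. The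
  weight is never negative and is at least 1 for \<open>N < d \<le> 2 * N\<close>, and the binomial
  coefficient is at most \<open>2 ^ (2 * N)\<close>.\<close>

lemma cheb_double: "cheb (2 * N) \<le> cheb N + 2 * real N"
proof -
  let ?T = "\<lambda>N. \<Sum>n=1..N. ln (real n)"
  have T: "?T N = ln (fact N)" for N
    unfolding fact_prod of_nat_prod by (subst ln_prod) auto
  have ext: "?T N = (\<Sum>d=1..2*N. mangoldt d * real (N div d))" unfolding sum_ln_eq
    by (rule sum.mono_neutral_left) auto
  have "cheb (2 * N) - cheb N = (\<Sum>d=N+1..2*N. mangoldt d)"
    unfolding cheb_def using sum.ub_add_nat[of 1 N "mangoldt :: nat \<Rightarrow> real" N] by (simp add: mult_2)
  also have "\<dots> = (\<Sum>d=1..2*N. if d > N then mangoldt d else 0)"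
    by (subst sum.inter_filter[symmetric]) (auto intro!: sum.cong)
  also have "\<dots> \<le> (\<Sum>d=1..2*N. mangoldt d * (real ((2*N) div d) - 2 * real (N div d)))"
  proof (intro sum_mono)
    fix d assume d: "d \<in> {1..2*N}"
    have "2 * (N div d) \<le> (2 * N) div d" using d
      by (simp add: less_eq_div_iff_mult_less_eq)
    then have nn: "real ((2*N) div d) - 2 * real (N div d) \<ge> 0"
      by (metis diff_ge_0_iff_ge of_nat_le_iff of_nat_mult of_nat_numeral)
    have "real ((2*N) div d) - 2 * real (N div d) \<ge> 1" if "d > N"
    proof -
      have "(2*N) div d \<ge> 1" using d by (simp add: div_greater_zero_iff Suc_le_eq)
      then show ?thesis using that by simp
    qed
    then show "(if d > N then mangoldt d else 0) \<le> mangoldt d * (real ((2*N) div d) - 2 * real (N div d))"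
      using nn mangoldt_nonneg[of d] mult_left_mono[of 1 "real ((2*N) div d) - 2 * real (N div d)" "mangoldt d"]
      by (auto intro: mult_nonneg_nonneg)
  qed
  also have "\<dots> = ?T (2*N) - 2 * ?T N"
    unfolding ext sum_ln_eq[of "2*N"] by (simp add: algebra_simps sum_subtractf sum_distrib_left)
  also have "\<dots> = ln (real ((2*N) choose N))"
    unfolding T by (simp add: binomial_fact ln_div ln_mult)
  also have "\<dots> \<le> ln (2 ^ (2 * N))"
  proof (subst ln_le_cancel_iff)
    have "real ((2*N) choose N) \<le> real (2 ^ (2*N))" by (intro of_nat_mono binomial_le_pow2)
    then show "real ((2*N) choose N) \<le> 2 ^ (2*N)" by simp
  qed auto
  also have "\<dots> = 2 * real N * ln 2" by (simp add: ln_realpow)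
  also have "\<dots> \<le> 2 * real N * 1" using ln_2_less_1 by (intro mult_left_mono) auto
  finally show ?thesis by simp
qed

lemma cheb_mono: "M \<le> N \<Longrightarrow> cheb M \<le> cheb N"
  unfolding cheb_def by (intro sum_mono2) (auto intro: mangoldt_nonneg)

lemma cheb_le: "cheb N \<le> 6 * real N"
proof (induction N rule: less_induct)
  case (less N)
  show ?case
  proof (cases "N \<ge> 2")
    case True
    \<comment> \<open>Rounding up fixes the constant: the induction gives
      \<open>8 * M \<le> 4 * (N + 1)\<close>, and this is at most \<open>6 * N\<close> as soon as
      \<open>N \<ge> 2\<close>.\<close>
    define M where "M = (N + 1) div 2"
    have M: "M < N" "N \<le> 2 * M" "2 * M \<le> N + 1" using True unfolding M_def by auto
    have "cheb N \<le> cheb (2 * M)" using M by (intro cheb_mono)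
    also have "\<dots> \<le> cheb M + 2 * real M" by (rule cheb_double)
    also have "\<dots> \<le> 8 * real M" using less[OF M(1)] by simp
    also have "\<dots> \<le> 4 * (real N + 1)" using of_nat_mono[OF M(3), where ?'a = real] by simp
    also have "\<dots> \<le> 6 * real N" using True by simp
    finally show ?thesis .
  next
    case False
    then have "N = 0 \<or> N = 1" by auto
    then show ?thesis by (auto simp: cheb_def)
  qed
qed

lemma sum_ln_ge: "(\<Sum>n=1..N. ln (real n)) \<ge> real N * ln (real N) - real N"
proof (induction N)
  case (Suc N)
  show ?case
  proof (cases "N = 0")
    case False
    have "1 + 1 / real N = real (Suc N) / real N" using False by (simp add: field_simps)
    then have "ln (real (Suc N)) - ln (real N) = ln (1 + 1 / real N)"
      using False by (simp add: ln_div)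
    also have "\<dots> \<le> 1 / real N" by (intro ln_add_one_self_le_self) auto
    finally have "real N * (ln (real (Suc N)) - ln (real N)) \<le> real N * (1 / real N)"
      by (intro mult_left_mono) auto
    then have "real N * ln (real (Suc N)) \<le> real N * ln (real N) + 1"
      using False by (simp add: algebra_simps)
    then show ?thesis using Suc by (simp add: algebra_simps)
  qed auto
qed auto

lemma real_div_le: "real N / real d \<le> real (N div d) + 1"
  using floor_divide_of_nat_eq[of N d, where ?'a = real] by linarith

lemma real_div_ge: "real (N div d) \<le> real N / real d"
  using floor_divide_of_nat_eq[of N d, where ?'a = real] of_int_floor_le[of "real N / real d"] by linarith

text \<open>Compares \<open>ln (fact N)\<close> with \<open>N * ln N\<close> and with Legendre's
  formula. Replacing \<open>N div d\<close> by \<open>N / d\<close> there costs at most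
  \<open>cheb N \<le> 6 * N\<close>, which is bounded after division by \<open>N\<close>.\<close>

theorem mertens:
  assumes "N \<ge> 1"
  shows "\<bar>(\<Sum>d=1..N. mangoldt d / real d) - ln (real N)\<bar> \<le> 6"
proof -
  let ?M = "\<Sum>d=1..N. mangoldt d / real d"
  let ?T = "\<Sum>n=1..N. ln (real n)"
  have "real N * ln (real N) - real N \<le> ?T" by (rule sum_ln_ge)
  also have "\<dots> \<le> (\<Sum>d=1..N. mangoldt d * (real N / real d))"
    unfolding sum_ln_eq by (intro sum_mono mult_left_mono mangoldt_nonneg real_div_ge)
  also have "\<dots> = real N * ?M" by (simp add: sum_distrib_left mult_ac)
  finally have "real N * (ln (real N) - 1) \<le> real N * ?M" by (simp add: algebra_simps)
  then have 1: "ln (real N) - 1 \<le> ?M" using assms by (simp del: right_diff_distrib)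
  have "real N * ?M - cheb N = (\<Sum>d=1..N. mangoldt d * (real N / real d - 1))"
    by (simp add: sum_distrib_left cheb_def sum_subtractf algebra_simps)
  also have "\<dots> \<le> ?T" unfolding sum_ln_eq
  proof (intro sum_mono mult_left_mono mangoldt_nonneg)
    fix d show "real N / real d - 1 \<le> real (N div d)"
      using real_div_le[of N d] by linarith
  qed
  also have "?T \<le> (\<Sum>n=1..N. ln (real N))" by (intro sum_mono) auto
  finally have "real N * ?M \<le> real N * ln (real N) + 6 * real N" using cheb_le[of N] by simp
  then have "real N * ?M \<le> real N * (ln (real N) + 6)" by (simp add: algebra_simps)
  then have 2: "?M \<le> ln (real N) + 6" using assms by (simp del: distrib_left)
  show ?thesis using 1 2 by linarith
qed

text \<open>The factor 2 arises because the sum over a block is a difference of two prefix sums; the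
  decrements of \<open>w\<close> telescope to the first weight. The bound is uniform in
  \<open>N\<close>, so it also controls tails of convergent series.\<close>

lemma sum_by_parts_bound:
  fixes a :: "nat \<Rightarrow> complex" and w :: "nat \<Rightarrow> real"
  assumes S: "\<And>N. norm (\<Sum>n=1..N. a n) \<le> B"
    and w: "\<And>n. n > M \<Longrightarrow> w (Suc n) \<le> w n" "\<And>n. n > M \<Longrightarrow> w n \<ge> 0"
  shows "norm (\<Sum>n\<in>{M<..N}. a n * of_real (w n)) \<le> 2 * B * w (Suc M)"
proof -
  define U where "U = (\<lambda>N. \<Sum>n\<in>{M<..N}. a n)"
  have B: "B \<ge> 0" using S[of 0] by simp
  have U: "norm (U N) \<le> 2 * B" for N
  proof (cases "N \<ge> M")
    case True
    have "U N = (\<Sum>n=1..N. a n) - (\<Sum>n=1..M. a n)"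
      unfolding U_def using True by (subst sum_diff[symmetric]) (auto intro!: sum.cong)
    then show ?thesis using S[of N] S[of M] norm_triangle_le_diff[of "\<Sum>n=1..N. a n" "\<Sum>n=1..M. a n" "2*B"] by simp
  qed (use B in \<open>simp add: U_def\<close>)
  have "(\<Sum>n\<in>{M<..M+k}. a n * of_real (w n)) = U (M+k) * of_real (w (M+k)) + (\<Sum>n\<in>{M<..<M+k}. U n * of_real (w n - w (Suc n)))" for k
  proof (induction k)
    case (Suc k)
    have 1: "{M<..M + Suc k} = insert (M + Suc k) {M<..M+k}" "{M<..<M + Suc k} = {M<..M+k}" by auto
    have 2: "(\<Sum>n\<in>{M<..M+k}. U n * of_real (w n - w (Suc n))) = (\<Sum>n\<in>{M<..<M+k}. U n * of_real (w n - w (Suc n))) + U (M+k) * of_real (w (M+k) - w (Suc (M+k)))"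
    proof (cases "k = 0")
      case False
      then have "{M<..M+k} = insert (M+k) {M<..<M+k}" by auto
      then show ?thesis by simp
    qed (simp add: U_def)
    have 3: "U (M + Suc k) = U (M + k) + a (M + Suc k)" unfolding U_def 1 by simp
    have "(\<Sum>n\<in>{M<..M + Suc k}. a n * of_real (w n)) = (\<Sum>n\<in>{M<..M + k}. a n * of_real (w n)) + a (M + Suc k) * of_real (w (M + Suc k))"
      unfolding 1(1) by simp
    then show ?case unfolding 1(2) 2 3 Suc by (simp add: algebra_simps)
  qed (simp add: U_def)
  note parts = this
  show ?thesis
  proof (cases "N > M")
    case True
    define k where "k = N - M"
    have k: "N = M + k" "k > 0" using True by (auto simp: k_def)
    have tel: "w (M+k) + (\<Sum>n\<in>{M<..<M+k}. (w n - w (Suc n))) = w (Suc M)"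
      using k(2)
    proof (induction k)
      case (Suc k)
      show ?case
      proof (cases "k = 0")
        case False
        then have "{M<..<M + Suc k} = insert (M+k) {M<..<M+k}" by auto
        then show ?thesis using Suc False by simp
      qed (simp add: greaterThanLessThan_eq[symmetric] atLeastSucLessThan_greaterThanLessThan[symmetric])
    qed auto
    have "norm (\<Sum>n\<in>{M<..N}. a n * of_real (w n)) \<le> norm (U (M+k) * of_real (w (M+k))) + norm (\<Sum>n\<in>{M<..<M+k}. U n * of_real (w n - w (Suc n)))"
      unfolding k(1) parts by (rule norm_triangle_ineq)
    also have "\<dots> \<le> 2 * B * w (M+k) + (\<Sum>n\<in>{M<..<M+k}. 2 * B * (w n - w (Suc n)))"
    proof (rule add_mono)
      show "norm (U (M+k) * of_real (w (M+k))) \<le> 2 * B * w (M+k)"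
        using w(2)[of "M+k"] k U[of "M+k"] by (simp add: norm_mult mult_right_mono)
      show "norm (\<Sum>n\<in>{M<..<M+k}. U n * of_real (w n - w (Suc n))) \<le> (\<Sum>n\<in>{M<..<M+k}. 2 * B * (w n - w (Suc n)))"
      proof (intro order_trans[OF norm_sum] sum_mono)
        fix n assume "n \<in> {M<..<M+k}"
        then show "norm (U n * of_real (w n - w (Suc n))) \<le> 2 * B * (w n - w (Suc n))"
          using w(1)[of n] U[of n] by (simp add: norm_mult mult_right_mono del: of_real_diff)
      qed
    qed
    also have "\<dots> = 2 * B * (w (M+k) + (\<Sum>n\<in>{M<..<M+k}. (w n - w (Suc n))))"
      by (simp only: sum_distrib_left distrib_left)
    finally show ?thesis unfolding tel .
  next
    case False
    then have "{M<..N} = {}" by auto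
    then show ?thesis using B w(2)[of "Suc M"] by simp
  qed
qed

context cmult
begin

text \<open>In \<open>sum_ln\<close> at \<open>s = 1\<close> the left side is bounded by partial
  summation, and the inner sums up to \<open>N div d\<close> differ from \<open>A\<close> by O(d/N).
  These errors add up to O(cheb N / N), which is bounded; hence \<open>A\<close> times the sum in
  question is bounded, and \<open>A\<close> can be divided out.\<close>

theorem mertens_twisted:
  assumes S: "\<And>N. norm (\<Sum>n=1..N. a n) \<le> B"
    and A: "(\<lambda>n. a n / of_nat n) sums A" "A \<noteq> 0"
  shows "\<exists>C. \<forall>N. norm (\<Sum>n=1..N. mangoldt n * a n / of_nat n) \<le> C"
proof -
  have B: "B \<ge> 0" using S[of 0] by simp
  have tail: "norm ((\<Sum>n=1..M. a n / of_nat n) - A) \<le> 2 * B * (1 / real (Suc M))" for M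
  proof -
    have "(\<lambda>N. norm (\<Sum>n\<in>{M<..N}. a n / of_nat n)) \<longlonglongrightarrow> norm (A - (\<Sum>n=1..M. a n / of_nat n))"
    proof (intro tendsto_norm)
      have "(\<lambda>N. (\<Sum>n<Suc N. a n / of_nat n) - (\<Sum>n=1..M. a n / of_nat n)) \<longlonglongrightarrow> A - (\<Sum>n=1..M. a n / of_nat n)"
        using A(1) unfolding sums_def by (intro tendsto_intros LIMSEQ_Suc)
      moreover have "\<forall>\<^sub>F N in sequentially. (\<Sum>n<Suc N. a n / of_nat n) - (\<Sum>n=1..M. a n / of_nat n) = (\<Sum>n\<in>{M<..N}. a n / of_nat n)"
        using eventually_ge_at_top[of M]
      proof eventually_elim
        case (elim N)
        have "(\<Sum>n<Suc N. a n / of_nat n) = (\<Sum>n=1..N. a n / of_nat n)"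
          by (rule sum.mono_neutral_right) (auto simp: not_le)
        moreover have "(\<Sum>n=1..N. a n / of_nat n) - (\<Sum>n=1..M. a n / of_nat n) = (\<Sum>n\<in>{M<..N}. a n / of_nat n)"
          using elim by (subst sum_diff[symmetric]) (auto intro!: sum.cong)
        ultimately show ?case by simp
      qed
      ultimately show "(\<lambda>N. \<Sum>n\<in>{M<..N}. a n / of_nat n) \<longlonglongrightarrow> A - (\<Sum>n=1..M. a n / of_nat n)"
        by (rule Lim_transform_eventually)
    qed
    moreover have "norm (\<Sum>n\<in>{M<..N}. a n / of_nat n) \<le> 2 * B * (1 / real (Suc M))" for N
      using sum_by_parts_bound[OF S, of M "\<lambda>n. 1 / real n" N] by (simp add: field_simps)
    ultimately have "norm (A - (\<Sum>n=1..M. a n / of_nat n)) \<le> 2 * B * (1 / real (Suc M))"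
      by (intro tendsto_upperbound) auto
    then show ?thesis by (simp add: norm_minus_commute)
  qed
  have lnb: "norm (\<Sum>n=1..N. of_real (ln (real n)) * a n / of_nat n) \<le> 2 + 2 * B" for N
  proof -
    \<comment> \<open>\<open>ln n / n\<close> decreases only beyond \<open>exp 1\<close>, so the
      monotone weights start at \<open>n = 3\<close>; the term \<open>n = 2\<close> is bounded
      separately and \<open>n = 1\<close> contributes 0.\<close>
    have 1: "norm (\<Sum>n\<in>{2<..N}. a n * of_real (ln (real n) / real n)) \<le> 2 * B * (ln (real (Suc 2)) / real (Suc 2))"
    proof (rule sum_by_parts_bound[OF S])
      fix n :: nat assume n: "n > 2"
      show "ln (real (Suc n)) / real (Suc n) \<le> ln (real n) / real n"
        using n exp_le by (intro ln_x_over_x_mono) linarith+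
      show "ln (real n) / real n \<ge> 0" using n by simp
    qed
    have "ln (3::real) \<le> 3" using ln_le_minus_one[of "3::real"] by simp
    then have "2 * B * (ln (real (Suc 2)) / real (Suc 2)) \<le> 2 * B * 1" using B by (intro mult_left_mono) auto
    with 1 have 2: "norm (\<Sum>n\<in>{2<..N}. a n * of_real (ln (real n) / real n)) \<le> 2 * B" by linarith
    have split: "(\<Sum>n=1..N. of_real (ln (real n)) * a n / of_nat n) = (\<Sum>n\<in>{1..N}\<inter>{2}. of_real (ln (real n)) * a n / of_nat n) + (\<Sum>n\<in>{2<..N}. a n * of_real (ln (real n) / real n))"
    proof -
      have "(\<Sum>n=1..N. of_real (ln (real n)) * a n / of_nat n) = (\<Sum>n\<in>({1..N}\<inter>{2}) \<union> {2<..N}. of_real (ln (real n)) * a n / of_nat n)"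
      proof (rule sum.mono_neutral_right)
        show "\<forall>i\<in>{1..N} - ({1..N} \<inter> {2} \<union> {2<..N}). of_real (ln (real i)) * a i / of_nat i = 0"
        proof
          fix i assume "i \<in> {1..N} - ({1..N} \<inter> {2} \<union> {2<..N})"
          then have "i = 1" by auto
          then show "of_real (ln (real i)) * a i / of_nat i = 0" by simp
        qed
      qed auto
      also have "\<dots> = (\<Sum>n\<in>{1..N}\<inter>{2}. of_real (ln (real n)) * a n / of_nat n) + (\<Sum>n\<in>{2<..N}. of_real (ln (real n)) * a n / of_nat n)"
        by (rule sum.union_disjoint) auto
      finally show ?thesis by (simp add: mult_ac)
    qed
    have "norm (\<Sum>n\<in>{1..N}\<inter>{2}. of_real (ln (real n)) * a n / of_nat n) \<le> 2"
    proof (cases "2 \<le> N")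
      case True
      then have "{1..N} \<inter> {2} = {2}" by auto
      moreover have "ln 2 * norm (a 2) \<le> 1 * 1" using ln_2_less_1 by (intro mult_mono bdd) auto
      ultimately show ?thesis by (simp add: norm_mult norm_divide)
    qed auto
    from norm_triangle_mono[OF this 2] show ?thesis unfolding split .
  qed
  have main: "norm (\<Sum>n=1..N. mangoldt n * a n / of_nat n) \<le> (2 + 2 * B + 12 * B) / norm A" for N
  proof (cases "N = 0")
    case False
    have pw: "complex_of_nat n powr (-1) = 1 / of_nat n" for n
      by (cases "n = 0") (auto simp: powr_minus divide_inverse)
    let ?D = "\<Sum>d=1..N. mangoldt d * a d / of_nat d"
    have "(\<Sum>n=1..N. of_real (ln (real n)) * a n / of_nat n) = (\<Sum>d=1..N. mangoldt d * a d / of_nat d * (\<Sum>m=1..N div d. a m / of_nat m))"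
      using sum_ln[of 1 N] unfolding pw by (simp only: times_divide_eq_right times_divide_eq_left mult_1_right)
    moreover have "(\<Sum>d=1..N. mangoldt d * a d / of_nat d * ((\<Sum>m=1..N div d. a m / of_nat m) - A)) =
        (\<Sum>d=1..N. mangoldt d * a d / of_nat d * (\<Sum>m=1..N div d. a m / of_nat m)) - ?D * A"
      by (simp only: right_diff_distrib sum_subtractf sum_distrib_right)
    ultimately have "?D * A = (\<Sum>n=1..N. of_real (ln (real n)) * a n / of_nat n) - (\<Sum>d=1..N. mangoldt d * a d / of_nat d * ((\<Sum>m=1..N div d. a m / of_nat m) - A))"
      by simp
    also have "norm \<dots> \<le> (2 + 2 * B) + 12 * B"
    proof (rule order_trans[OF norm_triangle_ineq4 add_mono[OF lnb]])
      have "norm (\<Sum>d=1..N. mangoldt d * a d / of_nat d * ((\<Sum>m=1..N div d. a m / of_nat m) - A)) \<le> (\<Sum>d=1..N. mangoldt d * (2 * B / real N))"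
      proof (intro order_trans[OF norm_sum] sum_mono)
        fix d assume d: "d \<in> {1..N}"
        have "real N / real d \<le> real (Suc (N div d))" using real_div_le[of N d] by simp
        then have "1 / real (Suc (N div d)) \<le> 1 / (real N / real d)"
          using d False by (intro divide_left_mono) auto
        then have *: "2 * B * (1 / real (Suc (N div d))) \<le> 2 * B * (real d / real N)" using B by (intro mult_left_mono) auto
        have "norm (mangoldt d * a d / of_nat d * ((\<Sum>m=1..N div d. a m / of_nat m) - A)) = mangoldt d / real d * (norm (a d) * norm ((\<Sum>m=1..N div d. a m / of_nat m) - A))"
          by (simp add: norm_mult norm_divide)
        also have "\<dots> \<le> mangoldt d / real d * (1 * (2 * B * (real d / real N)))"
          using order_trans[OF tail *] by (intro mult_left_mono mult_mono bdd) (auto intro: mangoldt_nonneg divide_nonneg_nonneg)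
        also have "\<dots> = mangoldt d * (2 * B / real N)" using d by simp
        finally show "norm (mangoldt d * a d / of_nat d * ((\<Sum>m=1..N div d. a m / of_nat m) - A)) \<le> mangoldt d * (2 * B / real N)" .
      qed
      also have "\<dots> = cheb N * (2 * B / real N)" unfolding cheb_def sum_distrib_right ..
      also have "\<dots> \<le> 6 * real N * (2 * B / real N)" using B by (intro mult_right_mono cheb_le) auto
      also have "\<dots> = 12 * B" using False by simp
      finally show "norm (\<Sum>d=1..N. mangoldt d * a d / of_nat d * ((\<Sum>m=1..N div d. a m / of_nat m) - A)) \<le> 12 * B" .
    qed
    finally show ?thesis using A(2) by (simp add: norm_mult field_simps)
  qed (use B in simp)
  then show ?thesis by blast
qed

end

section \<open>Nonvanishing on the line Re s = 1\<close>

lemma deriv_funpow_dser: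
  assumes "dconv a" "Re s > 1"
  shows "(deriv ^^ k) (dser a) s = (-1) ^ k * dser (\<lambda>n. of_real (ln (real n) ^ k) * a n) s"
    and "dconv (\<lambda>n. of_real (ln (real n) ^ k) * a n)"
proof -
  have *: "dconv (\<lambda>n. of_real (ln (real n) ^ k) * a n) \<and>
     (\<forall>s. Re s > 1 \<longrightarrow> (deriv ^^ k) (dser a) s = (-1) ^ k * dser (\<lambda>n. of_real (ln (real n) ^ k) * a n) s)"
  proof (induction k)
    case (Suc k)
    let ?b = "\<lambda>n. of_real (ln (real n) ^ k) * a n"
    have b: "dconv ?b" using Suc by blast
    have e: "(\<lambda>n. of_real (ln (real n)) * ?b n) = (\<lambda>n. of_real (ln (real n) ^ Suc k) * a n)"
      by (simp add: mult_ac)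
    have "(deriv ^^ Suc k) (dser a) s = (-1) ^ Suc k * dser (\<lambda>n. of_real (ln (real n) ^ Suc k) * a n) s" if s: "Re s > 1" for s
    proof -
      have "((\<lambda>s. (-1) ^ k * dser ?b s) has_field_derivative (-1) ^ k * (- dser (\<lambda>n. of_real (ln (real n)) * ?b n) s)) (at s)"
        by (intro DERIV_cmult has_field_derivative_dser b s)
      then have "((deriv ^^ k) (dser a) has_field_derivative (-1) ^ k * (- dser (\<lambda>n. of_real (ln (real n)) * ?b n) s)) (at s)"
        by (rule has_field_derivative_transform_within_open[OF _ open_halfspace_Re_gt[of 1]])
          (use Suc s in auto)
      then show ?thesis unfolding e using DERIV_imp_deriv by fastforce
    qed
    then show ?case using dconv_ln[OF b] unfolding e by blast
  qed (use assms in auto)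
  show "(deriv ^^ k) (dser a) s = (-1) ^ k * dser (\<lambda>n. of_real (ln (real n) ^ k) * a n) s"
    "dconv (\<lambda>n. of_real (ln (real n) ^ k) * a n)" using * assms by auto
qed

lemma dser_real_nonneg:
  assumes "dconv (\<lambda>n. of_real (w n))" "\<And>n. w n \<ge> (0::real)" "\<sigma> > 1"
  shows "dser (\<lambda>n. of_real (w n)) (of_real \<sigma>) \<in> \<real>\<^sub>\<ge>\<^sub>0"
proof -
  have eq: "(\<lambda>n. of_real (w n) * of_nat n powr (- of_real \<sigma>)) = (\<lambda>n. complex_of_real (w n * real n powr (-\<sigma>)))"
  proof
    fix n show "of_real (w n) * of_nat n powr (- of_real \<sigma>) = complex_of_real (w n * real n powr (-\<sigma>))"
      using powr_of_real[of "real n" "-\<sigma>"] by simp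
  qed
  have "(\<lambda>n. complex_of_real (w n * real n powr (-\<sigma>))) sums dser (\<lambda>n. of_real (w n)) (of_real \<sigma>)"
    using dser_sums[OF assms(1), of "of_real \<sigma>"] assms(3) unfolding eq by simp
  moreover have "summable (\<lambda>n. w n * real n powr (-\<sigma>))"
  proof -
    have "summable (\<lambda>n. norm (complex_of_real (w n)) * real n powr (-\<sigma>))" using assms unfolding dconv_def by blast
    then show ?thesis using assms(2) by simp
  qed
  ultimately have "dser (\<lambda>n. of_real (w n)) (of_real \<sigma>) = of_real (\<Sum>n. w n * real n powr (-\<sigma>))"
    using sums_unique2 sums_of_real summable_sums by blast
  moreover have "(\<Sum>n. w n * real n powr (-\<sigma>)) \<ge> 0"
    by (intro suminf_nonneg \<open>summable _\<close>) (use assms in auto)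
  ultimately show ?thesis by simp
qed

text \<open>The alternating sign means that the Taylor coefficients at 2 in powers of
  \<open>2 - s\<close> are nonnegative, which is the direction in which Landau's argument moves to
  the left.\<close>

definition alt_nonneg :: "(complex \<Rightarrow> complex) \<Rightarrow> bool" where
  "alt_nonneg f \<longleftrightarrow> (\<forall>k. (-1) ^ k * (deriv ^^ k) f 2 \<in> \<real>\<^sub>\<ge>\<^sub>0)"

lemma alt_nonneg_dser:
  assumes "dconv (\<lambda>n. of_real (w n))" "\<And>n. w n \<ge> (0::real)"
  shows "alt_nonneg (dser (\<lambda>n. of_real (w n)))"
  unfolding alt_nonneg_def
proof
  fix k
  have d: "dconv (\<lambda>n. of_real (ln (real n) ^ k * w n))"
    using deriv_funpow_dser(2)[OF assms(1), of 2 k] by simp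
  have "(-1) ^ k * (deriv ^^ k) (dser (\<lambda>n. of_real (w n))) 2 = (-1)^k * ((-1)^k * dser (\<lambda>n. of_real (ln (real n) ^ k * w n)) (of_real 2))"
    using deriv_funpow_dser(1)[OF assms(1), of 2 k] by simp
  also have "\<dots> = dser (\<lambda>n. of_real (ln (real n) ^ k * w n)) (of_real 2)"
    by (simp add: mult.assoc[symmetric] power_mult_distrib[symmetric])
  also have "\<dots> \<in> \<real>\<^sub>\<ge>\<^sub>0"
  proof (rule dser_real_nonneg[OF d])
    fix n show "ln (real n) ^ k * w n \<ge> 0"
      by (cases "n = 0") (auto intro!: mult_nonneg_nonneg assms simp: Suc_le_eq)
  qed auto
  finally show "(-1) ^ k * (deriv ^^ k) (dser (\<lambda>n. of_real (w n))) 2 \<in> \<real>\<^sub>\<ge>\<^sub>0" .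
qed

lemma sum_nonneg_Reals: "(\<And>i. i \<in> A \<Longrightarrow> f i \<in> \<real>\<^sub>\<ge>\<^sub>0) \<Longrightarrow> sum f A \<in> (\<real>\<^sub>\<ge>\<^sub>0 :: complex set)"
  by (induction A rule: infinite_finite_induct) auto

text \<open>In the Leibniz formula for (exp f)' = f' exp f the sign \<open>(-1) ^ k\<close> splits
  into one sign for each factor, so nonnegativity propagates by strong induction on the
  order.\<close>

lemma alt_nonneg_exp:
  assumes f: "f holomorphic_on S" "open S" "2 \<in> S" and nn: "alt_nonneg f"
  shows "alt_nonneg (\<lambda>s. exp (f s))"
proof -
  have f0: "f 2 \<in> \<real>\<^sub>\<ge>\<^sub>0" using nn[unfolded alt_nonneg_def, rule_format, of 0] by simp
  have df: "deriv f holomorphic_on S" using f by (intro holomorphic_deriv)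
  have ef: "(\<lambda>s. exp (f s)) holomorphic_on S" using f by (intro holomorphic_intros)
  have "(-1) ^ k * (deriv ^^ k) (\<lambda>s. exp (f s)) 2 \<in> \<real>\<^sub>\<ge>\<^sub>0" for k
  proof (induction k rule: less_induct)
    case (less k)
    show ?case
    proof (cases k)
      case 0
      from f0 obtain r where "f 2 = of_real r" by (auto elim: nonneg_Reals_cases)
      then show ?thesis using 0 by (simp add: exp_of_real)
    next
      case (Suc j)
      have "(deriv ^^ k) (\<lambda>s. exp (f s)) 2 = (deriv ^^ j) (deriv (\<lambda>s. exp (f s))) 2"
        by (simp add: Suc funpow_Suc_right del: funpow.simps)
      also have "\<dots> = (deriv ^^ j) (\<lambda>s. deriv f s * exp (f s)) 2"
      proof (rule higher_deriv_transform_within_open[OF _ _ f(2,3)])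
        show "deriv (\<lambda>s. exp (f s)) holomorphic_on S" using ef f(2) by (intro holomorphic_deriv)
        show "(\<lambda>s. deriv f s * exp (f s)) holomorphic_on S" by (rule holomorphic_on_mult[OF df ef])
        fix w assume "w \<in> S"
        then have "(f has_field_derivative deriv f w) (at w)" by (rule holomorphic_derivI[OF f(1,2)])
        then have "((\<lambda>s. exp (f s)) has_field_derivative (deriv f w * exp (f w))) (at w)"
          by (auto intro!: derivative_eq_intros)
        then show "deriv (\<lambda>s. exp (f s)) w = deriv f w * exp (f w)" by (rule DERIV_imp_deriv)
      qed
      also have "\<dots> = (\<Sum>i=0..j. of_nat (j choose i) * (deriv ^^ i) (deriv f) 2 * (deriv ^^ (j - i)) (\<lambda>s. exp (f s)) 2)"
        by (rule higher_deriv_mult[OF df ef f(2,3)])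
      finally have K: "(deriv ^^ k) (\<lambda>s. exp (f s)) 2 = (\<Sum>i=0..j. of_nat (j choose i) * (deriv ^^ i) (deriv f) 2 * (deriv ^^ (j - i)) (\<lambda>s. exp (f s)) 2)" .
      have "(-1) ^ k * (deriv ^^ k) (\<lambda>s. exp (f s)) 2 = - (\<Sum>i=0..j. (-1) ^ j * (of_nat (j choose i) * (deriv ^^ i) (deriv f) 2 * (deriv ^^ (j - i)) (\<lambda>s. exp (f s)) 2))"
        unfolding K unfolding Suc by (simp add: sum_distrib_left[symmetric] del: funpow.simps)
      also have "\<dots> = (\<Sum>i=0..j. of_nat (j choose i) * ((-1) ^ Suc i * (deriv ^^ Suc i) f 2) * ((-1) ^ (j - i) * (deriv ^^ (j - i)) (\<lambda>s. exp (f s)) 2))"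
        unfolding sum_negf[symmetric]
      proof (intro sum.cong refl)
        fix i assume i: "i \<in> {0..j}"
        have p: "(-1) ^ j = (-1 :: complex) ^ i * (-1) ^ (j - i)" using i by (simp add: power_add[symmetric])
        have d: "(deriv ^^ i) (deriv f) 2 = (deriv ^^ Suc i) f 2" by (simp add: funpow_Suc_right del: funpow.simps)
        show "- ((-1) ^ j * (of_nat (j choose i) * (deriv ^^ i) (deriv f) 2 * (deriv ^^ (j - i)) (\<lambda>s. exp (f s)) 2)) = of_nat (j choose i) * ((-1) ^ Suc i * (deriv ^^ Suc i) f 2) * ((-1) ^ (j - i) * (deriv ^^ (j - i)) (\<lambda>s. exp (f s)) 2)"
          unfolding p d by (simp add: mult_ac del: funpow.simps)
      qed
      also have "\<dots> \<in> \<real>\<^sub>\<ge>\<^sub>0"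
      proof (rule sum_nonneg_Reals)
        fix i assume "i \<in> {0..j}"
        have 1: "(-1) ^ Suc i * (deriv ^^ Suc i) f 2 \<in> \<real>\<^sub>\<ge>\<^sub>0" using nn unfolding alt_nonneg_def by blast
        have 2: "(-1) ^ (j - i) * (deriv ^^ (j - i)) (\<lambda>s. exp (f s)) 2 \<in> \<real>\<^sub>\<ge>\<^sub>0" using Suc by (intro less) auto
        have 3: "of_nat (j choose i) \<in> (\<real>\<^sub>\<ge>\<^sub>0 :: complex set)" by simp
        show "of_nat (j choose i) * ((-1) ^ Suc i * (deriv ^^ Suc i) f 2) * ((-1) ^ (j - i) * (deriv ^^ (j - i)) (\<lambda>s. exp (f s)) 2) \<in> \<real>\<^sub>\<ge>\<^sub>0"
          by (rule nonneg_Reals_mult_I[OF nonneg_Reals_mult_I[OF 3 1] 2])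
      qed
      finally show ?thesis .
    qed
  qed
  then show ?thesis by (simp add: alt_nonneg_def)
qed

text \<open>Landau's argument: the Taylor coefficients at 2 of a function with a holomorphic continuation
  dominate those of any finite part of its Euler product.\<close>

lemma landau_bound:
  assumes w: "dconv (\<lambda>n. of_real (w n))" "\<And>n. w n \<ge> (0::real)"
    and F: "F holomorphic_on ball 2 2" and C: "C \<noteq> 0"
    and eq: "\<And>s. Re s > 1 \<Longrightarrow> F s = C * exp (dser (\<lambda>n. of_real (w n)) s)"
  shows "exp (\<Sum>n<N. w n * real n powr (-1/2)) \<le> norm (F (1/2)) / norm C"
proof -
  \<comment> \<open>The first \<open>N\<close> coefficients form an entire function, so the Taylor
    series of its exponential is valid at 1/2. The others are only known to converge for
    \<open>Re s > 1\<close>, and enter through derivatives at 2 alone.\<close>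
  define u where "u = (\<lambda>n. if n < N then w n else 0)"
  define v where "v = (\<lambda>n. if n < N then 0 else w n)"
  have uv: "dconv (\<lambda>n. of_real (u n))" "dconv (\<lambda>n. of_real (v n))" "\<And>n. u n \<ge> 0" "\<And>n. v n \<ge> 0"
    using dconv_mono[OF w(1)] w(2) by (auto simp: u_def v_def)
  let ?P = "dser (\<lambda>n. of_real (u n))" and ?R = "dser (\<lambda>n. of_real (v n))"
  let ?S = "{s. Re s > 1}"
  have oS: "open ?S" "2 \<in> ?S" using open_halfspace_Re_gt[of 1] by auto
  have Pfin: "?P s = (\<Sum>n<N. of_real (w n) * of_nat n powr (-s))" for s
    unfolding dser_def by (subst suminf_finite[of "{..<N}"]) (auto simp: u_def)
  have Phol: "?P holomorphic_on UNIV"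
  proof -
    have "(\<lambda>s. complex_of_nat n powr - s) holomorphic_on UNIV" for n
      by (cases "n = 0") (auto simp: powr_def intro!: holomorphic_intros)
    then have "(\<lambda>s. \<Sum>n<N. of_real (w n) * of_nat n powr (-s)) holomorphic_on UNIV"
      by (intro holomorphic_on_sum holomorphic_on_mult holomorphic_on_const) auto
    moreover have "?P = (\<lambda>s. \<Sum>n<N. of_real (w n) * of_nat n powr (-s))" using Pfin by (rule ext)
    ultimately show ?thesis by simp
  qed
  have Rhol: "?R holomorphic_on ?S" by (rule holomorphic_dser[OF uv(2)])
  have PR: "dser (\<lambda>n. of_real (w n)) s = ?P s + ?R s" if "Re s > 1" for s
  proof -
    have "(\<lambda>n. of_real (u n) * of_nat n powr (-s) + of_real (v n) * of_nat n powr (-s)) sums (?P s + ?R s)"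
      using uv that by (intro sums_add dser_sums)
    moreover have "of_real (u n) * of_nat n powr (-s) + of_real (v n) * of_nat n powr (-s) = of_real (w n) * of_nat n powr (-s)" for n
      by (simp add: u_def v_def)
    ultimately show ?thesis unfolding dser_def[of "\<lambda>n. of_real (w n)"] by (simp add: sums_iff)
  qed
  have nP: "alt_nonneg (\<lambda>s. exp (?P s))" using uv Phol by (intro alt_nonneg_exp[of _ UNIV] alt_nonneg_dser) auto
  have nR: "alt_nonneg (\<lambda>s. exp (?R s))" using uv Rhol oS by (intro alt_nonneg_exp[of _ ?S] alt_nonneg_dser) auto
  define G where "G = (\<lambda>s. F s / C)"
  have Ghol: "G holomorphic_on ball 2 2" unfolding G_def using F C by (intro holomorphic_intros) auto
  have Geq: "G s = exp (?P s) * exp (?R s)" if "Re s > 1" for s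
    using that eq[OF that] C PR[OF that] by (simp add: G_def exp_add)
  have R1: "exp (?R 2) - 1 \<in> \<real>\<^sub>\<ge>\<^sub>0"
  proof -
    have "?R 2 \<in> \<real>\<^sub>\<ge>\<^sub>0" using dser_real_nonneg[OF uv(2,4), of 2] by simp
    then obtain r where "?R 2 = of_real r" "r \<ge> 0" by (auto elim: nonneg_Reals_cases)
    then have "exp (?R 2) - 1 = of_real (exp r - 1)" "exp r - 1 \<ge> 0" by (auto simp: exp_of_real)
    then show ?thesis by (simp only: nonneg_Reals_of_real_iff)
  qed
  \<comment> \<open>In the Leibniz formula for \<open>G\<close>, locally the product of the two
    exponentials, every term is nonnegative once the sign is distributed. The term
    \<open>i = k\<close> carries the factor \<open>exp (?R 2) \<ge> 1\<close>, so \<open>G\<close>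
    dominates the finite part coefficient by coefficient.\<close>
  have dom: "(-1) ^ k * (deriv ^^ k) G 2 - (-1) ^ k * (deriv ^^ k) (\<lambda>s. exp (?P s)) 2 \<in> \<real>\<^sub>\<ge>\<^sub>0" for k
  proof -
    let ?p = "\<lambda>i. (deriv ^^ i) (\<lambda>s. exp (?P s)) 2" and ?r = "\<lambda>i. (deriv ^^ i) (\<lambda>s. exp (?R s)) 2"
    have hP: "(\<lambda>s. exp (?P s)) holomorphic_on ?S" using holomorphic_on_subset[OF Phol] by (intro holomorphic_intros) auto
    have hR: "(\<lambda>s. exp (?R s)) holomorphic_on ?S" using Rhol by (intro holomorphic_intros) auto
    have "(deriv ^^ k) G 2 = (deriv ^^ k) (\<lambda>s. exp (?P s) * exp (?R s)) 2"
    proof (rule higher_deriv_transform_within_open[of _ "?S \<inter> ball 2 2"])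
      show "G holomorphic_on ?S \<inter> ball 2 2" by (rule holomorphic_on_subset[OF Ghol]) auto
      show "(\<lambda>s. exp (?P s) * exp (?R s)) holomorphic_on ?S \<inter> ball 2 2"
        by (rule holomorphic_on_subset[of _ ?S]) (use hP hR in \<open>auto intro!: holomorphic_intros\<close>)
    qed (use oS Geq in auto)
    also have "\<dots> = (\<Sum>i=0..k. of_nat (k choose i) * ?p i * ?r (k - i))"
      by (rule higher_deriv_mult[OF hP hR oS])
    also have "\<dots> = (\<Sum>i=0..<k. of_nat (k choose i) * ?p i * ?r (k - i)) + ?p k * exp (?R 2)"
      by (simp add: atLeast0AtMost atLeast0LessThan lessThan_Suc_atMost[symmetric])
    finally have "(-1) ^ k * (deriv ^^ k) G 2 - (-1) ^ k * ?p k = (\<Sum>i=0..<k. (-1) ^ k * (of_nat (k choose i) * ?p i * ?r (k - i))) + ((-1) ^ k * ?p k) * (exp (?R 2) - 1)"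
      by (simp add: algebra_simps sum_distrib_left)
    also have "(\<Sum>i=0..<k. (-1) ^ k * (of_nat (k choose i) * ?p i * ?r (k - i))) = (\<Sum>i=0..<k. of_nat (k choose i) * ((-1) ^ i * ?p i) * ((-1) ^ (k - i) * ?r (k - i)))"
    proof (intro sum.cong refl)
      fix i assume i: "i \<in> {0..<k}"
      have p: "(-1) ^ k = (-1 :: complex) ^ i * (-1) ^ (k - i)" using i by (simp add: power_add[symmetric])
      show "(-1) ^ k * (of_nat (k choose i) * ?p i * ?r (k - i)) = of_nat (k choose i) * ((-1) ^ i * ?p i) * ((-1) ^ (k - i) * ?r (k - i))"
        unfolding p by (simp add: mult_ac)
    qed
    also have "\<dots> + ((-1) ^ k * ?p k) * (exp (?R 2) - 1) \<in> \<real>\<^sub>\<ge>\<^sub>0"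
    proof -
      have 1: "(-1) ^ i * ?p i \<in> \<real>\<^sub>\<ge>\<^sub>0" "(-1) ^ i * ?r i \<in> \<real>\<^sub>\<ge>\<^sub>0" for i
        using nP nR unfolding alt_nonneg_def by blast+
      have 2: "of_nat (k choose i) \<in> (\<real>\<^sub>\<ge>\<^sub>0 :: complex set)" for i by simp
      have 3: "(\<Sum>i=0..<k. of_nat (k choose i) * ((-1) ^ i * ?p i) * ((-1) ^ (k - i) * ?r (k - i))) \<in> \<real>\<^sub>\<ge>\<^sub>0"
        by (rule sum_nonneg_Reals) (rule nonneg_Reals_mult_I[OF nonneg_Reals_mult_I[OF 2 1(1)] 1(2)])
      have 4: "((-1) ^ k * ?p k) * (exp (?R 2) - 1) \<in> \<real>\<^sub>\<ge>\<^sub>0" by (rule nonneg_Reals_mult_I[OF 1(1) R1])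
      show ?thesis by (rule nonneg_Reals_add_I[OF 3 4])
    qed
    finally show ?thesis by simp
  qed
  \<comment> \<open>At \<open>s = 1/2\<close> the increment from 2 is -3/2, and its powers carry
    exactly the alternating sign; the two series can therefore be compared term by term.\<close>
  let ?c = "\<lambda>f k. (deriv ^^ k) f (2::complex) / fact k * (1/2 - 2) ^ k"
  have c: "?c f k = (-1) ^ k * (deriv ^^ k) f 2 * (of_real ((3/2) ^ k / fact k))" for f k
  proof -
    have p: "(1/2 - 2 :: complex) ^ k = (-1) ^ k * (3/2) ^ k" by (simp add: power_mult_distrib[symmetric])
    have q: "complex_of_real ((3/2) ^ k / fact k) = (3/2) ^ k / fact k" by simp
    show ?thesis unfolding p q by (simp only: times_divide_eq_left times_divide_eq_right mult_ac)
  qed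
  have half: "1/2 \<in> ball (2::complex) 2" by (simp add: dist_norm)
  have sG: "(\<lambda>k. ?c G k) sums G (1/2)" by (rule holomorphic_power_series[OF Ghol half])
  have sP: "(\<lambda>k. ?c (\<lambda>s. exp (?P s)) k) sums exp (?P (1/2))"
    by (rule holomorphic_power_series[OF _ half]) (use holomorphic_on_subset[OF Phol] in \<open>auto intro!: holomorphic_intros\<close>)
  have "Re (?c (\<lambda>s. exp (?P s)) k) \<le> Re (?c G k)" for k
  proof -
    have "?c G k - ?c (\<lambda>s. exp (?P s)) k = ((-1) ^ k * (deriv ^^ k) G 2 - (-1) ^ k * (deriv ^^ k) (\<lambda>s. exp (?P s)) 2) * of_real ((3/2) ^ k / fact k)"
      unfolding c by (simp add: algebra_simps)
    also have "\<dots> \<in> \<real>\<^sub>\<ge>\<^sub>0" using dom[of k] by (intro nonneg_Reals_mult_I) (auto simp del: of_real_divide)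
    finally have "Re (?c G k - ?c (\<lambda>s. exp (?P s)) k) \<ge> 0" by (simp add: complex_nonneg_Reals_iff)
    then show ?thesis by simp
  qed
  then have "Re (exp (?P (1/2))) \<le> Re (G (1/2))"
    using sums_Re[OF sP] sums_Re[OF sG] by (rule sums_le)
  also have "\<dots> \<le> norm (G (1/2))" by (rule complex_Re_le_cmod)
  also have "?P (1/2) = of_real (\<Sum>n<N. w n * real n powr (-1/2))"
  proof -
    have "complex_of_nat n powr (- (1/2)) = of_real (real n powr (-1/2))" for n
      using powr_of_real[of "real n" "-1/2"] by simp
    then show ?thesis unfolding Pfin by simp
  qed
  finally have "Re (exp (of_real (\<Sum>n<N. w n * real n powr (-1/2)))) \<le> norm (G (1/2))" .
  moreover have "Re (exp (of_real x)) = exp x" for x by (simp add: Re_exp)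
  ultimately show ?thesis unfolding G_def norm_divide by (simp only:)
qed

section \<open>The zeta function and the divergence of prime sums\<close>

interpretation one: cmult "\<lambda>_. 1" by unfold_locales auto

text \<open>Zeta has a pole at 1, so it enters through the alternating series, whose coefficients
  are periodic of mean zero: subtracting twice the even terms multiplies zeta by a factor that
  vanishes at the pole.\<close>

lemma eta_continuation:
  obtains \<eta> where "\<eta> holomorphic_on UNIV"
    "\<And>s. Re s > 1 \<Longrightarrow> \<eta> s = (1 - 2 powr (1 - s)) * dser (\<lambda>_. 1) s"
proof -
  have "periodic_mean0 2 (\<lambda>i. (-1) ^ i)"
    by (simp add: periodic_mean0_def eval_nat_numeral)
  then obtain h C where h: "h holomorphic_on UNIV"
    "\<And>s. Re s > 1 \<Longrightarrow> (\<lambda>i. (-1) ^ i * of_nat (Suc i) powr (-s)) sums h s"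
    by (rule dirichlet_series_entire) blast
  have "h s = (1 - 2 powr (1 - s)) * dser (\<lambda>_. 1) s" if s: "Re s > 1" for s
  proof -
    let ?t = "\<lambda>n. complex_of_nat n powr (-s)"
    have all: "?t sums dser (\<lambda>_. 1) s" using dser_sums[OF one.dconv s] by simp
    then have "(\<lambda>m. 2 * (2 powr (-s) * ?t m)) sums (2 * (2 powr (-s) * dser (\<lambda>_. 1) s))"
      by (intro sums_mult)
    also have "(\<lambda>m. 2 * (2 powr (-s) * ?t m)) = (\<lambda>m. 2 * ?t (2 * m))"
      using nat_powr_mult[of 2 _ "-s"] by simp
    finally have "(\<lambda>m. (\<lambda>n. if even n then 2 * ?t n else 0) (2 * m)) sums (2 * (2 powr (-s) * dser (\<lambda>_. 1) s))" by simp
    then have "(\<lambda>n. if even n then 2 * ?t n else 0) sums (2 * (2 powr (-s) * dser (\<lambda>_. 1) s))"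
      by (subst (asm) sums_mono_reindex) (auto simp: strict_mono_def elim!: evenE)
    with all have "(\<lambda>n. ?t n - (if even n then 2 * ?t n else 0)) sums (dser (\<lambda>_. 1) s - 2 * (2 powr (-s) * dser (\<lambda>_. 1) s))"
      by (rule sums_diff)
    then have "(\<lambda>i. ?t (Suc i) - (if even (Suc i) then 2 * ?t (Suc i) else 0)) sums (dser (\<lambda>_. 1) s - 2 * (2 powr (-s) * dser (\<lambda>_. 1) s))"
      by (subst sums_Suc_iff) simp
    also have "(\<lambda>i. ?t (Suc i) - (if even (Suc i) then 2 * ?t (Suc i) else 0)) = (\<lambda>i. (-1) ^ i * of_nat (Suc i) powr (-s))"
      by (auto simp: fun_eq_iff minus_one_power_iff)
    finally have "h s = dser (\<lambda>_. 1) s - 2 * (2 powr (-s) * dser (\<lambda>_. 1) s)"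
      using h(2)[OF s] sums_unique2 by blast
    also have "2 * (2 powr (-s) * dser (\<lambda>_. 1) s) = 2 powr (1 - s) * dser (\<lambda>_. 1) s"
      by (simp add: powr_diff powr_minus divide_inverse)
    finally show ?thesis by (simp add: algebra_simps)
  qed
  with h(1) that show ?thesis by blast
qed

lemma holomorphic_factor_root:
  assumes "f holomorphic_on S" "open S" "z \<in> S" "f z = 0"
  shows "\<exists>g. g holomorphic_on S \<and> (\<forall>s\<in>S. f s = (s - z) * g s) \<and> g z = deriv f z"
proof (intro exI conjI ballI)
  let ?g = "\<lambda>s. if s = z then deriv f z else (f s - f z) / (s - z)"
  show "?g holomorphic_on S" using assms by (intro pole_lemma) (auto simp: interior_open)
qed (use assms in auto)

lemma two_powr_ne_1:
  assumes "s \<in> ball 2 2" "s \<noteq> 1"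
  shows "(2::complex) powr (1 - s) \<noteq> 1"
proof
  assume "(2::complex) powr (1 - s) = 1"
  then have "exp ((1 - s) * of_real (ln 2)) = 1" by (simp add: powr_def Ln_of_real[of 2, simplified] mult.commute)
  then obtain n where n: "Re ((1 - s) * of_real (ln 2)) = 0" "Im ((1 - s) * of_real (ln 2)) = of_int (2 * n) * pi"
    by (auto simp: exp_eq_1)
  have r: "Re s = 1" using n(1) by simp
  have im: "- Im s * ln 2 = of_int (2 * n) * pi" using n(2) by simp
  have "\<bar>Im s\<bar> < 2" using assms(1) abs_Im_le_cmod[of "2 - s"] by (simp add: dist_norm)
  have "n \<noteq> 0"
  proof
    assume "n = 0"
    then have "Im s = 0" using im by simp
    then have "s = 1" using r by (simp add: complex_eq_iff)
    then show False using assms by simp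
  qed
  then have "\<bar>of_int (2 * n) * pi\<bar> \<ge> 2 * pi" by (simp add: abs_mult)
  moreover have "\<bar>- Im s * ln 2\<bar> \<le> 2 * 1"
    unfolding abs_mult using \<open>\<bar>Im s\<bar> < 2\<close> ln_2_less_1 by (intro mult_mono) auto
  ultimately show False using im pi_gt3 by linarith
qed

lemma mangoldt_square: "mangoldt n \<le> (mangoldt (n ^ 2) :: real)"
proof (cases "primepow n")
  case True
  then obtain p k where pk: "prime p" "k > 0" "n = p ^ k"
    unfolding primepow_def by auto
  then show ?thesis using mangoldt_primepow'[of p "k * 2", where ?'a = real] by (simp add: power_mult[symmetric])
qed (simp add: mangoldt_def mangoldt_nonneg[unfolded mangoldt_def])

text \<open>By Mertens' estimate the sum of \<open>mangoldt d / d\<close> over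
  \<open>K \<le> d \<le> M\<close> is \<open>ln M\<close> up to a constant. If the terms divided by
  \<open>ln d\<close> had tails below 1/2, the same sum would be at most
  \<open>ln M / 2\<close>.\<close>

lemma mangoldt_over_ln_unbounded: "\<exists>M. (\<Sum>n=2..M. mangoldt n / (real n * ln (real n))) > B"
proof (rule ccontr)
  define f where "f = (\<lambda>n. mangoldt n / (real n * ln (real n)))"
  assume "\<not> ?thesis"
  then have B: "(\<Sum>n=2..M. f n) \<le> B" for M by (auto simp: f_def not_less)
  have f0: "f n \<ge> 0" for n unfolding f_def by (cases "n = 0") (auto intro!: divide_nonneg_nonneg mult_nonneg_nonneg mangoldt_nonneg)
  have f01: "f 0 = 0" "f 1 = 0" by (auto simp: f_def)
  have le: "(\<Sum>n<N. f n) \<le> B" for N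
  proof -
    have "(\<Sum>n<N. f n) \<le> (\<Sum>n\<in>{0,1} \<union> {2..N}. f n)" by (rule sum_mono2) (auto intro: f0)
    also have "\<dots> = (\<Sum>n=2..N. f n)" by (rule sum.mono_neutral_right) (auto simp: f01[simplified])
    finally show ?thesis using B[of N] by linarith
  qed
  have "summable f"
    by (rule summableI_nonneg_bounded[OF f0 le])
  then obtain N where N: "\<And>m n. m \<ge> N \<Longrightarrow> norm (sum f {m..<n}) < 1/2"
    unfolding summable_Cauchy by (meson half_gt_zero_iff zero_less_one)
  define K where "K = N + 2"
  have K: "norm (sum f {K..<n}) < 1/2" for n by (rule N) (simp add: K_def)
  have "filterlim (\<lambda>M::nat. ln (real M)) at_top sequentially" by real_asymp
  then have "eventually (\<lambda>M. ln (real M) \<ge> 2 * (12 + ln (real K) + 1)) sequentially"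
    unfolding filterlim_at_top by blast
  then have "eventually (\<lambda>M. ln (real M) \<ge> 2 * (12 + ln (real K) + 1) \<and> M \<ge> K) sequentially"
    using eventually_ge_at_top[of K] by eventually_elim auto
  then obtain M where M: "ln (real M) \<ge> 2 * (12 + ln (real K) + 1)" "M \<ge> K"
    by (auto simp: eventually_at_top_linorder)
  have K2: "K \<ge> 2" by (simp add: K_def)
  then have lnM: "ln (real M) > 0" using M by simp
  have "(\<Sum>d=1..M. mangoldt d / real d) - (\<Sum>d=1..K-1. mangoldt d / real d) = (\<Sum>d\<in>{K..<Suc M}. mangoldt d / real d)"
  proof -
    have "{1..M} - {1..K-1} = {K..<Suc M}" using K2 by auto
    then show ?thesis using M(2) by (subst sum_diff[symmetric]) auto
  qed
  moreover have "(\<Sum>d=1..M. mangoldt d / real d) \<ge> ln (real M) - 6" using mertens[of M] M K2 by linarith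
  moreover have "(\<Sum>d=1..K-1. mangoldt d / real d) \<le> ln (real K) + 6"
  proof -
    have "ln (real (K - 1)) \<le> ln (real K)" using K2 by simp
    then show ?thesis using mertens[of "K - 1"] K2 by linarith
  qed
  ultimately have "ln (real M) - 12 - ln (real K) \<le> (\<Sum>d\<in>{K..<Suc M}. mangoldt d / real d)" by linarith
  also have "\<dots> \<le> (\<Sum>d\<in>{K..<Suc M}. f d * ln (real M))"
  proof (intro sum_mono)
    fix d assume d: "d \<in> {K..<Suc M}"
    then have d2: "d \<ge> 2" "d \<le> M" using K2 by auto
    have "mangoldt d / real d = f d * ln (real d)" using d2 by (simp add: f_def)
    also have "\<dots> \<le> f d * ln (real M)" using d2 f0 by (intro mult_left_mono) auto
    finally show "mangoldt d / real d \<le> f d * ln (real M)" .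
  qed
  also have "\<dots> = ln (real M) * sum f {K..<Suc M}" by (simp add: sum_distrib_right[symmetric] mult.commute)
  also have "\<dots> \<le> ln (real M) * (1/2)" using K[of "Suc M"] lnM by (intro mult_left_mono) auto
  finally have "ln (real M) - 12 - ln (real K) \<le> ln (real M) * (1/2)" .
  moreover have "ln (real M) * (1/2) \<ge> 13 + ln (real K)" using M(1) by simp
  ultimately show False by linarith
qed

context cmult
begin

text \<open>The weights are the coefficients of the logarithm of zeta^2 times the series of
  \<open>a\<close> and of its conjugate. The weight at a prime power \<open>n\<close> vanishes when
  \<open>a n = -1\<close>, but then the one at \<open>n ^ 2\<close> does not: with
  \<open>c = Re (a n)\<close> the two together carry 2 + 2c + 2c^2 \<ge> 3/2. At
  \<open>s = 1/2\<close> both are compared with \<open>1 / n\<close>, since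
  \<open>(n ^ 2) powr (-1/2) = 1 / n\<close>.\<close>

lemma logcoeff_sum_unbounded:
  defines "w \<equiv> \<lambda>n. mangoldt n / ln (real n) * (2 + 2 * Re (a n))"
  shows "w n \<ge> 0" and "\<exists>N. (\<Sum>n<N. w n * real n powr (-1/2)) > K"
proof -
  have w0: "w n \<ge> 0" for n
  proof -
    have "Re (a n) \<ge> -1" using bdd[of n] abs_Re_le_cmod[of "a n"] by linarith
    moreover have "mangoldt n / ln (real n) \<ge> 0" by (cases "n = 0") (auto intro!: divide_nonneg_nonneg mangoldt_nonneg)
    ultimately show ?thesis unfolding w_def by (intro mult_nonneg_nonneg) auto
  qed
  then show "w n \<ge> 0" .
  have key: "w n * real n powr (-1/2) + w (n^2) * real (n^2) powr (-1/2) \<ge> 3/2 * (mangoldt n / (real n * ln (real n)))" if n: "n \<ge> 2" for n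
  proof -
    have p2: "real (n^2) powr (-1/2) = 1 / real n"
    proof -
      have h: "(-1/2 :: real) = - (1/2)" by simp
      have "real (n^2) powr (-1/2) = inverse (sqrt ((real n)\<^sup>2))"
        unfolding h powr_minus by (subst powr_half_sqrt) auto
      then show ?thesis by (simp add: inverse_eq_divide)
    qed
    have p1: "real n powr (-1/2) \<ge> 1 / real n"
    proof -
      have "real n powr (-1) \<le> real n powr (-1/2)" using n by (intro powr_mono) auto
      moreover have "real n powr (-1) = 1 / real n" by (simp add: powr_minus inverse_eq_divide)
      ultimately show ?thesis by simp
    qed
    define c where "c = Re (a n)"
    define L where "L = mangoldt n / (real n * ln (real n))"
    have L0: "L \<ge> 0" unfolding L_def using n by (intro divide_nonneg_nonneg mult_nonneg_nonneg mangoldt_nonneg) auto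
    have "w n * real n powr (-1/2) \<ge> w n * (1 / real n)" using p1 w0 by (intro mult_left_mono)
    also have "w n * (1 / real n) = L * (2 + 2 * c)" by (simp add: w_def L_def c_def)
    finally have A: "w n * real n powr (-1/2) \<ge> L * (2 + 2 * c)" .
    have cc: "Re (a (n^2)) \<ge> 2 * c^2 - 1"
    proof -
      have "(Re (a n))^2 + (Im (a n))^2 \<le> 1"
        using power_mono[OF bdd[of n], of 2] by (simp add: cmod_power2)
      moreover have "Re (a (n^2)) = (Re (a n))^2 - (Im (a n))^2" by (simp add: power2_eq_square mult)
      ultimately show ?thesis by (simp add: c_def)
    qed
    have "w (n^2) * (1 / real n) \<ge> (mangoldt n / (2 * ln (real n)) * (2 + 2 * (2 * c^2 - 1))) * (1 / real n)"
      unfolding w_def using n cc mangoldt_square[of n]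
      by (intro mult_right_mono mult_mono frac_le) (auto simp: ln_realpow intro!: divide_nonneg_nonneg mangoldt_nonneg)
    also have "(mangoldt n / (2 * ln (real n)) * (2 + 2 * (2 * c^2 - 1))) * (1 / real n) = L * (2 * c^2)"
      by (simp add: L_def algebra_simps)
    finally have Bd: "w (n^2) * real (n^2) powr (-1/2) \<ge> L * (2 * c^2)" unfolding p2 .
    have "3/2 \<le> (2 + 2 * c) + 2 * c^2"
    proof -
      have "(2 + 2 * c) + 2 * c^2 = 3/2 + 2 * (c + 1/2)^2" by (simp add: power2_eq_square algebra_simps)
      then show ?thesis using zero_le_power2[of "c + 1/2"] by linarith
    qed
    then have "L * (3/2) \<le> L * ((2 + 2 * c) + 2 * c^2)" using L0 by (rule mult_left_mono)
    also have "L * ((2 + 2 * c) + 2 * c^2) = L * (2 + 2 * c) + L * (2 * c^2)" by (simp only: distrib_left)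
    finally show ?thesis using A Bd unfolding L_def[symmetric] by linarith
  qed
  obtain M where M: "(\<Sum>n=2..M. mangoldt n / (real n * ln (real n))) > 4/3 * K" using mangoldt_over_ln_unbounded by blast
  let ?g = "\<lambda>n. w n * real n powr (-1/2)"
  have g0: "?g n \<ge> 0" for n using w0[of n] by (intro mult_nonneg_nonneg) auto
  have "2 * K < (\<Sum>n=2..M. 3/2 * (mangoldt n / (real n * ln (real n))))" unfolding sum_distrib_left[symmetric] using M by simp
  also have "\<dots> \<le> (\<Sum>n=2..M. ?g n + ?g (n^2))" by (intro sum_mono key) auto
  also have "\<dots> = (\<Sum>n=2..M. ?g n) + (\<Sum>n\<in>(\<lambda>n. n^2) ` {2..M}. ?g n)"
  proof -
    have "inj_on (\<lambda>n::nat. n^2) {2..M}" by (auto intro!: inj_onI)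
    then show ?thesis unfolding sum.distrib by (simp add: sum.reindex)
  qed
  also have "\<dots> \<le> (\<Sum>n<Suc (M^2). ?g n) + (\<Sum>n<Suc (M^2). ?g n)"
  proof (intro add_mono sum_mono2)
    have "M \<le> M^2" by (cases M) (auto simp: power2_eq_square)
    then show "{2..M} \<subseteq> {..<Suc (M^2)}" by auto
    show "(\<lambda>n. n^2) ` {2..M} \<subseteq> {..<Suc (M^2)}" by (auto simp: less_Suc_eq_le intro!: power_mono)
  qed (use g0 in auto)
  finally have "(\<Sum>n<Suc (M^2). ?g n) > K" by linarith
  then show "\<exists>N. (\<Sum>n<N. w n * real n powr (-1/2)) > K" by blast
qed

text \<open>If \<open>H 1 = 0\<close>, the zeros of \<open>H\<close> and of its conjugate cancel the
  double pole of zeta^2, and the product of the four functions is holomorphic on the disc of radius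
  2 about 2. Its logarithm has nonnegative coefficients with unbounded partial sums at 1/2, against
  \<open>landau_bound\<close>. Real and complex values of \<open>a\<close> are treated
  alike.\<close>

lemma nonzero_at_1:
  assumes H: "H holomorphic_on UNIV" "\<And>s. Re s > 1 \<Longrightarrow> H s = dser a s"
  shows "H 1 \<noteq> 0"
proof
  assume H1: "H 1 = 0"
  interpret c: cmult "\<lambda>n. cnj (a n)"
    using mult a1 bdd by unfold_locales auto
  let ?B = "ball (2::complex) 2"
  have oB: "open ?B" "(1::complex) \<in> ?B" by (auto simp: dist_norm)
  define H' where "H' = (\<lambda>s. cnj (H (cnj s)))"
  have H'hol: "H' holomorphic_on UNIV" unfolding H'_def
    using holomorphic_on_compose_cnj_cnj[OF holomorphic_on_subset[OF H(1)], of UNIV] by (simp add: o_def)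
  have H': "H' s = dser (\<lambda>n. cnj (a n)) s" if "Re s > 1" for s
  proof -
    have "(\<lambda>n. cnj (a n * of_nat n powr (- cnj s))) sums cnj (dser a (cnj s))"
      using dser_sums[OF dconv, of "cnj s"] that by (simp only: sums_cnj cnj.sel)
    moreover have "(\<lambda>n. cnj (a n * of_nat n powr (- cnj s))) = (\<lambda>n. cnj (a n) * of_nat n powr (-s))"
    proof
      show "cnj (a n * of_nat n powr (- cnj s)) = cnj (a n) * of_nat n powr (-s)" for n
        by (cases "n = 0") (simp_all add: powr_def exp_cnj Ln_of_nat)
    qed
    ultimately have "cnj (dser a (cnj s)) = dser (\<lambda>n. cnj (a n)) s"
      unfolding dser_def[of "\<lambda>n. cnj (a n)"] by (simp add: sums_iff)
    then show ?thesis using H(2)[of "cnj s"] that by (simp add: H'_def)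
  qed
  obtain \<eta> where \<eta>: "\<eta> holomorphic_on UNIV" "\<And>s. Re s > 1 \<Longrightarrow> \<eta> s = (1 - 2 powr (1 - s)) * dser (\<lambda>_. 1) s"
    using eta_continuation by blast
  let ?\<phi> = "\<lambda>s. 1 - (2::complex) powr (1 - s)"
  have \<phi>hol: "?\<phi> holomorphic_on UNIV" unfolding powr_def by (auto intro!: holomorphic_intros)
  have d\<phi>: "deriv ?\<phi> 1 = of_real (ln 2)"
  proof (rule DERIV_imp_deriv)
    have "((\<lambda>s. 1 - exp ((1 - s) * of_real (ln 2))) has_field_derivative complex_of_real (ln 2)) (at 1)"
      by (rule derivative_eq_intros refl | simp)+
    then show "(?\<phi> has_field_derivative complex_of_real (ln 2)) (at 1)"
      by (simp add: powr_def Ln_of_real[of 2, simplified])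
  qed
  obtain \<phi>1 where \<phi>1: "\<phi>1 holomorphic_on ?B" "\<And>s. s \<in> ?B \<Longrightarrow> ?\<phi> s = (s - 1) * \<phi>1 s" "\<phi>1 1 = deriv ?\<phi> 1"
    using holomorphic_factor_root[OF holomorphic_on_subset[OF \<phi>hol subset_UNIV] oB] by auto
  have \<phi>1nz: "\<phi>1 s \<noteq> 0" if "s \<in> ?B" for s
    using two_powr_ne_1[OF that] \<phi>1(2)[OF that] \<phi>1(3) d\<phi> by (cases "s = 1") auto
  obtain G where G: "G holomorphic_on ?B" "\<And>s. s \<in> ?B \<Longrightarrow> H s = (s - 1) * G s"
    using holomorphic_factor_root[OF holomorphic_on_subset[OF H(1) subset_UNIV] oB H1] by blast
  obtain G' where G': "G' holomorphic_on ?B" "\<And>s. s \<in> ?B \<Longrightarrow> H' s = (s - 1) * G' s"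
    using holomorphic_factor_root[OF holomorphic_on_subset[OF H'hol subset_UNIV] oB] H1 unfolding H'_def by auto
  obtain C1 where C1: "C1 \<noteq> 0" "\<And>s. Re s > 1 \<Longrightarrow> dser a s = C1 * exp (dser logcoeff s)" using dser_eq_exp by blast
  obtain C2 where C2: "C2 \<noteq> 0" "\<And>s. Re s > 1 \<Longrightarrow> dser (\<lambda>n. cnj (a n)) s = C2 * exp (dser c.logcoeff s)" using c.dser_eq_exp by blast
  obtain C3 where C3: "C3 \<noteq> 0" "\<And>s. Re s > 1 \<Longrightarrow> dser (\<lambda>_. 1) s = C3 * exp (dser one.logcoeff s)" using one.dser_eq_exp by blast
  define w where "w = (\<lambda>n. mangoldt n / ln (real n) * (2 + 2 * Re (a n)))"
  have wc: "complex_of_real (w n) = logcoeff n + c.logcoeff n + 2 * one.logcoeff n" for n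
  proof -
    have "complex_of_real (2 * Re (a n)) = a n + cnj (a n)" by (simp add: complex_add_cnj)
    then show ?thesis unfolding w_def logcoeff_def c.logcoeff_def one.logcoeff_def
      by (simp add: algebra_simps add_divide_distrib)
  qed
  have wd: "dconv (\<lambda>n. of_real (w n))"
  proof (rule dconv_bounded[of _ 4])
    fix n
    have "norm (logcoeff n + c.logcoeff n + 2 * one.logcoeff n) \<le> 1 + 1 + 2 * 1"
      by (intro norm_triangle_mono norm_logcoeff c.norm_logcoeff) (simp add: norm_mult one.norm_logcoeff)
    then show "norm (complex_of_real (w n)) \<le> 4" unfolding wc by simp
  qed
  have wsum: "dser (\<lambda>n. of_real (w n)) s = dser logcoeff s + dser c.logcoeff s + 2 * dser one.logcoeff s" if "Re s > 1" for s
  proof -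
    have "(\<lambda>n. logcoeff n * of_nat n powr (-s) + c.logcoeff n * of_nat n powr (-s) + 2 * (one.logcoeff n * of_nat n powr (-s))) sums (dser logcoeff s + dser c.logcoeff s + 2 * dser one.logcoeff s)"
      using that by (intro sums_add sums_mult dser_sums dconv_logcoeff c.dconv_logcoeff one.dconv_logcoeff)
    also have "(\<lambda>n. logcoeff n * of_nat n powr (-s) + c.logcoeff n * of_nat n powr (-s) + 2 * (one.logcoeff n * of_nat n powr (-s))) = (\<lambda>n. of_real (w n) * of_nat n powr (-s))"
      by (rule ext) (simp only: wc distrib_right mult.assoc)
    finally show ?thesis using sums_unique2[OF dser_sums[OF wd that]] by blast
  qed
  define F where "F = (\<lambda>s. G s * G' s * (\<eta> s / \<phi>1 s)^2)"
  have Fhol: "F holomorphic_on ?B" unfolding F_def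
    using G(1) G'(1) \<phi>1(1) \<phi>1nz holomorphic_on_subset[OF \<eta>(1)] by (intro holomorphic_intros) auto
  \<comment> \<open>\<open>landau_bound\<close> wants a single function that equals the exponential
    on all of \<open>Re s > 1\<close>, whereas the cancelled product makes sense in the disc only;
    outside it the Dirichlet series themselves are substituted.\<close>
  define F' where "F' = (\<lambda>s. if s \<in> ?B then F s else dser a s * dser (\<lambda>n. cnj (a n)) s * (dser (\<lambda>_. 1) s)^2)"
  have F'hol: "F' holomorphic_on ?B" using Fhol by (rule holomorphic_transform) (auto simp: F'_def)
  have F'eq: "F' s = (C1 * C2 * C3^2) * exp (dser (\<lambda>n. of_real (w n)) s)" if s: "Re s > 1" for s
  proof -
    have "F' s = dser a s * dser (\<lambda>n. cnj (a n)) s * (dser (\<lambda>_. 1) s)^2"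
    proof (cases "s \<in> ?B")
      case True
      have s1: "s - 1 \<noteq> 0" using s by auto
      have "\<eta> s / \<phi>1 s = (s - 1) * dser (\<lambda>_. 1) s"
        using \<eta>(2)[OF s] \<phi>1(2)[OF True] \<phi>1nz[OF True] by simp
      then have "F s = ((s - 1) * G s) * ((s - 1) * G' s) * (dser (\<lambda>_. 1) s)^2"
        unfolding F_def by (simp add: power2_eq_square)
      then show ?thesis using True G(2)[OF True] G'(2)[OF True] H(2)[OF s] H'[OF s] by (simp add: F'_def)
    qed (simp add: F'_def)
    then show ?thesis using C1(2)[OF s] C2(2)[OF s] C3(2)[OF s] wsum[OF s]
      by (simp add: exp_add exp_double power_mult_distrib)
  qed
  have Cnz: "C1 * C2 * C3^2 \<noteq> 0" using C1(1) C2(1) C3(1) by simp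
  have wnn: "w n \<ge> 0" for n unfolding w_def by (rule logcoeff_sum_unbounded(1))
  let ?X = "norm (F' (1/2)) / norm (C1 * C2 * C3^2)"
  obtain N where N: "(\<Sum>n<N. w n * real n powr (-1/2)) > ?X"
    using logcoeff_sum_unbounded(2)[of ?X] unfolding w_def by blast
  have "exp (\<Sum>n<N. w n * real n powr (-1/2)) \<le> ?X"
    by (rule landau_bound[OF wd wnn F'hol Cnz F'eq])
  moreover have "exp (\<Sum>n<N. w n * real n powr (-1/2)) \<ge> 1 + (\<Sum>n<N. w n * real n powr (-1/2))"
    by (rule exp_ge_add_one_self)
  ultimately show False using N by linarith
qed

text \<open>Twisting by \<open>n powr (- \<i> * t)\<close> keeps complete multiplicativity and the
  bound 1, and moves the point \<open>1 + \<i> * t\<close> to 1.\<close>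

theorem nonzero_on_line_1:
  assumes H: "H holomorphic_on UNIV" "\<And>s. Re s > 1 \<Longrightarrow> H s = dser a s" and s: "Re s = 1"
  shows "H s \<noteq> 0"
proof -
  define t where "t = Im s"
  have s_eq: "s = 1 + \<i> * of_real t" using s by (simp add: t_def complex_eq_iff)
  define b where "b = (\<lambda>n. a n * of_nat n powr (- \<i> * of_real t))"
  interpret b: cmult b
  proof
    show "b (m * n) = b m * b n" for m n unfolding b_def mult nat_powr_mult by simp
    show "b 1 = 1" using a1 by (simp add: b_def)
    show "norm (b n) \<le> 1" for n
      using bdd[of n] by (cases "n = 0") (auto simp: b_def norm_mult norm_nat_powr)
  qed
  have "H (1 + \<i> * of_real t) \<noteq> 0"
  proof (rule b.nonzero_at_1[where H = "\<lambda>s. H (s + \<i> * of_real t)", simplified])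
    show "(\<lambda>s. H (s + \<i> * of_real t)) holomorphic_on UNIV"
    proof -
      have "(H \<circ> (\<lambda>s. s + \<i> * of_real t)) holomorphic_on UNIV"
        by (rule holomorphic_on_compose) (auto intro!: holomorphic_intros intro: holomorphic_on_subset[OF H(1)])
      then show ?thesis by (simp add: o_def)
    qed
    fix s :: complex assume r: "Re s > 1"
    have "b n * of_nat n powr (-s) = a n * of_nat n powr (-(s + \<i> * of_real t))" for n
      by (cases "n = 0") (simp_all add: b_def powr_def exp_add[symmetric] algebra_simps)
    then have "dser b s = dser a (s + \<i> * of_real t)" unfolding dser_def by (simp only:)
    then show "H (s + \<i> * of_real t) = dser b s" using H(2)[of "s + \<i> * of_real t"] r by simp
  qed
  then show ?thesis unfolding s_eq .
qed

end

section \<open>Logarithmic derivatives under the Riemann hypothesis\<close>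

text \<open>On the circle of radius 5 each linear factor is at least 3 in modulus, at the centre at
  most 2. So every zero that is divided out gains a factor 2/3 in the maximum principle.\<close>

lemma linear_factors_bound:
  assumes g: "g holomorphic_on ball z0 6" and rs: "set rs \<subseteq> cball z0 2"
    and f: "\<And>s. s \<in> ball z0 6 \<Longrightarrow> f s = (\<Prod>\<rho>\<leftarrow>rs. s - \<rho>) * g s"
    and M: "\<And>s. s \<in> ball z0 6 \<Longrightarrow> norm (f s) \<le> M * norm (f z0)" and M0: "M \<ge> 0"
    and s: "s \<in> cball z0 5"
  shows "norm (g s) \<le> M * (2/3) ^ length rs * norm (g z0)"
proof (rule maximum_modulus_frontier[of g "cball z0 5"])
  have sub: "cball z0 5 \<subseteq> ball z0 6" by auto
  show "g holomorphic_on interior (cball z0 5)"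
    by (rule holomorphic_on_subset[OF g]) (use interior_subset sub in blast)
  show "continuous_on (closure (cball z0 5)) g"
    using holomorphic_on_imp_continuous_on[OF g] sub by (auto intro: continuous_on_subset)
  fix z assume "z \<in> frontier (cball z0 5)"
  then have z: "dist z0 z = 5" by simp
  then have zb: "z \<in> ball z0 6" by simp
  have z0b: "z0 \<in> ball z0 6" by simp
  have 1: "(3::real) ^ length rs \<le> norm (\<Prod>\<rho>\<leftarrow>rs. z - \<rho>)"
    using rs
  proof (induction rs)
    case (Cons a rs)
    have "dist z0 a \<le> 2" using Cons by simp
    then have "norm (z - a) \<ge> 3" using dist_triangle[of z0 z a] z by (simp add: dist_norm dist_commute norm_minus_commute)
    then have "3 * 3 ^ length rs \<le> norm (z - a) * norm (\<Prod>\<rho>\<leftarrow>rs. z - \<rho>)"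
      using Cons by (intro mult_mono) auto
    then show ?case by (simp add: norm_mult)
  qed auto
  have 2: "norm (\<Prod>\<rho>\<leftarrow>rs. z0 - \<rho>) \<le> (2::real) ^ length rs"
    using rs
  proof (induction rs)
    case (Cons a rs)
    have "norm (z0 - a) \<le> 2" using Cons by (simp add: dist_norm)
    then have "norm (z0 - a) * norm (\<Prod>\<rho>\<leftarrow>rs. z0 - \<rho>) \<le> 2 * 2 ^ length rs"
      using Cons by (intro mult_mono) auto
    then show ?case by (simp add: norm_mult)
  qed auto
  have "3 ^ length rs * norm (g z) \<le> norm (\<Prod>\<rho>\<leftarrow>rs. z - \<rho>) * norm (g z)"
    using 1 by (intro mult_right_mono) auto
  also have "\<dots> = norm (f z)" using f[OF zb] by (simp add: norm_mult)
  also have "\<dots> \<le> M * norm (f z0)" by (rule M[OF zb])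
  also have "norm (f z0) = norm (\<Prod>\<rho>\<leftarrow>rs. z0 - \<rho>) * norm (g z0)" using f[OF z0b] by (simp add: norm_mult)
  also have "M * (norm (\<Prod>\<rho>\<leftarrow>rs. z0 - \<rho>) * norm (g z0)) \<le> M * (2 ^ length rs * norm (g z0))"
    using 2 M0 by (intro mult_left_mono mult_right_mono) auto
  finally have "norm (g z) \<le> M * (2 ^ length rs * norm (g z0)) / 3 ^ length rs"
    by (simp add: field_simps)
  then show "norm (g z) \<le> M * (2/3) ^ length rs * norm (g z0)"
    by (simp add: power_divide)
qed (use s in auto)

text \<open>The gain of 2/3 per zero bounds the number of zeros that can be divided out, so a list
  of maximal length exists; it records multiplicities. Maximality is what makes the cofactor
  zero-free on the inner disc.\<close>

lemma factor_out_zeros: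
  assumes f: "f holomorphic_on ball z0 6" and f0: "f z0 \<noteq> 0"
    and M: "\<And>s. s \<in> ball z0 6 \<Longrightarrow> norm (f s) \<le> M * norm (f z0)"
  obtains rs g where "set rs \<subseteq> cball z0 2" "g holomorphic_on ball z0 6"
    "\<And>s. s \<in> ball z0 6 \<Longrightarrow> f s = (\<Prod>\<rho>\<leftarrow>rs. s - \<rho>) * g s"
    "\<And>s. s \<in> cball z0 2 \<Longrightarrow> g s \<noteq> 0" "(3/2) ^ length rs \<le> M"
    "\<And>s. s \<in> cball z0 5 \<Longrightarrow> norm (g s) \<le> M * norm (g z0)"
proof -
  define P where "P rs g \<longleftrightarrow> set rs \<subseteq> cball z0 2 \<and> g holomorphic_on ball z0 6 \<and>
    (\<forall>s\<in>ball z0 6. f s = (\<Prod>\<rho>\<leftarrow>rs. s - \<rho>) * g s)" for rs g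
  have z0b: "z0 \<in> ball z0 6" by simp
  have "1 * norm (f z0) \<le> M * norm (f z0)" using M[OF z0b] by simp
  then have M1: "M \<ge> 1" by (rule mult_right_le_imp_le) (use f0 in simp)
  have bd: "(3/2) ^ length rs \<le> M" and bd': "\<And>s. s \<in> cball z0 5 \<Longrightarrow> norm (g s) \<le> M * norm (g z0)" if "P rs g" for rs :: "complex list" and g
  proof -
    have *: "norm (g s) \<le> M * (2/3) ^ length rs * norm (g z0)" if "s \<in> cball z0 5" for s
      using \<open>P rs g\<close> M M1 that by (intro linear_factors_bound[where f = f]) (auto simp: P_def)
    have g0: "g z0 \<noteq> 0" using that f0 z0b by (auto simp: P_def)
    have "1 * norm (g z0) \<le> M * (2/3) ^ length rs * norm (g z0)" using *[of z0] by simp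
    then have "1 \<le> M * (2/3) ^ length rs" by (rule mult_right_le_imp_le) (use g0 in simp)
    then have "(3/2) ^ length rs * 1 \<le> (3/2) ^ length rs * (M * (2/3) ^ length rs)" by (intro mult_left_mono) auto
    also have "\<dots> = M * ((3/2) * (2/3)) ^ length rs" unfolding power_mult_distrib by simp
    finally show "(3/2) ^ length rs \<le> M" by simp
    fix s assume s: "s \<in> cball z0 5"
    have "M * (2/3) ^ length rs * norm (g z0) \<le> M * 1 * norm (g z0)"
      using M1 by (intro mult_right_mono mult_left_mono power_le_one) auto
    with *[OF s] show "norm (g s) \<le> M * norm (g z0)" by simp
  qed
  obtain K :: nat where K: "M < (3/2) ^ K" using real_arch_pow[of "3/2" M] by auto
  have lenK: "length rs < K" if "P rs g" for rs g
  proof (rule ccontr)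
    assume "\<not> length rs < K"
    then have "(3/2::real) ^ K \<le> (3/2) ^ length rs" by (intro power_increasing) auto
    then show False using bd[OF that] K by linarith
  qed
  have "P [] f" using f by (simp add: P_def)
  then have ex: "\<exists>rs g. P rs g \<and> length rs = 0" by auto
  define n where "n = (GREATEST n. \<exists>rs g. P rs g \<and> length rs = n)"
  have bdd: "\<forall>y. (\<exists>rs g. P rs g \<and> length rs = y) \<longrightarrow> y \<le> K" using lenK by (auto intro: less_imp_le)
  have "\<exists>rs g. P rs g \<and> length rs = n" unfolding n_def
    using GreatestI_nat[of "\<lambda>n. \<exists>rs g. P rs g \<and> length rs = n" 0 K] ex bdd by blast
  then obtain rs g where rg: "P rs g" "length rs = n" by blast
  have max: "length rs' \<le> n" if "P rs' g'" for rs' g' unfolding n_def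
    using Greatest_le_nat[of "\<lambda>n. \<exists>rs g. P rs g \<and> length rs = n" "length rs'" K] that bdd by blast
  have nz: "g s \<noteq> 0" if s: "s \<in> cball z0 2" for s
  proof
    assume "g s = 0"
    have ghol: "g holomorphic_on ball z0 6" using rg by (simp add: P_def)
    have sb: "s \<in> ball z0 6" using s by simp
    obtain g' where g': "g' holomorphic_on ball z0 6" "\<forall>z\<in>ball z0 6. g z = (z - s) * g' z"
      using holomorphic_factor_root[OF ghol open_ball sb \<open>g s = 0\<close>] by blast
    have "P (s # rs) g'" using rg(1) g' s by (auto simp: P_def mult_ac)
    then show False using max[of "s # rs" g'] rg(2) by simp
  qed
  show ?thesis
    by (rule that[of rs g]) (use rg(1) nz bd[OF rg(1)] bd'[OF rg(1)] in \<open>auto simp: P_def\<close>)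
qed

text \<open>Borel--Caratheodory for the derivative, via the Schwarz lemma for \<open>h / (2 A - h)\<close>.\<close>

lemma deriv_bound_of_Re_bound:
  assumes h: "h holomorphic_on ball z0 2" and h0: "h z0 = 0" and A: "A > 0"
    and Re: "\<And>s. s \<in> ball z0 2 \<Longrightarrow> Re (h s) < A" and s: "dist z0 s \<le> 8/5"
  shows "norm (deriv h s) \<le> 180 * A"
proof -
  define \<phi> where "\<phi> = (\<lambda>w. h (z0 + 2 * w) / (2 * of_real A - h (z0 + 2 * w)))"
  have mem: "z0 + 2 * w \<in> ball z0 2" if "norm w < 1" for w
    using that by (simp add: dist_norm norm_mult)
  have den: "norm (h z) < norm (2 * of_real A - h z)" if "z \<in> ball z0 2" for z
  proof -
    have "norm (2 * of_real A - h z) ^ 2 - norm (h z) ^ 2 = 4 * A * (A - Re (h z))"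
    proof -
      have "norm (2 * of_real A - h z) ^ 2 = (2 * A - Re (h z))\<^sup>2 + (Im (h z))\<^sup>2" unfolding cmod_power2 by simp
      moreover have "norm (h z) ^ 2 = (Re (h z))\<^sup>2 + (Im (h z))\<^sup>2" by (rule cmod_power2)
      ultimately show ?thesis by (simp add: power2_eq_square algebra_simps)
    qed
    also have "\<dots> > 0" using Re[OF that] A by simp
    finally have "norm (h z) ^ 2 < norm (2 * of_real A - h z) ^ 2" by linarith
    then show ?thesis by (rule power_less_imp_less_base) simp
  qed
  have den0: "2 * of_real A - h z \<noteq> 0" if "z \<in> ball z0 2" for z using den[OF that] by auto
  have hol: "(\<lambda>w. h (z0 + 2 * w)) holomorphic_on ball 0 1"
  proof -
    have "(h \<circ> (\<lambda>w. z0 + 2 * w)) holomorphic_on ball 0 1"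
      by (rule holomorphic_on_compose_gen[OF _ h]) (use mem in \<open>auto intro!: holomorphic_intros\<close>)
    then show ?thesis by (simp add: o_def)
  qed
  have \<phi>hol: "\<phi> holomorphic_on ball 0 1" unfolding \<phi>_def
    using den0 mem by (intro holomorphic_intros hol) auto
  have \<phi>1: "norm (\<phi> w) < 1" if "norm w < 1" for w
    using den[OF mem[OF that]] den0[OF mem[OF that]] by (simp add: \<phi>_def norm_divide)
  have \<phi>0: "\<phi> 0 = 0" using h0 by (simp add: \<phi>_def)
  \<comment> \<open>The Schwarz lemma gives 9/10 for the modulus of \<open>\<phi>\<close>; solving
    \<open>norm (h z) \<le> 9/10 * (2 * A + norm (h z))\<close> yields \<open>18 * A\<close>.
    Cauchy's estimate on circles of radius 1/10 then multiplies by 10.\<close>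
  have hb: "norm (h z) \<le> 18 * A" if z: "dist z0 z \<le> 9/5" for z
  proof -
    define w where "w = (z - z0) / 2"
    have w: "norm w \<le> 9/10" using z by (simp add: w_def norm_divide dist_norm norm_minus_commute)
    have z_eq: "z = z0 + 2 * w" by (simp add: w_def field_simps)
    have zb: "z \<in> ball z0 2" using z by simp
    have "norm (\<phi> w) \<le> norm w" using Schwarz_Lemma(1)[OF \<phi>hol \<phi>0 \<phi>1, of w] w by simp
    then have p: "norm (\<phi> w) \<le> 9/10" using w by linarith
    have "h z = \<phi> w * (2 * of_real A - h z)" using den0[OF zb] by (simp add: \<phi>_def z_eq)
    then have "norm (h z) = norm (\<phi> w) * norm (2 * of_real A - h z)" by (metis norm_mult)
    also have "\<dots> \<le> 9/10 * (2 * A + norm (h z))"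
      using p A norm_triangle_ineq4[of "2 * of_real A" "h z"] by (intro mult_mono) auto
    finally show ?thesis by simp
  qed
  have "norm ((deriv ^^ 1) h s) \<le> fact 1 * (18 * A) / (1/10) ^ 1"
  proof (rule Cauchy_inequality)
    have sub: "cball s (1/10) \<subseteq> cball z0 (9/5)"
    proof
      fix x assume "x \<in> cball s (1/10)"
      then show "x \<in> cball z0 (9/5)" using s dist_triangle[of z0 x s] by simp
    qed
    have sub2: "cball z0 (9/5) \<subseteq> ball z0 2" by auto
    show "h holomorphic_on ball s (1/10)"       by (rule holomorphic_on_subset[OF h]) (use sub sub2 ball_subset_cball in blast)
    show "continuous_on (cball s (1/10)) h"
      by (rule continuous_on_subset[OF holomorphic_on_imp_continuous_on[OF h]]) (use sub sub2 in blast)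
    fix x assume "norm (s - x) = 1/10"
    then have "x \<in> cball s (1/10)" by (simp add: dist_norm)
    then show "norm (h x) \<le> 18 * A" using sub hb by auto
  qed auto
  then show ?thesis by simp
qed

lemma has_field_derivative_linear_factors:
  assumes "s \<notin> set rs"
  shows "((\<lambda>s. \<Prod>\<rho>\<leftarrow>rs. s - \<rho>) has_field_derivative (\<Prod>\<rho>\<leftarrow>rs. s - \<rho>) * (\<Sum>\<rho>\<leftarrow>rs. 1 / (s - \<rho>))) (at (s::complex))"
  using assms
proof (induction rs)
  case (Cons a rs)
  have "((\<lambda>s. (s - a) * (\<Prod>\<rho>\<leftarrow>rs. s - \<rho>)) has_field_derivative
     (s - a) * ((\<Prod>\<rho>\<leftarrow>rs. s - \<rho>) * (\<Sum>\<rho>\<leftarrow>rs. 1 / (s - \<rho>))) + 1 * (\<Prod>\<rho>\<leftarrow>rs. s - \<rho>)) (at s)"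
    using Cons by (intro DERIV_mult' derivative_eq_intros) auto
  moreover have "(s - a) * ((\<Prod>\<rho>\<leftarrow>rs. s - \<rho>) * (\<Sum>\<rho>\<leftarrow>rs. 1 / (s - \<rho>))) + 1 * (\<Prod>\<rho>\<leftarrow>rs. s - \<rho>)
     = (\<Prod>\<rho>\<leftarrow>a # rs. s - \<rho>) * (\<Sum>\<rho>\<leftarrow>a # rs. 1 / (s - \<rho>))"
    using Cons.prems by (simp add: field_simps)
  ultimately show ?case by simp
qed auto

text \<open>The zero-free cofactor has a logarithm on the disc of radius 2, whose real part is at
  most \<open>ln M\<close> after normalisation at the centre; Borel--Caratheodory bounds its
  derivative, and the linear factors give the sum over \<open>rs\<close>. The added 1 makes the
  bound on the real part strict and positive.\<close>

theorem logderiv_partial_fractions: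
  assumes f: "f holomorphic_on ball z0 6" and f0: "f z0 \<noteq> 0"
    and M: "\<And>s. s \<in> ball z0 6 \<Longrightarrow> norm (f s) \<le> M * norm (f z0)"
  obtains rs where "(3/2) ^ length rs \<le> M" "\<And>\<rho>. \<rho> \<in> set rs \<Longrightarrow> f \<rho> = 0"
    "\<And>s. dist z0 s \<le> 8/5 \<Longrightarrow> f s \<noteq> 0 \<Longrightarrow>
       norm (deriv f s / f s - (\<Sum>\<rho>\<leftarrow>rs. 1 / (s - \<rho>))) \<le> 180 * (ln M + 1)"
proof -
  obtain rs g where rs: "set rs \<subseteq> cball z0 2" and g: "g holomorphic_on ball z0 6" and
    fac: "\<And>s. s \<in> ball z0 6 \<Longrightarrow> f s = (\<Prod>\<rho>\<leftarrow>rs. s - \<rho>) * g s" and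
    nz: "\<And>s. s \<in> cball z0 2 \<Longrightarrow> g s \<noteq> 0" and len: "(3/2) ^ length rs \<le> M" and
    gM: "\<And>s. s \<in> cball z0 5 \<Longrightarrow> norm (g s) \<le> M * norm (g z0)"
    using factor_out_zeros[OF f f0 M] by blast
  have g0: "g z0 \<noteq> 0" using nz by simp
  have M1: "M \<ge> 1" using len one_le_power[of "3/2 :: real" "length rs"] by linarith
  have ghol: "g holomorphic_on ball z0 2" by (rule holomorphic_on_subset[OF g]) auto
  have gg: "(\<lambda>s. g s / g z0) holomorphic_on ball z0 2" using ghol g0 by (intro holomorphic_intros) auto
  have gnz: "g s / g z0 \<noteq> 0" if "s \<in> ball z0 2" for s using nz[of s] g0 that by simp
  obtain h where h: "h holomorphic_on ball z0 2" "\<And>s. s \<in> ball z0 2 \<Longrightarrow> exp (h s) = g s / g z0"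
    by (rule holomorphic_logarithm_exists[OF convex_ball open_ball gg gnz centre_in_ball[THEN iffD2]]) auto
  define k where "k = (\<lambda>s. h s - h z0)"
  have khol: "k holomorphic_on ball z0 2" unfolding k_def by (intro holomorphic_intros h)
  have ek: "exp (k s) = g s / g z0" if "s \<in> ball z0 2" for s
    using h(2)[OF that] h(2)[of z0] g0 by (simp add: k_def exp_diff)
  have Rek: "Re (k s) < ln M + 1" if "s \<in> ball z0 2" for s
  proof -
    have "exp (Re (k s)) = norm (g s) / norm (g z0)"
      using ek[OF that] norm_exp_eq_Re[of "k s"] by (simp add: norm_divide)
    also have "\<dots> \<le> M" using gM[of s] that g0 by (simp add: divide_le_eq)
    finally have "exp (Re (k s)) \<le> exp (ln M)" using M1 by simp
    then show ?thesis by simp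
  qed
  have zeros: "f \<rho> = 0" if "\<rho> \<in> set rs" for \<rho>
  proof -
    have "\<rho> \<in> ball z0 6" using rs that by auto
    moreover have "(\<Prod>\<rho>'\<leftarrow>rs. \<rho> - \<rho>') = 0" using that by (auto simp: prod_list_zero_iff)
    ultimately show ?thesis using fac by simp
  qed
  show ?thesis
  proof (rule that[OF len zeros])
    fix s assume s: "dist z0 s \<le> 8/5" and fs: "f s \<noteq> 0"
    have sb: "s \<in> ball z0 2" "s \<in> ball z0 6" using s by auto
    have snot: "s \<notin> set rs" using zeros fs by auto
    let ?P = "\<lambda>s. \<Prod>\<rho>\<leftarrow>rs. s - \<rho>" and ?S = "\<Sum>\<rho>\<leftarrow>rs. 1 / (s - \<rho>)"
    have dk: "(k has_field_derivative deriv k s) (at s)" by (rule holomorphic_derivI[OF khol open_ball sb(1)])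
    have feq: "?P s * (g z0 * exp (k s)) = f s" if "s \<in> ball z0 2" for s
      using fac[of s] ek[OF that] g0 that by simp
    have "((\<lambda>s. ?P s * (g z0 * exp (k s))) has_field_derivative (?P s * (g z0 * (exp (k s) * deriv k s)) + (?P s * ?S) * (g z0 * exp (k s)))) (at s)"
      by (intro DERIV_mult' has_field_derivative_linear_factors[OF snot] DERIV_cmult DERIV_chain'[OF dk DERIV_exp])
    then have "(f has_field_derivative (?P s * (g z0 * (exp (k s) * deriv k s)) + (?P s * ?S) * (g z0 * exp (k s)))) (at s)"
      by (rule has_field_derivative_transform_within_open[OF _ open_ball sb(1)]) (use feq in auto)
    then have "deriv f s = ?P s * (g z0 * (exp (k s) * deriv k s)) + (?P s * ?S) * (g z0 * exp (k s))"
      by (rule DERIV_imp_deriv)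
    also have "\<dots> = (?P s * (g z0 * exp (k s))) * (deriv k s + ?S)" by (simp add: algebra_simps)
    finally have "deriv f s = f s * (deriv k s + ?S)" unfolding feq[OF sb(1)] .
    then have "deriv f s / f s - ?S = deriv k s" using fs by simp
    then show "norm (deriv f s / f s - ?S) \<le> 180 * (ln M + 1)"
      using deriv_bound_of_Re_bound[OF khol _ _ Rek s] M1 by (simp add: k_def ln_ge_zero add_nonneg_pos)
  qed
qed

text \<open>The source of the single logarithm: the kernel is as large as
  \<open>1 / \<delta>\<close> but has mass O(ln (1/\<delta>)), uniformly in \<open>\<gamma>\<close>
  and \<open>T\<close>. Within distance 1 of \<open>\<gamma>\<close> it is compared with the
  derivative of an arsinh, where 3/2 covers the lost factor \<open>sqrt 2\<close>; farther away it
  is at most 1.\<close>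

lemma nn_integral_inverse_dist:
  assumes d: "0 < \<delta>" "\<delta> \<le> 1/4"
  shows "(\<integral>\<^sup>+t. ennreal (1 / max \<delta> \<bar>t - \<gamma>\<bar>) * indicator {T - 1/2..T + 1/2} t \<partial>lborel) \<le> ennreal (7 * ln (1/\<delta>))"
proof -
  have ln1: "ln (1/\<delta>) \<ge> 1"
  proof -
    have "exp 1 \<le> (4::real)" using exp_le by simp
    also have "4 \<le> 1/\<delta>" using d by (simp add: field_simps)
    finally show ?thesis using d by (subst ln_ge_iff) auto
  qed
  let ?f = "\<lambda>t. 3/2 * (1 / sqrt ((t - \<gamma>)\<^sup>2 + \<delta>\<^sup>2))"
  have pos: "(t - \<gamma>)\<^sup>2 + \<delta>\<^sup>2 > 0" for t using d by (intro add_nonneg_pos) auto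
  have "(\<integral>\<^sup>+t. ennreal (1 / max \<delta> \<bar>t - \<gamma>\<bar>) * indicator {T - 1/2..T + 1/2} t \<partial>lborel)
     \<le> (\<integral>\<^sup>+t. indicator {T - 1/2..T + 1/2} t + ennreal (?f t) * indicator {\<gamma> - 1..\<gamma> + 1} t \<partial>lborel)"
  proof (rule nn_integral_mono)
    fix t
    have "1 / max \<delta> \<bar>t - \<gamma>\<bar> \<le> 1" if "t \<notin> {\<gamma> - 1..\<gamma> + 1}"
    proof -
      have "\<bar>t - \<gamma>\<bar> \<ge> 1" using that by (auto simp: abs_if)
      then show ?thesis by simp
    qed
    moreover have "1 / max \<delta> \<bar>t - \<gamma>\<bar> \<le> ?f t"
    proof -
      have "sqrt ((t - \<gamma>)\<^sup>2 + \<delta>\<^sup>2) \<le> sqrt ((3/2 * max \<delta> \<bar>t - \<gamma>\<bar>)\<^sup>2)"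
      proof (rule real_sqrt_le_mono)
        have "(t - \<gamma>)\<^sup>2 \<le> (max \<delta> \<bar>t - \<gamma>\<bar>)\<^sup>2" by (subst power2_abs[symmetric]) (intro power_mono, auto)
        moreover have "\<delta>\<^sup>2 \<le> (max \<delta> \<bar>t - \<gamma>\<bar>)\<^sup>2" using d by (intro power_mono) auto
        moreover have "(3/2 * max \<delta> \<bar>t - \<gamma>\<bar>)\<^sup>2 = 9/4 * (max \<delta> \<bar>t - \<gamma>\<bar>)\<^sup>2"
          unfolding power_mult_distrib by (simp add: power2_eq_square)
        ultimately show "(t - \<gamma>)\<^sup>2 + \<delta>\<^sup>2 \<le> (3/2 * max \<delta> \<bar>t - \<gamma>\<bar>)\<^sup>2"
          using zero_le_power2[of "max \<delta> \<bar>t - \<gamma>\<bar>"] by linarith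
      qed
      also have "\<dots> = 3/2 * max \<delta> \<bar>t - \<gamma>\<bar>" using d by (simp add: abs_mult)
      finally have le: "sqrt ((t - \<gamma>)\<^sup>2 + \<delta>\<^sup>2) \<le> 3/2 * max \<delta> \<bar>t - \<gamma>\<bar>" .
      moreover have "sqrt ((t - \<gamma>)\<^sup>2 + \<delta>\<^sup>2) > 0" using pos[of t] by simp
      moreover have "max \<delta> \<bar>t - \<gamma>\<bar> > 0" using d by simp
      ultimately show ?thesis by (simp add: divide_simps)
    qed
    ultimately show "ennreal (1 / max \<delta> \<bar>t - \<gamma>\<bar>) * indicator {T - 1/2..T + 1/2} t
       \<le> indicator {T - 1/2..T + 1/2} t + ennreal (?f t) * indicator {\<gamma> - 1..\<gamma> + 1} t"
    proof (cases "t \<in> {\<gamma> - 1..\<gamma> + 1}")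
      case True
      then show ?thesis using \<open>1 / max \<delta> \<bar>t - \<gamma>\<bar> \<le> ?f t\<close>
        by (auto simp: indicator_def intro!: ennreal_leI order_trans[OF _ add_increasing])
    next
      case False
      then show ?thesis using \<open>t \<notin> {\<gamma> - 1..\<gamma> + 1} \<Longrightarrow> 1 / max \<delta> \<bar>t - \<gamma>\<bar> \<le> 1\<close>[OF False] ennreal_leI[of "1 / max \<delta> \<bar>t - \<gamma>\<bar>" 1]
        by (auto simp: indicator_def)
    qed
  qed
  also have "\<dots> = (\<integral>\<^sup>+t. indicator {T - 1/2..T + 1/2} t \<partial>lborel) + (\<integral>\<^sup>+t. ennreal (?f t) * indicator {\<gamma> - 1..\<gamma> + 1} t \<partial>lborel)"
    by (rule nn_integral_add) auto
  also have "(\<integral>\<^sup>+t. ennreal (?f t) * indicator {\<gamma> - 1..\<gamma> + 1} t \<partial>lborel) = ennreal (3/2 * arsinh (((\<gamma> + 1) - \<gamma>) / \<delta>) - 3/2 * arsinh (((\<gamma> - 1) - \<gamma>) / \<delta>))"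
  proof (rule nn_integral_FTC_Icc)
    fix x
    have "sqrt (((x - \<gamma>) / \<delta>)\<^sup>2 + 1) = sqrt (((x - \<gamma>)\<^sup>2 + \<delta>\<^sup>2) / \<delta>\<^sup>2)"
      using d by (simp add: power_divide add_divide_distrib)
    also have "\<dots> = sqrt ((x - \<gamma>)\<^sup>2 + \<delta>\<^sup>2) / \<delta>" using d by (simp add: real_sqrt_divide)
    finally have sq: "sqrt (((x - \<gamma>) / \<delta>)\<^sup>2 + 1) = sqrt ((x - \<gamma>)\<^sup>2 + \<delta>\<^sup>2) / \<delta>" .
    have "((\<lambda>x. 3/2 * arsinh ((x - \<gamma>) / \<delta>)) has_real_derivative 3/2 * (1 / sqrt (((x - \<gamma>) / \<delta>)\<^sup>2 + 1) * (1 / \<delta>))) (at x)"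
      using d by (intro DERIV_cmult DERIV_chain2[OF arsinh_real_has_field_derivative]) (auto intro!: derivative_eq_intros)
    then show "((\<lambda>x. 3/2 * arsinh ((x - \<gamma>) / \<delta>)) has_real_derivative ?f x) (at x)"
      unfolding sq using d by simp
  qed (use pos in \<open>auto intro!: divide_nonneg_nonneg less_imp_le\<close>)
  also have "3/2 * arsinh (((\<gamma> + 1) - \<gamma>) / \<delta>) - 3/2 * arsinh (((\<gamma> - 1) - \<gamma>) / \<delta>) = 3 * arsinh (1 / \<delta>)"
    using arsinh_minus_real[of "1/\<delta>"] by simp
  also have "(\<integral>\<^sup>+t. indicator {T - 1/2..T + 1/2} t \<partial>lborel) = ennreal 1" by simp
  also have "ennreal 1 + ennreal (3 * arsinh (1 / \<delta>)) \<le> ennreal (7 * ln (1/\<delta>))"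
  proof -
    have "arsinh (1/\<delta>) = ln (1/\<delta> + sqrt ((1/\<delta>)\<^sup>2 + 1))" by (rule arsinh_real_def)
    also have "\<dots> \<le> ln (4 * (1/\<delta>))"
    proof (rule ln_mono)
      have "sqrt ((1/\<delta>)\<^sup>2 + 1) \<le> sqrt ((1/\<delta> + 1)\<^sup>2)"
        using d by (intro real_sqrt_le_mono) (simp add: power2_eq_square algebra_simps)
      also have "\<dots> = 1/\<delta> + 1" using d by simp
      finally have "sqrt ((1/\<delta>)\<^sup>2 + 1) \<le> 1/\<delta> + 1" .
      moreover have "4 \<le> 1/\<delta>" using d by (simp add: field_simps)
      ultimately show "1/\<delta> + sqrt ((1/\<delta>)\<^sup>2 + 1) \<le> 4 * (1/\<delta>)" by linarith
      show "0 < 1/\<delta> + sqrt ((1/\<delta>)\<^sup>2 + 1)" using d by (intro add_pos_nonneg) auto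
    qed
    also have "\<dots> = ln 4 + ln (1/\<delta>)" using d by (subst ln_mult) auto
    also have "ln 4 \<le> ln (1/\<delta>)" using d by (intro ln_mono) (auto simp: field_simps)
    finally have as: "arsinh (1/\<delta>) \<le> 2 * ln (1/\<delta>)" by simp
    have "ennreal 1 + ennreal (3 * arsinh (1 / \<delta>)) \<le> ennreal 1 + ennreal (6 * ln (1/\<delta>))"
      using as by (intro add_left_mono ennreal_leI) auto
    also have "\<dots> = ennreal (1 + 6 * ln (1/\<delta>))" using ln1 by (intro ennreal_plus[symmetric]) auto
    also have "\<dots> \<le> ennreal (7 * ln (1/\<delta>))" using ln1 by (intro ennreal_leI) auto
    finally show ?thesis .
  qed
  finally show ?thesis by (simp add: add.commute)
qed

lemma sum_list_norm_le:
  "norm (\<Sum>x\<leftarrow>xs. f x :: 'a :: real_normed_vector) \<le> (\<Sum>x\<leftarrow>xs. norm (f x))"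
  by (induction xs) (auto intro: norm_triangle_mono)

lemma nn_integral_sum_list:
  assumes "\<And>x. x \<in> set xs \<Longrightarrow> (\<lambda>t. f x t) \<in> borel_measurable M"
  shows "(\<integral>\<^sup>+t. (\<Sum>x\<leftarrow>xs. f x t) \<partial>M) = (\<Sum>x\<leftarrow>xs. \<integral>\<^sup>+t. f x t \<partial>M)"
    and "(\<lambda>t. \<Sum>x\<leftarrow>xs. f x t :: ennreal) \<in> borel_measurable M"
proof -
  have "(\<lambda>t. \<Sum>x\<leftarrow>xs. f x t :: ennreal) \<in> borel_measurable M \<and> (\<integral>\<^sup>+t. (\<Sum>x\<leftarrow>xs. f x t) \<partial>M) = (\<Sum>x\<leftarrow>xs. \<integral>\<^sup>+t. f x t \<partial>M)"
    using assms
  proof (induction xs)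
    case (Cons x xs)
    then have [measurable]: "(\<lambda>t. f x t) \<in> borel_measurable M" "(\<lambda>t. \<Sum>x\<leftarrow>xs. f x t) \<in> borel_measurable M" by auto
    show ?case using Cons by (auto simp: nn_integral_add)
  qed auto
  then show "(\<integral>\<^sup>+t. (\<Sum>x\<leftarrow>xs. f x t) \<partial>M) = (\<Sum>x\<leftarrow>xs. \<integral>\<^sup>+t. f x t \<partial>M)"
    "(\<lambda>t. \<Sum>x\<leftarrow>xs. f x t :: ennreal) \<in> borel_measurable M" by auto
qed

lemma sum_list_le_length:
  fixes f :: "'a \<Rightarrow> 'b :: ordered_semiring_1"
  assumes "\<And>x. x \<in> set xs \<Longrightarrow> f x \<le> c"
  shows "(\<Sum>x\<leftarrow>xs. f x) \<le> of_nat (length xs) * c"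
  using assms by (induction xs) (auto simp: distrib_right intro!: add_mono)

lemma sum_list_mono2:
  fixes f :: "'a \<Rightarrow> 'b :: ordered_comm_monoid_add"
  assumes "\<And>x. x \<in> set xs \<Longrightarrow> f x \<le> g x"
  shows "(\<Sum>x\<leftarrow>xs. f x) \<le> (\<Sum>x\<leftarrow>xs. g x)"
  using assms by (induction xs) (auto intro!: add_mono)

lemma ennreal_sum_list: "(\<And>x. x \<in> set xs \<Longrightarrow> f x \<ge> 0) \<Longrightarrow> ennreal (\<Sum>x\<leftarrow>xs. f x) = (\<Sum>x\<leftarrow>xs. ennreal (f x))"
  by (induction xs) (auto intro!: ennreal_plus sum_list_nonneg)

text \<open>Discs of radius 6 about \<open>2 + \<i> * T\<close> stay in
  \<open>Re s \<ge> -4\<close>, and \<open>H\<close> is bounded below at their centres. No zero lies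
  to the right of 1/2, so the distance from \<open>s\<close> to a zero is at least both
  \<open>\<sigma>\<close> and \<open>\<bar>t - Im \<rho>\<bar>\<close>. Pointwise this gives
  \<open>1 / \<sigma>\<close> per zero, which is enough for shifting contours; on average over
  \<open>t\<close> it gives only a logarithm, which is what the mean square needs.\<close>

theorem logderiv_bounds:
  assumes H: "H holomorphic_on UNIV" and Hb: "\<And>s. Re s \<ge> -4 \<Longrightarrow> norm (H s) \<le> C * (1 + norm s) ^ 6"
    and Hlow: "\<And>s. Re s = 2 \<Longrightarrow> norm (H s) \<ge> 1/4" and Hz: "\<And>s. H s = 0 \<Longrightarrow> Re s \<le> 1/2"
  obtains K where "K > 0"
    "\<And>\<sigma> t. 0 < \<sigma> \<Longrightarrow> \<sigma> \<le> 3/2 \<Longrightarrow> norm (deriv H (Complex (1/2 + \<sigma>) t) / H (Complex (1/2 + \<sigma>) t)) \<le> K / \<sigma> * (1 + \<bar>t\<bar>) powr (1/4)"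
    "\<And>\<delta> T. 0 < \<delta> \<Longrightarrow> \<delta> \<le> 1/4 \<Longrightarrow>
       (\<integral>\<^sup>+t. ennreal (norm (deriv H (Complex (1/2 + \<delta>) t) / H (Complex (1/2 + \<delta>) t))) * indicator {T - 1/2..T + 1/2} t \<partial>lborel)
         \<le> ennreal (K * ln (1/\<delta>) * (1 + \<bar>T\<bar>) powr (1/4))"
proof -
  define C' where "C' = max C 1"
  \<comment> \<open>25 is 24 + 1: six times \<open>ln (1 + \<bar>T\<bar>) \<le> 4 * w T\<close>, and
    the 1 of \<open>ln M + 1\<close>. The factor 4 comes from the lower bound 1/4 at the centre, and
    \<open>9 ^ 6\<close> from \<open>1 + norm s \<le> 9 * (1 + \<bar>T\<bar>)\<close> on the
    disc.\<close>
  define A where "A = ln (4 * C' * 9 ^ 6) + 25"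
  define w where "w = (\<lambda>T::real. (1 + \<bar>T\<bar>) powr (1/4))"
  have C': "C' \<ge> 1" "C \<le> C'" by (auto simp: C'_def)
  have lnC: "ln (4 * C' * 9 ^ 6) \<ge> 0" using C' by (intro ln_ge_zero) auto
  have A: "A \<ge> 25" using lnC by (simp add: A_def)
  have w1: "w T \<ge> 1" for T unfolding w_def by (intro ge_one_powr_ge_zero) auto
  have key: "\<exists>rs. real (length rs) \<le> 3 * A * w T \<and> (\<forall>\<rho>\<in>set rs. Re \<rho> \<le> 1/2) \<and>
     (\<forall>\<sigma> t. 0 < \<sigma> \<longrightarrow> \<sigma> \<le> 3/2 \<longrightarrow> \<bar>t - T\<bar> \<le> 1/2 \<longrightarrow> norm (deriv H (Complex (1/2 + \<sigma>) t) / H (Complex (1/2 + \<sigma>) t))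
        \<le> (\<Sum>\<rho>\<leftarrow>rs. 1 / max \<sigma> \<bar>t - Im \<rho>\<bar>) + 180 * A * w T)" for T
  proof -
    define z0 where "z0 = Complex 2 T"
    define M where "M = 4 * C' * 9 ^ 6 * (1 + \<bar>T\<bar>) ^ 6"
    have lnM: "ln M + 1 \<le> A * w T"
    proof -
      have "ln M = ln (4 * C' * 9 ^ 6) + 6 * ln (1 + \<bar>T\<bar>)"
        unfolding M_def using C' by (subst ln_mult) (auto simp: ln_realpow)
      also have "ln (1 + \<bar>T\<bar>) \<le> w T / (1/4)" unfolding w_def by (intro ln_powr_bound) auto
      finally have "ln M + 1 \<le> (ln (4 * C' * 9 ^ 6) + 1) * 1 + 24 * w T" by simp
      also have "\<dots> \<le> (ln (4 * C' * 9 ^ 6) + 1) * w T + 24 * w T"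
        using lnC w1[of T] by (intro add_right_mono mult_left_mono) auto
      finally show ?thesis by (simp add: A_def algebra_simps)
    qed
    have Hz0: "norm (H z0) \<ge> 1/4" using Hlow[of z0] by (simp add: z0_def)
    have Hnz: "H z0 \<noteq> 0" using Hz0 by auto
    have z0n: "norm z0 \<le> 2 + \<bar>T\<bar>" using cmod_le[of z0] by (simp add: z0_def)
    have bound: "norm (H s) \<le> M * norm (H z0)" if "s \<in> ball z0 6" for s
    proof -
      have d: "norm (z0 - s) < 6" using that by (simp add: dist_norm)
      have "Re z0 - Re s \<le> norm (z0 - s)" using complex_Re_le_cmod[of "z0 - s"] by simp
      then have "Re s \<ge> -4" using d by (simp add: z0_def)
      then have "norm (H s) \<le> C * (1 + norm s) ^ 6" by (rule Hb)
      also have "\<dots> \<le> C' * (9 * (1 + \<bar>T\<bar>)) ^ 6"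
      proof (intro mult_mono power_mono)
        have "norm s \<le> norm z0 + norm (z0 - s)" using norm_triangle_ineq4[of z0 "z0 - s"] by simp
        then show "1 + norm s \<le> 9 * (1 + \<bar>T\<bar>)" using d z0n abs_ge_zero[of T] unfolding distrib_left by linarith
        show "C \<le> C'" "0 \<le> C'" "0 \<le> 1 + norm s" using C' by auto
        show "0 \<le> (1 + norm s) ^ 6" by simp
      qed
      also have "\<dots> = M * (1/4)"
      proof -
        have "(9 * (1 + \<bar>T\<bar>)) ^ 6 = 9 ^ 6 * (1 + \<bar>T\<bar>) ^ 6" by (rule power_mult_distrib)
        then show ?thesis unfolding M_def by simp
      qed
      also have "\<dots> \<le> M * norm (H z0)" using Hz0 C' by (intro mult_left_mono) (auto simp: M_def)
      finally show ?thesis .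
    qed
    obtain rs where len: "(3/2) ^ length rs \<le> M" and zs: "\<And>\<rho>. \<rho> \<in> set rs \<Longrightarrow> H \<rho> = 0" and
      pf: "\<And>s. dist z0 s \<le> 8/5 \<Longrightarrow> H s \<noteq> 0 \<Longrightarrow>
        norm (deriv H s / H s - (\<Sum>\<rho>\<leftarrow>rs. 1 / (s - \<rho>))) \<le> 180 * (ln M + 1)"
      using logderiv_partial_fractions[OF holomorphic_on_subset[OF H subset_UNIV] Hnz bound] by blast
    have "real (length rs) \<le> 3 * A * w T"
    proof -
      have "ln ((3/2) ^ length rs) \<le> ln M" using len by (intro ln_mono) auto
      then have "real (length rs) * ln (3/2) \<le> ln M" by (simp add: ln_realpow)
      moreover have "ln (3/2::real) \<ge> 1/3"
        using ln_le_minus_one[of "2/3::real"] ln_inverse[of "2/3 :: real"] by simp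
      then have "real (length rs) * (1/3) \<le> real (length rs) * ln (3/2)" by (intro mult_left_mono) auto
      ultimately show ?thesis using lnM by linarith
    qed
    moreover have "norm (deriv H s / H s) \<le> (\<Sum>\<rho>\<leftarrow>rs. 1 / max \<sigma> \<bar>t - Im \<rho>\<bar>) + 180 * A * w T"
      if "0 < \<sigma>" "\<sigma> \<le> 3/2" "\<bar>t - T\<bar> \<le> 1/2" "s = Complex (1/2 + \<sigma>) t" for \<sigma> t s
    proof -
      have "H s \<noteq> 0" using Hz[of s] that by auto
      moreover have "dist z0 s \<le> 8/5"
      proof -
        have "(3/2 - \<sigma>)\<^sup>2 \<le> (3/2)\<^sup>2" using that by (intro power_mono) auto
        moreover have "(T - t)\<^sup>2 \<le> (1/2)\<^sup>2" using that by (subst power2_abs[symmetric], intro power_mono) (auto simp: abs_minus_commute)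
        moreover have "norm (z0 - s) ^ 2 = (3/2 - \<sigma>)\<^sup>2 + (T - t)\<^sup>2"
          unfolding cmod_power2 using that by (simp add: z0_def)
        ultimately have "norm (z0 - s) ^ 2 \<le> (8/5)\<^sup>2" by (simp add: power2_eq_square)
        then show ?thesis unfolding dist_norm by (rule power2_le_imp_le) simp
      qed
      ultimately have "norm (deriv H s / H s - (\<Sum>\<rho>\<leftarrow>rs. 1 / (s - \<rho>))) \<le> 180 * (ln M + 1)" by (intro pf)
      then have h1: "norm (deriv H s / H s) \<le> norm (\<Sum>\<rho>\<leftarrow>rs. 1 / (s - \<rho>)) + 180 * (ln M + 1)"
        using norm_triangle_sub[of "deriv H s / H s" "\<Sum>\<rho>\<leftarrow>rs. 1 / (s - \<rho>)"] by linarith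
      have "norm (\<Sum>\<rho>\<leftarrow>rs. 1 / (s - \<rho>)) \<le> (\<Sum>\<rho>\<leftarrow>rs. norm (1 / (s - \<rho>)))" by (rule sum_list_norm_le)
      also have "\<dots> \<le> (\<Sum>\<rho>\<leftarrow>rs. 1 / max \<sigma> \<bar>t - Im \<rho>\<bar>)"
      proof (rule sum_list_mono2)
        fix \<rho> assume "\<rho> \<in> set rs"
        then have "Re \<rho> \<le> 1/2" using zs Hz by blast
        then have "\<sigma> \<le> norm (s - \<rho>)" using complex_Re_le_cmod[of "s - \<rho>"] that by simp
        moreover have "\<bar>t - Im \<rho>\<bar> \<le> norm (s - \<rho>)" using abs_Im_le_cmod[of "s - \<rho>"] that by simp
        ultimately show "norm (1 / (s - \<rho>)) \<le> 1 / max \<sigma> \<bar>t - Im \<rho>\<bar>"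
          unfolding norm_divide norm_one using that by (intro divide_left_mono mult_pos_pos) auto
      qed
      finally have "norm (\<Sum>\<rho>\<leftarrow>rs. 1 / (s - \<rho>)) \<le> (\<Sum>\<rho>\<leftarrow>rs. 1 / max \<sigma> \<bar>t - Im \<rho>\<bar>)" .
      moreover have "180 * (ln M + 1) \<le> 180 * A * w T" using lnM by simp
      ultimately show ?thesis using h1 by linarith
    qed
    ultimately show ?thesis using zs Hz by blast
  qed
  show ?thesis
  \<comment> \<open>One constant for both estimates, which need 3 + 180 * 3/2 = 273 and 3 * 7 + 180
    = 201 times \<open>A\<close>.\<close>
  proof (rule that[of "300 * A"])
    show "300 * A > 0" using A by simp
    fix \<sigma> t :: real assume \<sigma>: "0 < \<sigma>" "\<sigma> \<le> 3/2"
    obtain rs where rs: "real (length rs) \<le> 3 * A * w t" and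
     b': "\<forall>\<sigma> t'. 0 < \<sigma> \<longrightarrow> \<sigma> \<le> 3/2 \<longrightarrow> \<bar>t' - t\<bar> \<le> 1/2 \<longrightarrow> norm (deriv H (Complex (1/2 + \<sigma>) t') / H (Complex (1/2 + \<sigma>) t'))
        \<le> (\<Sum>\<rho>\<leftarrow>rs. 1 / max \<sigma> \<bar>t' - Im \<rho>\<bar>) + 180 * A * w t"
      using key[of t] by blast
    have b: "norm (deriv H (Complex (1/2 + \<sigma>) t) / H (Complex (1/2 + \<sigma>) t))
        \<le> (\<Sum>\<rho>\<leftarrow>rs. 1 / max \<sigma> \<bar>t - Im \<rho>\<bar>) + 180 * A * w t"
      using b' \<sigma> by simp
    have "(\<Sum>\<rho>\<leftarrow>rs. 1 / max \<sigma> \<bar>t - Im \<rho>\<bar>) \<le> real (length rs) * (1 / \<sigma>)"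
      using \<sigma> by (intro sum_list_le_length divide_left_mono) auto
    also have "\<dots> \<le> 3 * A * w t * (1 / \<sigma>)" using rs \<sigma> by (intro mult_right_mono) auto
    finally have h1: "(\<Sum>\<rho>\<leftarrow>rs. 1 / max \<sigma> \<bar>t - Im \<rho>\<bar>) \<le> 3 * A * w t * (1 / \<sigma>)" .
    have h2: "180 * A * w t \<le> 180 * A * w t * (3/2 * (1 / \<sigma>))"
    proof -
      have "180 * A * w t * 1 \<le> 180 * A * w t * (3/2 * (1 / \<sigma>))"
        using \<sigma> A w1[of t] by (intro mult_left_mono) (auto simp: field_simps)
      then show ?thesis by simp
    qed
    have "273 * (A * w t * (1 / \<sigma>)) \<le> 300 * (A * w t * (1 / \<sigma>))" using \<sigma> A w1[of t] by (intro mult_right_mono) auto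
    then have "norm (deriv H (Complex (1/2 + \<sigma>) t) / H (Complex (1/2 + \<sigma>) t)) \<le> 300 * (A * w t * (1 / \<sigma>))"
      using b h1 h2 by linarith
    then show "norm (deriv H (Complex (1/2 + \<sigma>) t) / H (Complex (1/2 + \<sigma>) t)) \<le> 300 * A / \<sigma> * (1 + \<bar>t\<bar>) powr (1/4)"
      by (simp add: w_def)
  next
    fix \<delta> T :: real assume \<delta>: "0 < \<delta>" "\<delta> \<le> 1/4"
    obtain rs where rs: "real (length rs) \<le> 3 * A * w T" and
     b': "\<forall>\<sigma> t. 0 < \<sigma> \<longrightarrow> \<sigma> \<le> 3/2 \<longrightarrow> \<bar>t - T\<bar> \<le> 1/2 \<longrightarrow> norm (deriv H (Complex (1/2 + \<sigma>) t) / H (Complex (1/2 + \<sigma>) t))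
        \<le> (\<Sum>\<rho>\<leftarrow>rs. 1 / max \<sigma> \<bar>t - Im \<rho>\<bar>) + 180 * A * w T"
      using key[of T] by blast
    have b: "norm (deriv H (Complex (1/2 + \<delta>) t) / H (Complex (1/2 + \<delta>) t))
        \<le> (\<Sum>\<rho>\<leftarrow>rs. 1 / max \<delta> \<bar>t - Im \<rho>\<bar>) + 180 * A * w T" if "\<bar>t - T\<bar> \<le> 1/2" for t
      using b'[rule_format, of \<delta> t] \<delta> that by simp
    have ln1: "ln (1/\<delta>) \<ge> 1"
    proof -
      have "exp 1 \<le> (4::real)" using exp_le by simp
      also have "4 \<le> 1/\<delta>" using \<delta> by (simp add: field_simps)
      finally show ?thesis using \<delta> by (subst ln_ge_iff) auto
    qed
    let ?I = "\<lambda>t. indicator {T - 1/2..T + 1/2} t :: ennreal"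
    have "(\<integral>\<^sup>+t. ennreal (norm (deriv H (Complex (1/2 + \<delta>) t) / H (Complex (1/2 + \<delta>) t))) * ?I t \<partial>lborel)
      \<le> (\<integral>\<^sup>+t. (\<Sum>\<rho>\<leftarrow>rs. ennreal (1 / max \<delta> \<bar>t - Im \<rho>\<bar>) * ?I t) + ennreal (180 * A * w T) * ?I t \<partial>lborel)"
    proof (rule nn_integral_mono)
      fix t
      show "ennreal (norm (deriv H (Complex (1/2 + \<delta>) t) / H (Complex (1/2 + \<delta>) t))) * ?I t
         \<le> (\<Sum>\<rho>\<leftarrow>rs. ennreal (1 / max \<delta> \<bar>t - Im \<rho>\<bar>) * ?I t) + ennreal (180 * A * w T) * ?I t"
      proof (cases "t \<in> {T - 1/2..T + 1/2}")
        case True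
        then have "\<bar>t - T\<bar> \<le> 1/2" by (auto simp: abs_if)
        note E = ennreal_leI[OF b[OF this]]
        have pos: "1 / max \<delta> \<bar>t - Im \<rho>\<bar> \<ge> 0" for \<rho> using \<delta> by simp
        have "(\<Sum>\<rho>\<leftarrow>rs. 1 / max \<delta> \<bar>t - Im \<rho>\<bar>) \<ge> 0" by (rule sum_list_nonneg) (use pos in auto)
        moreover have "180 * A * w T \<ge> 0" using A w1[of T] by simp
        ultimately have P: "ennreal ((\<Sum>\<rho>\<leftarrow>rs. 1 / max \<delta> \<bar>t - Im \<rho>\<bar>) + 180 * A * w T) = ennreal (\<Sum>\<rho>\<leftarrow>rs. 1 / max \<delta> \<bar>t - Im \<rho>\<bar>) + ennreal (180 * A * w T)"
          by (rule ennreal_plus)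
        have S: "ennreal (\<Sum>\<rho>\<leftarrow>rs. 1 / max \<delta> \<bar>t - Im \<rho>\<bar>) = (\<Sum>\<rho>\<leftarrow>rs. ennreal (1 / max \<delta> \<bar>t - Im \<rho>\<bar>))"
          by (rule ennreal_sum_list) (rule pos)
        have I: "?I t = 1" using True by simp
        show ?thesis using E unfolding I mult_1_right P S .
      qed simp
    qed
    also have "\<dots> = (\<integral>\<^sup>+t. (\<Sum>\<rho>\<leftarrow>rs. ennreal (1 / max \<delta> \<bar>t - Im \<rho>\<bar>) * ?I t) \<partial>lborel) + (\<integral>\<^sup>+t. ennreal (180 * A * w T) * ?I t \<partial>lborel)"
      by (intro nn_integral_add nn_integral_sum_list(2)) auto
    finally have n1: "(\<integral>\<^sup>+t. ennreal (norm (deriv H (Complex (1/2 + \<delta>) t) / H (Complex (1/2 + \<delta>) t))) * ?I t \<partial>lborel)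
       \<le> (\<integral>\<^sup>+t. (\<Sum>\<rho>\<leftarrow>rs. ennreal (1 / max \<delta> \<bar>t - Im \<rho>\<bar>) * ?I t) \<partial>lborel) + (\<integral>\<^sup>+t. ennreal (180 * A * w T) * ?I t \<partial>lborel)" .
    have "(\<integral>\<^sup>+t. (\<Sum>\<rho>\<leftarrow>rs. ennreal (1 / max \<delta> \<bar>t - Im \<rho>\<bar>) * ?I t) \<partial>lborel) = (\<Sum>\<rho>\<leftarrow>rs. \<integral>\<^sup>+t. ennreal (1 / max \<delta> \<bar>t - Im \<rho>\<bar>) * ?I t \<partial>lborel)"
      by (rule nn_integral_sum_list(1)) auto
    also have "\<dots> \<le> of_nat (length rs) * ennreal (7 * ln (1/\<delta>))"
      by (intro sum_list_le_length nn_integral_inverse_dist \<delta>)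
    also have "\<dots> = ennreal (real (length rs) * (7 * ln (1/\<delta>)))"
      by (simp add: ennreal_mult' ennreal_of_nat_eq_real_of_nat)
    also have "\<dots> \<le> ennreal (3 * A * w T * (7 * ln (1/\<delta>)))"
      using rs ln1 by (intro ennreal_leI mult_right_mono) auto
    finally have n2: "(\<integral>\<^sup>+t. (\<Sum>\<rho>\<leftarrow>rs. ennreal (1 / max \<delta> \<bar>t - Im \<rho>\<bar>) * ?I t) \<partial>lborel) \<le> ennreal (3 * A * w T * (7 * ln (1/\<delta>)))" .
    have n3: "(\<integral>\<^sup>+t. ennreal (180 * A * w T) * ?I t \<partial>lborel) = ennreal (180 * A * w T)"
      by (subst nn_integral_cmult) auto
    note order_trans[OF n1 add_mono[OF n2 order_refl]]
    also note n3
    also have "ennreal (3 * A * w T * (7 * ln (1/\<delta>))) + ennreal (180 * A * w T) = ennreal (3 * A * w T * (7 * ln (1/\<delta>)) + 180 * A * w T)"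
      using A w1[of T] ln1 by (intro ennreal_plus[symmetric]) auto
    also have "\<dots> \<le> ennreal (300 * A * ln (1/\<delta>) * (1 + \<bar>T\<bar>) powr (1/4))"
    proof (rule ennreal_leI)
      have "180 * A * w T * 1 \<le> 180 * A * w T * ln (1/\<delta>)" using ln1 A w1[of T] by (intro mult_left_mono) auto
      then have "3 * A * w T * (7 * ln (1/\<delta>)) + 180 * A * w T \<le> 201 * (A * w T * ln (1/\<delta>))" by simp
      also have "\<dots> \<le> 300 * (A * w T * ln (1/\<delta>))" using ln1 A w1[of T] by (intro mult_right_mono) auto
      finally show "3 * A * w T * (7 * ln (1/\<delta>)) + 180 * A * w T \<le> 300 * A * ln (1/\<delta>) * (1 + \<bar>T\<bar>) powr (1/4)"
        by (simp add: w_def mult_ac)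
    qed
    finally show "(\<integral>\<^sup>+t. ennreal (norm (deriv H (Complex (1/2 + \<delta>) t) / H (Complex (1/2 + \<delta>) t))) * ?I t \<partial>lborel)
         \<le> ennreal (300 * A * ln (1/\<delta>) * (1 + \<bar>T\<bar>) powr (1/4))" .
  qed
qed

section \<open>Perron kernels and vertical integrals\<close>

lemma has_bochner_integral_vertical:
  assumes G: "\<And>z. z \<in> S \<Longrightarrow> (G has_field_derivative F z) (at z)" and F: "continuous_on S F"
    and line: "\<And>t. \<bar>t\<bar> \<le> T \<Longrightarrow> Complex a t \<in> S" and T: "T \<ge> 0"
  shows "has_bochner_integral lborel (\<lambda>t. indicator {-T..T} t *\<^sub>R F (Complex a t)) ((G (Complex a T) - G (Complex a (-T))) / \<i>)"
proof -
  have ceq: "Complex a = (\<lambda>t. of_real a + of_real t * \<i>)" by (auto simp: complex_eq_iff fun_eq_iff)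
  have "has_bochner_integral lborel (\<lambda>t. indicator {-T..T} t *\<^sub>R (F (Complex a t) * \<i>)) (G (Complex a T) - G (Complex a (-T)))"
  proof (rule has_bochner_integral_FTC_Icc)
    show "-T \<le> T" using T by simp
    fix t assume "-T \<le> t" "t \<le> T"
    then have "Complex a t \<in> S" by (intro line) auto
    then have "(G has_field_derivative F (Complex a t)) (at (Complex a t))" by (rule G)
    moreover have "(Complex a has_vector_derivative \<i>) (at t within {-T..T})"
      unfolding ceq by (auto intro!: derivative_eq_intros)
    ultimately show "((\<lambda>t. G (Complex a t)) has_vector_derivative F (Complex a t) * \<i>) (at t within {-T..T})"
      using field_vector_diff_chain_within[of "Complex a" \<i> t "{-T..T}" G "F (Complex a t)"] has_field_derivative_at_within
      by (auto simp: o_def mult.commute)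
  next
    have "continuous_on {-T..T} (Complex a)" unfolding ceq by (intro continuous_intros)
    then have "continuous_on {-T..T} (\<lambda>t. F (Complex a t))"
      by (rule continuous_on_compose2[OF F]) (auto intro!: line)
    then show "continuous_on {-T..T} (\<lambda>t. F (Complex a t) * \<i>)"
      by (intro continuous_on_mult_right)
  qed
  note base = this
  have "has_bochner_integral lborel (\<lambda>t. (indicator {-T..T} t *\<^sub>R (F (Complex a t) * \<i>)) * (1 / \<i>)) ((G (Complex a T) - G (Complex a (-T))) * (1 / \<i>))"
    by (rule has_bochner_integral_mult_left) (rule base)
  moreover have "(\<lambda>t. (indicator {-T..T} t *\<^sub>R (F (Complex a t) * \<i>)) * (1 / \<i>)) = (\<lambda>t. indicator {-T..T} t *\<^sub>R F (Complex a t))"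
    by (rule ext) (simp add: scaleR_conv_of_real mult.assoc)
  moreover have "(G (Complex a T) - G (Complex a (-T))) * (1 / \<i>) = (G (Complex a T) - G (Complex a (-T))) / \<i>"
    by (simp only: times_divide_eq_right mult_1_right)
  ultimately show ?thesis by (simp only:)
qed

text \<open>Cauchy's theorem for a rectangle, by means of a primitive on the convex set;
  \<open>\<epsilon>\<close> makes the horizontal sides vanish. Truncated integrals are kept because
  the integrand need not be absolutely integrable on the lines, as happens for the remainder
  \<open>E\<close> in \<open>perron_kernel_1\<close>.\<close>

lemma strip_shift:
  assumes F: "F holomorphic_on S" "convex S" "open S" and ab: "a \<le> b"
    and strip: "\<And>\<sigma> t. a \<le> \<sigma> \<Longrightarrow> \<sigma> \<le> b \<Longrightarrow> Complex \<sigma> t \<in> S"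
    and bd: "\<And>\<sigma> t. a \<le> \<sigma> \<Longrightarrow> \<sigma> \<le> b \<Longrightarrow> \<bar>t\<bar> \<ge> T0 \<Longrightarrow> norm (F (Complex \<sigma> t)) \<le> \<epsilon> \<bar>t\<bar>" and \<epsilon>: "(\<epsilon> \<longlongrightarrow> 0) at_top"
  shows "((\<lambda>T. (LINT t|lborel. indicator {-T..T} t *\<^sub>R F (Complex b t)) - (LINT t|lborel. indicator {-T..T} t *\<^sub>R F (Complex a t))) \<longlongrightarrow> 0) at_top"
proof -
  have "\<exists>G. \<forall>z\<in>S. (G has_field_derivative F z) (at z within S)"
  proof (rule holomorphic_convex_primitive'[OF F(2,3,1)])
    fix g assume "\<And>x. x \<in> S \<Longrightarrow> (g has_field_derivative F x) (at x within S)"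
    then show ?thesis by (intro exI[of _ g] ballI)
  qed
  then obtain G where G': "\<forall>z\<in>S. (G has_field_derivative F z) (at z within S)" ..
  have G: "(G has_field_derivative F z) (at z)" if "z \<in> S" for z
    using bspec[OF G' that] at_within_open[OF that F(3)] by simp
  have cF: "continuous_on S F" using F(1) by (rule holomorphic_on_imp_continuous_on)
  have hor: "norm (G (Complex b t) - G (Complex a t)) \<le> \<epsilon> \<bar>t\<bar> * (b - a)" if "\<bar>t\<bar> \<ge> T0" for t
  proof -
    let ?L = "closed_segment (Complex a t) (Complex b t)"
    have L: "\<exists>\<sigma>. a \<le> \<sigma> \<and> \<sigma> \<le> b \<and> w = Complex \<sigma> t" if "w \<in> ?L" for w
    proof -
      from that obtain u where u: "0 \<le> u" "u \<le> 1" "w = (1 - u) *\<^sub>R Complex a t + u *\<^sub>R Complex b t"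
        by (auto simp: closed_segment_def)
      have "w = Complex (a + u * (b - a)) t" using u(3) by (simp add: complex_eq_iff algebra_simps)
      moreover have "a + u * (b - a) \<le> b" using mult_right_mono[of u 1 "b - a"] u ab by simp
      moreover have "a \<le> a + u * (b - a)" using u ab by simp
      ultimately show ?thesis by blast
    qed
    have "norm (G (Complex b t) - G (Complex a t)) \<le> \<epsilon> \<bar>t\<bar> * norm (Complex b t - Complex a t)"
    proof (rule field_differentiable_bound[of ?L])
      fix w assume "w \<in> ?L"
      then obtain \<sigma> where s: "a \<le> \<sigma>" "\<sigma> \<le> b" "w = Complex \<sigma> t" using L by blast
      show "(G has_field_derivative F w) (at w within ?L)"
        using has_field_derivative_at_within[OF G[OF strip[OF s(1,2), of t]]] s(3) by simp
      show "norm (F w) \<le> \<epsilon> \<bar>t\<bar>" using bd[OF s(1,2) that] s(3) by simp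
    qed auto
    also have "norm (Complex b t - Complex a t) = b - a" using ab by (simp add: norm_complex_def)
    finally show ?thesis .
  qed
  have int: "(LINT t|lborel. indicator {-T..T} t *\<^sub>R F (Complex c t)) = (G (Complex c T) - G (Complex c (-T))) / \<i>"
    if "T \<ge> 0" "a \<le> c" "c \<le> b" for T c
    using that strip by (intro has_bochner_integral_integral_eq has_bochner_integral_vertical[OF G cF]) auto
  show ?thesis
  proof (rule Lim_null_comparison)
    show "\<forall>\<^sub>F T in at_top. norm ((LINT t|lborel. indicator {-T..T} t *\<^sub>R F (Complex b t)) - (LINT t|lborel. indicator {-T..T} t *\<^sub>R F (Complex a t))) \<le> 2 * (\<epsilon> T * (b - a))"
      using eventually_ge_at_top[of "max 0 T0"]
    proof eventually_elim
      case (elim T)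
      have "(LINT t|lborel. indicator {-T..T} t *\<^sub>R F (Complex b t)) - (LINT t|lborel. indicator {-T..T} t *\<^sub>R F (Complex a t))
        = ((G (Complex b T) - G (Complex a T)) - (G (Complex b (-T)) - G (Complex a (-T)))) / \<i>"
        using elim ab by (simp add: int diff_divide_distrib algebra_simps)
      also have "norm \<dots> \<le> norm (G (Complex b T) - G (Complex a T)) + norm (G (Complex b (-T)) - G (Complex a (-T)))"
        unfolding norm_divide using norm_triangle_ineq4 by simp
      also have "\<dots> \<le> \<epsilon> T * (b - a) + \<epsilon> T * (b - a)"
        using hor[of T] hor[of "-T"] elim by (intro add_mono) auto
      finally show ?case by simp
    qed
    show "((\<lambda>T. 2 * (\<epsilon> T * (b - a))) \<longlongrightarrow> 0) at_top"
      using tendsto_mult_right_zero[OF tendsto_mult_left_zero[OF \<epsilon>, of "b - a"], of 2] by simp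
  qed
qed

lemma tendsto_integral_symmetric:
  fixes f :: "real \<Rightarrow> complex"
  assumes "integrable lborel f"
  shows "((\<lambda>T. LINT t|lborel. indicator {-T..T} t *\<^sub>R f t) \<longlongrightarrow> (LINT t|lborel. f t)) at_top"
proof (rule integral_dominated_convergence_at_top[where w = "\<lambda>t. norm (f t)"])
  show "AE t in lborel. ((\<lambda>T. indicator {-T..T} t *\<^sub>R f t) \<longlongrightarrow> f t) at_top"
  proof (rule AE_I2)
    fix t :: real
    show "((\<lambda>T. indicator {-T..T} t *\<^sub>R f t) \<longlongrightarrow> f t) at_top"
      by (rule tendsto_eventually) (use eventually_ge_at_top[of "\<bar>t\<bar>"] in \<open>eventually_elim, auto simp: indicator_def abs_le_iff\<close>)
  qed
  show "\<forall>\<^sub>F T in at_top. AE t in lborel. norm (indicator {-T..T} t *\<^sub>R f t) \<le> norm (f t)"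
    by (intro always_eventually allI AE_I2) (auto simp: indicator_def)
qed (use assms in auto)

lemma integrable_inverse_1_plus_square: "integrable lborel (\<lambda>t::real. 1 / (1 + t\<^sup>2))"
proof -
  have "set_integrable lborel (einterval (-\<infinity>) \<infinity>) (\<lambda>t::real. inverse (1 + t\<^sup>2))"
  proof (rule interval_integral_FTC_nonneg(1)[of "-\<infinity>" \<infinity> arctan _ "-pi/2" "pi/2"])
    show "((arctan \<circ> real_of_ereal) \<longlongrightarrow> - pi/2) (at_right (-\<infinity>))"
      using tendsto_arctan_at_bot by (simp add: ereal_tendsto_simps1)
    show "((arctan \<circ> real_of_ereal) \<longlongrightarrow> pi/2) (at_left \<infinity>)"
      using tendsto_arctan_at_top by (simp add: ereal_tendsto_simps1)
    fix x :: real
    have "1 + x\<^sup>2 \<noteq> 0" by (metis add_pos_nonneg less_irrefl zero_le_power2 zero_less_one)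
    then show "isCont (\<lambda>t::real. inverse (1 + t\<^sup>2)) x" by (intro continuous_intros)
  qed (auto intro!: DERIV_arctan AE_I2)
  then show ?thesis by (simp add: set_integrable_def divide_inverse)
qed

lemma vertical_measurable [measurable]: "(\<lambda>t. Complex a t) \<in> borel_measurable borel"
proof -
  have "Complex a = (\<lambda>t. of_real a + of_real t * \<i>)" by (auto simp: complex_eq_iff fun_eq_iff)
  then show ?thesis by simp
qed

lemma vertical_continuous: "continuous_on A (\<lambda>t. Complex a t)"
proof -
  have "Complex a = (\<lambda>t. of_real a + of_real t * \<i>)" by (auto simp: complex_eq_iff fun_eq_iff)
  then show ?thesis by (simp add: continuous_intros)
qed

theorem vertical_shift:
  assumes F: "F holomorphic_on S" "convex S" "open S" and ab: "a \<le> b"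
    and strip: "\<And>\<sigma> t. a \<le> \<sigma> \<Longrightarrow> \<sigma> \<le> b \<Longrightarrow> Complex \<sigma> t \<in> S"
    and bd: "\<And>\<sigma> t. a \<le> \<sigma> \<Longrightarrow> \<sigma> \<le> b \<Longrightarrow> \<bar>t\<bar> \<ge> T0 \<Longrightarrow> norm (F (Complex \<sigma> t)) \<le> \<epsilon> \<bar>t\<bar>" and \<epsilon>: "(\<epsilon> \<longlongrightarrow> 0) at_top"
    and int: "integrable lborel (\<lambda>t. F (Complex a t))" "integrable lborel (\<lambda>t. F (Complex b t))"
  shows "(LINT t|lborel. F (Complex b t)) = (LINT t|lborel. F (Complex a t))"
proof -
  have "((\<lambda>T. (LINT t|lborel. indicator {-T..T} t *\<^sub>R F (Complex b t)) - (LINT t|lborel. indicator {-T..T} t *\<^sub>R F (Complex a t))) \<longlongrightarrow> (LINT t|lborel. F (Complex b t)) - (LINT t|lborel. F (Complex a t))) at_top"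
    by (intro tendsto_diff tendsto_integral_symmetric int)
  from tendsto_unique[OF _ this strip_shift[OF F ab strip bd \<epsilon>]] show ?thesis by simp
qed

lemma norm_Complex_power2: "norm (Complex c t) ^ 2 = c\<^sup>2 + t\<^sup>2"
  by (simp add: cmod_power2)

lemma abs_le_norm_Complex: "\<bar>t\<bar> \<le> norm (Complex c t)" "\<bar>c\<bar> \<le> norm (Complex c t)"
  using abs_Im_le_cmod[of "Complex c t"] abs_Re_le_cmod[of "Complex c t"] by simp_all

text \<open>Here \<open>n \<ge> 2\<close>, and the sign condition makes \<open>exp (z v)\<close> bounded by 1 on the half plane cut off by the line.\<close>

lemma integrable_exp_over_power:
  assumes c: "c \<noteq> 0" and n: "n \<ge> 2"
  shows "integrable lborel (\<lambda>t. exp (Complex c t * of_real v) / Complex c t ^ n)"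
    and "norm (exp (Complex c t * of_real v) / Complex c t ^ n) \<le> exp (c * v) / min 1 \<bar>c\<bar> ^ n * (1 / (1 + t\<^sup>2))"
proof -
  have cn: "Complex c t \<noteq> 0" for t using c by (simp add: complex_eq_iff)
  let ?\<mu> = "min 1 \<bar>c\<bar>"
  have mu: "?\<mu> > 0" "?\<mu> \<le> 1" using c by auto
  have lower: "?\<mu> ^ n * (1 + t\<^sup>2) \<le> norm (Complex c t) ^ n" for t
  proof -
    let ?r = "norm (Complex c t) / ?\<mu>"
    have "?\<mu>\<^sup>2 * (1 + t\<^sup>2) \<le> norm (Complex c t) ^ 2"
    proof -
      have "?\<mu>\<^sup>2 \<le> \<bar>c\<bar>\<^sup>2" by (rule power_mono) (use mu in auto)
      moreover have "?\<mu>\<^sup>2 \<le> 1" by (rule power_le_one) (use mu in auto)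
      ultimately have "?\<mu>\<^sup>2 * 1 \<le> c\<^sup>2" "?\<mu>\<^sup>2 * t\<^sup>2 \<le> 1 * t\<^sup>2" by (simp, intro mult_right_mono) auto
      then show ?thesis unfolding norm_Complex_power2 distrib_left by linarith
    qed
    then have r2: "1 + t\<^sup>2 \<le> ?r\<^sup>2" using mu by (simp add: power_divide field_simps)
    have r1: "?r \<ge> 1"
    proof (rule power2_le_imp_le)
      have "(1::real)\<^sup>2 \<le> 1 + t\<^sup>2" by simp
      with r2 show "1\<^sup>2 \<le> ?r\<^sup>2" by linarith
    qed (use mu in auto)
    have "?r\<^sup>2 \<le> ?r ^ n" using r1 n by (intro power_increasing)
    then have "1 + t\<^sup>2 \<le> ?r ^ n" using r2 by linarith
    then show ?thesis using mu by (simp add: power_divide field_simps)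
  qed
  have pos: "1 + t\<^sup>2 > 0" for t :: real by (intro add_pos_nonneg) auto
  show bd: "norm (exp (Complex c t * of_real v) / Complex c t ^ n) \<le> exp (c * v) / ?\<mu> ^ n * (1 / (1 + t\<^sup>2))" for t
  proof -
    have "norm (exp (Complex c t * of_real v) / Complex c t ^ n) = exp (c * v) / norm (Complex c t) ^ n"
      by (simp add: norm_divide norm_power norm_exp_eq_Re)
    also have "\<dots> \<le> exp (c * v) / (?\<mu> ^ n * (1 + t\<^sup>2))"
      using lower[of t] mu pos[of t] cn[of t] by (intro divide_left_mono mult_pos_pos zero_less_power) auto
    finally show ?thesis by simp
  qed
  show "integrable lborel (\<lambda>t. exp (Complex c t * of_real v) / Complex c t ^ n)"
  proof (rule Bochner_Integration.integrable_bound)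
    show "integrable lborel (\<lambda>t. exp (c * v) / ?\<mu> ^ n * (1 / (1 + t\<^sup>2)))"
      by (intro integrable_mult_right integrable_inverse_1_plus_square)
    show "AE t in lborel. norm (exp (Complex c t * of_real v) / Complex c t ^ n) \<le> norm (exp (c * v) / ?\<mu> ^ n * (1 / (1 + t\<^sup>2)))"
      using bd by (intro AE_I2 order_trans[OF bd]) simp
  qed measurable
qed

text \<open>Moving the line away from the pole, to the side where the exponential does not grow.\<close>

lemma integral_exp_over_power_eq_0:
  assumes c: "c \<noteq> 0" and n: "n \<ge> 2" and cv: "c * v \<le> 0"
  shows "(LINT t|lborel. exp (Complex c t * of_real v) / Complex c t ^ n) = 0"
proof -
  let ?F = "\<lambda>z. exp (z * of_real v) / z ^ n"
  define I where "I = (\<lambda>c. LINT t|lborel. ?F (Complex c t))"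
  have shift: "I b = I a" if ab: "a \<le> b" and S: "convex S" "open S" "0 \<notin> S" "\<And>\<sigma> t. a \<le> \<sigma> \<Longrightarrow> \<sigma> \<le> b \<Longrightarrow> Complex \<sigma> t \<in> S"
    and bv: "\<And>\<sigma>. a \<le> \<sigma> \<Longrightarrow> \<sigma> \<le> b \<Longrightarrow> \<sigma> * v \<le> 0" for a b S
    unfolding I_def
  proof (rule vertical_shift[of ?F S a b 1 "\<lambda>t. 1 / t ^ n"])
    show "?F holomorphic_on S" using S by (intro holomorphic_intros) auto
    fix \<sigma> t :: real assume s: "a \<le> \<sigma>" "\<sigma> \<le> b" and t: "1 \<le> \<bar>t\<bar>"
    have "norm (?F (Complex \<sigma> t)) = exp (\<sigma> * v) / norm (Complex \<sigma> t) ^ n"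
      by (simp add: norm_divide norm_power norm_exp_eq_Re)
    also have "\<dots> \<le> 1 / \<bar>t\<bar> ^ n"
      using bv[OF s] t abs_le_norm_Complex(1)[of t \<sigma>] by (intro frac_le power_mono) auto
    finally show "norm (?F (Complex \<sigma> t)) \<le> 1 / \<bar>t\<bar> ^ n" .
  next
    have "((\<lambda>t::real. inverse (t ^ n)) \<longlongrightarrow> 0) at_top"
      using n by (intro tendsto_inverse_0_at_top filterlim_pow_at_top filterlim_ident) auto
    then show "((\<lambda>t::real. 1 / t ^ n) \<longlongrightarrow> 0) at_top" by (simp add: divide_inverse)
  next
    have "a \<noteq> 0" "b \<noteq> 0" using S(3) S(4)[of a 0] S(4)[of b 0] ab by (auto simp: complex_eq_iff zero_complex.code)
    then show "integrable lborel (\<lambda>t. ?F (Complex a t))" "integrable lborel (\<lambda>t. ?F (Complex b t))"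
      using n by (auto intro: integrable_exp_over_power(1))
  qed (use ab S in auto)
  \<comment> \<open>The abscissae are multiples of \<open>c\<close>, so the line moves to infinity
    on its own side of the pole, where \<open>c * v \<le> 0\<close> keeps the exponential at most
    1.\<close>
  have const: "I (c * (1 + real k)) = I c" for k
  proof (cases "c > 0")
    case True
    have "c * 1 \<le> c * (1 + real k)" using True by (intro mult_left_mono) auto
    moreover have "v \<le> 0" using cv True by (auto simp: mult_le_0_iff)
    ultimately show ?thesis using True
      by (intro shift[of _ _ "{z. Re z > 0}"]) (auto simp: convex_halfspace_Re_gt open_halfspace_Re_gt mult_le_0_iff)
  next
    case False
    then have c: "c < 0" using c by simp
    have "c * (1 + real k) \<le> c * 1" using c by (intro mult_left_mono_neg) auto
    moreover have "v \<ge> 0" using cv c by (auto simp: mult_le_0_iff)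
    ultimately have "I c = I (c * (1 + real k))" using c
      by (intro shift[of _ _ "{z. Re z < 0}"]) (auto simp: convex_halfspace_Re_lt open_halfspace_Re_lt mult_le_0_iff)
    then show ?thesis by simp
  qed
  have "(\<lambda>k. I (c * (1 + real k))) \<longlonglongrightarrow> (LINT t|(lborel :: real measure). (0::complex))"
    unfolding I_def
  proof (rule integral_dominated_convergence[where w = "\<lambda>t. 1 / min 1 \<bar>c\<bar> ^ n * (1 / (1 + t\<^sup>2))"])
    show "integrable lborel (\<lambda>t::real. 1 / min 1 \<bar>c\<bar> ^ n * (1 / (1 + t\<^sup>2)))"
      by (intro integrable_mult_right integrable_inverse_1_plus_square)
    have ck: "c * (1 + real k) \<noteq> 0" for k using c by simp
    show "AE t in lborel. norm (?F (Complex (c * (1 + real k)) t)) \<le> 1 / min 1 \<bar>c\<bar> ^ n * (1 / (1 + t\<^sup>2))" for k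
    proof (rule AE_I2)
      fix t :: real
      have "\<bar>c\<bar> * 1 \<le> \<bar>c\<bar> * (1 + real k)" by (intro mult_left_mono) auto
      then have m: "min 1 \<bar>c\<bar> \<le> min 1 \<bar>c * (1 + real k)\<bar>" by (simp add: abs_mult)
      have e: "exp (c * (1 + real k) * v) \<le> 1"
      proof -
        have "(c * v) * (1 + real k) \<le> 0" by (rule mult_nonpos_nonneg[OF cv]) simp
        then show ?thesis by (simp add: mult_ac)
      qed
      have "norm (?F (Complex (c * (1 + real k)) t)) \<le> exp (c * (1 + real k) * v) / min 1 \<bar>c * (1 + real k)\<bar> ^ n * (1 / (1 + t\<^sup>2))"
        by (rule integrable_exp_over_power(2)[OF ck n])
      also have "\<dots> \<le> 1 / min 1 \<bar>c\<bar> ^ n * (1 / (1 + t\<^sup>2))"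
        using e m c by (intro mult_right_mono frac_le power_mono) auto
      finally show "norm (?F (Complex (c * (1 + real k)) t)) \<le> 1 / min 1 \<bar>c\<bar> ^ n * (1 / (1 + t\<^sup>2))" .
    qed
    show "AE t in lborel. (\<lambda>k. ?F (Complex (c * (1 + real k)) t)) \<longlonglongrightarrow> 0"
    proof (rule AE_I2, rule Lim_null_comparison)
      fix t :: real
      show "\<forall>\<^sub>F k in sequentially. norm (?F (Complex (c * (1 + real k)) t)) \<le> inverse ((\<bar>c\<bar> * (1 + real k)) ^ n)"
      proof (intro always_eventually allI)
        fix k
        have "(c * v) * (1 + real k) \<le> 0" by (rule mult_nonpos_nonneg[OF cv]) simp
        then have e: "exp (c * (1 + real k) * v) \<le> 1" by (simp add: mult_ac)
        have l: "\<bar>c\<bar> * (1 + real k) \<le> norm (Complex (c * (1 + real k)) t)"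
          using abs_le_norm_Complex(2)[of "c * (1 + real k)" t] by (simp add: abs_mult)
        have "norm (?F (Complex (c * (1 + real k)) t)) = exp (c * (1 + real k) * v) / norm (Complex (c * (1 + real k)) t) ^ n"
          by (simp add: norm_divide norm_power norm_exp_eq_Re)
        also have "\<dots> \<le> 1 / (\<bar>c\<bar> * (1 + real k)) ^ n"
          using e l c by (intro frac_le power_mono zero_less_power mult_pos_pos) auto
        finally show "norm (?F (Complex (c * (1 + real k)) t)) \<le> inverse ((\<bar>c\<bar> * (1 + real k)) ^ n)"
          by (simp add: divide_inverse)
      qed
      have "filterlim (\<lambda>k. \<bar>c\<bar> * (1 + real k)) at_top sequentially"
        using c by (intro filterlim_tendsto_pos_mult_at_top[OF tendsto_const] filterlim_tendsto_add_at_top[OF tendsto_const] filterlim_real_sequentially) auto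
      then show "(\<lambda>k. inverse ((\<bar>c\<bar> * (1 + real k)) ^ n)) \<longlonglongrightarrow> 0"
        using n by (intro tendsto_inverse_0_at_top filterlim_pow_at_top) auto
    qed
  qed measurable
  then have "I c = 0" unfolding const by (simp add: LIMSEQ_const_iff)
  then show ?thesis by (simp add: I_def)
qed

text \<open>Takes the place of a residue: as \<open>T\<close> grows the two values tend to
  \<open>pi\<close> and \<open>- pi\<close>, and their difference is the contribution of a simple
  pole at 0.\<close>

lemma integral_inverse_vertical:
  assumes c: "c > 0" and T: "T \<ge> 0"
  shows "(LINT t|lborel. indicator {-T..T} t *\<^sub>R (1 / Complex c t)) = of_real (2 * arctan (T / c))"
    and "(LINT t|lborel. indicator {-T..T} t *\<^sub>R (1 / Complex (-c) t)) = - of_real (2 * arctan (T / c))"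
proof -
  have "(LINT t|lborel. indicator {-T..T} t *\<^sub>R (1 / Complex c t)) = (Ln (Complex c T) - Ln (Complex c (-T))) / \<i>"
  proof (intro has_bochner_integral_integral_eq has_bochner_integral_vertical[of "{z. Re z > 0}"])
    fix z :: complex assume "z \<in> {z. Re z > 0}"
    then have "z \<notin> \<real>\<^sub>\<le>\<^sub>0" by (auto elim!: nonpos_Reals_cases)
    from has_field_derivative_Ln[OF this] show "(Ln has_field_derivative 1 / z) (at z)" by (simp add: divide_inverse)
  qed (use c T in \<open>auto intro!: continuous_intros\<close>)
  also have "Complex c (-T) = cnj (Complex c T)" by (simp add: complex_eq_iff)
  also have "Ln (cnj (Complex c T)) = cnj (Ln (Complex c T))"
    by (rule cnj_Ln[symmetric]) (use c in \<open>auto elim!: nonpos_Reals_cases simp: complex_eq_iff\<close>)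
  also have "(Ln (Complex c T) - cnj (Ln (Complex c T))) / \<i> = of_real (2 * Im (Ln (Complex c T)))"
    by (simp add: complex_eq_iff complex_diff_cnj)
  also have "Im (Ln (Complex c T)) = arctan (T / c)"
    using c Im_Ln_eq[of "Complex c T"] by (simp add: complex_eq_iff)
  finally show *: "(LINT t|lborel. indicator {-T..T} t *\<^sub>R (1 / Complex c t)) = of_real (2 * arctan (T / c))" .
  have "(LINT t|lborel. indicator {-T..T} t *\<^sub>R (1 / Complex (-c) t)) = (LINT t|lborel. indicator {-T..T} (0 + (-1) * t) *\<^sub>R (1 / Complex (-c) (0 + (-1) * t)))"
    by (subst lborel_integral_real_affine[of "-1" _ 0]) simp_all
  also have "(\<lambda>t. indicator {-T..T} (0 + (-1) * t) *\<^sub>R (1 / Complex (-c) (0 + (-1) * t))) = (\<lambda>t. - (indicator {-T..T} t *\<^sub>R (1 / Complex c t)))"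
  proof
    fix t
    have "Complex (-c) (0 + (-1) * t) = - Complex c t" by (simp add: complex_eq_iff)
    moreover have "indicat_real {-T..T} (0 + (-1) * t) = indicat_real {-T..T} t" by (auto simp: indicator_def)
    ultimately show "indicator {-T..T} (0 + (-1) * t) *\<^sub>R (1 / Complex (-c) (0 + (-1) * t)) = - (indicator {-T..T} t *\<^sub>R (1 / Complex c t))"
      by simp
  qed
  also have "(LINT t|lborel. - (indicator {-T..T} t *\<^sub>R (1 / Complex c t))) = - of_real (2 * arctan (T / c))"
    unfolding *[symmetric] by simp
  finally show "(LINT t|lborel. indicator {-T..T} t *\<^sub>R (1 / Complex (-c) t)) = - of_real (2 * arctan (T / c))" .
qed

text \<open>For \<open>v > 0\<close> the exponential grows to the right, so the line must cross the
  pole. Subtracting \<open>1 / z ^ 2\<close> and \<open>v / z\<close> leaves an entire function, for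
  which the lines at \<open>c\<close> and \<open>-c\<close> can be exchanged. The integrals over
  \<open>1 / z ^ 2\<close> and over the kernel on the left line vanish, and only the jump of the
  principal value of \<open>v / z\<close> survives.\<close>

theorem perron_kernel_1:
  assumes c: "c > 0"
  shows "(LINT t|lborel. exp (Complex c t * of_real v) / Complex c t ^ 2) = of_real (2 * pi * max v 0)"
proof (cases "v > 0")
  case False
  then have "c * v \<le> 0" using c by (simp add: mult_le_0_iff)
  then show ?thesis using False integral_exp_over_power_eq_0[of c 2 v] c by simp
next
  case True
  \<comment> \<open>The remainder is \<open>(exp (z * v) - 1 - z * v) / z ^ 2\<close>; dividing out
    the root at 0 twice makes it entire by construction.\<close>
  have fhol: "(\<lambda>z. exp (z * of_real v) - 1) holomorphic_on UNIV" by (intro holomorphic_intros)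
  have fderiv: "deriv (\<lambda>z. exp (z * of_real v) - 1) 0 = of_real v"
    by (rule DERIV_imp_deriv) (auto intro!: derivative_eq_intros)
  obtain g where g: "g holomorphic_on UNIV" "\<forall>z\<in>UNIV. exp (z * of_real v) - 1 = (z - 0) * g z" "g 0 = of_real v"
    using holomorphic_factor_root[OF fhol open_UNIV UNIV_I[of 0]] unfolding fderiv by auto
  have ghol: "(\<lambda>z. g z - of_real v) holomorphic_on UNIV" by (intro holomorphic_intros g)
  obtain E where E: "E holomorphic_on UNIV" "\<forall>z\<in>UNIV. g z - of_real v = (z - 0) * E z"
    using holomorphic_factor_root[OF ghol open_UNIV UNIV_I[of 0]] g(3) by auto
  have Eeq: "E z = exp (z * of_real v) / z ^ 2 - exp (z * of_real 0) / z ^ 2 - of_real v * (1 / z)" if "z \<noteq> 0" for z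
  proof -
    have "exp (z * of_real v) = 1 + z * (of_real v + z * E z)" using g(2) E(2) by (simp add: algebra_simps)
    then show ?thesis using that by (simp add: field_simps power2_eq_square)
  qed
  have lim: "((\<lambda>T. (LINT t|lborel. indicator {-T..T} t *\<^sub>R E (Complex c t)) - (LINT t|lborel. indicator {-T..T} t *\<^sub>R E (Complex (-c) t))) \<longlongrightarrow> 0) at_top"
  proof (rule strip_shift[of E UNIV _ _ 1 "\<lambda>t. (exp (c * v) + 1) / t ^ 2 + v / t"])
    show "((\<lambda>t::real. (exp (c * v) + 1) / t ^ 2 + v / t) \<longlongrightarrow> 0) at_top" by real_asymp
    fix \<sigma> t :: real assume s: "- c \<le> \<sigma>" "\<sigma> \<le> c" and t: "1 \<le> \<bar>t\<bar>"
    let ?z = "Complex \<sigma> t"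
    have z: "?z \<noteq> 0" "\<bar>t\<bar> \<le> norm ?z" using t abs_le_norm_Complex(1)[of t \<sigma>] by auto
    have "norm (E ?z) \<le> norm (exp (?z * of_real v) / ?z ^ 2 - exp (?z * of_real 0) / ?z ^ 2) + norm (of_real v * (1 / ?z))"
      unfolding Eeq[OF z(1)] by (rule norm_triangle_ineq4)
    also have "norm (exp (?z * of_real v) / ?z ^ 2 - exp (?z * of_real 0) / ?z ^ 2) = norm (exp (?z * of_real v) - 1) / norm ?z ^ 2"
      by (simp add: diff_divide_distrib[symmetric] norm_divide norm_power)
    also have "\<dots> \<le> (exp (c * v) + 1) / \<bar>t\<bar> ^ 2"
    proof (intro frac_le power_mono zero_less_power)
      have "norm (exp (?z * of_real v) - 1) \<le> norm (exp (?z * of_real v)) + norm (1::complex)" by (rule norm_triangle_ineq4)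
      also have "norm (exp (?z * of_real v)) = exp (\<sigma> * v)" by (simp add: norm_exp_eq_Re)
      also have "exp (\<sigma> * v) \<le> exp (c * v)" using s True by (simp add: mult_right_mono)
      finally show "norm (exp (?z * of_real v) - 1) \<le> exp (c * v) + 1" by simp
    qed (use t z in \<open>auto intro!: add_nonneg_nonneg\<close>)
    also have "norm (of_real v * (1 / ?z)) = v / norm ?z" using True by (simp add: norm_mult norm_divide)
    also have "v / norm ?z \<le> v / \<bar>t\<bar>" using True t z by (intro divide_left_mono mult_pos_pos) auto
    finally show "norm (E ?z) \<le> (exp (c * v) + 1) / \<bar>t\<bar> ^ 2 + v / \<bar>t\<bar>" by simp
  qed (use E c in auto)
  let ?A = "\<lambda>a v T. LINT t|lborel. indicator {-T..T} t *\<^sub>R (exp (Complex a t * of_real v) / Complex a t ^ 2)"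
  have split: "(LINT t|lborel. indicator {-T..T} t *\<^sub>R E (Complex a t)) = ?A a v T - ?A a 0 T - of_real v * (LINT t|lborel. indicator {-T..T} t *\<^sub>R (1 / Complex a t))"
    if a: "a \<noteq> 0" and T: "T \<ge> 0" for a T
  proof -
    have an: "Complex a t \<noteq> 0" for t using a by (simp add: complex_eq_iff)
    have i1: "integrable lborel (\<lambda>t. indicator {-T..T} t *\<^sub>R (exp (Complex a t * of_real v) / Complex a t ^ 2))" for v
      by (intro integrable_mult_indicator integrable_exp_over_power(1) a) auto
    have i2: "integrable lborel (\<lambda>t. indicator {-T..T} t *\<^sub>R (1 / Complex a t))"
    proof -
      have "continuous_on {-T..T} (\<lambda>t. 1 / Complex a t)" using an by (intro continuous_intros vertical_continuous) auto
      then show ?thesis using borel_integrable_atLeastAtMost'[of "-T" T] by (simp add: set_integrable_def)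
    qed
    have "(LINT t|lborel. indicator {-T..T} t *\<^sub>R E (Complex a t)) = (LINT t|lborel. indicator {-T..T} t *\<^sub>R (exp (Complex a t * of_real v) / Complex a t ^ 2) - indicator {-T..T} t *\<^sub>R (exp (Complex a t * of_real 0) / Complex a t ^ 2) - of_real v * (indicator {-T..T} t *\<^sub>R (1 / Complex a t)))"
      by (intro Bochner_Integration.integral_cong refl) (simp add: Eeq[OF an] scaleR_diff_right)
    also have "\<dots> = (LINT t|lborel. indicator {-T..T} t *\<^sub>R (exp (Complex a t * of_real v) / Complex a t ^ 2) - indicator {-T..T} t *\<^sub>R (exp (Complex a t * of_real 0) / Complex a t ^ 2)) - (LINT t|lborel. of_real v * (indicator {-T..T} t *\<^sub>R (1 / Complex a t)))"
      by (intro Bochner_Integration.integral_diff Bochner_Integration.integrable_diff i1 integrable_mult_right i2)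
    also have "(LINT t|lborel. indicator {-T..T} t *\<^sub>R (exp (Complex a t * of_real v) / Complex a t ^ 2) - indicator {-T..T} t *\<^sub>R (exp (Complex a t * of_real 0) / Complex a t ^ 2)) = ?A a v T - ?A a 0 T"
      by (intro Bochner_Integration.integral_diff i1)
    also have "(LINT t|lborel. of_real v * (indicator {-T..T} t *\<^sub>R (1 / Complex a t))) = of_real v * (LINT t|lborel. indicator {-T..T} t *\<^sub>R (1 / Complex a t))"
      by (rule integral_mult_right_zero)
    finally show ?thesis .
  qed
  have Alim: "(?A a u \<longlongrightarrow> (LINT t|lborel. exp (Complex a t * of_real u) / Complex a t ^ 2)) at_top" if "a \<noteq> 0" for a u
    by (intro tendsto_integral_symmetric integrable_exp_over_power(1) that) auto
  have z0: "(LINT t|lborel. exp (Complex a t * of_real u) / Complex a t ^ 2) = 0" if "a \<noteq> 0" "a * u \<le> 0" for a u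
    using integral_exp_over_power_eq_0[of a 2 u] that by simp
  have arct: "((\<lambda>T. complex_of_real (2 * arctan (T / c))) \<longlongrightarrow> of_real (2 * (pi/2))) at_top"
  proof (intro tendsto_intros filterlim_compose[OF tendsto_arctan_at_top])
    show "filterlim (\<lambda>T. T / c) at_top at_top" using c by real_asymp
  qed
  let ?I = "LINT t|lborel. exp (Complex c t * of_real v) / Complex c t ^ 2"
  have "((\<lambda>T. (?A c v T - ?A c 0 T - of_real v * of_real (2 * arctan (T / c))) - (?A (-c) v T - ?A (-c) 0 T - of_real v * (- of_real (2 * arctan (T / c)))))
     \<longlongrightarrow> (?I - 0 - of_real v * of_real (2 * (pi/2))) - (0 - 0 - of_real v * (- of_real (2 * (pi/2))))) at_top"
    using Alim[of c v] Alim[of c 0] Alim[of "-c" v] Alim[of "-c" 0] z0[of c 0] z0[of "-c" v] z0[of "-c" 0] c True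
    by (intro tendsto_diff tendsto_mult tendsto_const tendsto_minus arct) (auto simp: mult_nonneg_nonneg)
  moreover have "\<forall>\<^sub>F T in at_top. (LINT t|lborel. indicator {-T..T} t *\<^sub>R E (Complex c t)) - (LINT t|lborel. indicator {-T..T} t *\<^sub>R E (Complex (-c) t))
    = (?A c v T - ?A c 0 T - of_real v * of_real (2 * arctan (T / c))) - (?A (-c) v T - ?A (-c) 0 T - of_real v * (- of_real (2 * arctan (T / c))))"
    using eventually_ge_at_top[of 0]
  proof eventually_elim
    case (elim T)
    have cn: "c \<noteq> 0" "- c \<noteq> 0" using c by auto
    show ?case unfolding split[OF cn(1) elim] split[OF cn(2) elim] integral_inverse_vertical[OF c elim] ..
  qed
  ultimately have "((\<lambda>T. (LINT t|lborel. indicator {-T..T} t *\<^sub>R E (Complex c t)) - (LINT t|lborel. indicator {-T..T} t *\<^sub>R E (Complex (-c) t)))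
     \<longlongrightarrow> (?I - 0 - of_real v * of_real (2 * (pi/2))) - (0 - 0 - of_real v * (- of_real (2 * (pi/2))))) at_top"
    by (simp only: filterlim_cong[OF refl refl])
  from tendsto_unique[OF _ this lim] have "?I = of_real v * of_real (2 * (pi/2)) + of_real v * of_real (2 * (pi/2))"
    by (simp add: algebra_simps)
  then show ?thesis using True by simp
qed

text \<open>Integrates \<open>perron_kernel_1\<close> over \<open>[0, v]\<close>. This kernel
  evaluates the term \<open>m / z\<close> that is added to the logarithmic derivative.\<close>

theorem perron_kernel_2:
  assumes c: "c > 0" and v: "v \<ge> 0"
  shows "(LINT t|lborel. exp (Complex c t * of_real v) / Complex c t ^ 3) = of_real (pi * v\<^sup>2)"
proof -
  have cn: "Complex c t \<noteq> 0" for t using c by (simp add: complex_eq_iff)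
  let ?f = "\<lambda>u t. indicator {0..v} u *\<^sub>R (exp (Complex c t * of_real u) / Complex c t ^ 2)"
  have [measurable]: "(\<lambda>(u, t). ?f u t) \<in> borel_measurable (lborel \<Otimes>\<^sub>M lborel)" by measurable
  let ?Z = "LINT t|lborel. norm (1 / Complex c t ^ 2)"
  have int: "integrable (lborel \<Otimes>\<^sub>M lborel) (\<lambda>(u, t). ?f u t)"
  proof (rule lborel_pair.Fubini_integrable)
    have "(LINT t|lborel. norm (?f u t)) = (exp (c * u) * ?Z) * indicator {0..v} u" for u
    proof -
      have "(\<lambda>t. norm (?f u t)) = (\<lambda>t. (exp (c * u) * indicator {0..v} u) * norm (1 / Complex c t ^ 2))"
        by (rule ext) (auto simp: indicator_def norm_divide norm_power norm_exp_eq_Re)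
      then have "(LINT t|lborel. norm (?f u t)) = (LINT t|lborel. (exp (c * u) * indicator {0..v} u) * norm (1 / Complex c t ^ 2))"
        by (rule arg_cong)
      also have "\<dots> = (exp (c * u) * indicator {0..v} u) * ?Z" by (rule integral_mult_right_zero)
      finally show ?thesis by (simp only: mult_ac)
    qed
    then have "(\<lambda>u. LINT t|lborel. norm (case (u, t) of (u, t) \<Rightarrow> ?f u t)) = (\<lambda>u. (exp (c * u) * ?Z) * indicator {0..v} u)"
      by (simp only: prod.case)
    moreover have "integrable lborel (\<lambda>u. (exp (c * u) * ?Z) * indicator {0..v} u)"
      by (rule borel_integrable_atLeastAtMost) (intro continuous_intros)
    ultimately show "integrable lborel (\<lambda>u. LINT t|lborel. norm (case (u, t) of (u, t) \<Rightarrow> ?f u t))"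
      by (simp only:)
    show "AE u in lborel. integrable lborel (\<lambda>t. case (u, t) of (u, t) \<Rightarrow> ?f u t)"
      using c by (intro AE_I2) (auto intro!: integrable_exp_over_power(1))
  qed measurable
  have "(LINT t|lborel. LINT u|lborel. ?f u t) = (LINT u|lborel. LINT t|lborel. ?f u t)"
    by (rule lborel_pair.Fubini_integral[OF int])
  also have "(LINT u|lborel. LINT t|lborel. ?f u t) = (LINT u|lborel. indicator {0..v} u *\<^sub>R complex_of_real (2 * pi * u))"
    using c by (intro Bochner_Integration.integral_cong refl) (simp add: perron_kernel_1 indicator_def)
  also have "\<dots> = of_real (pi * v\<^sup>2) - of_real (pi * 0\<^sup>2)"
  proof (rule integral_FTC_Icc)
    fix x show "((\<lambda>u. complex_of_real (pi * u\<^sup>2)) has_vector_derivative complex_of_real (2 * pi * x)) (at x within {0..v})"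
      by (rule has_vector_derivative_of_real) (auto intro!: derivative_eq_intros)
  qed (use v in \<open>auto intro!: continuous_intros\<close>)
  also have "(LINT t|lborel. LINT u|lborel. ?f u t) = (LINT t|lborel. exp (Complex c t * of_real v) / Complex c t ^ 3 - exp (Complex c t * of_real 0) / Complex c t ^ 3)"
  proof (intro Bochner_Integration.integral_cong refl)
    fix t
    have "(LINT u|lborel. ?f u t) = exp (Complex c t * of_real v) / Complex c t ^ 3 - exp (Complex c t * of_real 0) / Complex c t ^ 3"
    proof (rule integral_FTC_Icc)
      fix u
      have "((\<lambda>w. exp (Complex c t * w) / Complex c t ^ 3) has_field_derivative (exp (Complex c t * of_real u) / Complex c t ^ 2)) (at (of_real u))"
        using cn[of t] by (auto intro!: derivative_eq_intros simp: power3_eq_cube power2_eq_square)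
      then show "((\<lambda>u. exp (Complex c t * of_real u) / Complex c t ^ 3) has_vector_derivative (exp (Complex c t * of_real u) / Complex c t ^ 2)) (at u within {0..v})"
        by (rule has_vector_derivative_real_field[THEN has_vector_derivative_at_within])
    qed (use v cn in \<open>auto intro!: continuous_intros\<close>)
    then show "(LINT u|lborel. ?f u t) = exp (Complex c t * of_real v) / Complex c t ^ 3 - exp (Complex c t * of_real 0) / Complex c t ^ 3" .
  qed
  also have "\<dots> = (LINT t|lborel. exp (Complex c t * of_real v) / Complex c t ^ 3) - (LINT t|lborel. exp (Complex c t * of_real 0) / Complex c t ^ 3)"
    using c by (intro Bochner_Integration.integral_diff integrable_exp_over_power(1)) auto
  also have "(LINT t|lborel. exp (Complex c t * of_real 0) / Complex c t ^ 3) = 0"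
    using c by (intro integral_exp_over_power_eq_0) auto
  finally show ?thesis by simp
qed

section \<open>Local mean squares\<close>

text \<open>Smears \<open>\<phi> t\<close> over the unit interval around \<open>t\<close>, on which
  it varies at most by the factor \<open>c\<close>, and exchanges the integrations. Then only the
  mass of \<open>\<beta>\<close> on unit intervals matters, not its size.\<close>

lemma block_integral:
  fixes \<beta> \<phi> :: "real \<Rightarrow> ennreal"
  assumes [measurable]: "\<beta> \<in> borel_measurable borel" "\<phi> \<in> borel_measurable borel"
    and K: "\<And>T. (\<integral>\<^sup>+t. \<beta> t * indicator {T - 1/2..T + 1/2} t \<partial>lborel) \<le> K"
    and \<phi>: "\<And>t T. \<bar>t - T\<bar> \<le> 1/2 \<Longrightarrow> \<phi> t \<le> c * \<phi> T"
  shows "(\<integral>\<^sup>+t. \<beta> t * \<phi> t \<partial>lborel) \<le> c * K * (\<integral>\<^sup>+t. \<phi> t \<partial>lborel)"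
proof -
  have ind: "indicator {t - 1/2..t + 1/2} T = (indicator {T - 1/2..T + 1/2} t :: ennreal)" for t T :: real
    by (auto simp: indicator_def)
  have "(\<integral>\<^sup>+t. \<beta> t * \<phi> t \<partial>lborel) = (\<integral>\<^sup>+t. \<integral>\<^sup>+T. \<beta> t * \<phi> t * indicator {t - 1/2..t + 1/2} T \<partial>lborel \<partial>lborel)"
  proof (intro nn_integral_cong)
    fix t :: real
    have "(\<integral>\<^sup>+T. \<beta> t * \<phi> t * indicator {t - 1/2..t + 1/2} T \<partial>lborel) = \<beta> t * \<phi> t * emeasure lborel {t - 1/2..t + 1/2}"
      by (rule nn_integral_cmult_indicator) auto
    then show "\<beta> t * \<phi> t = (\<integral>\<^sup>+T. \<beta> t * \<phi> t * indicator {t - 1/2..t + 1/2} T \<partial>lborel)" by simp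
  qed
  also have "\<dots> \<le> (\<integral>\<^sup>+t. \<integral>\<^sup>+T. c * \<phi> T * (\<beta> t * indicator {T - 1/2..T + 1/2} t) \<partial>lborel \<partial>lborel)"
  proof (intro nn_integral_mono)
    fix t T :: real
    show "\<beta> t * \<phi> t * indicator {t - 1/2..t + 1/2} T \<le> c * \<phi> T * (\<beta> t * indicator {T - 1/2..T + 1/2} t)"
    proof (cases "\<bar>t - T\<bar> \<le> 1/2")
      case True
      then have "\<beta> t * \<phi> t \<le> \<beta> t * (c * \<phi> T)" by (intro mult_left_mono \<phi>) auto
      then show ?thesis unfolding ind[of t T] by (auto simp: indicator_def mult_ac)
    next
      case False
      then have "t \<notin> {T - 1/2..T + 1/2}" by (auto simp: abs_if split: if_splits)
      then show ?thesis unfolding ind[of t T] by simp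
    qed
  qed
  also have "\<dots> = (\<integral>\<^sup>+T. \<integral>\<^sup>+t. c * \<phi> T * (\<beta> t * indicator {T - 1/2..T + 1/2} t) \<partial>lborel \<partial>lborel)"
  proof (rule lborel_pair.Fubini')
    have "(\<lambda>x. indicator {x. fst x - 1/2 \<le> snd x \<and> snd x \<le> fst x + 1/2} x :: ennreal) \<in> borel_measurable (lborel \<Otimes>\<^sub>M (lborel :: real measure))"
      by measurable
    then have [measurable]: "(\<lambda>x::real \<times> real. indicator {fst x - 1/2..fst x + 1/2} (snd x) :: ennreal) \<in> borel_measurable (lborel \<Otimes>\<^sub>M lborel)"
      by (rule measurable_cong[THEN iffD1, rotated]) (auto simp: indicator_def)
    show "(\<lambda>(T, t). c * \<phi> T * (\<beta> t * indicator {T - 1/2..T + 1/2} t)) \<in> borel_measurable (lborel \<Otimes>\<^sub>M lborel)"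
      unfolding case_prod_unfold by measurable
  qed
  also have "\<dots> = (\<integral>\<^sup>+T. c * \<phi> T * (\<integral>\<^sup>+t. \<beta> t * indicator {T - 1/2..T + 1/2} t \<partial>lborel) \<partial>lborel)"
    by (intro nn_integral_cong nn_integral_cmult) auto
  also have "\<dots> \<le> (\<integral>\<^sup>+T. c * K * \<phi> T \<partial>lborel)"
  proof (intro nn_integral_mono)
    fix T
    have "c * \<phi> T * (\<integral>\<^sup>+t. \<beta> t * indicator {T - 1/2..T + 1/2} t \<partial>lborel) \<le> c * \<phi> T * K"
      by (intro mult_left_mono K) auto
    then show "c * \<phi> T * (\<integral>\<^sup>+t. \<beta> t * indicator {T - 1/2..T + 1/2} t \<partial>lborel) \<le> c * K * \<phi> T" by (simp only: mult_ac)
  qed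
  also have "\<dots> = c * K * (\<integral>\<^sup>+t. \<phi> t \<partial>lborel)" by (rule nn_integral_cmult) auto
  finally show ?thesis .
qed

lemma gaussian_le: "exp (- x\<^sup>2 / 2) \<le> 2 / (1 + (x::real)\<^sup>2)"
proof -
  have "1 + x\<^sup>2 / 2 \<le> exp (x\<^sup>2 / 2)" by (rule exp_ge_add_one_self)
  then have "1 + x\<^sup>2 \<le> 2 * exp (x\<^sup>2 / 2)" by linarith
  then have "(1 + x\<^sup>2) * exp (- (x\<^sup>2 / 2)) \<le> 2 * exp (x\<^sup>2 / 2) * exp (- (x\<^sup>2 / 2))" by (intro mult_right_mono) auto
  also have "\<dots> = 2" by (simp add: mult.assoc exp_add[symmetric])
  finally have "(1 + x\<^sup>2) * exp (- (x\<^sup>2 / 2)) \<le> 2" .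
  moreover have "1 + x\<^sup>2 > 0" by (intro add_pos_nonneg) auto
  ultimately show ?thesis by (simp add: field_simps)
qed

lemma slowly_varying_square:
  fixes t T u :: real
  assumes "\<bar>t - T\<bar> \<le> 1/2"
  shows "1 / (1 + (t - u)\<^sup>2) \<le> 2 * (1 / (1 + (T - u)\<^sup>2))"
proof -
  have "(T - t)\<^sup>2 \<le> (1/2)\<^sup>2" using assms by (subst power2_abs[symmetric], intro power_mono) (auto simp: abs_minus_commute)
  moreover have "(T - u)\<^sup>2 \<le> 2 * (t - u)\<^sup>2 + 2 * (T - t)\<^sup>2"
  proof -
    have "2 * (t - u)\<^sup>2 + 2 * (T - t)\<^sup>2 - (T - u)\<^sup>2 = ((t - u) - (T - t))\<^sup>2" by (simp add: power2_eq_square algebra_simps)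
    then show ?thesis using zero_le_power2[of "(t - u) - (T - t)"] by linarith
  qed
  ultimately have le: "1 + (T - u)\<^sup>2 \<le> 2 * (1 + (t - u)\<^sup>2)" by (simp add: power2_eq_square)
  have "1 + (T - u)\<^sup>2 > 0" "1 + (t - u)\<^sup>2 > 0" by (auto intro!: add_pos_nonneg)
  then show ?thesis using le by (simp add: field_simps)
qed

lemma slowly_varying_powr:
  fixes t T a :: real
  assumes "\<bar>t - T\<bar> \<le> 1/2" and a: "0 \<le> a" "a \<le> 2"
  shows "(1 + \<bar>t\<bar>) powr a \<le> 3 * (1 + \<bar>T\<bar>) powr a" "(1 + \<bar>t\<bar>) powr (-a) \<le> 3 * (1 + \<bar>T\<bar>) powr (-a)"
proof -
  have *: "(1 + \<bar>x\<bar>) powr a \<le> 3 * (1 + \<bar>y\<bar>) powr a" if "\<bar>x - y\<bar> \<le> 1/2" for x y :: real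
  proof -
    have "1 + \<bar>x\<bar> \<le> 3/2 * (1 + \<bar>y\<bar>)" using that unfolding distrib_left by linarith
    then have "(1 + \<bar>x\<bar>) powr a \<le> (3/2 * (1 + \<bar>y\<bar>)) powr a" using a by (intro powr_mono2) auto
    also have "\<dots> = (3/2) powr a * (1 + \<bar>y\<bar>) powr a" by (rule powr_mult)
    also have "(3/2 :: real) powr a \<le> (3/2) powr 2" using a by (intro powr_mono) auto
    then have "(3/2) powr a * (1 + \<bar>y\<bar>) powr a \<le> 3 * (1 + \<bar>y\<bar>) powr a" by (intro mult_right_mono) (auto simp: power2_eq_square)
    finally show ?thesis .
  qed
  show "(1 + \<bar>t\<bar>) powr a \<le> 3 * (1 + \<bar>T\<bar>) powr a" using *[OF assms(1)] .
  have "(1 + \<bar>T\<bar>) powr a \<le> 3 * (1 + \<bar>t\<bar>) powr a" using *[of T t] assms(1) by (simp add: abs_minus_commute)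
  then show "(1 + \<bar>t\<bar>) powr (-a) \<le> 3 * (1 + \<bar>T\<bar>) powr (-a)"
    by (simp add: powr_minus field_simps)
qed

lemma nn_integral_powr_finite:
  "(\<integral>\<^sup>+t. ennreal ((1 + \<bar>t\<bar>) powr (-3/2)) \<partial>lborel) \<le> ennreal 4"
proof -
  let ?f = "\<lambda>t::real. (1 + \<bar>t\<bar>) powr (-3/2)"
  have half: "(\<integral>\<^sup>+t. ennreal (?f t) * indicator {0..} t \<partial>lborel) = ennreal (0 - (-2 * (1 + 0) powr (-1/2)))"
  proof -
    have "(\<integral>\<^sup>+t. ennreal (?f t) * indicator {0..} t \<partial>lborel) = (\<integral>\<^sup>+t. ennreal ((1 + t) powr (-3/2)) * indicator {0..} t \<partial>lborel)"
      by (intro nn_integral_cong) (auto simp: indicator_def)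
    also have "\<dots> = ennreal (0 - (-2 * (1 + 0) powr (-1/2)))"
    proof (rule nn_integral_FTC_atLeast)
      fix x :: real assume "0 \<le> x"
      then show "((\<lambda>x. -2 * (1 + x) powr (-1/2)) has_real_derivative (1 + x) powr (-3/2)) (at x)"
        by (auto intro!: derivative_eq_intros)
    next
      have "((\<lambda>x::real. (1 + x) powr (-1/2)) \<longlongrightarrow> 0) at_top"
        by (intro tendsto_neg_powr filterlim_tendsto_add_at_top[OF tendsto_const] filterlim_ident) auto
      then show "((\<lambda>x::real. -2 * (1 + x) powr (-1/2)) \<longlongrightarrow> 0) at_top" by (rule tendsto_mult_right_zero)
    qed auto
    finally show ?thesis .
  qed
  have "(\<integral>\<^sup>+t. ennreal (?f t) \<partial>lborel) \<le> (\<integral>\<^sup>+t. ennreal (?f t) * indicator {0..} t + ennreal (?f (0 + (-1) * t)) * indicator {0..} (0 + (-1) * t) \<partial>lborel)"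
    by (intro nn_integral_mono) (auto simp: indicator_def)
  also have "\<dots> = (\<integral>\<^sup>+t. ennreal (?f t) * indicator {0..} t \<partial>lborel) + (\<integral>\<^sup>+t. ennreal (?f (0 + (-1) * t)) * indicator {0..} (0 + (-1) * t) \<partial>lborel)"
    by (rule nn_integral_add) measurable
  also have "(\<integral>\<^sup>+t. ennreal (?f (0 + (-1) * t)) * indicator {0..} (0 + (-1) * t) \<partial>lborel) = (\<integral>\<^sup>+t. ennreal (?f t) * indicator {0..} t \<partial>lborel)"
    using nn_integral_real_affine[of "\<lambda>t. ennreal (?f t) * indicator {0..} t" "-1" 0] by simp
  also have "(\<integral>\<^sup>+t. ennreal (?f t) * indicator {0..} t \<partial>lborel) + (\<integral>\<^sup>+t. ennreal (?f t) * indicator {0..} t \<partial>lborel) = ennreal 4"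
    unfolding half by (simp add: ennreal_plus[symmetric] del: ennreal_plus)
  finally show ?thesis .
qed

lemma inverse_square_le: "1 / (1 + t\<^sup>2) \<le> 2 / (1 + \<bar>t\<bar>)\<^sup>2" for t :: real
proof -
  have "(1 + \<bar>t\<bar>)\<^sup>2 \<le> 2 * (1 + t\<^sup>2)"
    using zero_le_power2[of "1 - \<bar>t\<bar>"] by (simp add: power2_eq_square algebra_simps)
  moreover have "1 + t\<^sup>2 > 0" by (intro add_pos_nonneg) auto
  moreover have "(1 + \<bar>t\<bar>)\<^sup>2 > 0" by (intro zero_less_power) auto
  ultimately have "2 / (2 * (1 + t\<^sup>2)) \<le> 2 / (1 + \<bar>t\<bar>)\<^sup>2"
    using divide_left_mono[of "(1 + \<bar>t\<bar>)\<^sup>2" "2 * (1 + t\<^sup>2)" "2::real"] by (simp only: mult_pos_pos zero_less_numeral zero_le_numeral)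
  moreover have "1 / (1 + t\<^sup>2) = (2 * 1) / (2 * (1 + t\<^sup>2))"
    by (rule nonzero_mult_divide_mult_cancel_left[symmetric]) simp
  ultimately show ?thesis by (simp only: mult_1_right)
qed

lemma nn_integral_cauchy_kernel: "(\<integral>\<^sup>+t. ennreal (1 / (1 + (t - u)\<^sup>2)) \<partial>lborel) \<le> ennreal 8"
proof -
  have le: "1 / (1 + t\<^sup>2) \<le> 2 * (1 + \<bar>t\<bar>) powr (-3/2)" for t :: real
  proof -
    have "1 / (1 + t\<^sup>2) \<le> 2 / (1 + \<bar>t\<bar>)\<^sup>2" by (rule inverse_square_le)
    also have "\<dots> = 2 * (1 + \<bar>t\<bar>) powr (-2)" by (simp add: powr_minus divide_inverse)
    also have "\<dots> \<le> 2 * (1 + \<bar>t\<bar>) powr (-3/2)" by (intro mult_left_mono powr_mono) auto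
    finally show ?thesis .
  qed
  have "(\<integral>\<^sup>+t. ennreal (1 / (1 + (t - u)\<^sup>2)) \<partial>lborel) = (\<integral>\<^sup>+t. ennreal (1 / (1 + t\<^sup>2)) \<partial>lborel)"
    using nn_integral_real_affine[of "\<lambda>t. ennreal (1 / (1 + (t - u)\<^sup>2))" 1 u] by simp
  also have "\<dots> \<le> (\<integral>\<^sup>+t. ennreal 2 * ennreal ((1 + \<bar>t\<bar>) powr (-3/2)) \<partial>lborel)"
    by (intro nn_integral_mono, subst ennreal_mult[symmetric], simp, simp, rule ennreal_leI[OF le])
  also have "\<dots> = ennreal 2 * (\<integral>\<^sup>+t. ennreal ((1 + \<bar>t\<bar>) powr (-3/2)) \<partial>lborel)"
    by (rule nn_integral_cmult) auto
  also have "\<dots> \<le> ennreal 2 * ennreal 4" by (intro mult_left_mono nn_integral_powr_finite) auto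
  also have "\<dots> = ennreal 8" by (simp add: ennreal_mult[symmetric])
  finally show ?thesis .
qed

text \<open>Schur's test: \<open>B\<close> has mass at most \<open>K (1 + |T|) powr (-3/4)\<close> on unit intervals around \<open>T\<close>.\<close>

lemma schur_gaussian:
  fixes B :: "real \<Rightarrow> real"
  assumes [measurable]: "B \<in> borel_measurable borel" and B0: "\<And>t. B t \<ge> 0" and K0: "K \<ge> 0"
    and K: "\<And>T. (\<integral>\<^sup>+t. ennreal (B t) * indicator {T - 1/2..T + 1/2} t \<partial>lborel) \<le> ennreal (K * (1 + \<bar>T\<bar>) powr (-3/4))"
  shows "(\<integral>\<^sup>+t. \<integral>\<^sup>+u. ennreal (B t * B u * exp (- (t - u)\<^sup>2 / 2)) \<partial>lborel \<partial>lborel) \<le> ennreal (4000 * K\<^sup>2)"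
proof -
  \<comment> \<open>With the decay removed, the mass on unit intervals is bounded uniformly in
    \<open>T\<close>, as \<open>block_integral\<close> requires.\<close>
  define \<beta> where "\<beta> = (\<lambda>t. B t * (1 + \<bar>t\<bar>) powr (3/4))"
  define g where "g = (\<lambda>t::real. (1 + \<bar>t\<bar>) powr (-3/2))"
  define \<kappa> where "\<kappa> = (\<lambda>t u::real. 1 / (1 + (u - t)\<^sup>2))"
  have gm: "g \<in> borel_measurable borel" unfolding g_def by measurable
  note [measurable] = gm
  have bm: "\<beta> \<in> borel_measurable borel" unfolding \<beta>_def by measurable
  note [measurable] = bm
  have km: "(\<lambda>(t, u). \<kappa> t u) \<in> borel_measurable (borel \<Otimes>\<^sub>M borel)" unfolding \<kappa>_def by measurable
  note [measurable] = km
  have \<beta>0: "\<beta> t \<ge> 0" and g0: "g t \<ge> 0" and \<kappa>0: "\<kappa> t u \<ge> 0" for t u by (auto simp: \<beta>_def g_def \<kappa>_def B0)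
  have block: "(\<integral>\<^sup>+t. ennreal (\<beta> t) * indicator {T - 1/2..T + 1/2} t \<partial>lborel) \<le> ennreal (3 * K)" for T
  proof -
    have "(\<integral>\<^sup>+t. ennreal (\<beta> t) * indicator {T - 1/2..T + 1/2} t \<partial>lborel)
       \<le> (\<integral>\<^sup>+t. ennreal (3 * (1 + \<bar>T\<bar>) powr (3/4)) * (ennreal (B t) * indicator {T - 1/2..T + 1/2} t) \<partial>lborel)"
    proof (intro nn_integral_mono)
      fix t
      show "ennreal (\<beta> t) * indicator {T - 1/2..T + 1/2} t \<le> ennreal (3 * (1 + \<bar>T\<bar>) powr (3/4)) * (ennreal (B t) * indicator {T - 1/2..T + 1/2} t)"
      proof (cases "t \<in> {T - 1/2..T + 1/2}")
        case True
        then have "\<bar>t - T\<bar> \<le> 1/2" by (auto simp: abs_if)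
        then have "B t * (1 + \<bar>t\<bar>) powr (3/4) \<le> B t * (3 * (1 + \<bar>T\<bar>) powr (3/4))"
          by (intro mult_left_mono slowly_varying_powr B0) auto
        then have "ennreal (\<beta> t) \<le> ennreal (3 * (1 + \<bar>T\<bar>) powr (3/4) * B t)"
          unfolding \<beta>_def by (intro ennreal_leI) (simp add: mult_ac)
        also have "\<dots> = ennreal (3 * (1 + \<bar>T\<bar>) powr (3/4)) * ennreal (B t)" by (intro ennreal_mult B0) auto
        finally show ?thesis using True by simp
      qed simp
    qed
    also have "\<dots> = ennreal (3 * (1 + \<bar>T\<bar>) powr (3/4)) * (\<integral>\<^sup>+t. ennreal (B t) * indicator {T - 1/2..T + 1/2} t \<partial>lborel)"
      by (rule nn_integral_cmult) auto
    also have "\<dots> \<le> ennreal (3 * (1 + \<bar>T\<bar>) powr (3/4)) * ennreal (K * (1 + \<bar>T\<bar>) powr (-3/4))"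
      by (intro mult_left_mono K) auto
    also have "\<dots> = ennreal (3 * (1 + \<bar>T\<bar>) powr (3/4) * (K * (1 + \<bar>T\<bar>) powr (-3/4)))"
      using K0 by (intro ennreal_mult[symmetric]) auto
    also have "3 * (1 + \<bar>T\<bar>) powr (3/4) * (K * (1 + \<bar>T\<bar>) powr (-3/4)) = 3 * K * ((1 + \<bar>T\<bar>) powr (3/4) * (1 + \<bar>T\<bar>) powr (-3/4))" by simp
    also have "(1 + \<bar>T\<bar>) powr (3/4) * (1 + \<bar>T\<bar>) powr (-3/4) = 1"
    proof -
      have "(1 + \<bar>T\<bar>) powr (3/4) * (1 + \<bar>T\<bar>) powr (-3/4) = (1 + \<bar>T\<bar>) powr (3/4 + -3/4)" by (rule powr_add[symmetric])
      also have "\<dots> = 1" by (simp add: add_nonneg_eq_0_iff)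
      finally show ?thesis .
    qed
    finally show ?thesis by simp
  qed
  have inner: "(\<integral>\<^sup>+u. ennreal (\<beta> u) * ennreal (\<kappa> t u) \<partial>lborel) \<le> ennreal (48 * K)" for t
  proof -
    have "(\<integral>\<^sup>+u. ennreal (\<beta> u) * ennreal (\<kappa> t u) \<partial>lborel) \<le> ennreal 2 * ennreal (3 * K) * (\<integral>\<^sup>+u. ennreal (\<kappa> t u) \<partial>lborel)"
    proof (rule block_integral[OF _ _ block])
      show "ennreal (\<kappa> t a) \<le> ennreal 2 * ennreal (\<kappa> t b)" if "\<bar>a - b\<bar> \<le> 1/2" for a b
        using slowly_varying_square[OF that, of t] by (subst ennreal_mult[symmetric]) (auto simp: \<kappa>_def intro!: ennreal_leI)
      show "(\<lambda>u. ennreal (\<kappa> t u)) \<in> borel_measurable borel" unfolding \<kappa>_def by measurable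
    qed auto
    also have "\<dots> \<le> ennreal 2 * ennreal (3 * K) * ennreal 8"
      using nn_integral_cauchy_kernel[of t] by (intro mult_left_mono) (auto simp: \<kappa>_def)
    also have "\<dots> = ennreal (2 * (3 * K) * 8)"
      using K0 by (simp only: ennreal_mult mult_nonneg_nonneg zero_le_numeral)
    finally show ?thesis by (simp add: mult_ac)
  qed
  have outer: "(\<integral>\<^sup>+t. ennreal (\<beta> t) * ennreal (g t) \<partial>lborel) \<le> ennreal (36 * K)"
  proof -
    have "(\<integral>\<^sup>+t. ennreal (\<beta> t) * ennreal (g t) \<partial>lborel) \<le> ennreal 3 * ennreal (3 * K) * (\<integral>\<^sup>+t. ennreal (g t) \<partial>lborel)"
    proof (rule block_integral[OF _ _ block])
      show "ennreal (g a) \<le> ennreal 3 * ennreal (g b)" if "\<bar>a - b\<bar> \<le> 1/2" for a b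
        using slowly_varying_powr(2)[OF that, of "3/2"] by (subst ennreal_mult[symmetric]) (auto simp: g_def intro!: ennreal_leI)
    qed auto
    also have "\<dots> \<le> ennreal 3 * ennreal (3 * K) * ennreal 4"
      using nn_integral_powr_finite by (intro mult_left_mono) (auto simp: g_def)
    also have "\<dots> = ennreal (3 * (3 * K) * 4)"
      using K0 by (simp only: ennreal_mult mult_nonneg_nonneg zero_le_numeral)
    finally show ?thesis by (simp add: mult_ac)
  qed
  \<comment> \<open>48 = 2 * 3 * 8 from the inner integral and 36 = 3 * 3 * 4 from the outer one;
    their product is needed twice, and 3456 is rounded up to 4000.\<close>
  have one: "(\<integral>\<^sup>+t. \<integral>\<^sup>+u. ennreal (\<beta> t * \<beta> u * g t * \<kappa> t u) \<partial>lborel \<partial>lborel) \<le> ennreal (1728 * K\<^sup>2)"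
  proof -
    have "(\<integral>\<^sup>+t. \<integral>\<^sup>+u. ennreal (\<beta> t * \<beta> u * g t * \<kappa> t u) \<partial>lborel \<partial>lborel) = (\<integral>\<^sup>+t. (ennreal (\<beta> t) * ennreal (g t)) * (\<integral>\<^sup>+u. ennreal (\<beta> u) * ennreal (\<kappa> t u) \<partial>lborel) \<partial>lborel)"
    proof (intro nn_integral_cong)
      fix t
      have [measurable]: "(\<lambda>u. \<kappa> t u) \<in> borel_measurable borel" unfolding \<kappa>_def by measurable
      have "(\<integral>\<^sup>+u. ennreal (\<beta> t * \<beta> u * g t * \<kappa> t u) \<partial>lborel) = (\<integral>\<^sup>+u. (ennreal (\<beta> t) * ennreal (g t)) * (ennreal (\<beta> u) * ennreal (\<kappa> t u)) \<partial>lborel)"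
        by (intro nn_integral_cong) (simp add: ennreal_mult[symmetric] \<beta>0 g0 \<kappa>0 mult_ac)
      also have "\<dots> = (ennreal (\<beta> t) * ennreal (g t)) * (\<integral>\<^sup>+u. ennreal (\<beta> u) * ennreal (\<kappa> t u) \<partial>lborel)"
        by (rule nn_integral_cmult) auto
      finally show "(\<integral>\<^sup>+u. ennreal (\<beta> t * \<beta> u * g t * \<kappa> t u) \<partial>lborel) = (ennreal (\<beta> t) * ennreal (g t)) * (\<integral>\<^sup>+u. ennreal (\<beta> u) * ennreal (\<kappa> t u) \<partial>lborel)" .
    qed
    also have "\<dots> \<le> (\<integral>\<^sup>+t. (ennreal (\<beta> t) * ennreal (g t)) * ennreal (48 * K) \<partial>lborel)"
      by (intro nn_integral_mono mult_left_mono inner) auto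
    also have "\<dots> = (\<integral>\<^sup>+t. ennreal (\<beta> t) * ennreal (g t) \<partial>lborel) * ennreal (48 * K)"
      by (rule nn_integral_multc) auto
    also have "\<dots> \<le> ennreal (36 * K) * ennreal (48 * K)" by (intro mult_right_mono outer) auto
    also have "\<dots> = ennreal ((36 * K) * (48 * K))" using K0 by (intro ennreal_mult[symmetric]) auto
    finally show ?thesis by (simp add: power2_eq_square)
  qed
  \<comment> \<open>The inequality 2ab \<le> a^2 + b^2 separates the decay in \<open>t\<close> from
    the decay in \<open>u\<close>: each square is the integrable weight \<open>g\<close> in one
    variable, and the other variable is integrated against the kernel \<open>\<kappa>\<close>
    alone.\<close>
  have pt: "B t * B u * exp (- (t - u)\<^sup>2 / 2) \<le> \<beta> t * \<beta> u * g t * \<kappa> t u + \<beta> u * \<beta> t * g u * \<kappa> u t" for t u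
  proof -
    have Bt: "B t = \<beta> t * (1 + \<bar>t\<bar>) powr (-3/4)" for t
    proof -
      have "(1 + \<bar>t\<bar>) powr (3/4) * (1 + \<bar>t\<bar>) powr (-3/4) = (1 + \<bar>t\<bar>) powr (3/4 + -3/4)" by (rule powr_add[symmetric])
      also have "\<dots> = 1" by (simp add: add_nonneg_eq_0_iff)
      finally show ?thesis by (simp add: \<beta>_def mult.assoc)
    qed
    have gt: "((1 + \<bar>t\<bar>) powr (-3/4))\<^sup>2 = g t" for t
    proof -
      have "((1 + \<bar>t\<bar>) powr (-3/4))\<^sup>2 = (1 + \<bar>t\<bar>) powr (-3/4 + -3/4)" unfolding power2_eq_square by (rule powr_add[symmetric])
      then show ?thesis by (simp add: g_def)
    qed
    let ?a = "(1 + \<bar>t\<bar>) powr (-3/4)" and ?b = "(1 + \<bar>u\<bar>) powr (-3/4)"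
    have "2 * (?a * ?b) \<le> ?a\<^sup>2 + ?b\<^sup>2" using zero_le_power2[of "?a - ?b"] by (simp add: power2_eq_square algebra_simps)
    then have ab: "2 * (?a * ?b) \<le> g t + g u" unfolding gt .
    have e: "exp (- (t - u)\<^sup>2 / 2) \<le> 2 * \<kappa> t u" using gaussian_le[of "t - u"] by (simp add: \<kappa>_def power2_commute)
    have sym: "\<kappa> u t = \<kappa> t u" by (simp add: \<kappa>_def power2_commute)
    have "B t * B u * exp (- (t - u)\<^sup>2 / 2) \<le> B t * B u * (2 * \<kappa> t u)" using B0 e by (intro mult_left_mono mult_nonneg_nonneg)
    also have "\<dots> = \<beta> t * \<beta> u * \<kappa> t u * (2 * (?a * ?b))" unfolding Bt by simp
    also have "\<dots> \<le> \<beta> t * \<beta> u * \<kappa> t u * (g t + g u)" using \<beta>0 \<kappa>0 ab by (intro mult_left_mono mult_nonneg_nonneg)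
    finally show ?thesis unfolding sym by (simp add: algebra_simps)
  qed
  have m1: "(\<lambda>u. ennreal (\<beta> t * \<beta> u * g t * \<kappa> t u)) \<in> borel_measurable borel" for t unfolding \<kappa>_def by measurable
  have m1': "(\<lambda>u. ennreal (\<beta> u * \<beta> t * g u * \<kappa> u t)) \<in> borel_measurable borel" for t unfolding \<kappa>_def by measurable
  have m2: "(\<lambda>(t, u). ennreal (\<beta> t * \<beta> u * g t * \<kappa> t u)) \<in> borel_measurable (lborel \<Otimes>\<^sub>M lborel)" by measurable
  have m2': "(\<lambda>(t, u). ennreal (\<beta> u * \<beta> t * g u * \<kappa> u t)) \<in> borel_measurable (lborel \<Otimes>\<^sub>M lborel)" unfolding \<kappa>_def by measurable
  have "(\<integral>\<^sup>+t. \<integral>\<^sup>+u. ennreal (B t * B u * exp (- (t - u)\<^sup>2 / 2)) \<partial>lborel \<partial>lborel)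
     \<le> (\<integral>\<^sup>+t. \<integral>\<^sup>+u. ennreal (\<beta> t * \<beta> u * g t * \<kappa> t u) + ennreal (\<beta> u * \<beta> t * g u * \<kappa> u t) \<partial>lborel \<partial>lborel)"
  proof (intro nn_integral_mono)
    fix t u
    show "ennreal (B t * B u * exp (- (t - u)\<^sup>2 / 2)) \<le> ennreal (\<beta> t * \<beta> u * g t * \<kappa> t u) + ennreal (\<beta> u * \<beta> t * g u * \<kappa> u t)"
    proof -
      have "ennreal (\<beta> t * \<beta> u * g t * \<kappa> t u + \<beta> u * \<beta> t * g u * \<kappa> u t) = ennreal (\<beta> t * \<beta> u * g t * \<kappa> t u) + ennreal (\<beta> u * \<beta> t * g u * \<kappa> u t)"
        by (intro ennreal_plus mult_nonneg_nonneg \<beta>0 g0 \<kappa>0)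
      with ennreal_leI[OF pt[of t u]] show ?thesis by (simp only:)
    qed
  qed
  also have "\<dots> = (\<integral>\<^sup>+t. (\<integral>\<^sup>+u. ennreal (\<beta> t * \<beta> u * g t * \<kappa> t u) \<partial>lborel) + (\<integral>\<^sup>+u. ennreal (\<beta> u * \<beta> t * g u * \<kappa> u t) \<partial>lborel) \<partial>lborel)"
    using m1 m1' by (intro nn_integral_cong nn_integral_add) auto
  also have "\<dots> = (\<integral>\<^sup>+t. \<integral>\<^sup>+u. ennreal (\<beta> t * \<beta> u * g t * \<kappa> t u) \<partial>lborel \<partial>lborel) + (\<integral>\<^sup>+t. \<integral>\<^sup>+u. ennreal (\<beta> u * \<beta> t * g u * \<kappa> u t) \<partial>lborel \<partial>lborel)"
    using lborel.borel_measurable_nn_integral_fst[OF m2] lborel.borel_measurable_nn_integral_fst[OF m2']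
    by (intro nn_integral_add) auto
  also have "(\<integral>\<^sup>+t. \<integral>\<^sup>+u. ennreal (\<beta> u * \<beta> t * g u * \<kappa> u t) \<partial>lborel \<partial>lborel) = (\<integral>\<^sup>+t. \<integral>\<^sup>+u. ennreal (\<beta> t * \<beta> u * g t * \<kappa> t u) \<partial>lborel \<partial>lborel)"
    by (rule lborel_pair.Fubini'[OF m2])
  also have "(\<integral>\<^sup>+t. \<integral>\<^sup>+u. ennreal (\<beta> t * \<beta> u * g t * \<kappa> t u) \<partial>lborel \<partial>lborel) + (\<integral>\<^sup>+t. \<integral>\<^sup>+u. ennreal (\<beta> t * \<beta> u * g t * \<kappa> t u) \<partial>lborel \<partial>lborel) \<le> ennreal (1728 * K\<^sup>2) + ennreal (1728 * K\<^sup>2)"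
    by (intro add_mono one)
  also have "\<dots> = ennreal (1728 * K\<^sup>2 + 1728 * K\<^sup>2)" by (rule ennreal_plus[symmetric]) auto
  also have "\<dots> \<le> ennreal (4000 * K\<^sup>2)" by (intro ennreal_leI) auto
  finally show ?thesis .
qed

lemma norm_exp_minus_1_le: "norm (exp w - 1) \<le> exp (max 0 (Re w)) * norm (w::complex)"
proof -
  have "norm (exp w - exp 0) \<le> exp (max 0 (Re w)) * norm (w - 0)"
  proof (rule field_differentiable_bound[of "closed_segment 0 w"])
    fix z assume "z \<in> closed_segment 0 w"
    then obtain u where u: "0 \<le> u" "u \<le> 1" "z = u *\<^sub>R w" by (auto simp: closed_segment_def)
    show "(exp has_field_derivative exp z) (at z within closed_segment 0 w)" by (rule DERIV_subset[OF DERIV_exp]) simp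
    have "u * Re w \<le> max 0 (Re w)"
    proof (cases "Re w \<ge> 0")
      case True then show ?thesis using u mult_right_mono[of u 1 "Re w"] by simp
    next
      case False then show ?thesis using u by (simp add: mult_nonneg_nonpos)
    qed
    then show "norm (exp z) \<le> exp (max 0 (Re w))" using u by (simp add: norm_exp_eq_Re)
  qed auto
  then show ?thesis by simp
qed

lemma integrable_powr_tail: "integrable lborel (\<lambda>t::real. (1 + \<bar>t\<bar>) powr (-3/2))"
proof (rule integrableI_nonneg)
  have "(\<integral>\<^sup>+t. ennreal ((1 + \<bar>t\<bar>) powr (-3/2)) \<partial>lborel) \<le> ennreal 4" by (rule nn_integral_powr_finite)
  also have "\<dots> < \<infinity>" by simp
  finally show "(\<integral>\<^sup>+t. ennreal ((1 + \<bar>t\<bar>) powr (-3/2)) \<partial>lborel) < \<infinity>" .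
qed auto

lemma inverse_square_le_powr:
  fixes t :: real
  shows "1 / (1 + t\<^sup>2) * (1 + \<bar>t\<bar>) powr (1/4) \<le> 2 * (1 + \<bar>t\<bar>) powr (-3/2)"
proof -
  have 1: "1 / (1 + t\<^sup>2) \<le> 2 / (1 + \<bar>t\<bar>)\<^sup>2" by (rule inverse_square_le)
  have 2: "2 / (1 + \<bar>t\<bar>)\<^sup>2 = 2 * (1 + \<bar>t\<bar>) powr (-2)" by (simp add: powr_minus divide_inverse)
  have "1 / (1 + t\<^sup>2) * (1 + \<bar>t\<bar>) powr (1/4) \<le> 2 * (1 + \<bar>t\<bar>) powr (-2) * (1 + \<bar>t\<bar>) powr (1/4)"
    using 1 unfolding 2 by (intro mult_right_mono) auto
  also have "\<dots> = 2 * ((1 + \<bar>t\<bar>) powr (-2) * (1 + \<bar>t\<bar>) powr (1/4))" by (rule mult.assoc)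
  also have "(1 + \<bar>t\<bar>) powr (-2) * (1 + \<bar>t\<bar>) powr (1/4) = (1 + \<bar>t\<bar>) powr (-2 + 1/4)" by (rule powr_add[symmetric])
  also have "2 * (1 + \<bar>t\<bar>) powr (-2 + 1/4) \<le> 2 * (1 + \<bar>t\<bar>) powr (-3/2)" by (intro mult_left_mono powr_mono) auto
  finally show ?thesis .
qed

lemma measurable_cnj [measurable]: "cnj \<in> borel_measurable borel"
  by (intro borel_measurable_continuous_onI continuous_on_cnj continuous_on_id)

section \<open>Gaussian averages of Fourier integrals\<close>

abbreviation "\<N> \<equiv> std_normal_distribution"

lemma gaussian_swap:
  fixes F :: "real \<Rightarrow> complex"
  assumes F: "integrable lborel F" and b: "b \<in> borel_measurable borel" "\<And>v. norm (b v) \<le> B"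
  shows "(LINT v|\<N>. (LINT t|lborel. F t * iexp (v * t)) * b v) = (LINT t|lborel. F t * (LINT v|\<N>. iexp (v * t) * b v))"
proof -
  interpret N: prob_space \<N> by (rule real_dist_normal_dist[THEN real_distribution.axioms(1)])
  interpret P: pair_sigma_finite \<N> "lborel :: real measure" ..
  have [measurable]: "F \<in> borel_measurable borel" using F by auto
  note [measurable] = b(1)
  have B: "B \<ge> 0" using b(2)[of 0] norm_ge_zero order_trans by blast
  let ?f = "\<lambda>v t. F t * iexp (v * t) * b v"
  have m: "(\<lambda>(v, t). ?f v t) \<in> borel_measurable (\<N> \<Otimes>\<^sub>M lborel)"
    by measurable
  have int: "integrable (\<N> \<Otimes>\<^sub>M lborel) (\<lambda>(v, t). ?f v t)"
  proof (rule P.Fubini_integrable[OF m])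
    have e: "(LINT t|lborel. norm (case (v, t) of (v, t) \<Rightarrow> ?f v t)) = (LINT t|lborel. norm (F t)) * norm (b v)" for v
      by (simp add: norm_mult)
    show "integrable \<N> (\<lambda>v. LINT t|lborel. norm (case (v, t) of (v, t) \<Rightarrow> ?f v t))"
      unfolding e
      by (rule N.integrable_const_bound[where B = "(LINT t|lborel. norm (F t)) * B"]) (auto intro!: AE_I2 mult_left_mono b integral_nonneg_AE simp: abs_mult)
    show "AE v in \<N>. integrable lborel (\<lambda>t. case (v, t) of (v, t) \<Rightarrow> ?f v t)"
    proof (rule AE_I2)
      fix v
      have "integrable lborel (\<lambda>t. F t * iexp (v * t))"
        by (rule Bochner_Integration.integrable_bound[OF F]) (auto simp: norm_mult)
      then show "integrable lborel (\<lambda>t. case (v, t) of (v, t) \<Rightarrow> ?f v t)" by simp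
    qed
  qed
  have "(LINT v|\<N>. (LINT t|lborel. F t * iexp (v * t)) * b v) = (LINT v|\<N>. LINT t|lborel. ?f v t)" by simp
  also have "\<dots> = (LINT t|lborel. LINT v|\<N>. ?f v t)" by (rule P.Fubini_integral[OF int, symmetric])
  also have "\<dots> = (LINT t|lborel. F t * (LINT v|\<N>. iexp (v * t) * b v))" by (simp add: mult.assoc)
  finally show ?thesis .
qed

text \<open>Writes |h|^2 as \<open>h * cnj h\<close> and opens the two Fourier integrals one after
  the other with \<open>gaussian_swap\<close>, first against the bounded function
  \<open>cnj h\<close>, then against a pure oscillation. What remains is the characteristic function
  of the normal law, a positive Gaussian in \<open>t - u\<close>, which survives when absolute
  values are taken inside.\<close>

lemma gaussian_mean_square:
  fixes F :: "real \<Rightarrow> complex"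
  assumes F: "integrable lborel F"
  defines "h \<equiv> \<lambda>v. LINT t|lborel. F t * iexp (v * t)"
  shows "(\<integral>\<^sup>+v. ennreal ((norm (h v))\<^sup>2) \<partial>\<N>) \<le> (\<integral>\<^sup>+t. \<integral>\<^sup>+u. ennreal (norm (F t) * norm (F u) * exp (- (t - u)\<^sup>2 / 2)) \<partial>lborel \<partial>lborel)"
    and "h \<in> borel_measurable borel"
proof -
  interpret N: prob_space \<N> by (rule real_dist_normal_dist[THEN real_distribution.axioms(1)])
  have [measurable]: "F \<in> borel_measurable borel" using F by auto
  have hm: "h \<in> borel_measurable borel" unfolding h_def
    by (rule lborel.borel_measurable_lebesgue_integral) measurable
  then show "h \<in> borel_measurable borel" .
  note [measurable] = hm
  define A where "A = (LINT t|lborel. norm (F t))"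
  have hb: "norm (h v) \<le> A" for v
    unfolding h_def A_def by (rule order_trans[OF integral_norm_bound]) (simp add: norm_mult)
  have A0: "A \<ge> 0" using hb[of 0] norm_ge_zero order_trans by blast
  have inth: "integrable \<N> (\<lambda>v. h v * cnj (h v))"
    by (rule N.integrable_const_bound[where B = "A * A"]) (auto simp: norm_mult intro!: AE_I2 mult_mono hb A0)
  have main: "(LINT v|\<N>. h v * cnj (h v)) = (LINT t|lborel. F t * (LINT v|\<N>. iexp (v * t) * cnj (h v)))"
  proof -
    have hv: "(LINT t|lborel. F t * iexp (v * t)) = h v" for v by (simp add: h_def)
    have "(\<lambda>v. cnj (h v)) \<in> borel_measurable borel" by measurable
    moreover have "norm (cnj (h v)) \<le> A" for v using hb by simp
    ultimately have "(LINT v|\<N>. (LINT t|lborel. F t * iexp (v * t)) * cnj (h v)) = (LINT t|lborel. F t * (LINT v|\<N>. iexp (v * t) * cnj (h v)))"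
      by (rule gaussian_swap[OF F])
    then show ?thesis unfolding hv .
  qed
  have inner: "norm (LINT v|\<N>. iexp (v * t) * cnj (h v)) \<le> enn2real (\<integral>\<^sup>+u. ennreal (norm (F u) * exp (- (t - u)\<^sup>2 / 2)) \<partial>lborel)" for t
  proof -
    have "(LINT v|\<N>. iexp (v * t) * cnj (h v)) = cnj (LINT v|\<N>. h v * iexp (v * (-t)))"
    proof -
      have "(\<lambda>v. iexp (v * t) * cnj (h v)) = (\<lambda>v. cnj (h v * iexp (v * (-t))))"
        by (rule ext) (simp add: exp_cnj mult.commute)
      then show ?thesis by (simp only: Bochner_Integration.integral_cnj)
    qed
    also have "(LINT v|\<N>. h v * iexp (v * (-t))) = (LINT u|lborel. F u * (LINT v|\<N>. iexp (v * u) * iexp (v * (-t))))"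
      unfolding h_def by (rule gaussian_swap[OF F, where B = 1]) auto
    also have "\<dots> = (LINT u|lborel. F u * of_real (exp (- (t - u)\<^sup>2 / 2)))"
    proof (intro Bochner_Integration.integral_cong refl)
      fix u
      have "(LINT v|\<N>. iexp (v * u) * iexp (v * (-t))) = char \<N> (u - t)"
        unfolding char_def by (intro Bochner_Integration.integral_cong refl) (simp add: exp_add[symmetric] algebra_simps)
      also have "\<dots> = of_real (exp (- (t - u)\<^sup>2 / 2))" by (simp add: char_std_normal_distribution power2_commute)
      finally show "F u * (LINT v|\<N>. iexp (v * u) * iexp (v * (-t))) = F u * of_real (exp (- (t - u)\<^sup>2 / 2))" by simp
    qed
    finally have eq: "norm (LINT v|\<N>. iexp (v * t) * cnj (h v)) = norm (LINT u|lborel. F u * of_real (exp (- (t - u)\<^sup>2 / 2)))" by simp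
    have i: "integrable lborel (\<lambda>u. F u * of_real (exp (- (t - u)\<^sup>2 / 2)))"
      by (rule Bochner_Integration.integrable_bound[OF F]) (auto simp: norm_mult intro!: AE_I2 mult_left_le)
    have "norm (LINT u|lborel. F u * of_real (exp (- (t - u)\<^sup>2 / 2))) \<le> (LINT u|lborel. norm (F u * of_real (exp (- (t - u)\<^sup>2 / 2))))"
      by (rule integral_norm_bound)
    also have "\<dots> = enn2real (\<integral>\<^sup>+u. ennreal (norm (F u * of_real (exp (- (t - u)\<^sup>2 / 2)))) \<partial>lborel)"
      using i by (intro integral_eq_nn_integral) auto
    finally show ?thesis unfolding eq by (simp add: norm_mult)
  qed
  have fin: "(\<integral>\<^sup>+u. ennreal (norm (F u) * exp (- (t - u)\<^sup>2 / 2)) \<partial>lborel) < \<infinity>" for t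
  proof -
    have "(\<integral>\<^sup>+u. ennreal (norm (F u) * exp (- (t - u)\<^sup>2 / 2)) \<partial>lborel) \<le> (\<integral>\<^sup>+u. ennreal (norm (F u)) \<partial>lborel)"
      by (intro nn_integral_mono ennreal_leI mult_left_le) auto
    also have "\<dots> < \<infinity>" using F unfolding integrable_iff_bounded by simp
    finally show ?thesis .
  qed
  let ?G = "\<lambda>t. LINT v|\<N>. iexp (v * t) * cnj (h v)"
  have Gb: "norm (?G t) \<le> A" for t
  proof -
    have "norm (?G t) \<le> (LINT v|\<N>. norm (iexp (v * t) * cnj (h v)))" by (rule integral_norm_bound)
    also have "\<dots> \<le> (LINT v|\<N>. A)"
      by (intro integral_mono N.integrable_const_bound[where B = A]) (auto simp: norm_mult hb A0 intro!: AE_I2)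
    also have "\<dots> = A" using N.prob_space by simp
    finally show ?thesis .
  qed
  have Gm: "?G \<in> borel_measurable borel"
    by (rule N.borel_measurable_lebesgue_integral) measurable
  note [measurable] = Gm
  have iFG: "integrable lborel (\<lambda>t. F t * ?G t)"
  proof (rule Bochner_Integration.integrable_bound[where f = "\<lambda>t. of_real A * F t"])
    show "integrable lborel (\<lambda>t. of_real A * F t)" using F by simp
    show "(\<lambda>t. F t * ?G t) \<in> borel_measurable lborel" by measurable
    show "AE t in lborel. norm (F t * ?G t) \<le> norm (of_real A * F t)"
    proof (rule AE_I2)
      fix t
      have "norm (F t) * norm (?G t) \<le> norm (F t) * A" by (intro mult_left_mono Gb) auto
      then show "norm (F t * ?G t) \<le> norm (of_real A * F t)" unfolding norm_mult using A0 by (simp add: mult.commute)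
    qed
  qed
  have "(\<integral>\<^sup>+v. ennreal ((norm (h v))\<^sup>2) \<partial>\<N>) = (\<integral>\<^sup>+v. ennreal (norm (h v * cnj (h v))) \<partial>\<N>)"
    by (simp add: norm_mult power2_eq_square)
  also have "\<dots> = ennreal (LINT v|\<N>. norm (h v * cnj (h v)))" by (intro nn_integral_eq_integral integrable_norm inth) auto
  also have "(LINT v|\<N>. norm (h v * cnj (h v))) = Re (LINT v|\<N>. h v * cnj (h v))"
    unfolding integral_Re[OF inth, symmetric] by (intro Bochner_Integration.integral_cong refl) (simp add: norm_mult complex_mult_cnj cmod_def power2_eq_square[symmetric] flip: power2_eq_square)
  also have "\<dots> \<le> norm (LINT t|lborel. F t * ?G t)" unfolding main by (rule complex_Re_le_cmod)
  also have "\<dots> \<le> (LINT t|lborel. norm (F t * ?G t))" by (rule integral_norm_bound)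
  finally have "(\<integral>\<^sup>+v. ennreal ((norm (h v))\<^sup>2) \<partial>\<N>) \<le> ennreal (LINT t|lborel. norm (F t * ?G t))"
    by (simp add: ennreal_leI)
  also have "\<dots> = (\<integral>\<^sup>+t. ennreal (norm (F t * ?G t)) \<partial>lborel)"
    by (intro nn_integral_eq_integral[symmetric] integrable_norm iFG) auto
  also have "\<dots> \<le> (\<integral>\<^sup>+t. \<integral>\<^sup>+u. ennreal (norm (F t) * norm (F u) * exp (- (t - u)\<^sup>2 / 2)) \<partial>lborel \<partial>lborel)"
  proof (intro nn_integral_mono)
    fix t
    have "ennreal (norm (F t * ?G t)) = ennreal (norm (F t)) * ennreal (norm (?G t))" by (simp add: norm_mult ennreal_mult)
    also have "\<dots> \<le> ennreal (norm (F t)) * (\<integral>\<^sup>+u. ennreal (norm (F u) * exp (- (t - u)\<^sup>2 / 2)) \<partial>lborel)"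
    proof (intro mult_left_mono)
      have "ennreal (norm (?G t)) \<le> ennreal (enn2real (\<integral>\<^sup>+u. ennreal (norm (F u) * exp (- (t - u)\<^sup>2 / 2)) \<partial>lborel))"
        by (intro ennreal_leI inner)
      also have "\<dots> = (\<integral>\<^sup>+u. ennreal (norm (F u) * exp (- (t - u)\<^sup>2 / 2)) \<partial>lborel)"
        using fin[of t] by (intro ennreal_enn2real) auto
      finally show "ennreal (norm (?G t)) \<le> (\<integral>\<^sup>+u. ennreal (norm (F u) * exp (- (t - u)\<^sup>2 / 2)) \<partial>lborel)" .
    qed auto
    also have "\<dots> = (\<integral>\<^sup>+u. ennreal (norm (F t)) * ennreal (norm (F u) * exp (- (t - u)\<^sup>2 / 2)) \<partial>lborel)"
      by (rule nn_integral_cmult[symmetric]) auto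
    also have "\<dots> = (\<integral>\<^sup>+u. ennreal (norm (F t) * norm (F u) * exp (- (t - u)\<^sup>2 / 2)) \<partial>lborel)"
      by (intro nn_integral_cong) (simp add: ennreal_mult[symmetric] mult.assoc)
    finally show "ennreal (norm (F t * ?G t)) \<le> (\<integral>\<^sup>+u. ennreal (norm (F t) * norm (F u) * exp (- (t - u)\<^sup>2 / 2)) \<partial>lborel)" .
  qed
  finally show "(\<integral>\<^sup>+v. ennreal ((norm (h v))\<^sup>2) \<partial>\<N>) \<le> (\<integral>\<^sup>+t. \<integral>\<^sup>+u. ennreal (norm (F t) * norm (F u) * exp (- (t - u)\<^sup>2 / 2)) \<partial>lborel \<partial>lborel)" .
qed

text \<open>On the unit interval the normal density is at least 1/3 * 1/2, because
  \<open>sqrt (2 * pi) \<le> 3\<close> and \<open>exp (-1/2) \<ge> 1/2\<close>.\<close>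

lemma nn_integral_unit_le_gaussian:
  assumes [measurable]: "f \<in> borel_measurable borel"
  shows "(\<integral>\<^sup>+v. f v * indicator {0..1} v \<partial>lborel) \<le> 6 * (\<integral>\<^sup>+v. f v \<partial>\<N>)"
proof -
  have dens: "1 \<le> 6 * std_normal_density v" if "0 \<le> v" "v \<le> 1" for v
  proof -
    have "sqrt (2 * pi) \<le> sqrt (3\<^sup>2)" using pi_less_4 by (intro real_sqrt_le_mono) simp
    then have s: "sqrt (2 * pi) \<le> 3" by simp
    have "v\<^sup>2 \<le> 1" using that by (intro power_le_one) auto
    then have "1/2 \<le> 1 + (- v\<^sup>2 / 2)" by simp
    also have "\<dots> \<le> exp (- v\<^sup>2 / 2)" by (rule exp_ge_add_one_self)
    finally have e: "1/2 \<le> exp (- v\<^sup>2 / 2)" .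
    have "1 = 6 * (1/3 * (1/2::real))" by simp
    also have "\<dots> \<le> 6 * (1 / sqrt (2 * pi) * exp (- v\<^sup>2 / 2))"
      using s e by (intro mult_left_mono mult_mono divide_left_mono) auto
    finally show ?thesis by (simp add: std_normal_density_def)
  qed
  have "(\<integral>\<^sup>+v. f v * indicator {0..1} v \<partial>lborel) \<le> (\<integral>\<^sup>+v. 6 * (ennreal (std_normal_density v) * f v) \<partial>lborel)"
  proof (intro nn_integral_mono)
    fix v :: real
    show "f v * indicator {0..1} v \<le> 6 * (ennreal (std_normal_density v) * f v)"
    proof (cases "v \<in> {0..1}")
      case True
      then have "ennreal 1 \<le> ennreal (6 * std_normal_density v)" by (intro ennreal_leI dens) auto
      also have "\<dots> = 6 * ennreal (std_normal_density v)" by (simp add: ennreal_mult')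
      finally have "ennreal 1 * f v \<le> (6 * ennreal (std_normal_density v)) * f v" by (intro mult_right_mono) auto
      then show ?thesis using True by (simp add: mult.assoc)
    qed simp
  qed
  also have "\<dots> = 6 * (\<integral>\<^sup>+v. ennreal (std_normal_density v) * f v \<partial>lborel)" by (rule nn_integral_cmult) auto
  also have "(\<integral>\<^sup>+v. ennreal (std_normal_density v) * f v \<partial>lborel) = (\<integral>\<^sup>+v. f v \<partial>\<N>)"
    by (rule nn_integral_density[symmetric]) auto
  finally show ?thesis .
qed

lemma measurable_vertical_comp:
  assumes "Q holomorphic_on {z. Re z > 0}" "\<sigma> > 0"
  shows "(\<lambda>t. Q (Complex \<sigma> t)) \<in> borel_measurable borel"
proof (intro borel_measurable_continuous_onI)
  show "continuous_on UNIV (\<lambda>t. Q (Complex \<sigma> t))"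
    by (rule continuous_on_compose2[OF holomorphic_on_imp_continuous_on[OF assms(1)] vertical_continuous]) (use assms in auto)
qed

lemma integrable_vertical:
  assumes Q: "Q holomorphic_on {z. Re z > 0}" and \<sigma>: "\<sigma> > 0"
    and bd: "\<And>t. norm (Q (Complex \<sigma> t)) \<le> K * (1 + \<bar>t\<bar>) powr (1/4)"
  shows "integrable lborel (\<lambda>t. Q (Complex \<sigma> t) * (exp (Complex \<sigma> t * of_real v) / Complex \<sigma> t ^ 2))"
proof (rule Bochner_Integration.integrable_bound)
  let ?c = "exp (\<sigma> * v) / min 1 \<bar>\<sigma>\<bar> ^ 2"
  have K: "K \<ge> 0" using order_trans[OF norm_ge_zero bd[of 0]] by simp
  show "integrable lborel (\<lambda>t::real. K * ?c * 2 * (1 + \<bar>t\<bar>) powr (-3/2))"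
    by (intro integrable_mult_right integrable_powr_tail)
  have [measurable]: "(\<lambda>t. Q (Complex \<sigma> t)) \<in> borel_measurable borel" by (rule measurable_vertical_comp[OF Q \<sigma>])
  show "(\<lambda>t. Q (Complex \<sigma> t) * (exp (Complex \<sigma> t * of_real v) / Complex \<sigma> t ^ 2)) \<in> borel_measurable lborel" by measurable
  show "AE t in lborel. norm (Q (Complex \<sigma> t) * (exp (Complex \<sigma> t * of_real v) / Complex \<sigma> t ^ 2)) \<le> norm (K * ?c * 2 * (1 + \<bar>t\<bar>) powr (-3/2))"
  proof (rule AE_I2)
    fix t :: real
    have "norm (Q (Complex \<sigma> t) * (exp (Complex \<sigma> t * of_real v) / Complex \<sigma> t ^ 2)) \<le> (K * (1 + \<bar>t\<bar>) powr (1/4)) * (?c * (1 / (1 + t\<^sup>2)))"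
      unfolding norm_mult using \<sigma> K by (intro mult_mono bd integrable_exp_over_power(2)) auto
    also have "\<dots> = (K * ?c) * (1 / (1 + t\<^sup>2) * (1 + \<bar>t\<bar>) powr (1/4))" by (simp only: mult_ac)
    also have "\<dots> \<le> (K * ?c) * (2 * (1 + \<bar>t\<bar>) powr (-3/2))"
      using K by (intro mult_left_mono inverse_square_le_powr mult_nonneg_nonneg) auto
    also have "\<dots> \<le> norm (K * ?c * 2 * (1 + \<bar>t\<bar>) powr (-3/2))" by (simp only: mult.assoc real_norm_def abs_ge_self)
    finally show "norm (Q (Complex \<sigma> t) * (exp (Complex \<sigma> t * of_real v) / Complex \<sigma> t ^ 2)) \<le> norm (K * ?c * 2 * (1 + \<bar>t\<bar>) powr (-3/2))" .
  qed
qed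

text \<open>The kernel 1/z belonging to \<open>E\<close> is not absolutely integrable. The kernels
  of the difference quotients of \<open>E1\<close> are absolutely integrable and bounded by a
  multiple of 1/|z| for every step \<open>\<eta> \<le> 1\<close>; so the Gaussian average and
  Schur's test bound all quotients by the same constant, and Fatou's lemma carries the bound over to
  \<open>E\<close>.\<close>

theorem local_mean_square:
  assumes Q: "Q holomorphic_on {z. Re z > 0}" and K0: "K \<ge> 0"
    and grow: "\<And>\<sigma> t. 0 < \<sigma> \<Longrightarrow> \<sigma> \<le> 3/2 \<Longrightarrow> norm (Q (Complex \<sigma> t)) \<le> K / \<sigma> * (1 + \<bar>t\<bar>) powr (1/4)"
    and block: "\<And>\<delta> T. 0 < \<delta> \<Longrightarrow> \<delta> \<le> 1/4 \<Longrightarrow>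
       (\<integral>\<^sup>+t. ennreal (norm (Q (Complex \<delta> t)) / norm (Complex \<delta> t)) * indicator {T - 1/2..T + 1/2} t \<partial>lborel)
         \<le> ennreal (K * ln (1/\<delta>) * (1 + \<bar>T\<bar>) powr (-3/4))"
    and rep: "\<And>v. v \<ge> 0 \<Longrightarrow> of_real (2 * pi) * E1 v = (LINT t|lborel. Q (Complex (3/2) t) * (exp (Complex (3/2) t * of_real v) / Complex (3/2) t ^ 2))"
    and lim: "\<And>v. v \<ge> 0 \<Longrightarrow> ((\<lambda>\<eta>. (E1 (v + \<eta>) - E1 v) / of_real \<eta>) \<longlongrightarrow> E v) (at_right 0)"
    and Em: "E1 \<in> borel_measurable borel" and V: "V \<ge> 4"
  shows "(\<integral>\<^sup>+x. ennreal ((norm (E (V + x)))\<^sup>2) * indicator {0..1} x \<partial>lborel) \<le> ennreal (216000 * K\<^sup>2 * (ln V)\<^sup>2)"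
proof -
  \<comment> \<open>At this distance from the critical line the growth
    \<open>exp (\<delta> * (V + x))\<close> is still bounded, while \<open>ln (1 / \<delta>)\<close>
    is no more than \<open>ln V\<close>.\<close>
  define \<delta> where "\<delta> = 1 / V"
  have \<delta>: "0 < \<delta>" "\<delta> \<le> 1/4" using V by (auto simp: \<delta>_def field_simps)
  have lnV: "ln V \<ge> 0" using V by simp
  let ?z = "Complex \<delta>"
  have zn: "?z t \<noteq> 0" for t using \<delta> by (simp add: complex_eq_iff)
  have Qm [measurable]: "(\<lambda>t. Q (?z t)) \<in> borel_measurable borel" by (rule measurable_vertical_comp[OF Q \<delta>(1)])
  have rep\<delta>: "of_real (2 * pi) * E1 v = (LINT t|lborel. Q (?z t) * (exp (?z t * of_real v) / ?z t ^ 2))" if v: "v \<ge> 0" for v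
  proof -
    let ?F = "\<lambda>z. Q z * (exp (z * of_real v) / z ^ 2)"
    have "(LINT t|lborel. ?F (Complex (3/2) t)) = (LINT t|lborel. ?F (?z t))"
    proof (rule vertical_shift[of ?F "{z. Re z > 0}" \<delta> "3/2" 1 "\<lambda>t. K / \<delta> * (1 + t) powr (1/4) * (exp (3/2 * v) / t ^ 2)"])
      show "?F holomorphic_on {z. Re z > 0}" by (intro holomorphic_intros Q) auto
      fix \<sigma> t :: real assume s: "\<delta> \<le> \<sigma>" "\<sigma> \<le> 3/2" and t: "1 \<le> \<bar>t\<bar>"
      have \<sigma>: "\<sigma> > 0" using s \<delta> by linarith
      have "norm (Q (Complex \<sigma> t)) \<le> K / \<sigma> * (1 + \<bar>t\<bar>) powr (1/4)" by (rule grow[OF \<sigma> s(2)])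
      also have "\<dots> \<le> K / \<delta> * (1 + \<bar>t\<bar>) powr (1/4)" using s \<delta> K0 by (intro mult_right_mono divide_left_mono) auto
      finally have 1: "norm (Q (Complex \<sigma> t)) \<le> K / \<delta> * (1 + \<bar>t\<bar>) powr (1/4)" .
      have "norm (exp (Complex \<sigma> t * of_real v) / Complex \<sigma> t ^ 2) = exp (\<sigma> * v) / norm (Complex \<sigma> t) ^ 2"
        by (simp add: norm_divide norm_power norm_exp_eq_Re)
      also have "\<dots> \<le> exp (3/2 * v) / \<bar>t\<bar> ^ 2"
      proof -
        have "\<sigma> * v \<le> 3/2 * v" using s v by (intro mult_right_mono) auto
        then show ?thesis using t abs_le_norm_Complex(1)[of t \<sigma>] by (intro frac_le power_mono zero_less_power) auto
      qed
      finally have 2: "norm (exp (Complex \<sigma> t * of_real v) / Complex \<sigma> t ^ 2) \<le> exp (3/2 * v) / \<bar>t\<bar> ^ 2" .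
      show "norm (?F (Complex \<sigma> t)) \<le> K / \<delta> * (1 + \<bar>t\<bar>) powr (1/4) * (exp (3/2 * v) / \<bar>t\<bar> ^ 2)"
        unfolding norm_mult using 1 2 K0 \<delta> by (intro mult_mono) auto
    next
      show "((\<lambda>t::real. K / \<delta> * (1 + t) powr (1/4) * (exp (3/2 * v) / t ^ 2)) \<longlongrightarrow> 0) at_top" by real_asymp
      show "integrable lborel (\<lambda>t. ?F (?z t))" by (rule integrable_vertical[OF Q \<delta>(1) grow]) (use \<delta> in auto)
      show "integrable lborel (\<lambda>t. ?F (Complex (3/2) t))" by (rule integrable_vertical[OF Q _ grow]) auto
    qed (use \<delta> in \<open>auto simp: convex_halfspace_Re_gt open_halfspace_Re_gt\<close>)
    then show ?thesis using rep[OF v] by simp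
  qed
  have iz: "integrable lborel (\<lambda>t. Q (?z t) * (exp (?z t * of_real v) / ?z t ^ 2))" for v
    by (rule integrable_vertical[OF Q \<delta>(1) grow]) (use \<delta> in auto)
  \<comment> \<open>The factor 3 is \<open>exp 1\<close> rounded up: it bounds the exponential in
    the estimate of \<open>(exp (z * \<eta>) - 1) / \<eta>\<close> by a multiple of
    \<open>norm z\<close>, for all steps at once.\<close>
  define B where "B = (\<lambda>t. 3 * (norm (Q (?z t)) / norm (?z t)))"
  have Bm: "B \<in> borel_measurable borel" unfolding B_def by measurable
  note [measurable] = Bm
  have B0: "B t \<ge> 0" for t by (simp add: B_def)
  have Bblock: "(\<integral>\<^sup>+t. ennreal (B t) * indicator {T - 1/2..T + 1/2} t \<partial>lborel) \<le> ennreal ((3 * K * ln V) * (1 + \<bar>T\<bar>) powr (-3/4))" for T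
  proof -
    have "(\<integral>\<^sup>+t. ennreal (B t) * indicator {T - 1/2..T + 1/2} t \<partial>lborel) = (\<integral>\<^sup>+t. ennreal 3 * (ennreal (norm (Q (?z t)) / norm (?z t)) * indicator {T - 1/2..T + 1/2} t) \<partial>lborel)"
    proof -
      have "ennreal (3 * (norm (Q (?z t)) / norm (?z t))) = ennreal 3 * ennreal (norm (Q (?z t)) / norm (?z t))" for t
        by (rule ennreal_mult) auto
      then show ?thesis unfolding B_def by (simp only: mult.assoc)
    qed
    also have "\<dots> = ennreal 3 * (\<integral>\<^sup>+t. ennreal (norm (Q (?z t)) / norm (?z t)) * indicator {T - 1/2..T + 1/2} t \<partial>lborel)"
      by (rule nn_integral_cmult) measurable
    also have "\<dots> \<le> ennreal 3 * ennreal (K * ln (1/\<delta>) * (1 + \<bar>T\<bar>) powr (-3/4))" by (intro mult_left_mono block \<delta>) auto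
    also have "\<dots> = ennreal (3 * (K * ln (1/\<delta>) * (1 + \<bar>T\<bar>) powr (-3/4)))"
      using K0 lnV by (intro ennreal_mult[symmetric]) (auto simp: \<delta>_def)
    also have "3 * (K * ln (1/\<delta>) * (1 + \<bar>T\<bar>) powr (-3/4)) = (3 * K * ln V) * (1 + \<bar>T\<bar>) powr (-3/4)"
      by (simp add: \<delta>_def)
    finally show ?thesis .
  qed
  have BB: "(\<integral>\<^sup>+t. \<integral>\<^sup>+u. ennreal (B t * B u * exp (- (t - u)\<^sup>2 / 2)) \<partial>lborel \<partial>lborel) \<le> ennreal (4000 * (3 * K * ln V)\<^sup>2)"
    using K0 lnV by (intro schur_gaussian Bm B0 Bblock) auto
  define q where "q = (\<lambda>\<eta> v. (E1 (v + \<eta>) - E1 v) / of_real \<eta>)"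
  have qm: "q \<eta> \<in> borel_measurable borel" for \<eta> unfolding q_def using Em by measurable
  have qV: "(\<integral>\<^sup>+x. ennreal ((norm (q \<eta> (V + x)))\<^sup>2) * indicator {0..1} x \<partial>lborel) \<le> ennreal (216000 * K\<^sup>2 * (ln V)\<^sup>2)"
    if \<eta>: "0 < \<eta>" "\<eta> \<le> 1" for \<eta>
  proof -
    \<comment> \<open>The phase \<open>iexp (V * t)\<close> moves the window
      \<open>[V, V + 1]\<close> to \<open>[0, 1]\<close>. With the real factor
      \<open>exp (\<delta> * (V + x))\<close> taken out, the rest is a Fourier integral in
      \<open>x\<close>.\<close>
    define F where "F = (\<lambda>t. Q (?z t) / ?z t ^ 2 * ((exp (?z t * of_real \<eta>) - 1) / of_real \<eta>) * iexp (V * t))"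
    have Fb: "norm (F t) \<le> B t" for t
    proof -
      have "norm (exp (?z t * of_real \<eta>) - 1) \<le> exp (max 0 (Re (?z t * of_real \<eta>))) * norm (?z t * of_real \<eta>)" by (rule norm_exp_minus_1_le)
      also have "\<dots> \<le> 3 * norm (?z t * of_real \<eta>)"
      proof (rule mult_right_mono)
        have "\<delta> * \<eta> \<le> 1 * 1" using \<delta> \<eta> by (intro mult_mono) auto
        then have "exp (max 0 (Re (?z t * of_real \<eta>))) \<le> exp 1" using \<delta> \<eta> by simp
        then show "exp (max 0 (Re (?z t * of_real \<eta>))) \<le> 3" using exp_le by linarith
      qed auto
      also have "\<dots> = 3 * norm (?z t) * \<eta>" using \<eta> by (simp add: norm_mult)
      finally have "norm ((exp (?z t * of_real \<eta>) - 1) / of_real \<eta>) \<le> 3 * norm (?z t)"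
        using \<eta> by (simp add: norm_divide field_simps)
      then have "norm (Q (?z t)) / norm (?z t) ^ 2 * norm ((exp (?z t * of_real \<eta>) - 1) / of_real \<eta>) \<le> norm (Q (?z t)) / norm (?z t) ^ 2 * (3 * norm (?z t))"
        by (intro mult_left_mono) auto
      also have "\<dots> = B t" using zn[of t] by (simp add: B_def power2_eq_square)
      finally show ?thesis by (simp add: F_def norm_mult norm_divide norm_power)
    qed
    have Feq: "F t * iexp (x * t) * exp (of_real (\<delta> * (V + x))) = (Q (?z t) * (exp (?z t * of_real (V + x + \<eta>)) / ?z t ^ 2) - Q (?z t) * (exp (?z t * of_real (V + x)) / ?z t ^ 2)) / of_real \<eta>" for t x
    proof -
      have z_eq: "?z t = of_real \<delta> + \<i> * of_real t" by (simp add: complex_eq_iff)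
      have e1: "iexp (V * t) * iexp (x * t) * exp (of_real (\<delta> * (V + x))) = exp (?z t * of_real (V + x))"
        unfolding z_eq exp_add[symmetric] by (simp add: algebra_simps)
      have e2: "exp (?z t * of_real (V + x + \<eta>)) = exp (?z t * of_real (V + x)) * exp (?z t * of_real \<eta>)"
        unfolding exp_add[symmetric] by (simp add: algebra_simps)
      have "F t * iexp (x * t) * exp (of_real (\<delta> * (V + x))) = Q (?z t) / ?z t ^ 2 * ((exp (?z t * of_real \<eta>) - 1) / of_real \<eta>) * (iexp (V * t) * iexp (x * t) * exp (of_real (\<delta> * (V + x))))"
        unfolding F_def by (simp only: mult_ac)
      also have "\<dots> = Q (?z t) / ?z t ^ 2 * ((exp (?z t * of_real \<eta>) - 1) / of_real \<eta>) * exp (?z t * of_real (V + x))" unfolding e1 ..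
      also have "\<dots> = (Q (?z t) * (exp (?z t * of_real (V + x + \<eta>)) / ?z t ^ 2) - Q (?z t) * (exp (?z t * of_real (V + x)) / ?z t ^ 2)) / of_real \<eta>"
        unfolding e2 using \<eta> zn[of t] by (simp add: field_simps)
      finally show ?thesis .
    qed
    have Fint: "integrable lborel F"
    proof -
      have "integrable lborel (\<lambda>t. ((Q (?z t) * (exp (?z t * of_real (V + 0 + \<eta>)) / ?z t ^ 2) - Q (?z t) * (exp (?z t * of_real (V + 0)) / ?z t ^ 2)) / of_real \<eta>) * exp (- of_real (\<delta> * (V + 0))))"
        by (intro integrable_mult_left integrable_divide Bochner_Integration.integrable_diff iz)
      also have "(\<lambda>t. ((Q (?z t) * (exp (?z t * of_real (V + 0 + \<eta>)) / ?z t ^ 2) - Q (?z t) * (exp (?z t * of_real (V + 0)) / ?z t ^ 2)) / of_real \<eta>) * exp (- of_real (\<delta> * (V + 0)))) = F"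
        unfolding Feq[symmetric] by (rule ext) (simp add: mult.assoc exp_add[symmetric])
      finally show ?thesis .
    qed
    define h where "h = (\<lambda>v. LINT t|lborel. F t * iexp (v * t))"
    have hm: "h \<in> borel_measurable borel" unfolding h_def by (rule gaussian_mean_square(2)[OF Fint])
    note [measurable] = hm
    have qh: "q \<eta> (V + x) = h x * exp (of_real (\<delta> * (V + x))) / of_real (2 * pi)" if x: "0 \<le> x" for x
    proof -
      have "h x * exp (of_real (\<delta> * (V + x))) = (LINT t|lborel. F t * iexp (x * t) * exp (of_real (\<delta> * (V + x))))" unfolding h_def
        by (rule integral_mult_left_zero[symmetric])
      also have "\<dots> = (LINT t|lborel. (Q (?z t) * (exp (?z t * of_real (V + x + \<eta>)) / ?z t ^ 2) - Q (?z t) * (exp (?z t * of_real (V + x)) / ?z t ^ 2)) / of_real \<eta>)"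
        unfolding Feq ..
      also have "\<dots> = (LINT t|lborel. Q (?z t) * (exp (?z t * of_real (V + x + \<eta>)) / ?z t ^ 2) - Q (?z t) * (exp (?z t * of_real (V + x)) / ?z t ^ 2)) / of_real \<eta>"
        by (rule integral_divide_zero)
      also have "(LINT t|lborel. Q (?z t) * (exp (?z t * of_real (V + x + \<eta>)) / ?z t ^ 2) - Q (?z t) * (exp (?z t * of_real (V + x)) / ?z t ^ 2)) = of_real (2 * pi) * E1 (V + x + \<eta>) - of_real (2 * pi) * E1 (V + x)"
      proof -
        have n: "V + x + \<eta> \<ge> 0" "V + x \<ge> 0" using x V \<eta> by auto
        show ?thesis unfolding rep\<delta>[OF n(1)] rep\<delta>[OF n(2)] by (rule Bochner_Integration.integral_diff[OF iz iz])
      qed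
      finally show ?thesis using \<eta> by (simp add: q_def field_simps)
    qed
    \<comment> \<open>The division by \<open>2 * pi\<close> from Perron's formula outweighs the
      growth factor, which is at most \<open>exp (3/2) \<le> 6\<close>.\<close>
    have qle: "(norm (q \<eta> (V + x)))\<^sup>2 \<le> (norm (h x))\<^sup>2" if x: "0 \<le> x" "x \<le> 1" for x
    proof -
      have "\<delta> * (V + x) \<le> 3/2" using V x unfolding \<delta>_def by (simp add: field_simps)
      then have "exp (\<delta> * (V + x)) \<le> exp (3/2)" by simp
      also have "exp (3/2) \<le> (6::real)"
      proof -
        have "exp (3/2 :: real) * exp (3/2) = exp 1 * exp 1 * exp 1" by (simp add: exp_add[symmetric])
        also have "\<dots> \<le> 3 * 3 * 3" using exp_le by (intro mult_mono) auto
        finally have "(exp (3/2 :: real))\<^sup>2 \<le> 6\<^sup>2" by (simp add: power2_eq_square)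
        then show ?thesis by (rule power2_le_imp_le) simp
      qed
      also have "6 \<le> 2 * pi" using pi_gt3 by simp
      finally have e: "exp (\<delta> * (V + x)) / (2 * pi) \<le> 1" by simp
      have "norm (q \<eta> (V + x)) = norm (h x) * (exp (\<delta> * (V + x)) / (2 * pi))"
        unfolding qh[OF x(1)] using pi_gt_zero by (simp add: norm_mult norm_divide exp_of_real norm_exp_eq_Re)
      also have "\<dots> \<le> norm (h x) * 1" using e by (intro mult_left_mono) auto
      finally show ?thesis by (intro power_mono) auto
    qed
    have "(\<integral>\<^sup>+x. ennreal ((norm (q \<eta> (V + x)))\<^sup>2) * indicator {0..1} x \<partial>lborel) \<le> (\<integral>\<^sup>+x. ennreal ((norm (h x))\<^sup>2) * indicator {0..1} x \<partial>lborel)"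
    proof (intro nn_integral_mono)
      fix x :: real
      show "ennreal ((norm (q \<eta> (V + x)))\<^sup>2) * indicator {0..1} x \<le> ennreal ((norm (h x))\<^sup>2) * indicator {0..1} x"
      proof (cases "x \<in> {0..1}")
        case True
        then show ?thesis by (intro mult_right_mono ennreal_leI qle) auto
      qed simp
    qed
    also have "\<dots> \<le> 6 * (\<integral>\<^sup>+v. ennreal ((norm (h v))\<^sup>2) \<partial>\<N>)"
      by (rule nn_integral_unit_le_gaussian) measurable
    also have "\<dots> \<le> 6 * (\<integral>\<^sup>+t. \<integral>\<^sup>+u. ennreal (norm (F t) * norm (F u) * exp (- (t - u)\<^sup>2 / 2)) \<partial>lborel \<partial>lborel)"
      unfolding h_def by (intro mult_left_mono gaussian_mean_square(1)[OF Fint]) auto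
    also have "\<dots> \<le> 6 * (\<integral>\<^sup>+t. \<integral>\<^sup>+u. ennreal (B t * B u * exp (- (t - u)\<^sup>2 / 2)) \<partial>lborel \<partial>lborel)"
      by (intro mult_left_mono nn_integral_mono ennreal_leI mult_right_mono mult_mono Fb B0) auto
    also have "\<dots> \<le> 6 * ennreal (4000 * (3 * K * ln V)\<^sup>2)" by (intro mult_left_mono BB) auto
    also have "\<dots> = ennreal (6 * (4000 * (3 * K * ln V)\<^sup>2))" by (simp add: ennreal_mult')
    also have "6 * (4000 * (3 * K * ln V)\<^sup>2) = 216000 * K\<^sup>2 * (ln V)\<^sup>2" by (simp add: power_mult_distrib)
    finally show ?thesis .
  qed
  \<comment> \<open>Fatou's lemma is applied along a sequence of steps that decrease to 0 from the
    right.\<close>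
  define \<eta> where "\<eta> = (\<lambda>k::nat. 1 / (real k + 1))"
  have \<eta>: "0 < \<eta> k" "\<eta> k \<le> 1" for k by (auto simp: \<eta>_def)
  have \<eta>lim: "filterlim \<eta> (at_right 0) sequentially"
    unfolding \<eta>_def by real_asymp
  have "(\<integral>\<^sup>+x. ennreal ((norm (E (V + x)))\<^sup>2) * indicator {0..1} x \<partial>lborel)
      = (\<integral>\<^sup>+x. liminf (\<lambda>k. ennreal ((norm (q (\<eta> k) (V + x)))\<^sup>2) * indicator {0..1} x) \<partial>lborel)"
  proof (intro nn_integral_cong)
    fix x :: real
    show "ennreal ((norm (E (V + x)))\<^sup>2) * indicator {0..1} x = liminf (\<lambda>k. ennreal ((norm (q (\<eta> k) (V + x)))\<^sup>2) * indicator {0..1} x)"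
    proof (cases "x \<in> {0..1}")
      case True
      then have "V + x \<ge> 0" using V by simp
      from filterlim_compose[OF lim[OF this] \<eta>lim] have "(\<lambda>k. q (\<eta> k) (V + x)) \<longlonglongrightarrow> E (V + x)" unfolding q_def .
      then have "(\<lambda>k. ennreal ((norm (q (\<eta> k) (V + x)))\<^sup>2)) \<longlonglongrightarrow> ennreal ((norm (E (V + x)))\<^sup>2)"
        by (intro tendsto_ennrealI tendsto_intros)
      note L = lim_imp_Liminf[OF sequentially_bot this]
      have i1: "indicator {0..1} x = (1::ennreal)" using True by simp
      show ?thesis unfolding i1 mult_1_right using L by (simp only:)
    next
      case False
      then have "(\<lambda>k. ennreal ((norm (q (\<eta> k) (V + x)))\<^sup>2) * indicator {0..1} x) \<longlonglongrightarrow> 0" by simp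
      from lim_imp_Liminf[OF sequentially_bot this] show ?thesis using False by simp
    qed
  qed
  also have "\<dots> \<le> liminf (\<lambda>k. \<integral>\<^sup>+x. ennreal ((norm (q (\<eta> k) (V + x)))\<^sup>2) * indicator {0..1} x \<partial>lborel)"
  proof (rule nn_integral_liminf)
    fix k
    have [measurable]: "(\<lambda>x. q (\<eta> k) (V + x)) \<in> borel_measurable borel" using qm[of "\<eta> k"] by measurable
    show "(\<lambda>x. ennreal ((norm (q (\<eta> k) (V + x)))\<^sup>2) * indicator {0..1} x) \<in> borel_measurable lborel" by measurable
  qed
  also have "\<dots> \<le> liminf (\<lambda>k. ennreal (216000 * K\<^sup>2 * (ln V)\<^sup>2))"
    by (intro Liminf_mono always_eventually allI qV \<eta>)
  also have "\<dots> = ennreal (216000 * K\<^sup>2 * (ln V)\<^sup>2)" by (simp add: Liminf_const)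
  finally show ?thesis .
qed

section \<open>The prime sum in mean square\<close>

definition upto_exp :: "real \<Rightarrow> nat set" where "upto_exp v = {n. 0 < n \<and> real n \<le> exp v}"

lemma upto_exp_eq: "upto_exp v = {1..nat \<lfloor>exp v\<rfloor>}"
  by (auto simp: upto_exp_def le_nat_floor Suc_le_eq) (metis le_floor_iff nat_le_iff of_int_of_nat_eq exp_ge_zero le_nat_iff zero_le_floor)

lemma finite_upto_exp [simp]: "finite (upto_exp v)" by (simp add: upto_exp_eq)

lemma upto_exp_iff_ln: "n \<in> upto_exp v \<longleftrightarrow> 0 < n \<and> ln (real n) \<le> v"
proof (cases "0 < n")
  case True
  then have "real n \<le> exp v \<longleftrightarrow> exp (ln (real n)) \<le> exp v" by simp
  then show ?thesis using True by (simp add: upto_exp_def del: exp_ln exp_ln_iff)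
qed (simp add: upto_exp_def)

lemma measurable_upto_exp:
  fixes f :: "nat set \<Rightarrow> complex"
  shows "(\<lambda>v. f (upto_exp v)) \<in> borel_measurable borel"
proof -
  have fl: "(\<lambda>v::real. \<lfloor>exp v\<rfloor>) \<in> borel \<rightarrow>\<^sub>M count_space UNIV" by measurable
  have "(\<lambda>v::real. (\<lambda>k::int. f {1..nat k}) \<lfloor>exp v\<rfloor>) \<in> borel_measurable borel"
    using measurable_compose[OF fl, of "\<lambda>k::int. f {1..nat k}" borel] by simp
  then show ?thesis unfolding upto_exp_eq .
qed

text \<open>The index set is locally constant to the right; hence right difference quotients of
  \<open>E1\<close> recover \<open>E\<close> at every point, the jumps included.\<close>

lemma upto_exp_right: "eventually (\<lambda>\<eta>. upto_exp (v + \<eta>) = upto_exp v) (at_right 0)"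
proof -
  define k where "k = nat \<lfloor>exp v\<rfloor> + 1"
  have k: "exp v < real k" unfolding k_def by (simp add: of_nat_nat) linarith
  have "((\<lambda>\<eta>. exp (v + \<eta>)) \<longlongrightarrow> exp (v + 0)) (at_right 0)" by (intro tendsto_intros)
  then have "eventually (\<lambda>\<eta>. exp (v + \<eta>) < real k) (at_right 0)" using k by (intro order_tendstoD(2)) auto
  moreover have "eventually (\<lambda>\<eta>::real. \<eta> > 0) (at_right 0)" by (rule eventually_at_right_less)
  ultimately show ?thesis
  proof eventually_elim
    case (elim \<eta>)
    show ?case
    proof (intro equalityI subsetI)
      fix n assume n: "n \<in> upto_exp (v + \<eta>)"
      then have "real n < real k" using elim by (auto simp: upto_exp_def)
      then have "n \<le> nat \<lfloor>exp v\<rfloor>" by (simp add: k_def)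
      then show "n \<in> upto_exp v" using n by (auto simp: upto_exp_eq upto_exp_def[of "v + \<eta>"])
    next
      fix n assume "n \<in> upto_exp v"
      moreover have "exp v \<le> exp (v + \<eta>)" using elim by simp
      ultimately show "n \<in> upto_exp (v + \<eta>)" unfolding upto_exp_def using order_trans by blast
    qed
  qed
qed

text \<open>\<open>g\<close> and \<open>r\<close> encode that \<open>m\<close> is exactly the order
  of vanishing at 1/2, the case \<open>m = 0\<close> included. The condition \<open>H_zero\<close>
  is the form in which the Riemann hypothesis is used: zeros farther to the left are
  allowed.\<close>

locale GRH_L = cmult +
  fixes H g :: "complex \<Rightarrow> complex" and m :: nat and C r :: real
  assumes H: "H holomorphic_on UNIV" and H_dser: "\<And>s. Re s > 1 \<Longrightarrow> H s = dser a s"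
    and H_bound: "\<And>s. Re s \<ge> -4 \<Longrightarrow> norm (H s) \<le> C * (1 + norm s) ^ 6"
    and H_zero: "\<And>s. H s = 0 \<Longrightarrow> Re s \<le> 1/2"
    and r: "r > 0" and g: "g holomorphic_on ball (1/2) r"
    and order: "\<And>s. s \<in> ball (1/2) r \<Longrightarrow> H s = (s - 1/2) ^ m * g s" "\<And>s. s \<in> ball (1/2) r \<Longrightarrow> g s \<noteq> 0"
begin

text \<open>Adding \<open>m / z\<close> cancels the pole of the logarithmic derivative at the
  central point. It is the source of the term \<open>m * v\<close> in \<open>E\<close>, and so of
  the power of \<open>ln x\<close> in the product.\<close>

definition Q :: "complex \<Rightarrow> complex" where
  "Q z = - deriv H (1/2 + z) / H (1/2 + z) + of_nat m / z"

definition c :: "nat \<Rightarrow> complex" where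
  "c n = mangoldt n * a n * of_real (real n powr (-1/2))"

definition E :: "real \<Rightarrow> complex" where
  "E v = (\<Sum>n\<in>upto_exp v. c n) + of_real (real m * v)"

text \<open>The primitive of \<open>E\<close>, a Riesz mean of the prime sum; its Perron kernel
  \<open>1 / z ^ 2\<close> is absolutely integrable.\<close>

definition E1 :: "real \<Rightarrow> complex" where
  "E1 v = (\<Sum>n\<in>upto_exp v. c n * of_real (v - ln (real n))) + of_real (real m * v\<^sup>2 / 2)"

lemma measurable_E [measurable]: "E \<in> borel_measurable borel"
proof -
  have [measurable]: "(\<lambda>v. \<Sum>n\<in>upto_exp v. c n) \<in> borel_measurable borel" by (rule measurable_upto_exp)
  show ?thesis unfolding E_def[abs_def] by measurable
qed

lemma measurable_E1: "E1 \<in> borel_measurable borel"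
proof -
  have [measurable]: "(\<lambda>v. \<Sum>n\<in>upto_exp v. c n) \<in> borel_measurable borel"
    "(\<lambda>v. \<Sum>n\<in>upto_exp v. c n * of_real (ln (real n))) \<in> borel_measurable borel" by (rule measurable_upto_exp)+
  have "E1 = (\<lambda>v. of_real v * (\<Sum>n\<in>upto_exp v. c n) - (\<Sum>n\<in>upto_exp v. c n * of_real (ln (real n))) + of_real (real m * v\<^sup>2 / 2))"
    by (rule ext) (simp add: E1_def algebra_simps sum_subtractf sum_distrib_left)
  then show ?thesis by simp
qed

lemma E1_deriv: "((\<lambda>\<eta>. (E1 (v + \<eta>) - E1 v) / of_real \<eta>) \<longlongrightarrow> E v) (at_right 0)"
proof -
  have "((\<lambda>\<eta>. (\<Sum>n\<in>upto_exp v. c n) + of_real (real m * (v + \<eta> / 2))) \<longlongrightarrow> (\<Sum>n\<in>upto_exp v. c n) + of_real (real m * (v + 0 / 2))) (at_right 0)"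
    by (intro tendsto_intros) auto
  then have "((\<lambda>\<eta>. (\<Sum>n\<in>upto_exp v. c n) + of_real (real m * (v + \<eta> / 2))) \<longlongrightarrow> E v) (at_right 0)"
    by (simp add: E_def)
  moreover have "eventually (\<lambda>\<eta>. (\<Sum>n\<in>upto_exp v. c n) + of_real (real m * (v + \<eta> / 2)) = (E1 (v + \<eta>) - E1 v) / of_real \<eta>) (at_right 0)"
    using upto_exp_right[of v] eventually_at_right_less[of 0]
  proof eventually_elim
    case (elim \<eta>)
    have "E1 (v + \<eta>) - E1 v = (\<Sum>n\<in>upto_exp v. c n * of_real \<eta>) + of_real (real m * (v + \<eta>)\<^sup>2 / 2 - real m * v\<^sup>2 / 2)"
      unfolding E1_def elim(1) by (simp add: algebra_simps sum_subtractf sum.distrib)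
    also have "real m * (v + \<eta>)\<^sup>2 / 2 - real m * v\<^sup>2 / 2 = (real m * (v + \<eta> / 2)) * \<eta>"
      by (simp add: power2_eq_square algebra_simps)
    finally have "E1 (v + \<eta>) - E1 v = ((\<Sum>n\<in>upto_exp v. c n) + of_real (real m * (v + \<eta> / 2))) * of_real \<eta>"
      by (simp only: sum_distrib_right[symmetric] of_real_mult distrib_right)
    then show ?case using elim(2) by simp
  qed
  ultimately show ?thesis by (rule Lim_transform_eventually)
qed

lemma Q_holomorphic: "Q holomorphic_on {z. Re z > 0}"
proof -
  have nz: "H (1/2 + z) \<noteq> 0" if "Re z > 0" for z using H_zero[of "1/2 + z"] that by auto
  have dH: "deriv H holomorphic_on UNIV" using H by (rule holomorphic_deriv) simp
  have "(H \<circ> (\<lambda>z. 1/2 + z)) holomorphic_on {z. Re z > 0}"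
    by (rule holomorphic_on_compose_gen[OF _ H]) (auto intro!: holomorphic_intros)
  moreover have "(deriv H \<circ> (\<lambda>z. 1/2 + z)) holomorphic_on {z. Re z > 0}"
    by (rule holomorphic_on_compose_gen[OF _ dH]) (auto intro!: holomorphic_intros)
  ultimately show ?thesis unfolding Q_def[abs_def] o_def
    using nz by (intro holomorphic_intros) auto
qed

lemma Q_eq_series:
  assumes "Re z > 1/2"
  shows "(\<lambda>n. c n * of_nat n powr (-z)) sums (Q z - of_nat m / z)"
proof -
  let ?s = "1/2 + z"
  have s: "Re ?s > 1" using assms by simp
  have "(H has_field_derivative - dser (\<lambda>n. of_real (ln (real n)) * a n) ?s) (at ?s)"
    by (rule has_field_derivative_transform_within_open[OF has_field_derivative_dser[OF dconv s] open_halfspace_Re_gt[of 1]])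
      (use s H_dser in auto)
  then have "deriv H ?s = - (dser (\<lambda>n. mangoldt n * a n) ?s * dser a ?s)"
    using DERIV_imp_deriv dser_ln[OF s] by metis
  then have "Q z - of_nat m / z = dser (\<lambda>n. mangoldt n * a n) ?s"
    using H_dser[OF s] dser_nonzero[OF s] by (simp add: Q_def)
  moreover have "mangoldt n * a n * of_nat n powr (- ?s) = c n * of_nat n powr (-z)" for n
  proof (cases "n = 0")
    case False
    have "complex_of_nat n powr (- ?s) = of_nat n powr (-1/2) * of_nat n powr (-z)"
      using powr_add[of "complex_of_nat n" "-1/2" "-z"] False by simp
    also have "complex_of_nat n powr (-1/2) = of_real (real n powr (-1/2))"
      using powr_of_real[of "real n" "-1/2"] by simp
    finally show ?thesis by (simp add: c_def)
  qed (simp add: c_def)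
  ultimately show ?thesis using dser_sums[OF dconv_Lambda s] by (simp only:)
qed

text \<open>The line \<open>Re z = 3/2\<close> is \<open>Re s = 2\<close>, where the Dirichlet
  series converges absolutely and can be integrated term by term. \<open>perron_kernel_1\<close>
  cuts the sum off at \<open>exp v\<close>, and \<open>perron_kernel_2\<close> evaluates the term
  \<open>m / z\<close>.\<close>

lemma E1_representation:
  assumes v: "v \<ge> 0"
  shows "of_real (2 * pi) * E1 v = (LINT t|lborel. Q (Complex (3/2) t) * (exp (Complex (3/2) t * of_real v) / Complex (3/2) t ^ 2))"
proof -
  let ?z = "Complex (3/2)"
  have zn: "?z t \<noteq> 0" for t by (simp add: complex_eq_iff)
  let ?k = "\<lambda>w t. exp (?z t * of_real w) / ?z t ^ 2"
  have ik: "integrable lborel (?k w)" for w by (rule integrable_exp_over_power(1)) auto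
  define f where "f = (\<lambda>n t. c n * ?k (v - ln (real n)) t)"
  have powr_eq: "c n * of_nat n powr (- ?z t) * ?k v t = f n t" for n t
  proof (cases "n = 0")
    case False
    have "complex_of_nat n powr (- ?z t) * exp (?z t * of_real v) = exp (?z t * of_real (v - ln (real n)))"
      using False by (simp add: powr_def Ln_of_nat exp_add[symmetric] algebra_simps)
    then show ?thesis by (simp add: f_def mult.assoc)
  qed (simp add: f_def c_def)
  have fn: "norm (f n t) = (norm (c n) * real n powr (-3/2)) * norm (?k v t)" for n t
    unfolding powr_eq[symmetric] norm_mult norm_nat_powr by simp
  have sm: "summable (\<lambda>n. norm (c n) * real n powr (-3/2))"
  proof -
    have "summable (\<lambda>n. norm (mangoldt n * a n) * real n powr (-2))"
      using dconv_Lambda by (simp add: dconv_def)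
    moreover have "norm (c n) * real n powr (-3/2) = norm (mangoldt n * a n) * real n powr (-2)" for n
    proof -
      have "real n powr (-1/2) * real n powr (-3/2) = real n powr (-1/2 + -3/2)" by (rule powr_add[symmetric])
      then show ?thesis by (simp add: c_def norm_mult mult.assoc)
    qed
    ultimately show ?thesis by simp
  qed
  have isum: "(LINT t|lborel. (\<Sum>n. f n t)) = (\<Sum>n. LINT t|lborel. f n t)"
  proof (rule integral_suminf)
    show "integrable lborel (f n)" for n unfolding f_def by (intro integrable_mult_right ik)
    show "AE t in lborel. summable (\<lambda>n. norm (f n t))" unfolding fn by (intro AE_I2 summable_mult2 sm)
    show "summable (\<lambda>n. LINT t|lborel. norm (f n t))" unfolding fn integral_mult_right_zero by (intro summable_mult2 sm)
  qed
  have ser: "(\<Sum>n. f n t) = (Q (?z t) - of_nat m / ?z t) * ?k v t" for t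
  proof -
    have "(\<lambda>n. c n * of_nat n powr (- ?z t) * ?k v t) sums ((Q (?z t) - of_nat m / ?z t) * ?k v t)"
      by (intro sums_mult2 Q_eq_series) simp
    then show ?thesis unfolding powr_eq by (simp add: sums_iff)
  qed
  have each: "(LINT t|lborel. f n t) = c n * of_real (2 * pi * max (v - ln (real n)) 0)" for n
    unfolding f_def integral_mult_right_zero by (subst perron_kernel_1) auto
  have fsum: "(\<Sum>n. LINT t|lborel. f n t) = of_real (2 * pi) * (\<Sum>n\<in>upto_exp v. c n * of_real (v - ln (real n)))"
  proof -
    have "(\<Sum>n. LINT t|lborel. f n t) = (\<Sum>n\<in>upto_exp v. LINT t|lborel. f n t)"
    proof (rule suminf_finite)
      fix n assume "n \<notin> upto_exp v"
      then have "n = 0 \<or> v - ln (real n) \<le> 0" by (auto simp: upto_exp_iff_ln)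
      then show "(LINT t|lborel. f n t) = 0" unfolding each by (auto simp: c_def max_def)
    qed simp
    also have "\<dots> = (\<Sum>n\<in>upto_exp v. of_real (2 * pi) * (c n * of_real (v - ln (real n))))"
      unfolding each by (intro sum.cong refl) (auto simp: upto_exp_iff_ln max_def)
    finally show ?thesis by (simp only: sum_distrib_left)
  qed
  have k3: "of_nat m / ?z t * ?k v t = of_nat m * (exp (?z t * of_real v) / ?z t ^ 3)" for t
    using zn[of t] by (simp add: power2_eq_square power3_eq_cube)
  have i3: "integrable lborel (\<lambda>t. of_nat m / ?z t * ?k v t)"
    unfolding k3 by (intro integrable_mult_right integrable_exp_over_power(1)) auto
  have if': "integrable lborel (\<lambda>t. (Q (?z t) - of_nat m / ?z t) * ?k v t)"
  proof -
    have "integrable lborel (\<lambda>t. \<Sum>n. f n t)"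
    proof (rule integrable_suminf)
      show "integrable lborel (f n)" for n unfolding f_def by (intro integrable_mult_right ik)
      show "AE t in lborel. summable (\<lambda>n. norm (f n t))" unfolding fn by (intro AE_I2 summable_mult2 sm)
      show "summable (\<lambda>n. LINT t|lborel. norm (f n t))" unfolding fn integral_mult_right_zero by (intro summable_mult2 sm)
    qed
    then show ?thesis unfolding ser .
  qed
  have "(LINT t|lborel. Q (?z t) * ?k v t) = (LINT t|lborel. (Q (?z t) - of_nat m / ?z t) * ?k v t + of_nat m / ?z t * ?k v t)"
    by (intro Bochner_Integration.integral_cong refl) (simp only: left_diff_distrib diff_add_cancel)
  also have "\<dots> = (LINT t|lborel. (Q (?z t) - of_nat m / ?z t) * ?k v t) + (LINT t|lborel. of_nat m / ?z t * ?k v t)"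
    by (rule Bochner_Integration.integral_add[OF if' i3])
  also have "(LINT t|lborel. (Q (?z t) - of_nat m / ?z t) * ?k v t) = of_real (2 * pi) * (\<Sum>n\<in>upto_exp v. c n * of_real (v - ln (real n)))"
    unfolding ser[symmetric] isum by (rule fsum)
  also have "(LINT t|lborel. of_nat m / ?z t * ?k v t) = of_nat m * of_real (pi * v\<^sup>2)"
    unfolding k3 integral_mult_right_zero using v by (subst perron_kernel_2) auto
  finally show ?thesis by (simp add: E1_def algebra_simps)
qed

text \<open>With the zero at 1/2 divided out, \<open>Q\<close> is \<open>- g' / g\<close> near 0,
  which is continuous on a compact disc.\<close>

lemma Q_bounded_near_0: "\<exists>r0 C0. 0 < r0 \<and> r0 \<le> 1 \<and> (\<forall>z. z \<noteq> 0 \<longrightarrow> norm z < r0 \<longrightarrow> norm (Q z) \<le> C0)"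
proof -
  define r0 where "r0 = min 1 (r/2)"
  have r0: "0 < r0" "r0 \<le> 1" "r0 < r" using r by (auto simp: r0_def)
  have dg: "deriv g holomorphic_on ball (1/2) r" using g by (rule holomorphic_deriv) simp
  have sub: "cball (1/2) r0 \<subseteq> ball (1/2::complex) r" using r0 by auto
  have "continuous_on (cball (1/2) r0) (\<lambda>s. deriv g s / g s)"
    using order(2) sub by (intro continuous_on_divide continuous_on_subset[OF holomorphic_on_imp_continuous_on[OF dg]]
        continuous_on_subset[OF holomorphic_on_imp_continuous_on[OF g]]) auto
  then have "compact ((\<lambda>s. deriv g s / g s) ` cball (1/2) r0)" by (intro compact_continuous_image) auto
  then obtain C0 where C0: "\<forall>w\<in>(\<lambda>s. deriv g s / g s) ` cball (1/2) r0. norm w \<le> C0"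
    using compact_imp_bounded bounded_iff by metis
  have "norm (Q z) \<le> C0" if z: "z \<noteq> 0" "norm z < r0" for z
  proof -
    let ?s = "1/2 + z"
    have sb: "?s \<in> ball (1/2) r" "?s \<in> cball (1/2) r0" using z r0 by (auto simp: dist_norm)
    have "((\<lambda>s. (s - 1/2) ^ m * g s) has_field_derivative (of_nat m * (?s - 1/2) ^ (m - 1) * g ?s + (?s - 1/2) ^ m * deriv g ?s)) (at ?s)"
      by (rule derivative_eq_intros holomorphic_derivI[OF g open_ball sb(1)] refl | simp)+
    then have "(H has_field_derivative (of_nat m * (?s - 1/2) ^ (m - 1) * g ?s + (?s - 1/2) ^ m * deriv g ?s)) (at ?s)"
      by (rule has_field_derivative_transform_within_open[OF _ open_ball sb(1)]) (use order(1) in auto)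
    then have dH: "deriv H ?s = of_nat m * z ^ (m - 1) * g ?s + z ^ m * deriv g ?s"
      using DERIV_imp_deriv by fastforce
    have Hs: "H ?s = z ^ m * g ?s" using order(1)[OF sb(1)] by simp
    have gn: "g ?s \<noteq> 0" by (rule order(2)[OF sb(1)])
    have "deriv H ?s / H ?s = of_nat m / z + deriv g ?s / g ?s"
    proof (cases "m = 0")
      case False
      then have "z ^ m = z * z ^ (m - 1)" by (metis power_eq_if)
      then show ?thesis unfolding dH Hs using z gn by (simp add: field_simps)
    qed (use dH Hs gn in simp)
    then have "Q z = - (deriv g ?s / g ?s)" by (simp add: Q_def)
    then show ?thesis using C0 sb(2) by simp
  qed
  then show ?thesis using r0 by blast
qed

text \<open>It remains to bound the mass of |Q| / |z| on unit intervals, where two singular factors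
  could meet. Near the centre 1/|z| is as large as \<open>1 / \<delta>\<close>, but \<open>Q\<close>
  is bounded there and only 1/|z| is averaged; elsewhere 1/|z| is O(1/(1 + |T|)) and only the
  logarithmic derivative is averaged. Either way one logarithm arises.\<close>

theorem E_mean_square:
  "\<exists>K. \<forall>V\<ge>4. (\<integral>\<^sup>+x. ennreal ((norm (E (V + x)))\<^sup>2) * indicator {0..1} x \<partial>lborel) \<le> ennreal (K * (ln V)\<^sup>2)"
proof -
  have Hlow: "norm (H s) \<ge> 1/4" if "Re s = 2" for s
  proof -
    have "norm (dser a s - 1) \<le> 3/4" using that by (intro norm_dser_minus_1) simp
    then show ?thesis using norm_triangle_sub[of 1 "dser a s"] H_dser[of s] that by (simp add: norm_minus_commute)
  qed
  obtain K where K: "K > 0"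
    "\<And>\<sigma> t. 0 < \<sigma> \<Longrightarrow> \<sigma> \<le> 3/2 \<Longrightarrow> norm (deriv H (Complex (1/2 + \<sigma>) t) / H (Complex (1/2 + \<sigma>) t)) \<le> K / \<sigma> * (1 + \<bar>t\<bar>) powr (1/4)"
    "\<And>\<delta> T. 0 < \<delta> \<Longrightarrow> \<delta> \<le> 1/4 \<Longrightarrow>
       (\<integral>\<^sup>+t. ennreal (norm (deriv H (Complex (1/2 + \<delta>) t) / H (Complex (1/2 + \<delta>) t))) * indicator {T - 1/2..T + 1/2} t \<partial>lborel)
         \<le> ennreal (K * ln (1/\<delta>) * (1 + \<bar>T\<bar>) powr (1/4))"
    by (rule logderiv_bounds[OF H H_bound Hlow H_zero]) (assumption+, rule that)
  obtain r0 C0' where r0: "0 < r0" "r0 \<le> 1" and C0': "\<And>z. z \<noteq> 0 \<Longrightarrow> norm z < r0 \<Longrightarrow> norm (Q z) \<le> C0'"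
    using Q_bounded_near_0 by blast
  define C0 where "C0 = max 0 C0'"
  have C0: "C0 \<ge> 0" "\<And>z. z \<noteq> 0 \<Longrightarrow> norm z < r0 \<Longrightarrow> norm (Q z) \<le> C0" using C0' by (force simp: C0_def)+
  let ?D = "\<lambda>\<sigma> t. norm (deriv H (Complex (1/2 + \<sigma>) t) / H (Complex (1/2 + \<sigma>) t))"
  have half: "1/2 + Complex \<sigma> t = Complex (1/2 + \<sigma>) t" for \<sigma> t by (simp add: complex_eq_iff)
  have QD: "norm (Q (Complex \<sigma> t)) \<le> ?D \<sigma> t + real m / norm (Complex \<sigma> t)" for \<sigma> t
    unfolding Q_def half by (rule order_trans[OF norm_triangle_ineq]) (simp add: norm_divide)
  define K' where "K' = K + real m + 40 * C0 + 12 / r0 * (K + real m / r0)"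
  have K': "K' \<ge> K + real m" "K' \<ge> 40 * C0 + 12 / r0 * (K + real m / r0)" "K' \<ge> 0"
    using K(1) C0(1) r0 by (auto simp: K'_def intro!: add_nonneg_nonneg mult_nonneg_nonneg divide_nonneg_nonneg)
  have grow: "norm (Q (Complex \<sigma> t)) \<le> K' / \<sigma> * (1 + \<bar>t\<bar>) powr (1/4)" if \<sigma>: "0 < \<sigma>" "\<sigma> \<le> 3/2" for \<sigma> t
  proof -
    have w: "(1 + \<bar>t\<bar>) powr (1/4) \<ge> 1" by (intro ge_one_powr_ge_zero) auto
    have "real m / norm (Complex \<sigma> t) \<le> real m / \<sigma>"
      using \<sigma> abs_le_norm_Complex(2)[of \<sigma> t] by (intro divide_left_mono mult_pos_pos) auto
    also have "\<dots> \<le> real m / \<sigma> * (1 + \<bar>t\<bar>) powr (1/4)"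
      using mult_left_mono[OF w, of "real m / \<sigma>"] \<sigma> by simp
    finally have "norm (Q (Complex \<sigma> t)) \<le> K / \<sigma> * (1 + \<bar>t\<bar>) powr (1/4) + real m / \<sigma> * (1 + \<bar>t\<bar>) powr (1/4)"
      using QD[of \<sigma> t] K(2)[OF \<sigma>, of t] by linarith
    also have "\<dots> = (K + real m) / \<sigma> * (1 + \<bar>t\<bar>) powr (1/4)" by (simp add: add_divide_distrib distrib_right)
    also have "\<dots> \<le> K' / \<sigma> * (1 + \<bar>t\<bar>) powr (1/4)" using K' \<sigma> by (intro mult_right_mono divide_right_mono) auto
    finally show ?thesis .
  qed
  have block: "(\<integral>\<^sup>+t. ennreal (norm (Q (Complex \<delta> t)) / norm (Complex \<delta> t)) * indicator {T - 1/2..T + 1/2} t \<partial>lborel)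
         \<le> ennreal (K' * ln (1/\<delta>) * (1 + \<bar>T\<bar>) powr (-3/4))" if \<delta>: "0 < \<delta>" "\<delta> \<le> 1/4" for \<delta> T
  proof -
    let ?I = "\<lambda>t. indicator {T - 1/2..T + 1/2} t :: ennreal"
    let ?w = "(1 + \<bar>T\<bar>) powr (-3/4)"
    have ln1: "ln (1/\<delta>) \<ge> 1"
    proof -
      have "exp 1 \<le> (4::real)" using exp_le by simp
      also have "4 \<le> 1/\<delta>" using \<delta> by (simp add: field_simps)
      finally show ?thesis using \<delta> by (subst ln_ge_iff) auto
    qed
    \<comment> \<open>\<open>A\<close> serves the part \<open>norm z < r0\<close>, where
      \<open>1 + \<bar>T\<bar> \<le> 3\<close> and hence \<open>5 * ?w \<ge> 1\<close>;
      \<open>B\<close> serves the rest, where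
      \<open>(1 + \<bar>T\<bar>) * r0 \<le> 6 * norm z\<close>. Both decay in \<open>T\<close>, so
      the two bounds can simply be added.\<close>
    define A where "A = C0 * 5 * ?w"
    define B where "B = 6 / r0 * (1 + \<bar>T\<bar>) powr (-1)"
    have AB: "A \<ge> 0" "B \<ge> 0" using C0 r0 by (auto simp: A_def B_def)
    have Hm: "(\<lambda>t. ?D \<delta> t) \<in> borel_measurable borel"
    proof -
      have "(\<lambda>t. Q (Complex \<delta> t) - of_nat m / Complex \<delta> t) \<in> borel_measurable borel"
        using measurable_vertical_comp[OF Q_holomorphic \<delta>(1)] by measurable
      then have "(\<lambda>t. norm (Q (Complex \<delta> t) - of_nat m / Complex \<delta> t)) \<in> borel_measurable borel" by measurable
      moreover have "norm (Q (Complex \<delta> t) - of_nat m / Complex \<delta> t) = ?D \<delta> t" for t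
        unfolding Q_def half by (simp add: norm_divide)
      ultimately show ?thesis by (simp only:)
    qed
    note [measurable] = Hm
    have pt: "norm (Q (Complex \<delta> t)) / norm (Complex \<delta> t) \<le> A * (1 / max \<delta> \<bar>t - 0\<bar>) + (B * ?D \<delta> t + B * (real m / r0))" if t: "t \<in> {T - 1/2..T + 1/2}" for t
    proof -
      have tT: "\<bar>t - T\<bar> \<le> 1/2" using t by (auto simp: abs_if)
      let ?n = "norm (Complex \<delta> t)"
      have n: "?n > 0" "max \<delta> \<bar>t\<bar> \<le> ?n" using \<delta> abs_le_norm_Complex[of \<delta> t] abs_le_norm_Complex[of t \<delta>] by (auto simp: complex_eq_iff)
      show ?thesis
      proof (cases "?n < r0")
        case True
        then have "\<bar>t\<bar> < 1" using n r0 by linarith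
        then have T2: "1 + \<bar>T\<bar> \<le> 3" using tT by linarith
        have w5: "5 * ?w \<ge> 1"
        proof -
          have "(1 + \<bar>T\<bar>) powr (3/4) \<le> (1 + \<bar>T\<bar>) powr 1" by (intro powr_mono) auto
          then have "(1 + \<bar>T\<bar>) powr (3/4) \<le> 5" using T2 by simp
          then show ?thesis by (simp add: powr_minus field_simps)
        qed
        have "norm (Q (Complex \<delta> t)) / ?n \<le> C0 / max \<delta> \<bar>t\<bar>"
          using C0(2)[of "Complex \<delta> t"] True n \<delta> by (intro frac_le C0(1)) auto
        also have "\<dots> = C0 * 1 * (1 / max \<delta> \<bar>t\<bar>)" by simp
        also have "\<dots> \<le> C0 * (5 * ?w) * (1 / max \<delta> \<bar>t\<bar>)"
          using w5 C0 \<delta> by (intro mult_right_mono mult_left_mono) auto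
        also have "\<dots> = A * (1 / max \<delta> \<bar>t - 0\<bar>)" by (simp add: A_def)
        finally have le: "norm (Q (Complex \<delta> t)) / ?n \<le> A * (1 / max \<delta> \<bar>t - 0\<bar>)" .
        have "0 \<le> B * ?D \<delta> t + B * (real m / r0)" using AB r0 by simp
        with le show ?thesis by linarith
      next
        case False
        have low: "(1 + \<bar>T\<bar>) * r0 \<le> 6 * ?n"
        proof (cases "\<bar>t\<bar> \<le> 2")
          case True
          then have "1 + \<bar>T\<bar> \<le> 6" using tT by linarith
          then have "(1 + \<bar>T\<bar>) * r0 \<le> 6 * r0" using r0 by (intro mult_right_mono) auto
          then show ?thesis using False by linarith
        next
          case False
          have "(1 + \<bar>T\<bar>) * r0 \<le> (1 + \<bar>T\<bar>) * 1" using r0 by (intro mult_left_mono) auto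
          moreover have "1 + \<bar>T\<bar> \<le> 6 * \<bar>t\<bar>" using False tT by arith
          ultimately show ?thesis using n by simp
        qed
        have inv: "1 / ?n \<le> B"
        proof -
          have "1 / ?n \<le> 6 / ((1 + \<bar>T\<bar>) * r0)" using low n r0 by (simp add: field_simps add_pos_nonneg)
          also have "\<dots> = B" by (simp add: B_def powr_minus divide_inverse)
          finally show ?thesis .
        qed
        have "norm (Q (Complex \<delta> t)) / ?n = norm (Q (Complex \<delta> t)) * (1 / ?n)" by simp
        also have "\<dots> \<le> (?D \<delta> t + real m / r0) * B"
        proof (intro mult_mono inv)
          have "real m / ?n \<le> real m / r0" using False r0 by (intro divide_left_mono mult_pos_pos) auto
          then show "norm (Q (Complex \<delta> t)) \<le> ?D \<delta> t + real m / r0" using QD[of \<delta> t] by linarith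
        qed (use n r0 in auto)
        also have "\<dots> = B * ?D \<delta> t + B * (real m / r0)" by (simp add: algebra_simps)
        finally have le: "norm (Q (Complex \<delta> t)) / ?n \<le> B * ?D \<delta> t + B * (real m / r0)" .
        have "0 \<le> A * (1 / max \<delta> \<bar>t - 0\<bar>)" using AB \<delta> by simp
        with le show ?thesis by linarith
      qed
    qed
    have "(\<integral>\<^sup>+t. ennreal (norm (Q (Complex \<delta> t)) / norm (Complex \<delta> t)) * ?I t \<partial>lborel)
      \<le> (\<integral>\<^sup>+t. ennreal A * (ennreal (1 / max \<delta> \<bar>t - 0\<bar>) * ?I t) + (ennreal B * (ennreal (?D \<delta> t) * ?I t) + ennreal (B * (real m / r0)) * ?I t) \<partial>lborel)"
    proof (intro nn_integral_mono)
      fix t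
      show "ennreal (norm (Q (Complex \<delta> t)) / norm (Complex \<delta> t)) * ?I t \<le> ennreal A * (ennreal (1 / max \<delta> \<bar>t - 0\<bar>) * ?I t) + (ennreal B * (ennreal (?D \<delta> t) * ?I t) + ennreal (B * (real m / r0)) * ?I t)"
      proof (cases "t \<in> {T - 1/2..T + 1/2}")
        case True
        have e: "ennreal (A * (1 / max \<delta> \<bar>t - 0\<bar>) + (B * ?D \<delta> t + B * (real m / r0))) = ennreal A * ennreal (1 / max \<delta> \<bar>t - 0\<bar>) + (ennreal B * ennreal (?D \<delta> t) + ennreal (B * (real m / r0)))"
        proof -
          have "ennreal (A * x + (B * y + z)) = ennreal A * ennreal x + (ennreal B * ennreal y + ennreal z)"
            if "x \<ge> 0" "y \<ge> 0" "z \<ge> 0" for x y z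
            using that AB by (simp add: ennreal_plus ennreal_mult)
          then show ?thesis by this (use AB \<delta> r0 in auto)
        qed
        have I: "?I t = 1" using True by simp
        show ?thesis unfolding I mult_1_right using ennreal_leI[OF pt[OF True]] unfolding e .
      qed simp
    qed
    also have "\<dots> = ennreal A * (\<integral>\<^sup>+t. ennreal (1 / max \<delta> \<bar>t - 0\<bar>) * ?I t \<partial>lborel) + (ennreal B * (\<integral>\<^sup>+t. ennreal (?D \<delta> t) * ?I t \<partial>lborel) + ennreal (B * (real m / r0)) * (\<integral>\<^sup>+t. ?I t \<partial>lborel))"
      by (subst nn_integral_add, measurable, subst nn_integral_add, measurable) (simp add: nn_integral_cmult del: nn_integral_indicator)
    also have "\<dots> \<le> ennreal A * ennreal (7 * ln (1/\<delta>)) + (ennreal B * ennreal (K * ln (1/\<delta>) * (1 + \<bar>T\<bar>) powr (1/4)) + ennreal (B * (real m / r0)) * ennreal 1)"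
      by (intro add_mono mult_left_mono nn_integral_inverse_dist K(3) \<delta>) auto
    also have "\<dots> = ennreal (A * (7 * ln (1/\<delta>)) + (B * (K * ln (1/\<delta>) * (1 + \<bar>T\<bar>) powr (1/4)) + B * (real m / r0)))"
    proof -
      have "A * (7 * ln (1/\<delta>)) \<ge> 0" "B * (K * ln (1/\<delta>) * (1 + \<bar>T\<bar>) powr (1/4)) \<ge> 0" "B * (real m / r0) \<ge> 0"
        "7 * ln (1/\<delta>) \<ge> 0" "K * ln (1/\<delta>) * (1 + \<bar>T\<bar>) powr (1/4) \<ge> 0"
        using AB ln1 K(1) r0 by (auto intro!: mult_nonneg_nonneg)
      then show ?thesis using AB by (simp only: ennreal_plus ennreal_mult add_nonneg_nonneg mult_1_right ennreal_1)
    qed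
    also have "\<dots> \<le> ennreal (K' * ln (1/\<delta>) * ?w)"
    proof (rule ennreal_leI)
      \<comment> \<open>The power -1 from 1/|z| meets the growth 1/4 of the logarithmic derivative
        and leaves -3/4.\<close>
      have pw: "(1 + \<bar>T\<bar>) powr (-1) * (1 + \<bar>T\<bar>) powr (1/4) = ?w"
        using powr_add[of "1 + \<bar>T\<bar>" "-1" "1/4"] by simp
      have w1: "(1 + \<bar>T\<bar>) powr (-1) \<le> ?w" by (intro powr_mono) auto
      have "A * (7 * ln (1/\<delta>)) = 35 * C0 * ln (1/\<delta>) * ?w" by (simp add: A_def)
      moreover have "35 * C0 * ln (1/\<delta>) * ?w \<le> 40 * C0 * ln (1/\<delta>) * ?w" using C0 ln1 by (intro mult_right_mono) auto
      moreover have "B * (K * ln (1/\<delta>) * (1 + \<bar>T\<bar>) powr (1/4)) = 6 / r0 * K * ln (1/\<delta>) * ?w"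
        unfolding B_def pw[symmetric] by (simp only: mult_ac)
      moreover have "6 / r0 * K * ln (1/\<delta>) * ?w \<le> 12 / r0 * K * ln (1/\<delta>) * ?w"
        using r0 K(1) ln1 by (intro mult_right_mono divide_right_mono) auto
      moreover have "B * (real m / r0) \<le> 12 / r0 * (real m / r0) * ln (1/\<delta>) * ?w"
      proof -
        have "B * (real m / r0) = 6 / r0 * (real m / r0) * 1 * (1 + \<bar>T\<bar>) powr (-1)" by (simp add: B_def)
        also have "\<dots> \<le> 12 / r0 * (real m / r0) * ln (1/\<delta>) * ?w"
          using r0 ln1 w1 by (intro mult_mono mult_nonneg_nonneg divide_right_mono) auto
        finally show ?thesis .
      qed
      ultimately have "A * (7 * ln (1/\<delta>)) + (B * (K * ln (1/\<delta>) * (1 + \<bar>T\<bar>) powr (1/4)) + B * (real m / r0))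
         \<le> 40 * C0 * ln (1/\<delta>) * ?w + (12 / r0 * K * ln (1/\<delta>) * ?w + 12 / r0 * (real m / r0) * ln (1/\<delta>) * ?w)" by linarith
      also have "\<dots> = (40 * C0 + 12 / r0 * (K + real m / r0)) * ln (1/\<delta>) * ?w" by (simp only: distrib_left distrib_right add.assoc)
      also have "\<dots> \<le> K' * ln (1/\<delta>) * ?w" using K' ln1 by (intro mult_right_mono) auto
      finally show "A * (7 * ln (1/\<delta>)) + (B * (K * ln (1/\<delta>) * (1 + \<bar>T\<bar>) powr (1/4)) + B * (real m / r0)) \<le> K' * ln (1/\<delta>) * ?w" .
    qed
    finally show ?thesis .
  qed
  have "(\<integral>\<^sup>+x. ennreal ((norm (E (V + x)))\<^sup>2) * indicator {0..1} x \<partial>lborel) \<le> ennreal (216000 * K'\<^sup>2 * (ln V)\<^sup>2)" if "V \<ge> 4" for V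
    by (rule local_mean_square[OF Q_holomorphic K'(3) grow block E1_representation E1_deriv measurable_E1 that])
  then show ?thesis by blast
qed

end

section \<open>Partial summation\<close>

lemma upto_exp_mono: "v \<le> w \<Longrightarrow> upto_exp v \<subseteq> upto_exp w"
  by (auto simp: upto_exp_iff_ln)

text \<open>At \<open>n = 1\<close> the denominator is 0, and the convention for division makes the
  term 0.\<close>

definition lnsum :: "(nat \<Rightarrow> complex) \<Rightarrow> real \<Rightarrow> complex" where
  "lnsum b v = (\<Sum>n\<in>upto_exp v. b n / of_real (ln (real n)))"

text \<open>\<open>lnsum b v + k * ln v\<close> is the integral of \<open>1 / v\<close> against
  \<open>R\<close>; integrating by parts and moving the boundary term \<open>R v / v\<close> into
  \<open>F\<close> leaves exactly the integral of \<open>R v / v ^ 2\<close>. The conclusion is a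
  bound by a nonnegative integral because \<open>R\<close> will be controlled in mean.\<close>

theorem partial_summation:
  fixes b :: "nat \<Rightarrow> complex" and k :: complex
  defines "R \<equiv> \<lambda>v. (\<Sum>n\<in>upto_exp v. b n) + k * of_real v"
  defines "F \<equiv> \<lambda>v. lnsum b v + k * of_real (ln v) - R v / of_real v"
  assumes b1: "b 1 = 0" and V: "0 < V1" "V1 \<le> V2"
  shows "ennreal (norm (F V2 - F V1)) \<le> (\<integral>\<^sup>+v. ennreal (norm (R v) / v\<^sup>2) * indicator {V1..V2} v \<partial>lborel)"
proof -
  let ?l = "\<lambda>n. ln (real n)"
  have hb: "has_bochner_integral lborel (\<lambda>v. indicator {a..V2} v *\<^sub>R complex_of_real (1 / v\<^sup>2)) (of_real (1 / a - 1 / V2))"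
    if a: "0 < a" "a \<le> V2" for a
  proof -
    have d: "((\<lambda>v. complex_of_real (- 1 / v)) has_vector_derivative complex_of_real (1 / x\<^sup>2)) (at x within {a..V2})"
      if x: "a \<le> x" "x \<le> V2" for x
    proof -
      have "((\<lambda>v. - 1 / v) has_real_derivative (1 / x\<^sup>2)) (at x within {a..V2})"
        using x a by (auto intro!: derivative_eq_intros simp: power2_eq_square)
      then show ?thesis by (rule has_vector_derivative_of_real)
    qed
    have ct: "continuous_on {a..V2} (\<lambda>x. complex_of_real (1 / x\<^sup>2))"
      using a by (auto intro!: continuous_intros)
    show ?thesis using has_bochner_integral_FTC_Icc[OF a(2) d ct] by simp
  qed
  have d: "((\<lambda>v. complex_of_real (ln v)) has_vector_derivative complex_of_real (1 / x)) (at x within {V1..V2})"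
    if x: "V1 \<le> x" "x \<le> V2" for x
  proof -
    have "(ln has_real_derivative (1 / x)) (at x within {V1..V2})"
      using x V by (auto intro!: derivative_eq_intros)
    then show ?thesis by (rule has_vector_derivative_of_real)
  qed
  have ct: "continuous_on {V1..V2} (\<lambda>x. complex_of_real (1 / x))"
    using V by (auto intro!: continuous_intros)
  have "has_bochner_integral lborel (\<lambda>v. indicator {V1..V2} v *\<^sub>R complex_of_real (1 / v)) (of_real (ln V2) - of_real (ln V1))"
    by (rule has_bochner_integral_FTC_Icc[OF V(2) d ct])
  then have hl: "has_bochner_integral lborel (\<lambda>v. k * (indicator {V1..V2} v *\<^sub>R complex_of_real (1 / v))) (k * (of_real (ln V2) - of_real (ln V1)))"
    by (rule has_bochner_integral_mult_right)
  let ?U = "upto_exp V2"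
  \<comment> \<open>Each difference \<open>1 / ln n - 1 / V2\<close> is the integral of
    \<open>1 / v ^ 2\<close> from \<open>ln n\<close> to \<open>V2\<close>. Cutting the range off
    below at \<open>V1\<close> accounts for the terms already present in
    \<open>F V1\<close>.\<close>
  define g where "g = (\<lambda>v. (\<Sum>n\<in>?U. b n * (indicator {max V1 (?l n)..V2} v *\<^sub>R complex_of_real (1 / v\<^sup>2)))
      + k * (indicator {V1..V2} v *\<^sub>R complex_of_real (1 / v)))"
  define I where "I = (\<Sum>n\<in>?U. b n * of_real (1 / max V1 (?l n) - 1 / V2)) + k * (of_real (ln V2) - of_real (ln V1))"
  have hg: "has_bochner_integral lborel g I"
    unfolding g_def I_def
    by (intro has_bochner_integral_add hl has_bochner_integral_sum has_bochner_integral_mult_right hb)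
      (use V in \<open>auto simp: upto_exp_iff_ln\<close>)
  have sub: "upto_exp V1 \<subseteq> ?U" using V by (intro upto_exp_mono)
  have low: "(\<Sum>n\<in>upto_exp V1. f n) = (\<Sum>n\<in>?U. if ?l n \<le> V1 then f n else 0)" for f :: "nat \<Rightarrow> complex"
    by (subst sum.inter_filter[symmetric]) (use sub in \<open>auto intro!: sum.cong simp: upto_exp_iff_ln\<close>)
  have FI: "F V2 - F V1 = I"
  proof -
    have VV: "V1 \<noteq> 0" "V2 \<noteq> 0" using V by auto
    have R: "R v / of_real v = (\<Sum>n\<in>upto_exp v. b n / of_real v) + k" if "v \<noteq> 0" for v
      using that by (simp add: R_def add_divide_distrib sum_divide_distrib)
    have "F V2 - F V1 = (\<Sum>n\<in>?U. b n / of_real (?l n) - b n / of_real V2 - (if ?l n \<le> V1 then b n / of_real (?l n) else 0)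
        + (if ?l n \<le> V1 then b n / of_real V1 else 0)) + k * (of_real (ln V2) - of_real (ln V1))"
      unfolding F_def R[OF VV(1)] R[OF VV(2)] lnsum_def low by (simp add: sum.distrib sum_subtractf algebra_simps)
    also have "(\<Sum>n\<in>?U. b n / of_real (?l n) - b n / of_real V2 - (if ?l n \<le> V1 then b n / of_real (?l n) else 0)
        + (if ?l n \<le> V1 then b n / of_real V1 else 0)) = (\<Sum>n\<in>?U. b n * of_real (1 / max V1 (?l n) - 1 / V2))"
      by (intro sum.cong refl) (auto simp: max_def field_simps)
    finally show ?thesis by (simp add: I_def)
  qed
  have gR: "g v = indicator {V1..V2} v *\<^sub>R (R v / of_real (v\<^sup>2))" for v
  proof (cases "v \<in> {V1..V2}")
    case True
    then have v: "v > 0" "v \<le> V2" "V1 \<le> v" using V by auto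
    have "(\<Sum>n\<in>upto_exp v. b n) = (\<Sum>n\<in>?U. if ?l n \<le> v then b n else 0)"
      by (subst sum.inter_filter[symmetric]) (use upto_exp_mono[OF v(2)] in \<open>auto intro!: sum.cong simp: upto_exp_iff_ln\<close>)
    moreover have "(\<Sum>n\<in>?U. b n * (indicator {max V1 (?l n)..V2} v *\<^sub>R complex_of_real (1 / v\<^sup>2)))
        = (\<Sum>n\<in>?U. if ?l n \<le> v then b n else 0) / of_real (v\<^sup>2)"
      unfolding sum_divide_distrib using v by (intro sum.cong refl) (auto simp: indicator_def)
    ultimately show ?thesis using True v by (simp add: g_def R_def add_divide_distrib power2_eq_square)
  next
    case False
    then have z: "indicator {max V1 (?l n)..V2} v = (0::real)" "indicator {V1..V2} v = (0::real)" for n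
      by (auto simp: indicator_def)
    show ?thesis unfolding g_def z by simp
  qed
  have geq: "g = (\<lambda>v. indicator {V1..V2} v *\<^sub>R (R v / of_real (v\<^sup>2)))" by (rule ext) (rule gR)
  have "has_bochner_integral lborel (\<lambda>v. indicator {V1..V2} v *\<^sub>R (R v / of_real (v\<^sup>2))) (F V2 - F V1)"
    unfolding FI geq[symmetric] by (rule hg)
  then have "ennreal (norm (F V2 - F V1)) \<le> (\<integral>\<^sup>+v. ennreal (norm (indicator {V1..V2} v *\<^sub>R (R v / of_real (v\<^sup>2)))) \<partial>lborel)"
    by (rule has_bochner_integral_norm_bound)
  also have "\<dots> = (\<integral>\<^sup>+v. ennreal (norm (R v) / v\<^sup>2) * indicator {V1..V2} v \<partial>lborel)"
    by (intro nn_integral_cong) (auto simp: indicator_def norm_divide norm_power)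
  finally show ?thesis .
qed

text \<open>The increments are majorised by decrements of \<open>G\<close> and telescope: any number
  of whole steps followed by one incomplete step, charged as a whole one, costs at most
  \<open>G V\<close>. The values along \<open>V0 + n\<close> are therefore Cauchy, and the rate
  \<open>G\<close> survives in the limit.\<close>

lemma telescoping_limit:
  fixes F :: "real \<Rightarrow> complex" and G :: "real \<Rightarrow> real"
  assumes step: "\<And>V W. V0 \<le> V \<Longrightarrow> V \<le> W \<Longrightarrow> W \<le> V + 1 \<Longrightarrow> norm (F W - F V) \<le> G V - G (V + 1)"
    and G: "\<And>V. V0 \<le> V \<Longrightarrow> G V \<ge> 0" "(G \<longlongrightarrow> 0) at_top"
  shows "\<exists>L. \<forall>V\<ge>V0. norm (F V - L) \<le> G V"
proof -
  have nat_step: "norm (F (V + real n) - F V) \<le> G V - G (V + real n)" if "V0 \<le> V" for V n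
  proof (induction n)
    case (Suc n)
    have "norm (F (V + real n + 1) - F (V + real n)) \<le> G (V + real n) - G (V + real n + 1)"
      using that by (intro step) auto
    moreover have "norm (F (V + real n + 1) - F V) \<le> norm (F (V + real n + 1) - F (V + real n)) + norm (F (V + real n) - F V)"
      by (rule norm_diff_triangle_le) auto
    ultimately show ?case using Suc.IH by (simp add: add_ac)
  qed simp
  have bound: "norm (F W - F V) \<le> G V" if VW: "V0 \<le> V" "V \<le> W" for V W
  proof -
    define n where "n = nat \<lfloor>W - V\<rfloor>"
    have n: "real n \<le> W - V" "W - V \<le> real n + 1" unfolding n_def using VW by (auto simp: of_nat_nat)
    have "norm (F W - F (V + real n)) \<le> G (V + real n) - G (V + real n + 1)"
      using n VW by (intro step) auto
    moreover have "G (V + real n + 1) \<ge> 0" using VW by (intro G) auto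
    moreover have "norm (F W - F V) \<le> norm (F W - F (V + real n)) + norm (F (V + real n) - F V)"
      by (rule norm_diff_triangle_le) auto
    ultimately show ?thesis using nat_step[OF VW(1), of n] by linarith
  qed
  let ?s = "\<lambda>n. V0 + real n"
  have top: "filterlim ?s at_top sequentially" by real_asymp
  have Gs: "(\<lambda>n. G (?s n)) \<longlonglongrightarrow> 0" by (rule filterlim_compose[OF G(2) top])
  have "Cauchy (\<lambda>n. F (?s n))"
  proof (rule CauchyI')
    fix e :: real assume "e > 0"
    then obtain M where M: "\<And>n. n \<ge> M \<Longrightarrow> norm (G (?s n) - 0) < e" using Gs LIMSEQ_D by blast
    show "\<exists>M. \<forall>m\<ge>M. \<forall>n>m. dist (F (?s m)) (F (?s n)) < e"
    proof (intro exI allI impI)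
      fix m n assume "M \<le> m" "m < n"
      then show "dist (F (?s m)) (F (?s n)) < e"
        using bound[of "?s m" "?s n"] M[of m] by (simp add: dist_norm norm_minus_commute)
    qed
  qed
  then obtain L where L: "(\<lambda>n. F (?s n)) \<longlonglongrightarrow> L" using Cauchy_convergent convergent_def by blast
  have "norm (F V - L) \<le> G V" if V: "V \<ge> V0" for V
  proof (rule tendsto_upperbound)
    show "(\<lambda>n. norm (F V - F (?s n))) \<longlonglongrightarrow> norm (F V - L)" by (intro tendsto_intros L)
    have "eventually (\<lambda>n. ?s n \<ge> V) sequentially" using top by (auto simp: filterlim_at_top)
    then show "eventually (\<lambda>n. norm (F V - F (?s n)) \<le> G V) sequentially"
      by eventually_elim (subst norm_minus_commute, rule bound[OF V])
  qed simp
  then show ?thesis by blast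
qed

text \<open>\<open>- (ln v + 1) / v\<close> is a primitive of \<open>ln v / v ^ 2\<close>; the
  factor 4 allows for an intermediate point as large as \<open>2 * V\<close>.\<close>

lemma ln_over_telescope:
  assumes "V \<ge> (3::real)"
  shows "ln V / V\<^sup>2 \<le> 4 * ((ln V + 1) / V - (ln (V + 1) + 1) / (V + 1))"
proof -
  have "\<exists>z>V. z < V + 1 \<and> (- ((ln (V + 1) + 1) / (V + 1))) - (- ((ln V + 1) / V)) = (V + 1 - V) * (ln z / z\<^sup>2)"
    by (rule MVT2) (use assms in \<open>auto intro!: derivative_eq_intros simp: power2_eq_square field_simps\<close>)
  then obtain z where z: "V < z" "z < V + 1" "(ln V + 1) / V - (ln (V + 1) + 1) / (V + 1) = ln z / z\<^sup>2" by auto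
  have "ln V / (2 * V)\<^sup>2 \<le> ln z / z\<^sup>2"
    using z(1,2) assms by (intro frac_le power_mono) auto
  moreover have "ln V / V\<^sup>2 = 4 * (ln V / (2 * V)\<^sup>2)" by (simp add: power_mult_distrib)
  ultimately show ?thesis unfolding z(3) by simp
qed

text \<open>Passes from the mean square to the mean without the Cauchy--Schwarz inequality. With
  \<open>l = ln V\<close>, the size of \<open>E\<close> in mean square, the two terms are of the
  same order \<open>ln V / V ^ 2\<close>.\<close>

lemma weighted_am_gm:
  fixes x l :: real
  assumes "l > 0"
  shows "x / V\<^sup>2 \<le> 1 / (2 * V\<^sup>2) / l * x\<^sup>2 + 1 / (2 * V\<^sup>2) * l"
proof (cases "V = 0")
  case False
  have "0 \<le> (x - l)\<^sup>2 / (2 * V\<^sup>2 * l)" using assms by simp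
  also have "\<dots> = 1 / (2 * V\<^sup>2) / l * x\<^sup>2 + 1 / (2 * V\<^sup>2) * l - x / V\<^sup>2"
    using False assms by (simp add: power2_diff field_simps) (simp add: power2_eq_square)
  finally show ?thesis by simp
qed simp

lemma nn_integral_unit_shift:
  fixes f :: "real \<Rightarrow> ennreal"
  assumes [measurable]: "f \<in> borel_measurable borel"
  shows "(\<integral>\<^sup>+v. f v * indicator {V..V+1} v \<partial>lborel) = (\<integral>\<^sup>+x. f (V + x) * indicator {0..1} x \<partial>lborel)"
proof -
  have "(\<integral>\<^sup>+v. f v * indicator {V..V+1} v \<partial>lborel) = ennreal \<bar>1\<bar> * (\<integral>\<^sup>+x. f (V + 1 * x) * indicator {V..V+1} (V + 1 * x) \<partial>lborel)"
    by (rule nn_integral_real_affine) simp_all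
  also have "\<dots> = (\<integral>\<^sup>+x. f (V + x) * indicator {V..V+1} (V + x) \<partial>lborel)" by simp
  also have "\<dots> = (\<integral>\<^sup>+x. f (V + x) * indicator {0..1} x \<partial>lborel)"
    by (intro nn_integral_cong) (simp add: indicator_def)
  finally show ?thesis .
qed

lemma ennreal_mult_plus: "a \<ge> 0 \<Longrightarrow> x \<ge> 0 \<Longrightarrow> b \<ge> 0 \<Longrightarrow> ennreal (a * x + b) = ennreal a * ennreal x + ennreal b"
  by (simp add: ennreal_mult)

context GRH_L
begin

lemma c1: "c 1 = 0" by (simp add: c_def)

text \<open>Over a unit window the integral of \<open>norm (E v) / v ^ 2\<close> is O(ln V / V^2),
  which is summable over the windows, so \<open>F\<close> converges with the rate
  \<open>(ln V + 1) / V\<close> for every \<open>V\<close>. Only the boundary term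
  \<open>E V / V\<close> is left without a pointwise bound; it alone is responsible for the
  exceptional set.\<close>

theorem lnsum_c:
  "\<exists>L K. K \<ge> 0 \<and> (\<forall>V\<ge>4. norm (lnsum c V + of_nat m * of_real (ln V) - L) \<le> norm (E V) / V + K * (ln V + 1) / V)"
proof -
  obtain K0 where K0: "\<And>V. V \<ge> 4 \<Longrightarrow> (\<integral>\<^sup>+x. ennreal ((norm (E (V + x)))\<^sup>2) * indicator {0..1} x \<partial>lborel) \<le> ennreal (K0 * (ln V)\<^sup>2)"
    using E_mean_square by blast
  define K where "K = max K0 0"
  have K: "K \<ge> 0" "K0 \<le> K" by (auto simp: K_def)
  define G where "G = (\<lambda>V. 4 * (K + 1) * ((ln V + 1) / V))"
  have R: "(\<Sum>n\<in>upto_exp v. c n) + of_nat m * of_real v = E v" for v by (simp add: E_def)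
  define F where "F = (\<lambda>v. lnsum c v + of_nat m * of_real (ln v) - E v / of_real v)"
  have "norm (F W - F V) \<le> G V - G (V + 1)" if V: "4 \<le> V" "V \<le> W" "W \<le> V + 1" for V W
  proof -
    have V0: "V > 0" using V by simp
    have lnV: "ln V \<ge> 1"
    proof -
      have "exp 1 \<le> V" using exp_le V by linarith
      then show ?thesis using V0 by (simp add: ln_ge_iff)
    qed
    let ?w = "1 / (2 * V\<^sup>2)"
    have "ennreal (norm (F W - F V)) \<le> (\<integral>\<^sup>+v. ennreal (norm (E v) / v\<^sup>2) * indicator {V..W} v \<partial>lborel)"
      using partial_summation[of c V W "of_nat m", OF c1] V unfolding R F_def by simp
    also have "\<dots> \<le> (\<integral>\<^sup>+v. (ennreal (?w / ln V) * ennreal ((norm (E v))\<^sup>2) + ennreal (?w * ln V)) * indicator {V..V+1} v \<partial>lborel)"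
    proof (intro nn_integral_mono)
      fix v
      show "ennreal (norm (E v) / v\<^sup>2) * indicator {V..W} v \<le> (ennreal (?w / ln V) * ennreal ((norm (E v))\<^sup>2) + ennreal (?w * ln V)) * indicator {V..V+1} v"
      proof (cases "v \<in> {V..W}")
        case True
        have "norm (E v) / V\<^sup>2 \<le> ?w / ln V * (norm (E v))\<^sup>2 + ?w * ln V"
          by (rule weighted_am_gm) (use lnV in simp)
        moreover have "norm (E v) / v\<^sup>2 \<le> norm (E v) / V\<^sup>2" using True V0 by (intro divide_left_mono power_mono mult_pos_pos) auto
        ultimately have "ennreal (norm (E v) / v\<^sup>2) \<le> ennreal (?w / ln V * (norm (E v))\<^sup>2 + ?w * ln V)" by (intro ennreal_leI) linarith
        also have "\<dots> = ennreal (?w / ln V) * ennreal ((norm (E v))\<^sup>2) + ennreal (?w * ln V)"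
          by (rule ennreal_mult_plus) (use lnV in auto)
        finally show ?thesis using True V by simp
      qed simp
    qed
    also have "\<dots> = (\<integral>\<^sup>+x. (ennreal (?w / ln V) * ennreal ((norm (E (V + x)))\<^sup>2) + ennreal (?w * ln V)) * indicator {0..1} x \<partial>lborel)"
      by (rule nn_integral_unit_shift) measurable
    also have "\<dots> = (\<integral>\<^sup>+x. ennreal (?w / ln V) * (ennreal ((norm (E (V + x)))\<^sup>2) * indicator {0..1} x) + ennreal (?w * ln V) * indicator {0..1} x \<partial>lborel)"
      by (simp only: distrib_right mult.assoc)
    also have "\<dots> = (\<integral>\<^sup>+x. ennreal (?w / ln V) * (ennreal ((norm (E (V + x)))\<^sup>2) * indicator {0..1} x) \<partial>lborel) + (\<integral>\<^sup>+x. ennreal (?w * ln V) * indicator {0..1::real} x \<partial>lborel)"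
      by (rule nn_integral_add) measurable
    also have "\<dots> = ennreal (?w / ln V) * (\<integral>\<^sup>+x. ennreal ((norm (E (V + x)))\<^sup>2) * indicator {0..1} x \<partial>lborel) + ennreal (?w * ln V)"
    proof -
      have 1: "(\<integral>\<^sup>+x. ennreal (?w / ln V) * (ennreal ((norm (E (V + x)))\<^sup>2) * indicator {0..1} x) \<partial>lborel) = ennreal (?w / ln V) * (\<integral>\<^sup>+x. ennreal ((norm (E (V + x)))\<^sup>2) * indicator {0..1} x \<partial>lborel)"
        by (rule nn_integral_cmult) measurable
      have 2: "(\<integral>\<^sup>+x. ennreal (?w * ln V) * indicator {0..1::real} x \<partial>lborel) = ennreal (?w * ln V)"
        by (subst nn_integral_cmult_indicator) simp_all
      show ?thesis unfolding 1 2 ..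
    qed
    also have "\<dots> \<le> ennreal (?w / ln V) * ennreal (K * (ln V)\<^sup>2) + ennreal (?w * ln V)"
    proof (intro add_mono mult_left_mono order.refl)
      have "K0 * (ln V)\<^sup>2 \<le> K * (ln V)\<^sup>2" using K by (intro mult_right_mono) auto
      then show "(\<integral>\<^sup>+x. ennreal ((norm (E (V + x)))\<^sup>2) * indicator {0..1} x \<partial>lborel) \<le> ennreal (K * (ln V)\<^sup>2)"
        using K0[OF V(1)] ennreal_leI order_trans by blast
    qed simp
    also have "\<dots> = ennreal (?w / ln V * (K * (ln V)\<^sup>2) + ?w * ln V)"
      by (rule ennreal_mult_plus[symmetric]) (use lnV K in auto)
    also have "ennreal (?w / ln V * (K * (ln V)\<^sup>2) + ?w * ln V) = ennreal ((K + 1) * (ln V / V\<^sup>2) / 2)"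
    proof -
      have "1 / (2 * V\<^sup>2) / l * (K * l\<^sup>2) + 1 / (2 * V\<^sup>2) * l = (K + 1) * (l / V\<^sup>2) / 2" if "l \<noteq> 0" for l :: real
        using that V0 by (simp add: power2_eq_square field_simps)
      then have "?w / ln V * (K * (ln V)\<^sup>2) + ?w * ln V = (K + 1) * (ln V / V\<^sup>2) / 2" by this (use lnV in simp)
      then show ?thesis by (rule arg_cong)
    qed
    finally have le: "ennreal (norm (F W - F V)) \<le> ennreal ((K + 1) * (ln V / V\<^sup>2) / 2)" .
    have nn: "0 \<le> (K + 1) * (ln V / V\<^sup>2)" using K lnV by (intro mult_nonneg_nonneg divide_nonneg_nonneg) auto
    then have nn2: "0 \<le> (K + 1) * (ln V / V\<^sup>2) / 2" by (rule divide_nonneg_pos) simp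
    have "norm (F W - F V) \<le> (K + 1) * (ln V / V\<^sup>2) / 2" using le unfolding ennreal_le_iff[OF nn2] .
    also have "\<dots> \<le> (K + 1) * (ln V / V\<^sup>2)"
    proof -
      have "x / 2 \<le> x" if "0 \<le> x" for x :: real using that by simp
      then show ?thesis using nn .
    qed
    also have "\<dots> \<le> (K + 1) * (4 * ((ln V + 1) / V - (ln (V + 1) + 1) / (V + 1)))"
      using K V by (intro mult_left_mono ln_over_telescope) auto
    also have "\<dots> = G V - G (V + 1)"
    proof -
      have "(K + 1) * (4 * (x - y)) = 4 * (K + 1) * x - 4 * (K + 1) * y" for x y :: real by (simp add: algebra_simps)
      then show ?thesis unfolding G_def .
    qed
    finally show ?thesis .
  qed
  moreover have "G V \<ge> 0" if "4 \<le> V" for V using that K by (auto simp: G_def intro!: mult_nonneg_nonneg divide_nonneg_nonneg add_nonneg_nonneg)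
  moreover have "(G \<longlongrightarrow> 0) at_top"
  proof -
    have "((\<lambda>V::real. (ln V + 1) / V) \<longlongrightarrow> 0) at_top" by real_asymp
    then show ?thesis unfolding G_def by (rule tendsto_mult_right_zero)
  qed
  ultimately obtain L where L: "\<And>V. V \<ge> 4 \<Longrightarrow> norm (F V - L) \<le> G V"
    using telescoping_limit[of 4 F G] by blast
  show ?thesis
  proof (intro exI[of _ L] exI[of _ "4 * (K + 1)"] conjI allI impI)
    fix V :: real assume V: "V \<ge> 4"
    have "lnsum c V + of_nat m * of_real (ln V) - L = (F V - L) + E V / of_real V" by (simp add: F_def)
    then have "norm (lnsum c V + of_nat m * of_real (ln V) - L) \<le> norm (F V - L) + norm (E V / of_real V)"
      using norm_triangle_ineq by metis
    then show "norm (lnsum c V + of_nat m * of_real (ln V) - L) \<le> norm (E V) / V + 4 * (K + 1) * (ln V + 1) / V"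
      using L[OF V] V by (simp add: norm_divide G_def)
  qed (use K in simp)
qed

end

text \<open>The partial sums have a bounded error here, so the integral over
  \<open>[V / 2, V]\<close> is at most \<open>2 * C / V\<close>, and the boundary terms at
  \<open>V\<close> and \<open>V / 2\<close> are at most \<open>C / V\<close> and
  \<open>2 * C / V\<close>. The main term comes from
  \<open>ln V - ln (V / 2) = ln 2\<close>.\<close>

lemma lnsum_half_difference:
  fixes b :: "nat \<Rightarrow> complex" and k :: complex
  assumes b1: "b 1 = 0" and C: "\<And>v. v \<ge> 0 \<Longrightarrow> norm ((\<Sum>n\<in>upto_exp v. b n) - k * of_real v) \<le> C" and V: "V > 0"
  shows "norm (lnsum b V - lnsum b (V / 2) - k * of_real (ln 2)) \<le> 5 * C / V"
proof -
  let ?R = "\<lambda>v. (\<Sum>n\<in>upto_exp v. b n) + (- k) * of_real v"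
  let ?F = "\<lambda>v. lnsum b v + (- k) * of_real (ln v) - ?R v / of_real v"
  have R: "norm (?R v) \<le> C" if "v \<ge> 0" for v using C[OF that] by simp
  have C0: "C \<ge> 0" using R[of 0] norm_ge_zero order_trans by (metis order.refl)
  have "ennreal (norm (?F V - ?F (V / 2))) \<le> (\<integral>\<^sup>+v. ennreal (norm (?R v) / v\<^sup>2) * indicator {V / 2..V} v \<partial>lborel)"
    by (rule partial_summation) (use b1 V in auto)
  also have "\<dots> \<le> (\<integral>\<^sup>+v. ennreal (4 * C / V\<^sup>2) * indicator {V / 2..V} v \<partial>lborel)"
  proof (intro nn_integral_mono)
    fix v
    show "ennreal (norm (?R v) / v\<^sup>2) * indicator {V / 2..V} v \<le> ennreal (4 * C / V\<^sup>2) * indicator {V / 2..V} v"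
    proof (cases "v \<in> {V / 2..V}")
      case True
      have "norm (?R v) / v\<^sup>2 \<le> C / (V / 2)\<^sup>2"
        using True V R[of v] C0 by (intro frac_le power_mono) auto
      also have "\<dots> = 4 * C / V\<^sup>2" by (simp add: power2_eq_square)
      finally show ?thesis using True by (auto intro!: ennreal_leI)
    qed simp
  qed
  also have "\<dots> = ennreal (4 * C / V\<^sup>2 * (V - V / 2))"
    using V C0 by (subst nn_integral_cmult) (auto simp: ennreal_mult[symmetric])
  also have "\<dots> = ennreal (2 * C / V)" using V by (intro arg_cong[of _ _ ennreal]) (simp add: power2_eq_square field_simps)
  finally have n1: "norm (?F V - ?F (V / 2)) \<le> 2 * C / V" using C0 V by (subst (asm) ennreal_le_iff) auto
  have nd: "norm (x / complex_of_real v) \<le> C / v" if "norm x \<le> C" "v > 0" for x v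
    using that by (simp add: norm_divide divide_right_mono)
  have n2: "norm (?R V / of_real V) \<le> C / V" by (rule nd[OF R]) (use V in auto)
  have n3: "norm (?R (V / 2) / of_real (V / 2)) \<le> 2 * C / V" using nd[OF R[of "V / 2"], of "V / 2"] V by (simp add: mult.commute)
  have "ln V - ln (V / 2) = ln 2" using V by (simp add: ln_div)
  then have ll: "complex_of_real (ln 2) = complex_of_real (ln V) - of_real (ln (V / 2))" by (simp only: of_real_diff[symmetric])
  have "x - y - k * (u - w) = ((x + (-k) * u - r) - (y + (-k) * w - t)) + r - t" for x y u w r t :: complex
    by (simp add: algebra_simps)
  then have "lnsum b V - lnsum b (V / 2) - k * of_real (ln 2) = (?F V - ?F (V / 2)) + ?R V / of_real V - ?R (V / 2) / of_real (V / 2)"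
    unfolding ll .
  moreover have "norm (A + B - D) \<le> norm A + norm B + norm D" for A B D :: complex
    using norm_triangle_ineq4[of "A + B" D] norm_triangle_ineq[of A B] by linarith
  ultimately have "norm (lnsum b V - lnsum b (V / 2) - k * of_real (ln 2))
      \<le> norm (?F V - ?F (V / 2)) + norm (?R V / of_real V) + norm (?R (V / 2) / of_real (V / 2))" by metis
  also have "\<dots> \<le> 2 * C / V + C / V + 2 * C / V" by (rule add_mono[OF add_mono[OF n1 n2] n3])
  also have "\<dots> = 5 * C / V" using V by (simp add: field_simps)
  finally show ?thesis .
qed

section \<open>The logarithm of the partial product\<close>

lemma sum_mangoldt_primepow:
  fixes f :: "nat \<Rightarrow> complex"
  shows "(\<Sum>n\<in>upto_exp v. mangoldt n * f n) =
    (\<Sum>p | prime p \<and> p \<in> upto_exp v. \<Sum>k | p ^ Suc k \<in> upto_exp v. of_real (ln (real p)) * f (p ^ Suc k))"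
proof -
  let ?A = "{p. prime p \<and> p \<in> upto_exp v}" and ?K = "\<lambda>p::nat. {k. p ^ Suc k \<in> upto_exp v}"
  have finA: "finite ?A" by (rule finite_subset[of _ "upto_exp v"]) auto
  have finK: "finite (?K p)" if "prime p" for p
  proof -
    have "inj (\<lambda>k. p ^ Suc k)" using prime_gt_1_nat[OF that] by (intro injI) (simp add: power_inject_exp del: power_Suc)
    from finite_vimageI[OF finite_upto_exp this, of v] show ?thesis by (simp add: vimage_def)
  qed
  have bij: "bij_betw (\<lambda>(p, k). p ^ Suc k) (Sigma ?A ?K) {n \<in> upto_exp v. primepow n}"
  proof (rule bij_betw_subset[OF bij_betw_primepows])
    show "Sigma ?A ?K \<subseteq> Collect prime \<times> UNIV" by auto
    show "(\<lambda>(p, k). p ^ Suc k) ` Sigma ?A ?K = {n \<in> upto_exp v. primepow n}"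
    proof (intro equalityI subsetI)
      fix n assume "n \<in> (\<lambda>(p, k). p ^ Suc k) ` Sigma ?A ?K"
      then obtain p k where "prime p" "n = p ^ Suc k" "n \<in> upto_exp v" by auto
      then show "n \<in> {n \<in> upto_exp v. primepow n}" unfolding primepow_def by blast
    next
      fix n assume n: "n \<in> {n \<in> upto_exp v. primepow n}"
      then obtain p j where pj: "prime p" "j > 0" "n = p ^ j" unfolding primepow_def by auto
      then obtain k where k: "j = Suc k" using gr0_implies_Suc by blast
      have "n > 0" "real n \<le> exp v" using n by (auto simp: upto_exp_def)
      moreover have "p \<le> n" using pj k \<open>n > 0\<close> by (intro dvd_imp_le) auto
      ultimately have "p \<in> upto_exp v" using pj(1) prime_gt_0_nat unfolding upto_exp_def
        by (auto intro: order_trans[of "real p" "real n"])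
      then show "n \<in> (\<lambda>(p, k). p ^ Suc k) ` Sigma ?A ?K" using n pj k by (intro image_eqI[of _ _ "(p, k)"]) auto
    qed
  qed
  have "(\<Sum>n\<in>upto_exp v. mangoldt n * f n) = (\<Sum>n\<in>{n \<in> upto_exp v. primepow n}. mangoldt n * f n)"
    by (intro sum.mono_neutral_right) (auto simp: mangoldt_def)
  also have "\<dots> = (\<Sum>x\<in>Sigma ?A ?K. mangoldt (case x of (p, k) \<Rightarrow> p ^ Suc k) * f (case x of (p, k) \<Rightarrow> p ^ Suc k))"
    by (rule sum.reindex_bij_betw[OF bij, symmetric])
  also have "\<dots> = (\<Sum>(p, k)\<in>Sigma ?A ?K. of_real (ln (real p)) * f (p ^ Suc k))"
    by (intro sum.cong refl) (auto simp del: power_Suc simp: mangoldt_primepow')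
  also have "\<dots> = (\<Sum>p\<in>?A. \<Sum>k\<in>?K p. of_real (ln (real p)) * f (p ^ Suc k))"
    by (rule sum.Sigma[symmetric]) (use finA finK in auto)
  finally show ?thesis .
qed

lemma prime_power_upto_exp_iff:
  assumes "prime p" shows "p ^ Suc k \<in> upto_exp v \<longleftrightarrow> real (Suc k) * ln (real p) \<le> v"
  using prime_gt_0_nat[OF assms] by (simp add: upto_exp_iff_ln ln_realpow del: power_Suc of_nat_Suc)

lemma lnsum_primes:
  assumes h: "\<And>p k. prime p \<Longrightarrow> h (p ^ k) = h p ^ k"
  shows "lnsum (\<lambda>n. mangoldt n * h n) v =
    (\<Sum>p | prime p \<and> p \<in> upto_exp v. \<Sum>k | real (Suc k) * ln (real p) \<le> v. h p ^ Suc k / of_nat (Suc k))"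
proof -
  have "lnsum (\<lambda>n. mangoldt n * h n) v = (\<Sum>n\<in>upto_exp v. mangoldt n * (h n / of_real (ln (real n))))"
    by (simp add: lnsum_def)
  also have "\<dots> = (\<Sum>p | prime p \<and> p \<in> upto_exp v. \<Sum>k | real (Suc k) * ln (real p) \<le> v. h p ^ Suc k / of_nat (Suc k))"
    unfolding sum_mangoldt_primepow
  proof (intro sum.cong refl)
    fix p k assume "p \<in> {p. prime p \<and> p \<in> upto_exp v}"
    then have p: "prime p" by simp
    then have p1: "real p > 1" using prime_gt_1_nat by simp
    have "ln (real (p ^ Suc k)) = real (Suc k) * ln (real p)" using p1 by (simp add: ln_realpow del: power_Suc of_nat_Suc)
    then have "complex_of_real (ln (real (p ^ Suc k))) = of_nat (Suc k) * of_real (ln (real p))"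
      by (simp only: of_real_mult of_real_of_nat_eq)
    moreover have "complex_of_real (ln (real p)) \<noteq> 0" using p1 by (simp del: of_nat_Suc)
    ultimately show "of_real (ln (real p)) * (h (p ^ Suc k) / of_real (ln (real (p ^ Suc k)))) = h p ^ Suc k / of_nat (Suc k)"
      unfolding h[OF p] by (simp del: power_Suc of_nat_Suc of_nat_power)
  qed (auto simp del: power_Suc of_nat_Suc simp: prime_power_upto_exp_iff)
  finally show ?thesis .
qed

text \<open>A term of exponent \<open>k + 1\<close> survives in the difference only if \<open>k \<ge> 2\<close> and \<open>(k + 1) l > v\<close>:
  halving \<open>v\<close> in the sums of the squares removes exactly the squares missing from the truncated logarithm.\<close>

lemma log_series_truncation:
  fixes z :: complex and y l v :: real
  defines "K \<equiv> \<lambda>v. {k. real (Suc k) * l \<le> v}"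
  defines "u \<equiv> \<lambda>z k. z ^ Suc k / of_nat (Suc k)"
  assumes z: "norm z \<le> y" "y \<le> 3/4" and l: "0 < l" "l \<le> v"
  shows "norm (- Ln (1 - z) - (\<Sum>k\<in>K v. u z k) - ((\<Sum>k\<in>K v. u (z\<^sup>2) k) - (\<Sum>k\<in>K (v / 2). u (z\<^sup>2) k)) / 2) \<le> 4 * l / v * y ^ 3"
proof -
  have v: "v > 0" using l by simp
  have y0: "y \<ge> 0" using z(1) norm_ge_zero order_trans by blast
  have finK: "finite (K w)" for w
  proof -
    have "K w \<subseteq> {..nat \<lfloor>w / l\<rfloor>}"
    proof
      fix k assume "k \<in> K w"
      then have "real k * l \<le> w" using l(1) by (simp add: K_def algebra_simps)
      then have "real k \<le> w / l" using l(1) by (simp add: field_simps)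
      then show "k \<in> {..nat \<lfloor>w / l\<rfloor>}" by (simp add: le_nat_floor)
    qed
    then show ?thesis by (rule finite_subset) simp
  qed
  define J where "J = K v - K (v / 2)"
  have sub: "K (v / 2) \<subseteq> K v" using v by (auto simp: K_def)
  have finJ: "finite J" using finK by (simp add: J_def)
  \<comment> \<open>Index \<open>k\<close> stands for the exponent \<open>k + 1\<close>. Half the
    term of exponent \<open>j + 1\<close> for \<open>z ^ 2\<close> is the term of exponent
    \<open>2 * (j + 1)\<close> for \<open>z\<close>, whose index is
    \<open>2 * j + 1\<close>.\<close>
  have uu: "u (z\<^sup>2) j / 2 = u z (2 * j + 1)" for j
  proof -
    have "(z\<^sup>2) ^ Suc j = z ^ Suc (2 * j + 1)" by (simp add: power_mult[symmetric] power2_eq_square power_even_eq mult.assoc power_mult_distrib)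
    moreover have "of_nat (Suc (2 * j + 1)) = (2 * of_nat (Suc j) :: complex)" by simp
    ultimately show ?thesis by (simp add: u_def del: power_Suc of_nat_Suc)
  qed
  have "((\<Sum>k\<in>K v. u (z\<^sup>2) k) - (\<Sum>k\<in>K (v / 2). u (z\<^sup>2) k)) / 2 = (\<Sum>k\<in>J. u (z\<^sup>2) k) / 2"
    unfolding J_def by (subst sum_diff[OF finK sub]) simp
  also have "\<dots> = (\<Sum>j\<in>J. u z (2 * j + 1))" by (simp only: sum_divide_distrib uu)
  also have "\<dots> = (\<Sum>k\<in>(\<lambda>j. 2 * j + 1) ` J. u z k)"
    by (subst sum.reindex) (auto intro: inj_onI)
  finally have J: "((\<Sum>k\<in>K v. u (z\<^sup>2) k) - (\<Sum>k\<in>K (v / 2). u (z\<^sup>2) k)) / 2 = (\<Sum>k\<in>(\<lambda>j. 2 * j + 1) ` J. u z k)" .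
  have "(\<lambda>n. - (z ^ n) / of_nat n) sums Ln (1 - z)" using Ln_series'[of "- z"] z by simp
  then have "(\<lambda>n. - (- (z ^ n) / of_nat n)) sums (- Ln (1 - z))" by (rule sums_minus)
  then have s1: "u z sums (- Ln (1 - z))"
    unfolding u_def using sums_Suc_iff[of "\<lambda>n. z ^ n / of_nat n"] by (simp del: power_Suc of_nat_Suc)
  define I where "I = (\<lambda>j. 2 * j + 1) ` J"
  define w where "w = (\<lambda>k. u z k - (if k \<in> K v then u z k else 0) - (if k \<in> I then u z k else 0))"
  define D where "D = - Ln (1 - z) - (\<Sum>k\<in>K v. u z k) - (\<Sum>k\<in>I. u z k)"
  have wD: "w sums D" unfolding w_def D_def
    by (intro sums_diff s1 sums_If_finite_set finK) (use finJ in \<open>simp add: I_def\<close>)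
  have IK: "k \<notin> K v" if "k \<in> I" for k
    using that by (auto simp: I_def J_def K_def algebra_simps)
  have w0: "w k = 0" if "k \<in> K v \<or> k \<in> I" for k using that IK by (auto simp: w_def)
  \<comment> \<open>Exponent 1 is in the truncated sum because \<open>l \<le> v\<close>; exponent 2
    is either there as well or supplied by the half difference. So the error starts with the cube,
    which makes the later sum over primes converge.\<close>
  have w01: "w 0 = 0" "w 1 = 0"
  proof -
    show "w 0 = 0" by (rule w0) (use l in \<open>simp add: K_def\<close>)
    show "w 1 = 0"
    proof (cases "1 \<in> K v")
      case False
      then have "0 \<in> J" using l by (auto simp: J_def K_def)
      then have "1 \<in> I" unfolding I_def by force
      then show ?thesis by (intro w0) simp
    qed (intro w0, simp)
  qed
  \<comment> \<open>A surviving exponent exceeds \<open>v / l\<close>, so the denominator of its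
    term already provides the factor \<open>l / v\<close>.\<close>
  have wb: "norm (w k) \<le> l / v * y ^ Suc k" for k
  proof (cases "k \<in> K v \<or> k \<in> I")
    case False
    then have k: "real (Suc k) * l > v" by (simp add: K_def)
    then have "1 / real (Suc k) \<le> l / v" using v by (simp add: field_simps)
    then have "1 / real (Suc k) * norm z ^ Suc k \<le> l / v * y ^ Suc k"
      using z l v by (intro mult_mono power_mono) auto
    moreover have "w k = u z k" using False by (simp add: w_def)
    ultimately show ?thesis by (simp add: u_def norm_divide norm_power norm_mult del: of_nat_Suc power_Suc)
  qed (use w0 l v y0 in simp)
  have "(\<lambda>k. w (k + 2)) sums D"
    using wD w01 by (subst sums_iff_shift) (simp add: numeral_2_eq_2)
  moreover have "(\<lambda>k. l / v * y ^ 3 * y ^ k) sums (l / v * y ^ 3 * (1 / (1 - y)))"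
    using z y0 by (intro sums_mult geometric_sums) auto
  moreover have "norm (w (k + 2)) \<le> l / v * y ^ 3 * y ^ k" for k
    using wb[of "k + 2"] by (simp add: power_add eval_nat_numeral mult_ac)
  ultimately have "norm D \<le> l / v * y ^ 3 * (1 / (1 - y))" by (rule norm_sums_le)
  also have "\<dots> \<le> l / v * y ^ 3 * 4"
    using z y0 l v by (intro mult_left_mono) (auto simp: field_simps)
  finally have "norm D \<le> 4 * l / v * y ^ 3" by (simp add: mult_ac)
  then show ?thesis unfolding J D_def I_def .
qed

lemma norm_exp_minus_one:
  fixes z :: complex
  assumes "norm z \<le> 1/2" shows "norm (exp z - 1) \<le> 2 * norm z"
proof -
  have "norm (exp z - exp 0) \<le> 2 * norm (z - 0)"
  proof (rule field_differentiable_bound[where S = "cball 0 (1/2)" and f' = exp])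
    fix w :: complex assume "w \<in> cball 0 (1/2)"
    then have "norm w \<le> 1/2" by simp
    then have "norm (exp w) \<le> 1 + 2 * norm w" by (rule exp_bound_lemma)
    then show "norm (exp w) \<le> 2" using \<open>norm w \<le> 1/2\<close> by simp
  qed (use assms in \<open>auto intro!: derivative_eq_intros\<close>)
  then show ?thesis by simp
qed

lemma powr_neg_half: "0 \<le> x \<Longrightarrow> x powr (-1/2) = 1 / sqrt (x :: real)"
proof -
  assume "0 \<le> x"
  then have "x powr (1/2) = sqrt x" by (rule powr_half_sqrt)
  moreover have "x powr (- (1/2)) = inverse (x powr (1/2))" by (rule powr_minus)
  ultimately show ?thesis by (simp add: inverse_eq_divide)
qed

context GRH_L
begin

definition z :: "nat \<Rightarrow> complex" where "z n = a n * of_real (real n powr (-1/2))"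

text \<open>The same as \<open>mangoldt n * (z n) ^ 2\<close>: the coefficients that belong to the
  squares of the primes, and through them to the square of the character.\<close>

definition c2 :: "nat \<Rightarrow> complex" where "c2 n = mangoldt n * (a n)\<^sup>2 / of_nat n"

definition prime_log :: "real \<Rightarrow> complex" where
  "prime_log v = (\<Sum>p | prime p \<and> p \<in> upto_exp v. - Ln (1 - z p))"

lemma z_power: assumes "prime p" shows "z (p ^ k) = z p ^ k"
proof (induction k)
  case (Suc k)
  have "z (p * p ^ k) = z p * z (p ^ k)" using prime_gt_0_nat[OF assms] by (simp add: z_def mult powr_mult)
  then show ?case using Suc by simp
qed (use a1 in \<open>simp add: z_def\<close>)

lemma norm_z_le: "norm (z n) \<le> real n powr (-1/2)"
  using mult_right_mono[OF bdd[of n], of "real n powr (-1/2)"] by (simp add: z_def norm_mult)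

lemma z_prime_bound: assumes "prime p" shows "real p powr (-1/2) \<le> 3/4"
proof -
  have "real p powr (-1/2) \<le> 2 powr (-1/2)" using prime_ge_2_nat[OF assms] by (intro powr_mono2') auto
  also have "(2::real) powr (-1/2) = 1 / sqrt 2" by (rule powr_neg_half) simp
  also have "\<dots> \<le> 1 / (4/3)"
  proof (intro divide_left_mono)
    show "(4/3::real) \<le> sqrt 2" by (rule real_le_rsqrt) (simp add: power2_eq_square)
  qed auto
  finally show ?thesis by simp
qed

lemma norm_z_prime: "prime p \<Longrightarrow> norm (z p) < 1"
  using norm_z_le[of p] z_prime_bound[of p] by simp

text \<open>The partial product contains all powers of the primes up to \<open>exp V\<close>,
  whereas \<open>lnsum c V\<close> contains the prime powers up to \<open>exp V\<close>. The squares
  in this mismatch need not be small and are kept as the half difference. The rest is bounded prime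
  by prime by \<open>4 * ln p / V * p powr (-3/2)\<close>, and the sum of these over all primes
  converges.\<close>

theorem prime_log_approx:
  "\<exists>C\<ge>0. \<forall>V>0. norm (prime_log V - lnsum c V - (lnsum c2 V - lnsum c2 (V / 2)) / 2) \<le> C / V"
proof -
  define g where "g = (\<lambda>n. norm (of_real (ln (real n)) * (1::complex)) * real n powr (-(3/2)))"
  have sm: "summable g" using dconv_ln[OF dconv_bounded[of "\<lambda>_. 1" 1]] unfolding dconv_def g_def by simp
  have g0: "g n \<ge> 0" for n by (simp add: g_def)
  define S where "S = suminf g"
  have S0: "S \<ge> 0" unfolding S_def by (intro suminf_nonneg sm g0)
  have "norm (prime_log V - lnsum c V - (lnsum c2 V - lnsum c2 (V / 2)) / 2) \<le> 4 * S / V" if V: "V > 0" for V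
  proof -
    let ?P = "{p. prime p \<and> p \<in> upto_exp V}"
    let ?K = "\<lambda>p v. {k. real (Suc k) * ln (real p) \<le> v}"
    have finP: "finite ?P" by (rule finite_subset[of _ "upto_exp V"]) auto
    have c: "c = (\<lambda>n. mangoldt n * z n)" by (rule ext) (simp add: c_def z_def mult.assoc)
    have c2: "c2 = (\<lambda>n. mangoldt n * (z n)\<^sup>2)"
    proof
      fix n show "c2 n = mangoldt n * (z n)\<^sup>2"
      proof (cases "n = 0")
        case False
        have "(real n powr (-1/2))\<^sup>2 = 1 / real n"
          using powr_neg_half[of "real n"] by (simp add: power_divide)
        then have "complex_of_real (real n powr (-1/2)) ^ 2 = 1 / of_nat n"
          by (metis of_real_1 of_real_divide of_real_of_nat_eq of_real_power)
        then show ?thesis by (simp add: c2_def z_def power_mult_distrib)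
      qed (simp add: c2_def)
    qed
    have S1: "lnsum c V = (\<Sum>p\<in>?P. \<Sum>k\<in>?K p V. z p ^ Suc k / of_nat (Suc k))"
      unfolding c by (rule lnsum_primes) (rule z_power)
    have z2: "(z (p ^ k))\<^sup>2 = ((z p)\<^sup>2) ^ k" if "prime p" for p k
      unfolding z_power[OF that] by (simp add: power_mult[symmetric] mult.commute)
    have S2: "lnsum c2 V = (\<Sum>p\<in>?P. \<Sum>k\<in>?K p V. ((z p)\<^sup>2) ^ Suc k / of_nat (Suc k))"
      unfolding c2 by (rule lnsum_primes) (rule z2)
    have "lnsum c2 (V / 2) = (\<Sum>p | prime p \<and> p \<in> upto_exp (V / 2). \<Sum>k\<in>?K p (V / 2). ((z p)\<^sup>2) ^ Suc k / of_nat (Suc k))"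
      unfolding c2 by (rule lnsum_primes) (rule z2)
    also have "\<dots> = (\<Sum>p\<in>?P. \<Sum>k\<in>?K p (V / 2). ((z p)\<^sup>2) ^ Suc k / of_nat (Suc k))"
    proof (rule sum.mono_neutral_left[OF finP])
      show "{p. prime p \<and> p \<in> upto_exp (V / 2)} \<subseteq> ?P" using upto_exp_mono[of "V / 2" V] V by auto
      show "\<forall>p\<in>?P - {p. prime p \<and> p \<in> upto_exp (V / 2)}. (\<Sum>k\<in>?K p (V / 2). ((z p)\<^sup>2) ^ Suc k / of_nat (Suc k)) = 0"
      proof
        fix p assume p: "p \<in> ?P - {p. prime p \<and> p \<in> upto_exp (V / 2)}"
        then have "prime p" "ln (real p) > V / 2" using prime_gt_0_nat by (auto simp: upto_exp_iff_ln)
        then have "ln (real p) > V / 2" "ln (real p) \<ge> 0" using prime_ge_1_nat by auto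
        moreover have "ln (real p) * 1 \<le> ln (real p) * real (Suc k)" for k
          using \<open>ln (real p) \<ge> 0\<close> by (intro mult_left_mono) auto
        ultimately have "\<not> real (Suc k) * ln (real p) \<le> V / 2" for k
          by (smt (verit) mult.commute mult.right_neutral)
        then have "?K p (V / 2) = {}" by simp
        then show "(\<Sum>k\<in>?K p (V / 2). ((z p)\<^sup>2) ^ Suc k / of_nat (Suc k)) = 0" by (simp only: sum.empty)
      qed
    qed
    finally have S3: "lnsum c2 (V / 2) = (\<Sum>p\<in>?P. \<Sum>k\<in>?K p (V / 2). ((z p)\<^sup>2) ^ Suc k / of_nat (Suc k))" .
    have "prime_log V - lnsum c V - (lnsum c2 V - lnsum c2 (V / 2)) / 2 =
      (\<Sum>p\<in>?P. - Ln (1 - z p) - (\<Sum>k\<in>?K p V. z p ^ Suc k / of_nat (Suc k))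
         - ((\<Sum>k\<in>?K p V. ((z p)\<^sup>2) ^ Suc k / of_nat (Suc k)) - (\<Sum>k\<in>?K p (V / 2). ((z p)\<^sup>2) ^ Suc k / of_nat (Suc k))) / 2)"
      unfolding S1 S2 S3 prime_log_def by (simp only: sum_subtractf sum_divide_distrib[symmetric])
    also have "norm \<dots> \<le> (\<Sum>p\<in>?P. 4 / V * g p)"
    proof (rule sum_norm_le)
      fix p assume "p \<in> ?P"
      then have p: "prime p" "ln (real p) \<le> V" by (auto simp: upto_exp_iff_ln)
      have lp: "ln (real p) > 0" using prime_gt_1_nat[OF p(1)] by simp
      have pw: "(real p powr (-1/2)) ^ 3 = real p powr (-(3/2))"
        using prime_gt_0_nat[OF p(1)] powr_power[of "real p" "-1/2" 3] by simp
      have "norm (- Ln (1 - z p) - (\<Sum>k\<in>?K p V. z p ^ Suc k / of_nat (Suc k))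
         - ((\<Sum>k\<in>?K p V. ((z p)\<^sup>2) ^ Suc k / of_nat (Suc k)) - (\<Sum>k\<in>?K p (V / 2). ((z p)\<^sup>2) ^ Suc k / of_nat (Suc k))) / 2)
        \<le> 4 * ln (real p) / V * (real p powr (-1/2)) ^ 3"
        by (rule log_series_truncation[OF norm_z_le z_prime_bound[OF p(1)] lp p(2)])
      also have "4 * ln (real p) / V * (real p powr (-1/2)) ^ 3 = 4 / V * g p"
      proof -
        have "g p = ln (real p) * real p powr (-(3/2))" using lp by (simp add: g_def)
        moreover have "4 * l / V * w = 4 / V * (l * w)" for l w :: real by simp
        ultimately show ?thesis unfolding pw by (simp only:)
      qed
      finally show "norm (- Ln (1 - z p) - (\<Sum>k\<in>?K p V. z p ^ Suc k / of_nat (Suc k))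
         - ((\<Sum>k\<in>?K p V. ((z p)\<^sup>2) ^ Suc k / of_nat (Suc k)) - (\<Sum>k\<in>?K p (V / 2). ((z p)\<^sup>2) ^ Suc k / of_nat (Suc k))) / 2)
        \<le> 4 / V * g p" .
    qed
    also have "\<dots> = 4 / V * (\<Sum>p\<in>?P. g p)" by (simp only: sum_distrib_left)
    also have "\<dots> \<le> 4 / V * S" using V g0 unfolding S_def by (intro mult_left_mono sum_le_suminf sm finP) auto
    also have "\<dots> = 4 * S / V" by simp
    finally show ?thesis .
  qed
  then show ?thesis using S0 by (intro exI[of _ "4 * S"] conjI allI impI) simp_all
qed

definition partial_product :: "real \<Rightarrow> complex" where
  "partial_product x = of_real (ln x) ^ m * (\<Prod>p | prime p \<and> real p \<le> x. inverse (1 - a p / of_real (sqrt (real p))))"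

lemma partial_product_exp:
  assumes V: "V > 0"
  shows "partial_product (exp V) = exp (prime_log V + of_nat m * of_real (ln V))"
proof -
  have P: "{p. prime p \<and> real p \<le> exp V} = {p. prime p \<and> p \<in> upto_exp V}"
    using prime_gt_0_nat by (auto simp: upto_exp_def)
  have "inverse (1 - a p / of_real (sqrt (real p))) = exp (- Ln (1 - z p))" if "prime p" for p
  proof -
    have "real p powr (-1/2) = 1 / sqrt (real p)" by (rule powr_neg_half) simp
    then have "a p / of_real (sqrt (real p)) = z p" by (simp add: z_def)
    moreover have "1 - z p \<noteq> 0" using norm_z_prime[OF that] by auto
    ultimately show ?thesis by (simp add: exp_minus)
  qed
  then have "(\<Prod>p | prime p \<and> real p \<le> exp V. inverse (1 - a p / of_real (sqrt (real p)))) = (\<Prod>p | prime p \<and> p \<in> upto_exp V. exp (- Ln (1 - z p)))"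
    unfolding P by (intro prod.cong) auto
  also have "\<dots> = exp (prime_log V)" unfolding prime_log_def
    by (rule exp_sum[symmetric]) (rule finite_subset[of _ "upto_exp V"], auto)
  finally have "(\<Prod>p | prime p \<and> real p \<le> exp V. inverse (1 - a p / of_real (sqrt (real p)))) = exp (prime_log V)" .
  moreover have "complex_of_real V ^ m = exp (of_nat m * of_real (ln V))"
    using V by (simp add: exp_of_nat_mult exp_of_real)
  ultimately show ?thesis by (simp add: partial_product_def exp_add mult.commute)
qed

text \<open>The squares of the primes between \<open>sqrt x\<close> and \<open>x\<close> add
  \<open>k * ln 2 / 2\<close> to the exponent; for \<open>k = 1\<close> this is a factor
  \<open>sqrt 2\<close> in the limit. The limit is an exponential, hence nonzero.\<close>

theorem partial_product_approx:
  fixes k :: complex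
  assumes T: "\<And>v. v \<ge> 0 \<Longrightarrow> norm ((\<Sum>n\<in>upto_exp v. c2 n) - k * of_real v) \<le> C2"
  shows "\<exists>L K. L \<noteq> 0 \<and> K \<ge> 0 \<and> (\<forall>V\<ge>4. \<exists>e. partial_product (exp V) = L * exp e \<and> norm e \<le> norm (E V) / V + K * (ln V + 1) / V)"
proof -
  obtain C where C: "C \<ge> 0" "\<And>V. V > 0 \<Longrightarrow> norm (prime_log V - lnsum c V - (lnsum c2 V - lnsum c2 (V / 2)) / 2) \<le> C / V"
    using prime_log_approx by blast
  obtain L K where K: "K \<ge> 0" "\<And>V. V \<ge> 4 \<Longrightarrow> norm (lnsum c V + of_nat m * of_real (ln V) - L) \<le> norm (E V) / V + K * (ln V + 1) / V"
    using lnsum_c by blast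
  have C2: "C2 \<ge> 0" using T[of 0] norm_ge_zero order_trans by (metis order.refl)
  define D where "D = K + (C + 5 * C2)"
  have D: "D \<ge> 0" using K C C2 by (simp add: D_def)
  have "\<exists>e. partial_product (exp V) = exp (L + k * of_real (ln 2) / 2) * exp e \<and> norm e \<le> norm (E V) / V + D * (ln V + 1) / V" if V: "V \<ge> 4" for V
  proof (intro exI conjI)
    \<comment> \<open>\<open>e1\<close> is the error of truncating the logarithms, \<open>e2\<close>
      that of the prime sum and \<open>e3\<close> that of the squares. Only \<open>e2\<close> brings
      in the value of \<open>E\<close> at the point itself.\<close>
    define e1 where "e1 = prime_log V - lnsum c V - (lnsum c2 V - lnsum c2 (V / 2)) / 2"
    define e2 where "e2 = lnsum c V + of_nat m * of_real (ln V) - L"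
    define e3 where "e3 = lnsum c2 V - lnsum c2 (V / 2) - k * of_real (ln 2)"
    have "prime_log V + of_nat m * of_real (ln V) = (L + k * of_real (ln 2) / 2) + (e1 + e2 + e3 / 2)"
      by (simp add: e1_def e2_def e3_def field_simps)
    then show "partial_product (exp V) = exp (L + k * of_real (ln 2) / 2) * exp (e1 + e2 + e3 / 2)"
      using V by (simp add: partial_product_exp exp_add[symmetric])
    have "norm e1 \<le> C / V" using C(2)[of V] V by (simp add: e1_def)
    moreover have "norm e2 \<le> norm (E V) / V + K * (ln V + 1) / V" using K(2)[OF V] by (simp add: e2_def)
    moreover have "norm e3 \<le> 5 * C2 / V" unfolding e3_def
      by (rule lnsum_half_difference[OF _ T]) (use V in \<open>simp_all add: c2_def\<close>)
    moreover have "norm (e1 + e2 + e3 / 2) \<le> norm e1 + norm e2 + norm e3"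
    proof -
      have "norm (e3 / 2) \<le> norm e3" by (simp add: norm_divide)
      then show ?thesis using norm_triangle_ineq[of "e1 + e2" "e3 / 2"] norm_triangle_ineq[of e1 e2] by linarith
    qed
    moreover have "C / V + 5 * C2 / V \<le> (C + 5 * C2) * (ln V + 1) / V"
    proof -
      have "(C + 5 * C2) * 1 \<le> (C + 5 * C2) * (ln V + 1)" using C C2 V by (intro mult_left_mono) auto
      then have "(C + 5 * C2) * 1 / V \<le> (C + 5 * C2) * (ln V + 1) / V" using V by (intro divide_right_mono) auto
      then show ?thesis by (simp add: add_divide_distrib)
    qed
    moreover have "D * (ln V + 1) / V = K * (ln V + 1) / V + (C + 5 * C2) * (ln V + 1) / V"
      by (simp only: D_def distrib_right add_divide_distrib)
    ultimately show "norm (e1 + e2 + e3 / 2) \<le> norm (E V) / V + D * (ln V + 1) / V" by linarith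
  qed
  then show ?thesis using D by (intro exI[of _ "exp (L + k * of_real (ln 2) / 2)"] exI[of _ D]) auto
qed

end

section \<open>Natural density\<close>

text \<open>Chebyshev's inequality on the block from \<open>exp V\<close> to
  \<open>exp (V + 1)\<close>: the part outside \<open>A\<close> has relative measure O((ln V)^2 /
  (ln V)^6). The blocks grow geometrically, so relative smallness on all late blocks gives relative
  smallness on \<open>[2, X]\<close>.\<close>

lemma density_one_of_mean_square:
  fixes E :: "real \<Rightarrow> complex"
  assumes Em [measurable]: "E \<in> borel_measurable borel" and A: "A \<in> sets borel" "A \<subseteq> {2..}"
    and ms: "\<And>V. V \<ge> 4 \<Longrightarrow> (\<integral>\<^sup>+x. ennreal ((norm (E (V + x)))\<^sup>2) * indicator {0..1} x \<partial>lborel) \<le> ennreal (K * (ln V)\<^sup>2)"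
    and good: "\<And>V. V \<ge> V0 \<Longrightarrow> norm (E V) \<le> ln V ^ 3 \<Longrightarrow> exp V \<in> A"
  shows "has_natural_density A 1"
proof -
  define K' where "K' = max K 0"
  have K': "K' \<ge> 0" "K \<le> K'" by (auto simp: K'_def)
  have meas [measurable]: "A \<in> sets borel" by fact
  have block: "measure lborel ({exp V<..exp (V + 1)} - A) \<le> K' * exp (V + 1) / ln V ^ 4" if V: "V \<ge> 4" "V \<ge> V0" for V
  proof -
    have lnV: "ln V > 0" using V by simp
    define f where "f = (\<lambda>x. (norm (E (ln x)))\<^sup>2 / ln V ^ 6)"
    have fm: "f \<in> borel_measurable borel" unfolding f_def by measurable
    have eV: "exp V \<le> exp (V + 1)" by simp
    have "emeasure lborel ({exp V<..exp (V + 1)} - A) = (\<integral>\<^sup>+x. indicator ({exp V<..exp (V + 1)} - A) x \<partial>lborel)"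
      by (rule nn_integral_indicator[symmetric]) simp
    also have "\<dots> \<le> (\<integral>\<^sup>+x. ennreal (f x * indicator {exp V..exp (V + 1)} x) \<partial>lborel)"
    proof (intro nn_integral_mono)
      fix x
      show "indicator ({exp V<..exp (V + 1)} - A) x \<le> ennreal (f x * indicator {exp V..exp (V + 1)} x)"
      proof (cases "x \<in> {exp V<..exp (V + 1)} - A")
        case True
        then have x: "exp V < x" "x \<le> exp (V + 1)" "x \<notin> A" by auto
        then have x0: "x > 0" using exp_gt_zero less_trans by blast
        then have V1: "V < ln x" using x by (metis exp_less_cancel_iff exp_ln)
        have "\<not> norm (E (ln x)) \<le> ln (ln x) ^ 3"
        proof
          assume "norm (E (ln x)) \<le> ln (ln x) ^ 3"
          then have "exp (ln x) \<in> A" by (intro good) (use V V1 in auto)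
          then show False using x x0 by simp
        qed
        moreover have "ln V ^ 3 \<le> ln (ln x) ^ 3" using V V1 lnV by (intro power_mono) auto
        ultimately have "ln V ^ 3 \<le> norm (E (ln x))" by linarith
        then have "(ln V ^ 3)\<^sup>2 \<le> (norm (E (ln x)))\<^sup>2" using lnV by (intro power_mono) auto
        then have "ln V ^ 6 \<le> (norm (E (ln x)))\<^sup>2" by (simp flip: power_mult)
        then have "1 \<le> f x" using lnV by (simp add: f_def)
        then show ?thesis using True x by simp
      qed simp
    qed
    \<comment> \<open>On the block the Jacobian \<open>exp x\<close> is at most
      \<open>exp (V + 1)\<close>, comparable to the length of the block, so a mean in the
      logarithmic variable becomes a mean in the original one.\<close>
    also have "\<dots> = (\<integral>\<^sup>+x. ennreal (f (exp x) * exp x * indicator {V..V + 1} x) \<partial>lborel)"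
    proof (rule nn_integral_substitution)
      show "set_borel_measurable borel {exp V..exp (V + 1)} f" using fm unfolding set_borel_measurable_def by measurable
      show "(exp has_real_derivative exp x) (at x)" for x :: real by (rule DERIV_exp)
      show "continuous_on {V..V + 1} (exp :: real \<Rightarrow> real)" by (rule continuous_on_exp[OF continuous_on_id])
    qed auto
    also have "\<dots> \<le> (\<integral>\<^sup>+x. ennreal (exp (V + 1) / ln V ^ 6) * (ennreal ((norm (E x))\<^sup>2) * indicator {V..V + 1} x) \<partial>lborel)"
    proof (intro nn_integral_mono)
      fix x
      show "ennreal (f (exp x) * exp x * indicator {V..V + 1} x) \<le> ennreal (exp (V + 1) / ln V ^ 6) * (ennreal ((norm (E x))\<^sup>2) * indicator {V..V + 1} x)"
      proof (cases "x \<in> {V..V + 1}")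
        case True
        have "f (exp x) * exp x \<le> f (exp x) * exp (V + 1)" using True lnV by (intro mult_left_mono) (auto simp: f_def)
        also have "\<dots> = exp (V + 1) / ln V ^ 6 * (norm (E x))\<^sup>2" by (simp add: f_def)
        finally show ?thesis using True lnV by (simp add: ennreal_mult[symmetric] ennreal_leI)
      qed simp
    qed
    also have "\<dots> = ennreal (exp (V + 1) / ln V ^ 6) * (\<integral>\<^sup>+x. ennreal ((norm (E x))\<^sup>2) * indicator {V..V + 1} x \<partial>lborel)"
      by (rule nn_integral_cmult) measurable
    also have "\<dots> = ennreal (exp (V + 1) / ln V ^ 6) * (\<integral>\<^sup>+x. ennreal ((norm (E (V + x)))\<^sup>2) * indicator {0..1} x \<partial>lborel)"
    proof -
      have "(\<lambda>x. ennreal ((norm (E x))\<^sup>2)) \<in> borel_measurable borel" by measurable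
      from nn_integral_unit_shift[OF this] show ?thesis by (simp only:)
    qed
    also have "\<dots> \<le> ennreal (exp (V + 1) / ln V ^ 6) * ennreal (K' * (ln V)\<^sup>2)"
      using order_trans[OF ms[OF V(1)] ennreal_leI[OF mult_right_mono[OF K'(2)]]] by (intro mult_left_mono) auto
    also have "\<dots> = ennreal (exp (V + 1) / ln V ^ 6 * (K' * (ln V)\<^sup>2))"
      using K' lnV by (intro ennreal_mult[symmetric]) auto
    finally have "emeasure lborel ({exp V<..exp (V + 1)} - A) \<le> ennreal (exp (V + 1) / ln V ^ 6 * (K' * (ln V)\<^sup>2))" .
    then have "measure lborel ({exp V<..exp (V + 1)} - A) \<le> exp (V + 1) / ln V ^ 6 * (K' * (ln V)\<^sup>2)"
      unfolding measure_def using K' lnV by (intro enn2real_leI) auto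
    also have "\<dots> = K' * exp (V + 1) / ln V ^ 4"
    proof -
      have "a / l ^ 6 * (k * l\<^sup>2) = k * a / l ^ 4" if "l \<noteq> 0" for a k l :: real
        using that by (simp add: field_simps eval_nat_numeral)
      then show ?thesis using lnV by simp
    qed
    finally show ?thesis .
  qed
  have fin: "emeasure lborel ({a..b} - A) < top" "emeasure lborel ({a<..b} - A) < top" for a b :: real
  proof -
    have "emeasure lborel ({a..b} - A) \<le> emeasure lborel {a..b}" "emeasure lborel ({a<..b} - A) \<le> emeasure lborel {a..b}"
      by (intro emeasure_mono; auto)+
    moreover have "emeasure lborel {a..b} < top" by (simp add: emeasure_lborel_Icc_eq)
    ultimately show "emeasure lborel ({a..b} - A) < top" "emeasure lborel ({a<..b} - A) < top"
      using order.strict_trans1 by blast+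
  qed
  have small: "\<exists>B. \<forall>X\<ge>B. measure lborel ({2..X} - A) \<le> B + \<eta> * X" if \<eta>: "\<eta> > 0" for \<eta>
  proof -
    have "((\<lambda>V. K' * exp 1 / ln V ^ 4) \<longlongrightarrow> 0) at_top"
    proof -
      have "((\<lambda>V::real. 1 / ln V ^ 4) \<longlongrightarrow> 0) at_top" by real_asymp
      then have "((\<lambda>V::real. K' * exp 1 * (1 / ln V ^ 4)) \<longlongrightarrow> 0) at_top" by (rule tendsto_mult_right_zero)
      then show ?thesis by simp
    qed
    then have "eventually (\<lambda>V. K' * exp 1 / ln V ^ 4 < \<eta>) at_top" using \<eta> by (rule order_tendstoD)
    then obtain V1' where V1': "\<And>V. V \<ge> V1' \<Longrightarrow> K' * exp 1 / ln V ^ 4 < \<eta>" by (auto simp: eventually_at_top_linorder)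
    define V1 where "V1 = max V1' (max 4 V0)"
    have bl: "measure lborel ({exp V<..exp (V + 1)} - A) \<le> \<eta> * exp V" if "V \<ge> V1" for V
    proof -
      have "measure lborel ({exp V<..exp (V + 1)} - A) \<le> K' * exp (V + 1) / ln V ^ 4" using that by (intro block) (auto simp: V1_def)
      also have "\<dots> = K' * exp 1 / ln V ^ 4 * exp V" by (simp add: exp_add)
      also have "\<dots> \<le> \<eta> * exp V" using V1'[of V] that by (intro mult_right_mono) (auto simp: V1_def)
      finally show ?thesis .
    qed
    \<comment> \<open>\<open>w\<close> ranges over a unit interval so that every large
      \<open>X\<close> has the form \<open>exp (w + n)\<close>. In the induction the new block at
      most doubles \<open>\<eta> * exp ?W\<close>, and this is absorbed because
      \<open>exp 1 \<ge> 2\<close>.\<close>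
    have step: "measure lborel ({2..exp (w + real n)} - A) \<le> exp (V1 + 1) + \<eta> * exp (w + real n)" if w: "V1 \<le> w" "w \<le> V1 + 1" for w n
    proof (induction n)
      case 0
      have "measure lborel ({2..exp w} - A) \<le> measure lborel {0..exp w}"
        by (intro measure_mono_fmeasurable) (auto simp: fmeasurable_def emeasure_lborel_Icc_eq)
      also have "\<dots> = exp w" by simp
      also have "\<dots> \<le> exp (V1 + 1)" using w by simp
      finally have "measure lborel ({2..exp w} - A) \<le> exp (V1 + 1)" .
      moreover have "0 \<le> \<eta> * exp w" using \<eta> by simp
      ultimately show ?case by simp
    next
      case (Suc n)
      let ?W = "w + real n"
      have "{2..exp (?W + 1)} - A \<subseteq> ({2..exp ?W} - A) \<union> ({exp ?W<..exp (?W + 1)} - A)" by auto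
      then have "measure lborel ({2..exp (?W + 1)} - A) \<le> measure lborel (({2..exp ?W} - A) \<union> ({exp ?W<..exp (?W + 1)} - A))"
        by (intro measure_mono_fmeasurable fmeasurable.Un) (auto simp: fmeasurable_def fin)
      also have "\<dots> \<le> measure lborel ({2..exp ?W} - A) + measure lborel ({exp ?W<..exp (?W + 1)} - A)"
        by (intro measure_Un_le) auto
      also have "\<dots> \<le> (exp (V1 + 1) + \<eta> * exp ?W) + \<eta> * exp ?W" using Suc.IH w by (intro add_mono bl) auto
      also have "\<dots> = exp (V1 + 1) + \<eta> * (2 * exp ?W)" by simp
      also have "\<dots> \<le> exp (V1 + 1) + \<eta> * exp (?W + 1)"
      proof -
        have "2 * exp ?W \<le> exp 1 * exp ?W" using exp_ge_add_one_self[of 1] by (intro mult_right_mono) auto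
        then show ?thesis using \<eta> by (intro add_left_mono mult_left_mono) (auto simp: exp_add mult.commute)
      qed
      finally show ?case by (simp add: add_ac)
    qed
    have "measure lborel ({2..X} - A) \<le> exp (V1 + 1) + \<eta> * X" if X: "X \<ge> exp (V1 + 1)" for X
    proof -
      have X0: "X > 0" using X exp_gt_zero less_le_trans by blast
      have lX: "ln X \<ge> V1 + 1" using X X0 by (simp add: ln_ge_iff)
      define n where "n = nat \<lfloor>ln X - V1\<rfloor>"
      have n: "real n \<le> ln X - V1" "ln X - V1 \<le> real n + 1" unfolding n_def using lX by (auto simp: of_nat_nat)
      have "measure lborel ({2..exp ((ln X - real n) + real n)} - A) \<le> exp (V1 + 1) + \<eta> * exp ((ln X - real n) + real n)"
        by (rule step) (use n in auto)
      then show ?thesis using X0 by simp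
    qed
    then show ?thesis by blast
  qed
  have "((\<lambda>X. measure lborel (A \<inter> {2..X}) / X) \<longlongrightarrow> 1) at_top"
  proof (rule tendstoI)
    fix e :: real assume e: "e > 0"
    obtain B where B: "\<And>X. X \<ge> B \<Longrightarrow> measure lborel ({2..X} - A) \<le> B + e / 2 * X" using small[of "e / 2"] e by auto
    \<comment> \<open>The 2 accounts for the missing interval from 0 to 2, and \<open>B\<close> for
      the early blocks.\<close>
    have "((\<lambda>X. (2 + B) / X) \<longlongrightarrow> 0) at_top" by real_asymp
    then have "eventually (\<lambda>X. (2 + B) / X < e / 2) at_top" using e by (intro order_tendstoD) auto
    moreover have "eventually (\<lambda>X. X \<ge> max B 2) at_top" by (rule eventually_ge_at_top)
    ultimately show "eventually (\<lambda>X. dist (measure lborel (A \<inter> {2..X}) / X) 1 < e) at_top"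
    proof eventually_elim
      case (elim X)
      then have X: "X \<ge> B" "X \<ge> 2" by auto
      have "A \<inter> {2..X} = {2..X} - ({2..X} - A)" by auto
      then have "measure lborel (A \<inter> {2..X}) = measure lborel {2..X} - measure lborel ({2..X} - A)"
        by (simp only:) (intro measure_Diff; auto simp: emeasure_lborel_Icc_eq)
      then have eq: "measure lborel (A \<inter> {2..X}) = (X - 2) - measure lborel ({2..X} - A)" using X by simp
      have "\<bar>measure lborel (A \<inter> {2..X}) - X\<bar> \<le> (2 + B) + e / 2 * X"
        using B[OF X(1)] measure_nonneg[of lborel "{2..X} - A"] unfolding eq by linarith
      also have "\<dots> < e / 2 * X + e / 2 * X" using elim(1) X by (simp add: field_simps)
      finally have "\<bar>measure lborel (A \<inter> {2..X}) - X\<bar> < e * X" by (simp add: field_simps)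
      moreover have "measure lborel (A \<inter> {2..X}) / X - 1 = (measure lborel (A \<inter> {2..X}) - X) / X" using X by (simp add: diff_divide_distrib)
      ultimately show ?case using X by (simp add: dist_real_def abs_divide field_simps)
    qed
  qed
  then show ?thesis using A by (simp add: has_natural_density_def)
qed

context GRH_L
begin

lemma measurable_partial_product [measurable]: "partial_product \<in> borel_measurable borel"
proof -
  have fl: "(\<lambda>x::real. \<lfloor>x\<rfloor>) \<in> borel \<rightarrow>\<^sub>M count_space UNIV" by measurable
  define F where "F = (\<lambda>k::int. \<Prod>p | prime p \<and> int p \<le> k. inverse (1 - a p / of_real (sqrt (real p))))"
  have [measurable]: "(\<lambda>x::real. F \<lfloor>x\<rfloor>) \<in> borel_measurable borel"
    using measurable_compose[OF fl, of F borel] by simp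
  have "partial_product = (\<lambda>x. of_real (ln x) ^ m * F \<lfloor>x\<rfloor>)"
    by (rule ext) (simp add: partial_product_def F_def le_floor_iff)
  then show ?thesis by simp
qed

text \<open>Where \<open>norm (E V) \<le> ln V ^ 3\<close>, the error in the exponent is at most
  \<open>(1 + 2 * K) * ln V ^ 3 / V\<close>, with \<open>V = ln x\<close>. Once this is below 1/2,
  \<open>norm (exp e - 1) \<le> 2 * norm e\<close>, and the remaining constant
  \<open>2 * norm L * (1 + 2 * K)\<close> is absorbed by
  \<open>ln V powr \<epsilon>\<close>.\<close>

theorem density_near_limit:
  fixes k :: complex
  assumes T: "\<And>v. v \<ge> 0 \<Longrightarrow> norm ((\<Sum>n\<in>upto_exp v. c2 n) - k * of_real v) \<le> C2"
  shows "\<exists>L. L \<noteq> 0 \<and> (\<forall>\<epsilon>>0. has_natural_density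
    {x. x \<ge> 2 \<and> norm (partial_product x - L) \<le> ln (ln x) powr (3 + \<epsilon>) / ln x} 1)"
proof -
  obtain L K where L: "L \<noteq> 0" and K: "K \<ge> 0"
    and P: "\<And>V. V \<ge> 4 \<Longrightarrow> \<exists>e. partial_product (exp V) = L * exp e \<and> norm e \<le> norm (E V) / V + K * (ln V + 1) / V"
    using partial_product_approx[OF T] by blast
  obtain K0 where K0: "\<And>V. V \<ge> 4 \<Longrightarrow> (\<integral>\<^sup>+x. ennreal ((norm (E (V + x)))\<^sup>2) * indicator {0..1} x \<partial>lborel) \<le> ennreal (K0 * (ln V)\<^sup>2)"
    using E_mean_square by blast
  have "has_natural_density {x. x \<ge> 2 \<and> norm (partial_product x - L) \<le> ln (ln x) powr (3 + \<epsilon>) / ln x} 1" if \<epsilon>: "\<epsilon> > 0" for \<epsilon>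
  proof -
    let ?A = "{x. x \<ge> 2 \<and> norm (partial_product x - L) \<le> ln (ln x) powr (3 + \<epsilon>) / ln x}"
    let ?M = "1 + 2 * K"
    have "((\<lambda>V. ?M * (ln V ^ 3 / V)) \<longlongrightarrow> 0) at_top"
    proof -
      have "((\<lambda>V::real. ln V ^ 3 / V) \<longlongrightarrow> 0) at_top" by real_asymp
      then show ?thesis by (rule tendsto_mult_right_zero)
    qed
    then have ev1: "eventually (\<lambda>V. ?M * (ln V ^ 3 / V) < 1/2) at_top" by (rule order_tendstoD) simp
    have "filterlim (\<lambda>V::real. ln V powr \<epsilon>) at_top at_top" using \<epsilon> by real_asymp
    then have ev2: "eventually (\<lambda>V. ln V powr \<epsilon> \<ge> 2 * norm L * ?M) at_top" by (auto simp: filterlim_at_top)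
    obtain V1 where V1: "\<And>V. V \<ge> V1 \<Longrightarrow> ?M * (ln V ^ 3 / V) < 1/2 \<and> ln V powr \<epsilon> \<ge> 2 * norm L * ?M"
      using eventually_conj[OF ev1 ev2] by (auto simp: eventually_at_top_linorder)
    show ?thesis
    proof (rule density_one_of_mean_square[OF measurable_E _ _ K0])
      show "?A \<in> sets borel" by measurable
      show "?A \<subseteq> {2..}" by auto
    next
      fix V assume V: "V \<ge> max 4 V1" and EV: "norm (E V) \<le> ln V ^ 3"
      have V4: "V \<ge> 4" using V by simp
      have lnV: "ln V \<ge> 1"
      proof -
        have "exp 1 \<le> V" using exp_le V4 by linarith
        then show ?thesis using V4 by (simp add: ln_ge_iff)
      qed
      obtain e where e: "partial_product (exp V) = L * exp e" "norm e \<le> norm (E V) / V + K * (ln V + 1) / V"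
        using P[OF V4] by blast
      have "K * (ln V + 1) \<le> K * (2 * ln V ^ 3)"
      proof (intro mult_left_mono K)
        have "ln V ^ 1 \<le> ln V ^ 3" using lnV by (intro power_increasing) auto
        then show "ln V + 1 \<le> 2 * ln V ^ 3" using lnV by simp
      qed
      then have "(norm (E V) + K * (ln V + 1)) / V \<le> (?M * ln V ^ 3) / V"
        using EV V4 by (intro divide_right_mono) (simp_all add: algebra_simps)
      then have eb: "norm e \<le> ?M * (ln V ^ 3 / V)" using e(2) by (simp add: add_divide_distrib)
      have "V \<ge> V1" using V by simp
      from V1[OF this] eb have "norm e \<le> 1/2" by linarith
      then have "norm (exp e - 1) \<le> 2 * norm e" by (rule norm_exp_minus_one)
      then have "norm L * norm (exp e - 1) \<le> norm L * (2 * norm e)" by (intro mult_left_mono) auto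
      moreover have "partial_product (exp V) - L = L * (exp e - 1)" by (simp add: e(1) algebra_simps)
      ultimately have "norm (partial_product (exp V) - L) \<le> norm L * (2 * norm e)" by (simp add: norm_mult)
      also have "\<dots> \<le> norm L * (2 * (?M * (ln V ^ 3 / V)))" using eb by (intro mult_left_mono) auto
      also have "\<dots> = (2 * norm L * ?M) * (ln V ^ 3 / V)" by (simp only: mult_ac)
      also have "\<dots> \<le> ln V powr \<epsilon> * (ln V ^ 3 / V)" using V1[of V] V lnV by (intro mult_right_mono) auto
      also have "\<dots> = ln V powr (3 + \<epsilon>) / V"
      proof -
        have "ln V powr (3 + \<epsilon>) = ln V powr 3 * ln V powr \<epsilon>" by (rule powr_add)
        moreover have "ln V powr 3 = ln V ^ 3" using powr_realpow[of "ln V" 3] lnV by simp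
        ultimately show ?thesis by (simp add: mult_ac)
      qed
      finally have "norm (partial_product (exp V) - L) \<le> ln (ln (exp V)) powr (3 + \<epsilon>) / ln (exp V)" by simp
      moreover have "exp V \<ge> 2" using exp_ge_add_one_self[of V] V4 by linarith
      ultimately show "exp V \<in> ?A" by blast
    qed
  qed
  then show ?thesis using L by blast
qed

end

section \<open>Dirichlet characters\<close>

text \<open>A value of modulus above 1 would have unbounded powers, which are again values; but a
  periodic function takes only finitely many values.\<close>

lemma dirichlet_character_cmult:
  assumes "dirichlet_character q c"
  shows "cmult c"
proof
  have q: "q \<ge> 1" and per: "\<And>n. c (n + q) = c n" and mult: "\<And>m n. c (m * n) = c m * c n" and one: "c 1 = 1"
    using assms by (auto simp: dirichlet_character_def)
  show "c (m * n) = c m * c n" for m n by (rule mult)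
  show "c 1 = 1" by (rule one)
  have bound: "norm (c n) \<le> (\<Sum>i<q. norm (c i))" for n
  proof -
    have "norm (c (n mod q)) \<le> (\<Sum>i<q. norm (c i))" using q by (intro member_le_sum) auto
    then show ?thesis using periodic_mod[of c q, OF per] by simp
  qed
  show "norm (c n) \<le> 1" for n
  proof (rule ccontr)
    assume n: "\<not> norm (c n) \<le> 1"
    then obtain k where k: "(\<Sum>i<q. norm (c i)) < norm (c n) ^ k"
      using real_arch_pow[of "norm (c n)" "\<Sum>i<q. norm (c i)"] by auto
    have "c (n ^ k) = c n ^ k" by (induction k) (use one mult in auto)
    then show False using bound[of "n ^ k"] k by (simp add: norm_power)
  qed
qed

text \<open>Multiplication by a unit \<open>b\<close> with \<open>c b \<noteq> 1\<close> permutes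
  the residues and multiplies the sum over a period by \<open>c b\<close>. The shift to
  \<open>Suc i\<close> matches series that start at \<open>n = 1\<close>.\<close>

lemma nonprincipal_periodic_mean0:
  assumes c: "dirichlet_character q c" and np: "\<not> principal_character q c"
  shows "periodic_mean0 q (\<lambda>i. c (Suc i))"
proof -
  have q: "q \<ge> 1" and per: "\<And>n. c (n + q) = c n" and mult: "\<And>m n. c (m * n) = c m * c n"
    using c by (auto simp: dirichlet_character_def)
  obtain b where b: "coprime b q" "c b \<noteq> 1" using np by (auto simp: principal_character_def)
  have inj: "inj_on (\<lambda>i. b * i mod q) {..<q}"
  proof (rule inj_onI)
    fix i j assume ij: "i \<in> {..<q}" "j \<in> {..<q}" "b * i mod q = b * j mod q"
    then have "[i = j] (mod q)" using cong_mult_lcancel_nat[OF b(1)] by (simp add: cong_def)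
    then show "i = j" using ij by (simp add: cong_def)
  qed
  have "(\<lambda>i. b * i mod q) ` {..<q} = {..<q}"
    by (rule endo_inj_surj[OF _ _ inj]) (use q in auto)
  then have bij: "bij_betw (\<lambda>i. b * i mod q) {..<q} {..<q}" using inj by (simp add: bij_betw_def)
  have "(\<Sum>i<q. c i) = (\<Sum>i<q. c (b * i mod q))" by (rule sum.reindex_bij_betw[OF bij, symmetric])
  also have "\<dots> = c b * (\<Sum>i<q. c i)" by (simp add: periodic_mod[of c q, OF per] mult sum_distrib_left)
  finally have "(1 - c b) * (\<Sum>i<q. c i) = 0" by (simp add: algebra_simps)
  then have "(\<Sum>i<q. c i) = 0" using b by simp
  moreover have "c 0 + (\<Sum>i<q. c (Suc i)) = (\<Sum>i<q. c i) + c q"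
    using sum.lessThan_Suc_shift[of c q] sum.lessThan_Suc[of c q] by simp
  ultimately have "(\<Sum>i<q. c (Suc i)) = 0" using per[of 0] by simp
  then show ?thesis using q per[of "Suc _"] by (simp add: periodic_mean0_def)
qed

lemma periodic_mean0_prefix_bounded:
  assumes "periodic_mean0 q f"
  shows "\<exists>B. \<forall>N. norm (\<Sum>i<N. f i) \<le> B"
proof -
  obtain F c where F: "periodic_mean0 q F" "\<And>n. f (Suc n) = F (Suc n) - F n" "f 0 = F 0 + c"
    by (rule periodic_mean0_prefix[OF assms]) (rule that)
  obtain B where B: "B \<ge> 0" "\<And>n. norm (F n) \<le> B" by (rule periodic_mean0_bounded[OF F(1)]) (rule that)
  have eq: "(\<Sum>i<Suc n. f i) = F n + c" for n by (induction n) (simp_all add: F(2,3))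
  have "norm (\<Sum>i<N. f i) \<le> B + norm c" for N
  proof (cases N)
    case (Suc n)
    then show ?thesis unfolding Suc eq using B(2)[of n] norm_triangle_ineq[of "F n" c] by linarith
  qed (use B in simp)
  then show ?thesis by blast
qed

lemma (in cmult) sums_imp_eq_dser:
  assumes "(\<lambda>i. a (Suc i) * of_nat (Suc i) powr (-s)) sums h" and "Re s > 1"
  shows "h = dser a s"
proof -
  have "dconv a" by (rule dconv)
  then have "(\<lambda>n. a n * of_nat n powr (-s)) sums dser a s" using assms(2) by (rule dser_sums)
  then have "(\<lambda>i. a (Suc i) * of_nat (Suc i) powr (-s)) sums dser a s"
    using sums_Suc_iff[of "\<lambda>n. a n * of_nat n powr (-s)" "dser a s"] by simp
  then show ?thesis using assms(1) sums_unique2 by blast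
qed

lemma nonprincipal_entire:
  assumes c: "dirichlet_character q c" and np: "\<not> principal_character q c"
  shows "\<exists>h C. h holomorphic_on UNIV \<and> (\<forall>s. Re s > 1 \<longrightarrow> h s = dser c s) \<and>
    (\<forall>s. Re s > 0 \<longrightarrow> (\<lambda>i. c (Suc i) * of_nat (Suc i) powr (-s)) sums h s) \<and>
    (\<forall>s. Re s \<ge> -4 \<longrightarrow> norm (h s) \<le> C * (1 + norm s) ^ 6)"
proof -
  interpret cmult c by (rule dirichlet_character_cmult[OF c])
  obtain h C where h: "h holomorphic_on UNIV"
    "\<And>s. Re s > 1 \<Longrightarrow> (\<lambda>i. c (Suc i) * of_nat (Suc i) powr (-s)) sums h s"
    "\<And>s. Re s > 0 \<Longrightarrow> (\<lambda>i. c (Suc i) * of_nat (Suc i) powr (-s)) sums h s"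
    "\<And>s. Re s \<ge> -4 \<Longrightarrow> norm (h s) \<le> C * (1 + norm s) ^ 6"
    by (rule dirichlet_series_entire[OF nonprincipal_periodic_mean0[OF c np]]) (rule that)
  show ?thesis using h sums_imp_eq_dser[OF h(2)] by blast
qed

text \<open>Only powers of primes dividing \<open>q\<close> contribute; for each such prime the
  geometric series gives at most \<open>ln p \<le> q\<close>, and there are at most \<open>q\<close>
  of them.\<close>

lemma mangoldt_not_coprime_bounded:
  "norm (\<Sum>n\<in>upto_exp v. mangoldt n * (if coprime n q then 0 else 1 / of_nat n :: complex)) \<le> real q * real q"
  if q: "q \<ge> 1"
proof -
  let ?f = "\<lambda>n. if coprime n q then 0 else 1 / of_nat n :: complex"
  let ?A = "{p. prime p \<and> p \<in> upto_exp v}"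
  have finA: "finite ?A" by (rule finite_subset[of _ "upto_exp v"]) auto
  have "norm (\<Sum>p\<in>?A. \<Sum>k | p ^ Suc k \<in> upto_exp v. of_real (ln (real p)) * ?f (p ^ Suc k)) \<le> (\<Sum>p\<in>?A. if p dvd q then real q else 0)"
  proof (rule sum_norm_le)
    fix p assume "p \<in> ?A"
    then have p: "prime p" by simp
    show "norm (\<Sum>k | p ^ Suc k \<in> upto_exp v. of_real (ln (real p)) * ?f (p ^ Suc k)) \<le> (if p dvd q then real q else 0)"
    proof (cases "p dvd q")
      case False
      then have "coprime (p ^ Suc k) q" for k using p prime_imp_coprime by (simp del: power_Suc)
      then show ?thesis using False by (simp del: power_Suc)
    next
      case True
      have pq: "p \<le> q" using True q by (intro dvd_imp_le) auto
      have p2: "real p \<ge> 2" using prime_ge_2_nat[OF p] by simp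
      let ?K = "{k. p ^ Suc k \<in> upto_exp v}"
      have "(\<Sum>k\<in>?K. (1/2) ^ Suc k) \<le> (1 :: real)"
      proof (cases "finite ?K")
        case True
        have "(\<Sum>k\<in>?K. (1/2) ^ Suc k) \<le> (\<Sum>k. (1/2 :: real) ^ Suc k)"
          by (rule sum_le_suminf[OF sums_summable[OF power_half_series] True]) simp
        then show ?thesis using sums_unique[OF power_half_series] by simp
      qed simp
      then have le: "ln (real p) * (\<Sum>k\<in>?K. (1/2) ^ Suc k) \<le> real q * 1"
        using pq p2 ln_le_minus_one[of "real p"] by (intro mult_mono) (auto intro!: sum_nonneg)
      have "norm (\<Sum>k\<in>?K. of_real (ln (real p)) * ?f (p ^ Suc k)) \<le> (\<Sum>k\<in>?K. ln (real p) * (1/2) ^ Suc k)"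
      proof (rule sum_norm_le)
        fix k
        have "(1 / real p) ^ Suc k \<le> (1/2) ^ Suc k" using p2 by (intro power_mono divide_left_mono) auto
        then have "1 / real p ^ Suc k \<le> (1/2) ^ Suc k" by (simp only: power_one_over power_divide power_one)
        then have "norm (?f (p ^ Suc k)) \<le> (1/2) ^ Suc k" by (simp add: norm_divide norm_power del: power_Suc)
        then show "norm (of_real (ln (real p)) * ?f (p ^ Suc k)) \<le> ln (real p) * (1/2) ^ Suc k"
          unfolding norm_mult using p2 by (intro mult_mono) auto
      qed
      also have "\<dots> \<le> real q" using le by (simp only: sum_distrib_left mult_1_right)
      finally show ?thesis using True by simp
    qed
  qed
  also have "\<dots> = (\<Sum>p\<in>{p \<in> ?A. p dvd q}. real q)" by (rule sum.inter_filter[symmetric, OF finA])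
  also have "\<dots> = real (card {p \<in> ?A. p dvd q}) * real q" by simp
  also have "\<dots> \<le> real q * real q"
  proof (intro mult_right_mono)
    have "{p \<in> ?A. p dvd q} \<subseteq> {1..q}" using q prime_ge_1_nat by (auto intro: dvd_imp_le)
    from card_mono[OF _ this] show "real (card {p \<in> ?A. p dvd q}) \<le> real q" by simp
  qed simp
  finally show ?thesis unfolding sum_mangoldt_primepow .
qed

text \<open>The square of the character is again a character modulo \<open>q\<close>. If it is
  principal, Mertens' estimate gives \<open>k = 1\<close> up to the primes dividing
  \<open>q\<close>; otherwise the twisted estimate gives \<open>k = 0\<close>, and this rests on the
  nonvanishing of its series at 1.\<close>

lemma sum_mangoldt_squares:
  assumes chi: "dirichlet_character q chi"
  shows "\<exists>k C. \<forall>v\<ge>0. norm ((\<Sum>n\<in>upto_exp v. mangoldt n * (chi n)\<^sup>2 / of_nat n) - k * of_real v) \<le> C"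
proof -
  define c where "c = (\<lambda>n. (chi n)\<^sup>2)"
  have c: "dirichlet_character q c" using chi by (auto simp: dirichlet_character_def c_def power_mult_distrib)
  have q: "q \<ge> 1" using chi by (simp add: dirichlet_character_def)
  interpret cmult c by (rule dirichlet_character_cmult[OF c])
  show ?thesis
  proof (cases "principal_character q c")
    case True
    have cv: "c n = (if coprime n q then 1 else 0)" for n
      using True c by (auto simp: principal_character_def dirichlet_character_def)
    have "norm ((\<Sum>n\<in>upto_exp v. mangoldt n * (chi n)\<^sup>2 / of_nat n) - 1 * of_real v) \<le> 7 + real q * real q" if v: "v \<ge> 0" for v
    proof -
      define N where "N = nat \<lfloor>exp v\<rfloor>"
      have N: "real N \<le> exp v" "exp v < real N + 1" unfolding N_def by (auto simp: of_nat_nat)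
      have "exp v \<ge> 1" using v by simp
      then have N1: "N \<ge> 1" unfolding N_def by (simp add: le_nat_iff le_floor_iff)
      have l1: "ln (real N) \<le> v" using N N1 by (metis exp_gt_zero ln_exp ln_le_cancel_iff of_nat_0_less_iff less_le_trans zero_less_one)
      have "exp v \<le> 2 * real N" using N N1 by linarith
      then have "ln (exp v) \<le> ln (2 * real N)" using N1 by (subst ln_le_cancel_iff) auto
      then have l2: "v \<le> ln 2 + ln (real N)" using N1 by (simp add: ln_mult)
      have ln2: "ln 2 \<le> (1::real)" using ln_le_minus_one[of "2::real"] by simp
      have M: "\<bar>(\<Sum>n=1..N. mangoldt n / real n) - ln (real N)\<bar> \<le> 6" by (rule mertens[OF N1])
      have "\<bar>(\<Sum>n=1..N. mangoldt n / real n) - v\<bar> \<le> 7" using M l1 l2 ln2 by linarith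
      \<comment> \<open>6 comes from Mertens' estimate, and at most \<open>ln 2 \<le> 1\<close> from
        replacing \<open>ln N\<close> by \<open>v\<close>, as
        \<open>N \<le> exp v < N + 1\<close>.\<close>
      then have "norm (complex_of_real ((\<Sum>n=1..N. mangoldt n / real n) - v)) \<le> 7" by (simp only: norm_of_real)
      moreover have g: "X - 1 * w = (A - w) - Y" if "X = A - Y" for X A Y w :: complex
        using that by simp
      have "(\<Sum>n\<in>upto_exp v. mangoldt n * (chi n)\<^sup>2 / of_nat n)
          = of_real (\<Sum>n=1..N. mangoldt n / real n) - (\<Sum>n\<in>upto_exp v. mangoldt n * (if coprime n q then 0 else 1 / of_nat n))"
        unfolding upto_exp_eq N_def[symmetric] of_real_sum sum_subtractf[symmetric]
        by (intro sum.cong refl) (use cv in \<open>auto simp: c_def\<close>)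
      then have "(\<Sum>n\<in>upto_exp v. mangoldt n * (chi n)\<^sup>2 / of_nat n) - 1 * of_real v
          = of_real ((\<Sum>n=1..N. mangoldt n / real n) - v) - (\<Sum>n\<in>upto_exp v. mangoldt n * (if coprime n q then 0 else 1 / of_nat n))"
        unfolding of_real_diff by (rule g)
      ultimately show ?thesis
        using mangoldt_not_coprime_bounded[OF q, of v]
          norm_triangle_ineq4[of "complex_of_real ((\<Sum>n=1..N. mangoldt n / real n) - v)" "\<Sum>n\<in>upto_exp v. mangoldt n * (if coprime n q then 0 else 1 / of_nat n)"]
        by (simp only:)
    qed
    then show ?thesis by blast
  next
    case False
    obtain h where h: "h holomorphic_on UNIV" "\<And>s. Re s > 1 \<Longrightarrow> h s = dser c s"
      "\<And>s. Re s > 0 \<Longrightarrow> (\<lambda>i. c (Suc i) * of_nat (Suc i) powr (-s)) sums h s"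
      using nonprincipal_entire[OF c False] by blast
    have "h 1 \<noteq> 0" by (rule nonzero_at_1[OF h(1,2)])
    moreover have "(\<lambda>i. c (Suc i) / of_nat (Suc i)) sums h 1"
      using h(3)[of 1] by (simp add: powr_minus divide_inverse del: of_nat_Suc)
    then have "(\<lambda>n. c n / of_nat n) sums h 1" using sums_Suc_iff[of "\<lambda>n. c n / of_nat n" "h 1"] by simp
    moreover obtain B where B: "\<And>N. norm (\<Sum>i<N. c (Suc i)) \<le> B"
      using periodic_mean0_prefix_bounded[OF nonprincipal_periodic_mean0[OF c False]] by blast
    have "norm (\<Sum>n=1..N. c n) \<le> B" for N
      using B[of N] by (simp add: sum.atLeast1_atMost_eq)
    ultimately obtain C where C: "\<And>N. norm (\<Sum>n=1..N. mangoldt n * c n / of_nat n) \<le> C"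
      using mertens_twisted by blast
    have "\<forall>v\<ge>0. norm ((\<Sum>n\<in>upto_exp v. mangoldt n * (chi n)\<^sup>2 / of_nat n) - 0 * of_real v) \<le> C"
      using C by (simp add: upto_exp_eq c_def)
    then show ?thesis by blast
  qed
qed

theorem theorem1p3:
  fixes q :: nat and chi :: "nat \<Rightarrow> complex"
  assumes "q \<ge> 3"
    and "dirichlet_character q chi"
    and "\<not> principal_character q chi"
    and "GRH_for chi"
  shows "\<exists>L::complex. L \<noteq> 0 \<and>
    (\<forall>\<epsilon>::real. \<epsilon> > 0 \<longrightarrow>
      has_natural_density
        {x::real. x \<ge> 2 \<and>
          cmod (complex_of_real (ln x) ^ vanishing_order chi *
                (\<Prod>p\<in>{p::nat. prime p \<and> real p \<le> x}.
                    inverse (1 - chi p / complex_of_real (sqrt (real p)))) - L)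
            \<le> ln (ln x) powr (3 + \<epsilon>) / ln x}
        1)"
proof -
  note chi = assms(2) and np = assms(3)
  interpret cmult chi by (rule dirichlet_character_cmult[OF chi])
  obtain h C where h: "h holomorphic_on UNIV" "\<And>s. Re s > 1 \<Longrightarrow> h s = dser chi s"
    "\<And>s. Re s > 0 \<Longrightarrow> (\<lambda>i. chi (Suc i) * of_nat (Suc i) powr (-s)) sums h s"
    "\<And>s. Re s \<ge> -4 \<Longrightarrow> norm (h s) \<le> C * (1 + norm s) ^ 6"
    using nonprincipal_entire[OF chi np] by blast
  let ?H = "dirichlet_L chi"
  let ?P = "\<lambda>f. f holomorphic_on UNIV \<and> (\<forall>s. Re s > 1 \<longrightarrow> (\<lambda>n. chi (Suc n) / of_nat (Suc n) powr s) sums f s)"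
  have conv: "chi (Suc n) / of_nat (Suc n) powr s = chi (Suc n) * of_nat (Suc n) powr (-s)" for n s
    by (simp add: powr_minus divide_inverse del: of_nat_Suc)
  have "?P h"
  proof (intro conjI allI impI h(1))
    fix s :: complex assume "Re s > 1"
    then show "(\<lambda>n. chi (Suc n) / of_nat (Suc n) powr s) sums h s" unfolding conv by (intro h(3)) simp
  qed
  \<comment> \<open>The constructed continuation witnesses the choice that defines
    \<open>dirichlet_L\<close>, so the chosen function has the defining properties too.\<close>
  then have "?P (SOME f. ?P f)" by (rule someI[of ?P])
  then have "?P ?H" unfolding dirichlet_L_def .
  then have H: "?H holomorphic_on UNIV" and Hs: "\<And>s. Re s > 1 \<Longrightarrow> ?H s = dser chi s"
    unfolding conv using sums_imp_eq_dser by blast+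
  \<comment> \<open>The identity theorem makes the chosen function equal to \<open>h\<close>, so
    that the growth bound of \<open>h\<close> carries over.\<close>
  have Hh: "?H s = h s" for s
    by (rule analytic_continuation_open[OF open_halfspace_Re_gt[of 1] open_UNIV _ _ _ H h(1)])
      (use Hs h(2) in \<open>auto intro: exI[of _ 2]\<close>)
  \<comment> \<open>\<open>GRH_for\<close> covers the open strip only. To the right of it the Euler
    product excludes zeros, and on the line \<open>Re s = 1\<close> Landau's argument does; zeros
    with \<open>Re s \<le> 0\<close> satisfy the claim anyway.\<close>
  have nz: "Re s \<le> 1/2" if s: "?H s = 0" for s
  proof (rule ccontr)
    assume "\<not> Re s \<le> 1/2"
    then consider "Re s > 1" | "Re s = 1" | "0 < Re s" "Re s < 1" "Re s \<noteq> 1/2" by linarith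
    then show False
    proof cases
      case 1 then show ?thesis using s Hs dser_nonzero by simp
    next
      case 2 then show ?thesis using s nonzero_on_line_1[OF H Hs] by simp
    next
      case 3 then show ?thesis using s assms(4) by (auto simp: GRH_for_def)
    qed
  qed
  \<comment> \<open>A nonzero value rules out the zero function, so the order of vanishing at 1/2 is
    finite.\<close>
  have "?H 2 \<noteq> 0" using nz[of 2] by auto
  then have ex: "\<exists>w\<in>UNIV. ?H w \<noteq> 0" by blast
  obtain r where r: "r > 0" "zor_poly ?H (1/2) holomorphic_on cball (1/2) r"
    "\<And>w. w \<in> cball (1/2) r \<Longrightarrow> ?H w = zor_poly ?H (1/2) w * (w - 1/2) ^ nat (zorder ?H (1/2)) \<and> zor_poly ?H (1/2) w \<noteq> 0"
    using zorder_exist_zero[OF H open_UNIV connected_UNIV UNIV_I ex, of "1/2"] by blast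
  interpret GRH_L chi ?H "zor_poly ?H (1/2)" "vanishing_order chi" C r
  proof
    show "zor_poly ?H (1/2) holomorphic_on ball (1/2) r" using r(2) by (rule holomorphic_on_subset) auto
    show "norm (?H s) \<le> C * (1 + norm s) ^ 6" if "-4 \<le> Re s" for s unfolding Hh using h(4) that .
    show "?H s = (s - 1/2) ^ vanishing_order chi * zor_poly ?H (1/2) s" "zor_poly ?H (1/2) s \<noteq> 0" if "s \<in> ball (1/2) r" for s
      using r(3)[of s] that by (auto simp: vanishing_order_def)
  qed (use H Hs nz r(1) in auto)
  obtain k C2 where T: "\<And>v. v \<ge> 0 \<Longrightarrow> norm ((\<Sum>n\<in>upto_exp v. c2 n) - k * of_real v) \<le> C2"
    unfolding c2_def using sum_mangoldt_squares[OF chi] by blast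
  show ?thesis using density_near_limit[OF T] unfolding partial_product_def by simp
qed

end
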